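(* Let $\rho: \mathbb{Z} \to \mathrm{GL}_n(\mathbb{C})$ be an $n$-dimensional monodromy representation of $\mathbf{Y}_{(0,\infty)} = \mathbb{P}^1 - \{0,\infty\}$, let $(\mathcal{V}_{\mathrm{Log}(\rho)}, \nabla_{\mathrm{Log}(\rho)})$ be the associated extended logarithmic connection on $\mathbb{P}^1$, and let $\zeta = c_1(\mathcal{V}_{\mathrm{Log}(\rho)})$. (1) If $\rho$ is an indecomposable representation determined by $1 \mapsto M$, where $M$ is a Jordan block with eigenvalue $\lambda = r e^{2\pi i q}$, $r>0$, $0 \le q < 1$, then $$\mathcal{V}_{\mathrm{Log}(\rho)} \cong \begin{cases} \mathcal{O}(0)^{\oplus n} & \text{when } q = 0,\\ \mathcal{O}(-1)^{\oplus n} & \text{when } q \neq 0.\end{cases}$$ (2) If $\rho \cong \bigoplus_{i=1}^{u} \rho_i$ where each $\rho_i$ is indecomposable, then $$\mathcal{V}_{\mathrm{Log}(\rho)} \cong \mathcal{O}(-1)^{\oplus (-\zeta)} \oplus \mathcal{O}(0)^{\oplus (n+\zeta)}.$$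
   Context: $\mathbb{P}^1$ is the complex projective line and $\mathbf{Y}_{(0,\infty)} = \mathbb{P}^1 - \{0,\infty\}$. Its fundamental group is identified with $\mathbb{Z}$; a monodromy representation of $\mathbf{Y}_{(0,\infty)}$ is a finite-dimensional complex representation $\rho$ of this group. The local monodromy at $0$ is $\rho(1)$ and the local monodromy at $\infty$ is $\rho(1)^{-1}$. Finite-dimensional monodromy representations $\rho$ are equivalent, as a category, to holomorphic connections $(\mathcal{Q}_\rho, \nabla_\rho)$ on $\mathbf{Y}_{(0,\infty)}$. A connection with logarithmic poles along a finite set $S \subset \mathbb{P}^1$ is a pair $(\overline{\mathcal{E}}, \overline{\nabla})$ with $\overline{\mathcal{E}}$ a locally free sheaf of finite rank on $\mathbb{P}^1$ and $\overline{\nabla}: \overline{\mathcal{E}} \to \overline{\mathcal{E}} \otimes \Omega^1_{\mathbb{P}^1}(S)$ a $\mathbb{C}$-linear map satisfying the Leibniz rule, where $\Omega^1_{\mathbb{P}^1}(S)$ is the sheaf of 1-forms with logarithmic poles along $S$. The associated extended logarithmic connection $(\mathcal{V}_{\mathrm{Log}(\rho)}, \nabla_{\mathrm{Log}(\rho)})$ is the unique connection on $\mathbb{P}^1$ with logarithmic poles along $\{0,\infty\}$ which restricts to $(\mathcal{Q}_\rho,\nabla_\rho)$ and whose residue at each pole is (up to conjugation) the principal logarithm of the local monodromy there. Here the principal logarithm of an invertible matrix $A$ is the unique matrix $L$ with $\exp(2\pi i L) = A$ all of whose eigenvalues have real part in $[0,1)$ (so an eigenvalue $re^{2\pi i q}$,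 $r>0$, $0\le q<1$, gives $q + \frac{1}{2\pi i}\log r$). The loops are oriented so that the local monodromy at a pole with such a residue $L$ is conjugate to $\exp(2\pi i L)$. $c_1(\mathcal{V})$ denotes the first Chern class (degree), viewed as an integer, and $\mathcal{O}(k)$ the twisting sheaf of degree $k$ on $\mathbb{P}^1$. *)

theory Defs
  imports "HOL-Complex_Analysis.Complex_Analysis" "Jordan_Normal_Form.Jordan_Normal_Form"
begin

section \<open>The complex projective line\<close>

datatype cp1 = Affine complex | Infty

text \<open>The local coordinate centred at a point: \<open>z - a\<close> at a finite point \<open>a\<close>, and \<open>1 / z\<close> at
  infinity. The function below is the inverse of the coordinate, and sends \<open>0\<close> to \<open>p\<close>.\<close>

fun chart :: "cp1 \<Rightarrow> complex \<Rightarrow> cp1" where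
  "chart (Affine a) t = Affine (a + t)"
| "chart Infty t = (if t = 0 then Infty else Affine (1 / t))"

instantiation cp1 :: topological_space
begin

definition open_cp1 :: "cp1 set \<Rightarrow> bool" where
  "open_cp1 U \<longleftrightarrow> (\<forall>p\<in>U. \<forall>\<^sub>F t in nhds 0. chart p t \<in> U)"

instance
proof
  show "open (UNIV :: cp1 set)" by (simp add: open_cp1_def)
next
  fix S T :: "cp1 set"
  assume "open S" "open T"
  then show "open (S \<inter> T)" by (auto simp: open_cp1_def intro: eventually_conj)
next
  fix K :: "cp1 set set"
  assume K: "\<forall>S\<in>K. open S"
  show "open (\<Union>K)"
    unfolding open_cp1_def
  proof
    fix p assume "p \<in> \<Union>K"
    then obtain S where S: "S \<in> K" "p \<in> S" by blast
    then have "\<forall>\<^sub>F t in nhds 0. chart p t \<in> S" using K by (auto simp: open_cp1_def)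
    then show "\<forall>\<^sub>F t in nhds 0. chart p t \<in> \<Union>K"
      by (rule eventually_mono) (use S in blast)
  qed
qed

end

text \<open>The punctured line \<open>P\<^sup>1 - {0, \<infinity>}\<close>.\<close>

definition punctured_line :: "cp1 set" where
  "punctured_line = - {Affine 0, Infty}"

definition hol_on :: "(cp1 \<Rightarrow> complex) \<Rightarrow> cp1 set \<Rightarrow> bool" where
  "hol_on f U \<longleftrightarrow> (\<forall>p\<in>U. (\<lambda>t. f (chart p t)) analytic_on {0})"

text \<open>Functions on \<open>U\<close> are represented by functions on the whole line that vanish off \<open>U\<close>.\<close>

definition zero_off :: "cp1 set \<Rightarrow> (cp1 \<Rightarrow> complex) \<Rightarrow> cp1 \<Rightarrow> complex" where
  "zero_off U f = (\<lambda>x. if x \<in> U then f x else 0)"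

definition hol_ring :: "cp1 set \<Rightarrow> (cp1 \<Rightarrow> complex) ring" where
  "hol_ring U = \<lparr>carrier = {f. hol_on f U \<and> (\<forall>x. x \<notin> U \<longrightarrow> f x = 0)},
     monoid.mult = (\<lambda>f g x. f x * g x), one = zero_off U (\<lambda>_. 1),
     zero = (\<lambda>_. 0), add = (\<lambda>f g x. f x + g x)\<rparr>"

section \<open>Sheaves of modules over the holomorphic functions\<close>

text \<open>\<open>Res E U V\<close> is the restriction from \<open>U\<close> to \<open>V \<subseteq> U\<close>. The base of a sheaf is not part of the
  record: a sheaf on \<open>X\<close> is restricted to an open subset \<open>Y\<close> of \<open>X\<close> by considering the same record
  over \<open>Y\<close>. The ring fields \<open>mult\<close> and \<open>one\<close> of the section modules are unused.\<close>

record 's osheaf =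
  Sec :: "cp1 set \<Rightarrow> (cp1 \<Rightarrow> complex, 's) module"
  Res :: "cp1 set \<Rightarrow> cp1 set \<Rightarrow> 's \<Rightarrow> 's"

locale omodule_sheaf =
  fixes X :: "cp1 set" and E :: "'s osheaf"
  assumes open_base: "open X"
    and module_Sec: "\<And>U. open U \<Longrightarrow> U \<subseteq> X \<Longrightarrow> module (hol_ring U) (Sec E U)"
    and Res_closed: "\<And>U V s. open U \<Longrightarrow> open V \<Longrightarrow> V \<subseteq> U \<Longrightarrow> U \<subseteq> X \<Longrightarrow>
      s \<in> carrier (Sec E U) \<Longrightarrow> Res E U V s \<in> carrier (Sec E V)"
    and Res_add: "\<And>U V s t. open U \<Longrightarrow> open V \<Longrightarrow> V \<subseteq> U \<Longrightarrow> U \<subseteq> X \<Longrightarrow>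
      s \<in> carrier (Sec E U) \<Longrightarrow> t \<in> carrier (Sec E U) \<Longrightarrow>
      Res E U V (s \<oplus>\<^bsub>Sec E U\<^esub> t) = Res E U V s \<oplus>\<^bsub>Sec E V\<^esub> Res E U V t"
    and Res_smult: "\<And>U V f s. open U \<Longrightarrow> open V \<Longrightarrow> V \<subseteq> U \<Longrightarrow> U \<subseteq> X \<Longrightarrow>
      f \<in> carrier (hol_ring U) \<Longrightarrow> s \<in> carrier (Sec E U) \<Longrightarrow>
      Res E U V (f \<odot>\<^bsub>Sec E U\<^esub> s) = zero_off V f \<odot>\<^bsub>Sec E V\<^esub> Res E U V s"
    and Res_id: "\<And>U s. open U \<Longrightarrow> U \<subseteq> X \<Longrightarrow> s \<in> carrier (Sec E U) \<Longrightarrow> Res E U U s = s"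
    and Res_Res: "\<And>U V W s. open U \<Longrightarrow> open V \<Longrightarrow> open W \<Longrightarrow> W \<subseteq> V \<Longrightarrow> V \<subseteq> U \<Longrightarrow> U \<subseteq> X \<Longrightarrow>
      s \<in> carrier (Sec E U) \<Longrightarrow> Res E V W (Res E U V s) = Res E U W s"
    and gluing: "\<And>\<U> s. \<forall>U\<in>\<U>. open U \<and> U \<subseteq> X \<and> s U \<in> carrier (Sec E U) \<Longrightarrow>
      \<forall>U\<in>\<U>. \<forall>V\<in>\<U>. Res E U (U \<inter> V) (s U) = Res E V (U \<inter> V) (s V) \<Longrightarrow>
      \<exists>!t. t \<in> carrier (Sec E (\<Union>\<U>)) \<and> (\<forall>U\<in>\<U>. Res E (\<Union>\<U>) U t = s U)"

definition sheaf_hom :: "cp1 set \<Rightarrow> 's osheaf \<Rightarrow> 't osheaf \<Rightarrow> (cp1 set \<Rightarrow> 's \<Rightarrow> 't) \<Rightarrow> bool" where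
  "sheaf_hom X E F \<phi> \<longleftrightarrow>
     (\<forall>U. open U \<and> U \<subseteq> X \<longrightarrow>
        (\<forall>s\<in>carrier (Sec E U). \<phi> U s \<in> carrier (Sec F U)) \<and>
        (\<forall>s\<in>carrier (Sec E U). \<forall>t\<in>carrier (Sec E U).
           \<phi> U (s \<oplus>\<^bsub>Sec E U\<^esub> t) = \<phi> U s \<oplus>\<^bsub>Sec F U\<^esub> \<phi> U t) \<and>
        (\<forall>f\<in>carrier (hol_ring U). \<forall>s\<in>carrier (Sec E U).
           \<phi> U (f \<odot>\<^bsub>Sec E U\<^esub> s) = f \<odot>\<^bsub>Sec F U\<^esub> \<phi> U s) \<and>
        (\<forall>V. open V \<and> V \<subseteq> U \<longrightarrow>
           (\<forall>s\<in>carrier (Sec E U). \<phi> V (Res E U V s) = Res F U V (\<phi> U s))))"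

definition sheaf_iso :: "cp1 set \<Rightarrow> 's osheaf \<Rightarrow> 't osheaf \<Rightarrow> (cp1 set \<Rightarrow> 's \<Rightarrow> 't) \<Rightarrow> bool" where
  "sheaf_iso X E F \<phi> \<longleftrightarrow> sheaf_hom X E F \<phi> \<and>
     (\<forall>U. open U \<and> U \<subseteq> X \<longrightarrow> bij_betw (\<phi> U) (carrier (Sec E U)) (carrier (Sec F U)))"

definition isomorphic_sheaves :: "'s osheaf \<Rightarrow> 't osheaf \<Rightarrow> bool" where
  "isomorphic_sheaves E F \<longleftrightarrow> (\<exists>\<phi>. sheaf_iso UNIV E F \<phi>)"

text \<open>A frame \<open>e 0, \<dots>, e (n - 1)\<close> of \<open>E\<close> over \<open>U\<close> is an isomorphism from the \<open>n\<close>-th power of the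
  structure sheaf to \<open>E\<close> over \<open>U\<close>.\<close>

definition is_frame :: "'s osheaf \<Rightarrow> cp1 set \<Rightarrow> nat \<Rightarrow> (nat \<Rightarrow> 's) \<Rightarrow> bool" where
  "is_frame E U n e \<longleftrightarrow> (\<forall>i<n. e i \<in> carrier (Sec E U)) \<and>
     (\<forall>V. open V \<and> V \<subseteq> U \<longrightarrow> (\<forall>s\<in>carrier (Sec E V).
        \<exists>!c. c \<in> {..<n} \<rightarrow>\<^sub>E carrier (hol_ring V) \<and>
             s = (\<Oplus>\<^bsub>Sec E V\<^esub>i\<in>{..<n}. c i \<odot>\<^bsub>Sec E V\<^esub> Res E U V (e i))))"

definition locally_free :: "cp1 set \<Rightarrow> nat \<Rightarrow> 's osheaf \<Rightarrow> bool" where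
  "locally_free X n E \<longleftrightarrow> omodule_sheaf X E \<and>
     (\<forall>p\<in>X. \<exists>U e. open U \<and> p \<in> U \<and> U \<subseteq> X \<and> is_frame E U n e)"

definition direct_sum :: "nat \<Rightarrow> (nat \<Rightarrow> 's osheaf) \<Rightarrow> (nat \<Rightarrow> 's) osheaf" where
  "direct_sum m F = \<lparr>
     Sec = (\<lambda>U. \<lparr>carrier = (\<Pi>\<^sub>E i\<in>{..<m}. carrier (Sec (F i) U)),
       monoid.mult = undefined, one = undefined,
       zero = (\<lambda>i\<in>{..<m}. \<zero>\<^bsub>Sec (F i) U\<^esub>),
       add = (\<lambda>s t. \<lambda>i\<in>{..<m}. s i \<oplus>\<^bsub>Sec (F i) U\<^esub> t i),
       module.smult = (\<lambda>f s. \<lambda>i\<in>{..<m}. f \<odot>\<^bsub>Sec (F i) U\<^esub> s i)\<rparr>),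
     Res = (\<lambda>U V s. \<lambda>i\<in>{..<m}. Res (F i) U V (s i))\<rparr>"

text \<open>Sheaves of functions or of differential forms, with pointwise operations.\<close>

definition function_sheaf :: "(cp1 set \<Rightarrow> (cp1 \<Rightarrow> complex) set) \<Rightarrow> (cp1 \<Rightarrow> complex) osheaf" where
  "function_sheaf C = \<lparr>
     Sec = (\<lambda>U. \<lparr>carrier = C U, monoid.mult = undefined, one = undefined, zero = (\<lambda>_. 0),
       add = (\<lambda>f g x. f x + g x), module.smult = (\<lambda>f g x. f x * g x)\<rparr>),
     Res = (\<lambda>U V. zero_off V)\<rparr>"

text \<open>The twisting sheaf \<open>O(k)\<close>, as the sheaf of the divisor \<open>k \<cdot> \<infinity>\<close>: the section with
  homogeneous form \<open>F(x\<^sub>0, x\<^sub>1)\<close> of degree \<open>k\<close> is represented by \<open>f(z) = F(1, z)\<close>, and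
  \<open>F(w, 1) = w\<^sup>k f(1 / w)\<close> has to be holomorphic at \<open>w = 0\<close>.\<close>

definition twisting_sheaf :: "int \<Rightarrow> (cp1 \<Rightarrow> complex) osheaf" where
  "twisting_sheaf k = function_sheaf (\<lambda>U.
     {f. hol_on f (U - {Infty}) \<and> (\<forall>x. x \<notin> U - {Infty} \<longrightarrow> f x = 0) \<and>
         (Infty \<in> U \<longrightarrow> (\<exists>h. h analytic_on {0} \<and>
            (\<forall>\<^sub>F w in at 0. w powi k * f (chart Infty w) = h w)))})"

section \<open>The first Chern class\<close>

text \<open>Let \<open>s 0, \<dots>, s (n - 1)\<close> be sections of \<open>E\<close> over the complement of the finite set \<open>T\<close>. The
  section \<open>s 0 \<and> \<dots> \<and> s (n - 1)\<close> of the determinant line bundle of \<open>E\<close> is meromorphic and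
  nonzero at \<open>p\<close>, of order \<open>k\<close>, if this holds for its coefficient with respect to
  \<open>e 0 \<and> \<dots> \<and> e (n - 1)\<close>, where \<open>e\<close> is a frame of \<open>E\<close> near \<open>p\<close>.\<close>

definition wedge_order :: "'s osheaf \<Rightarrow> nat \<Rightarrow> cp1 set \<Rightarrow> (nat \<Rightarrow> 's) \<Rightarrow> cp1 \<Rightarrow> int \<Rightarrow> bool" where
  "wedge_order E n T s p k \<longleftrightarrow> (\<exists>U e F D. open U \<and> p \<in> U \<and> is_frame E U n e \<and>
     (\<forall>i<n. \<forall>j<n. F i j \<in> carrier (hol_ring (U - T))) \<and>
     (\<forall>j<n. Res E (- T) (U - T) (s j) =
        (\<Oplus>\<^bsub>Sec E (U - T)\<^esub>i\<in>{..<n}. F i j \<odot>\<^bsub>Sec E (U - T)\<^esub> Res E U (U - T) (e i))) \<and>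
     D = (\<lambda>t. Determinant.det (Matrix.mat n n (\<lambda>(i, j). F i j (chart p t)))) \<and>
     D meromorphic_on {0} \<and> (\<forall>\<^sub>F t in at 0. D t \<noteq> 0) \<and> k = zorder D 0)"

text \<open>The degree is the degree of the divisor of a nonzero meromorphic section of the determinant
  line bundle.\<close>

definition has_degree :: "'s osheaf \<Rightarrow> int \<Rightarrow> bool" where
  "has_degree E d \<longleftrightarrow> (\<exists>n T s k. locally_free UNIV n E \<and> finite T \<and>
     (\<forall>j<n. s j \<in> carrier (Sec E (- T))) \<and>
     (\<forall>p. wedge_order E n T s p (k p)) \<and>
     finite {p. k p \<noteq> 0} \<and> d = (\<Sum>p\<in>{p. k p \<noteq> 0}. k p))"

definition c1 :: "'s osheaf \<Rightarrow> int" where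
  "c1 E = (THE d. has_degree E d)"

section \<open>Logarithmic connections\<close>

text \<open>A 1-form \<open>f(z) dz\<close> is represented by \<open>f\<close> on the affine line. Its coefficient in the
  coordinate \<open>t\<close> centred at \<open>p\<close>; at infinity \<open>z = 1 / t\<close> and \<open>dz = - dt / t\<^sup>2\<close>.\<close>

definition form_at :: "cp1 \<Rightarrow> (cp1 \<Rightarrow> complex) \<Rightarrow> complex \<Rightarrow> complex" where
  "form_at p \<eta> t = \<eta> (chart p t) * (case p of Affine _ \<Rightarrow> 1 | Infty \<Rightarrow> - 1 / t\<^sup>2)"

text \<open>The sheaf of 1-forms that are holomorphic off \<open>S\<close> and have at most simple poles along \<open>S\<close>;
  the representing functions vanish off \<open>U - S - {\<infinity>}\<close>.\<close>

definition log_forms :: "cp1 set \<Rightarrow> (cp1 \<Rightarrow> complex) osheaf" where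
  "log_forms S = function_sheaf (\<lambda>U.
     {\<eta>. hol_on \<eta> (U - S - {Infty}) \<and> (\<forall>x. x \<notin> U - S - {Infty} \<longrightarrow> \<eta> x = 0) \<and>
         (\<forall>p\<in>U. \<exists>h. h analytic_on {0} \<and>
            (\<forall>\<^sub>F t in at 0. form_at p \<eta> t = (if p \<in> S then h t / t else h t)))})"

definition exterior_d :: "cp1 set \<Rightarrow> cp1 set \<Rightarrow> (cp1 \<Rightarrow> complex) \<Rightarrow> cp1 \<Rightarrow> complex" where
  "exterior_d S U f = zero_off (U - S - {Infty})
     (\<lambda>x. case x of Affine z \<Rightarrow> deriv (\<lambda>v. f (Affine v)) z | Infty \<Rightarrow> 0)"

text \<open>\<open>T\<close> with \<open>b\<close> is the tensor product of the locally free sheaf \<open>E\<close> and the line bundle \<open>W\<close>: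
  \<open>b\<close> is bilinear and sends local frames to local frames. This determines \<open>(T, b)\<close> up to a unique
  isomorphism.\<close>

definition is_tensor :: "cp1 set \<Rightarrow> 's osheaf \<Rightarrow> 'w osheaf \<Rightarrow> 't osheaf \<Rightarrow>
    (cp1 set \<Rightarrow> 's \<Rightarrow> 'w \<Rightarrow> 't) \<Rightarrow> bool" where
  "is_tensor X E W T b \<longleftrightarrow> omodule_sheaf X T \<and>
     (\<forall>U. open U \<and> U \<subseteq> X \<longrightarrow>
        (\<forall>s\<in>carrier (Sec E U). \<forall>w\<in>carrier (Sec W U). b U s w \<in> carrier (Sec T U)) \<and>
        (\<forall>s\<in>carrier (Sec E U). \<forall>s'\<in>carrier (Sec E U). \<forall>w\<in>carrier (Sec W U).
           b U (s \<oplus>\<^bsub>Sec E U\<^esub> s') w = b U s w \<oplus>\<^bsub>Sec T U\<^esub> b U s' w) \<and>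
        (\<forall>s\<in>carrier (Sec E U). \<forall>w\<in>carrier (Sec W U). \<forall>w'\<in>carrier (Sec W U).
           b U s (w \<oplus>\<^bsub>Sec W U\<^esub> w') = b U s w \<oplus>\<^bsub>Sec T U\<^esub> b U s w') \<and>
        (\<forall>f\<in>carrier (hol_ring U). \<forall>s\<in>carrier (Sec E U). \<forall>w\<in>carrier (Sec W U).
           b U (f \<odot>\<^bsub>Sec E U\<^esub> s) w = f \<odot>\<^bsub>Sec T U\<^esub> b U s w \<and>
           b U s (f \<odot>\<^bsub>Sec W U\<^esub> w) = f \<odot>\<^bsub>Sec T U\<^esub> b U s w) \<and>
        (\<forall>V. open V \<and> V \<subseteq> U \<longrightarrow> (\<forall>s\<in>carrier (Sec E U). \<forall>w\<in>carrier (Sec W U).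
           Res T U V (b U s w) = b V (Res E U V s) (Res W U V w))) \<and>
        (\<forall>n e \<theta>. is_frame E U n e \<and> is_frame W U 1 (\<lambda>_. \<theta>) \<longrightarrow>
           is_frame T U n (\<lambda>i. b U (e i) \<theta>)))"

text \<open>\<open>forms\<close> and \<open>tens\<close> are the tensor product of \<open>vbundle\<close> and the sheaf of logarithmic 1-forms.\<close>

record ('s, 't) connection =
  vbundle :: "'s osheaf"
  forms :: "'t osheaf"
  tens :: "cp1 set \<Rightarrow> 's \<Rightarrow> (cp1 \<Rightarrow> complex) \<Rightarrow> 't"
  nabla :: "cp1 set \<Rightarrow> 's \<Rightarrow> 't"

definition log_connection :: "cp1 set \<Rightarrow> cp1 set \<Rightarrow> ('s, 't) connection \<Rightarrow> bool" where
  "log_connection X S C \<longleftrightarrow> finite S \<and> (\<exists>n. locally_free X n (vbundle C)) \<and>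
     is_tensor X (vbundle C) (log_forms S) (forms C) (tens C) \<and>
     (\<forall>U. open U \<and> U \<subseteq> X \<longrightarrow>
        (\<forall>s\<in>carrier (Sec (vbundle C) U). nabla C U s \<in> carrier (Sec (forms C) U)) \<and>
        (\<forall>s\<in>carrier (Sec (vbundle C) U). \<forall>t\<in>carrier (Sec (vbundle C) U).
           nabla C U (s \<oplus>\<^bsub>Sec (vbundle C) U\<^esub> t) = nabla C U s \<oplus>\<^bsub>Sec (forms C) U\<^esub> nabla C U t) \<and>
        (\<forall>c. \<forall>s\<in>carrier (Sec (vbundle C) U).
           nabla C U (zero_off U (\<lambda>_. c) \<odot>\<^bsub>Sec (vbundle C) U\<^esub> s) =
           zero_off U (\<lambda>_. c) \<odot>\<^bsub>Sec (forms C) U\<^esub> nabla C U s) \<and>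
        (\<forall>f\<in>carrier (hol_ring U). \<forall>s\<in>carrier (Sec (vbundle C) U).
           nabla C U (f \<odot>\<^bsub>Sec (vbundle C) U\<^esub> s) =
           tens C U s (exterior_d S U f) \<oplus>\<^bsub>Sec (forms C) U\<^esub> f \<odot>\<^bsub>Sec (forms C) U\<^esub> nabla C U s) \<and>
        (\<forall>V. open V \<and> V \<subseteq> U \<longrightarrow> (\<forall>s\<in>carrier (Sec (vbundle C) U).
           nabla C V (Res (vbundle C) U V s) = Res (forms C) U V (nabla C U s))))"

text \<open>Isomorphism over \<open>X\<close> of connections without poles on \<open>X\<close>; \<open>\<psi>\<close> is the map \<open>\<phi> \<otimes> id\<close>.\<close>

definition isomorphic_connections ::
    "cp1 set \<Rightarrow> ('s, 't) connection \<Rightarrow> ('u, 'v) connection \<Rightarrow> bool" where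
  "isomorphic_connections X C C' \<longleftrightarrow> (\<exists>\<phi> \<psi>.
     sheaf_iso X (vbundle C) (vbundle C') \<phi> \<and> sheaf_iso X (forms C) (forms C') \<psi> \<and>
     (\<forall>U. open U \<and> U \<subseteq> X \<longrightarrow> (\<forall>s\<in>carrier (Sec (vbundle C) U).
        (\<forall>\<omega>\<in>carrier (Sec (log_forms {}) U). \<psi> U (tens C U s \<omega>) = tens C' U (\<phi> U s) \<omega>) \<and>
        \<psi> U (nabla C U s) = nabla C' U (\<phi> U s))))"

text \<open>\<open>R\<close> is the matrix of the residue of the connection at \<open>p\<close> in some local frame. Here
  \<open>\<nabla> e\<^sub>j = \<Sum>\<^sub>i e\<^sub>i \<otimes> \<omega>\<^sub>i\<^sub>j\<close>.\<close>

definition residue_matrix :: "cp1 set \<Rightarrow> ('s, 't) connection \<Rightarrow> cp1 \<Rightarrow> complex mat \<Rightarrow> bool" where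
  "residue_matrix S C p R \<longleftrightarrow> (\<exists>U n e \<omega>. open U \<and> p \<in> U \<and> is_frame (vbundle C) U n e \<and>
     (\<forall>i<n. \<forall>j<n. \<omega> i j \<in> carrier (Sec (log_forms S) U)) \<and>
     (\<forall>j<n. nabla C U (e j) = (\<Oplus>\<^bsub>Sec (forms C) U\<^esub>i\<in>{..<n}. tens C U (e i) (\<omega> i j))) \<and>
     R = Matrix.mat n n (\<lambda>(i, j). residue (form_at p (\<omega> i j)) 0))"

section \<open>Monodromy representations\<close>

definition monodromy_rep :: "nat \<Rightarrow> (int \<Rightarrow> complex mat) \<Rightarrow> bool" where
  "monodromy_rep n \<rho> \<longleftrightarrow> (\<forall>k. \<rho> k \<in> carrier_mat n n) \<and> \<rho> 0 = 1\<^sub>m n \<and>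
     (\<forall>k l. \<rho> (k + l) = \<rho> k * \<rho> l)"

definition isomorphic_reps :: "(int \<Rightarrow> complex mat) \<Rightarrow> (int \<Rightarrow> complex mat) \<Rightarrow> bool" where
  "isomorphic_reps \<rho> \<sigma> \<longleftrightarrow> (\<exists>P Q. \<forall>k. similar_mat_wit (\<rho> k) (\<sigma> k) P Q)"

definition sum_rep :: "(int \<Rightarrow> complex mat) list \<Rightarrow> int \<Rightarrow> complex mat" where
  "sum_rep \<sigma>s k = diag_block_mat (map (\<lambda>\<sigma>. \<sigma> k) \<sigma>s)"

definition indecomposable_rep :: "nat \<Rightarrow> (int \<Rightarrow> complex mat) \<Rightarrow> bool" where
  "indecomposable_rep n \<rho> \<longleftrightarrow> monodromy_rep n \<rho> \<and> n > 0 \<and>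
     \<not> (\<exists>a b \<sigma> \<tau>. a > 0 \<and> b > 0 \<and> monodromy_rep a \<sigma> \<and> monodromy_rep b \<tau> \<and>
          isomorphic_reps \<rho> (sum_rep [\<sigma>, \<tau>]))"

text \<open>The universal cover of the punctured line, with deck transformations \<open>u \<mapsto> u + k\<close>.\<close>

definition cover :: "complex \<Rightarrow> cp1" where
  "cover u = Affine (exp (2 * complex_of_real pi * \<i> * u))"

text \<open>The connection on the punctured line that belongs to \<open>\<rho>\<close>: the quotient of the trivial bundle
  with the connection \<open>d\<close> on the universal cover by the action of the integers. Sections are the
  vector functions \<open>f\<close> with \<open>f(u + k) = \<rho>(k) f(u)\<close>. The 1-forms with values in the bundle are
  written as section times \<open>dz\<close>, and \<open>df = f'(u) du\<close> with \<open>dz = 2 \<pi> i z du\<close>.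

  This fixes the orientation. On the trivial bundle with \<open>\<nabla> = d + L dz / z\<close>, the
  function of a section \<open>s\<close> is \<open>exp(2 \<pi> i u L) s\<close>, so that \<open>\<rho>(1) = exp(2 \<pi> i L)\<close>.\<close>

definition rep_bundle :: "nat \<Rightarrow> (int \<Rightarrow> complex mat) \<Rightarrow> (complex \<Rightarrow> complex Matrix.vec) osheaf" where
  "rep_bundle n \<rho> = \<lparr>
     Sec = (\<lambda>U. \<lparr>carrier = {f. (\<forall>u. f u \<in> carrier_vec n) \<and>
            (\<forall>u. cover u \<notin> U \<longrightarrow> f u = 0\<^sub>v n) \<and>
            (\<forall>i<n. \<forall>u. cover u \<in> U \<longrightarrow> (\<lambda>v. vec_index (f v) i) analytic_on {u}) \<and>
            (\<forall>k u. f (u + of_int k) = \<rho> k *\<^sub>v f u)},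
       monoid.mult = undefined, one = undefined, zero = (\<lambda>_. 0\<^sub>v n),
       add = (\<lambda>f g u. f u + g u),
       module.smult = (\<lambda>f g u. f (cover u) \<cdot>\<^sub>v g u)\<rparr>),
     Res = (\<lambda>U V f u. if cover u \<in> V then f u else 0\<^sub>v n)\<rparr>"

definition rep_connection :: "nat \<Rightarrow> (int \<Rightarrow> complex mat) \<Rightarrow>
    (complex \<Rightarrow> complex Matrix.vec, complex \<Rightarrow> complex Matrix.vec) connection" where
  "rep_connection n \<rho> = \<lparr>
     vbundle = rep_bundle n \<rho>,
     forms = rep_bundle n \<rho>,
     tens = (\<lambda>U f \<eta> u. \<eta> (cover u) \<cdot>\<^sub>v f u),
     nabla = (\<lambda>U f u. if cover u \<in> U
       then Matrix.vec n (\<lambda>i. deriv (\<lambda>v. vec_index (f v) i) u /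
              (2 * complex_of_real pi * \<i> * exp (2 * complex_of_real pi * \<i> * u)))
       else 0\<^sub>v n)\<rparr>"

section \<open>The extended logarithmic connection\<close>

definition mat_exp :: "complex mat \<Rightarrow> complex mat" where
  "mat_exp A = Matrix.mat (dim_row A) (dim_row A)
     (\<lambda>(i, j). \<Sum>k. (A ^\<^sub>m k) $$ (i, j) / fact k)"

definition principal_log :: "complex mat \<Rightarrow> complex mat \<Rightarrow> bool" where
  "principal_log A L \<longleftrightarrow> L \<in> carrier_mat (dim_row A) (dim_row A) \<and>
     mat_exp ((2 * complex_of_real pi * \<i>) \<cdot>\<^sub>m L) = A \<and>
     (\<forall>x. eigenvalue L x \<longrightarrow> 0 \<le> Re x \<and> Re x < 1)"

text \<open>The residue at \<open>p\<close> is conjugate to the principal logarithm of \<open>A\<close>.\<close>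

definition principal_residue :: "cp1 set \<Rightarrow> ('s, 't) connection \<Rightarrow> cp1 \<Rightarrow> complex mat \<Rightarrow> bool" where
  "principal_residue S C p A \<longleftrightarrow>
     (\<exists>R L. residue_matrix S C p R \<and> principal_log A L \<and> similar_mat R L)"

text \<open>The characterization of the extended logarithmic connection of \<open>\<rho>\<close>. The local monodromy is
  \<open>\<rho>(1)\<close> at \<open>0\<close> and \<open>\<rho>(1)\<^sup>-\<^sup>1 = \<rho>(- 1)\<close> at infinity.\<close>

definition extended_log_connection ::
    "nat \<Rightarrow> (int \<Rightarrow> complex mat) \<Rightarrow> ('s, 't) connection \<Rightarrow> bool" where
  "extended_log_connection n \<rho> C \<longleftrightarrow>
     log_connection UNIV {Affine 0, Infty} C \<and>
     isomorphic_connections punctured_line C (rep_connection n \<rho>) \<and>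
     principal_residue {Affine 0, Infty} C (Affine 0) (\<rho> 1) \<and>
     principal_residue {Affine 0, Infty} C Infty (\<rho> (- 1))"

end

theory Submission
  imports "Jordan_Normal_Form.Jordan_Normal_Form_Existence" Defs
begin

text \<open>
Let \<open>L\<^sub>0\<close> and \<open>L\<^sub>\<infinity>\<close> be the principal logarithms of \<open>\<rho>(1)\<close> and \<open>\<rho>(- 1)\<close>. Sections over the
punctured line are vector functions \<open>f\<close> on the universal cover with \<open>f(u + 1) = \<rho>(1) f(u)\<close>, so the
columns of \<open>exp(2 \<pi> i u L\<^sub>0)\<close> and the columns of \<open>exp(- 2 \<pi> i u L\<^sub>\<infinity>)\<close> are two global frames there.

The first frame extends to a frame of the bundle across \<open>0\<close>, the second one across \<open>\<infinity>\<close>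
(\<open>local_frame_extension\<close>). Indeed, let \<open>h(t) dt / t\<close> be the connection matrix in any local frame at
the pole. The matrix \<open>H\<close> that expresses this frame in the canonical one solves
\<open>t H' = - L H + H h\<close>. This is a system with a regular singularity, so \<open>H\<close> has at most a pole, and a
pole of order \<open>k > 0\<close> would require eigenvalues \<open>a\<close> of \<open>L\<close> and \<open>b\<close> of \<open>h(0)\<close> with
\<open>b - a = - k\<close>. The real parts of both lie in \<open>[0, 1)\<close>, so there are none, and the same holds for the
inverse of \<open>H\<close>.

The bundle is therefore given by the single transition matrix
\<open>P(z) = exp(2 \<pi> i u L\<^sub>\<infinity>) exp(2 \<pi> i u L\<^sub>0)\<close> with \<open>z = exp(2 \<pi> i u)\<close>, which solves
\<open>z P' = L\<^sub>\<infinity> P + P L\<^sub>0\<close>. The sum of an eigenvalue of \<open>L\<^sub>\<infinity>\<close> and one of \<open>L\<^sub>0\<close> has real part in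
\<open>[0, 2)\<close>, so \<open>P\<close> has no pole at \<open>0\<close> and at most a simple pole at \<open>\<infinity>\<close>. By Liouville,
\<open>P = P\<^sub>0 + z P\<^sub>1\<close>, where \<open>L\<^sub>\<infinity> P\<^sub>0 + P\<^sub>0 L\<^sub>0 = 0\<close> and \<open>L\<^sub>\<infinity> P\<^sub>1 + P\<^sub>1 L\<^sub>0 = P\<^sub>1\<close>
(\<open>log_transition_linear\<close>). By symmetry the inverse is \<open>Q\<^sub>0 + z\<^sup>-\<^sup>1 Q\<^sub>1\<close>. Since \<open>P(1) = 1\<close>, this forces
\<open>P\<^sub>0\<close> and \<open>P\<^sub>1\<close> to be complementary idempotents (\<open>log_transition_idempotent\<close>). After
diagonalizing \<open>P\<^sub>1\<close>, of rank \<open>m\<close> say, the transition matrix is the diagonal matrix with \<open>m\<close> entries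
\<open>z\<close> and \<open>n - m\<close> entries \<open>1\<close>. Thus the bundle is a sum of \<open>m\<close> copies of \<open>O(- 1)\<close> and \<open>n - m\<close>
copies of \<open>O(0)\<close> (\<open>isomorphic_direct_sum_twisting\<close>), and its degree is \<open>- m\<close> (\<open>c1_eq\<close>). This is
the second claim.

If \<open>\<rho>(1)\<close> is a Jordan block for \<open>r exp(2 \<pi> i q)\<close>, then every eigenvalue of \<open>L\<^sub>0\<close> has real part \<open>q\<close>,
and every eigenvalue of \<open>L\<^sub>\<infinity>\<close> has real part \<open>0\<close> or \<open>1 - q\<close>, according to whether \<open>q = 0\<close>. The sums
of eigenvalues are then never \<open>1\<close>, respectively never \<open>0\<close>, so that one of the two Sylvester
equations above has only the solution \<open>P\<^sub>1 = 0\<close>, respectively \<open>P\<^sub>0 = 0\<close> (\<open>sylvester_zero\<close>). Hence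
\<open>m = 0\<close> or \<open>m = n\<close>, which is the first claim.
\<close>

section \<open>The Sylvester equation\<close>

lemma sq_mult: "A \<in> carrier_mat n n \<Longrightarrow> B \<in> carrier_mat n n \<Longrightarrow> A * B \<in> carrier_mat n n"
  by simp

lemma sq_mult_entry:
  assumes "A \<in> carrier_mat n n" "B \<in> carrier_mat n n" "i < n" "j < n"
  shows "(A * B) $$ (i, j) = (\<Sum>l<n. A $$ (i, l) * B $$ (l, j))"
  using assms by (simp add: scalar_prod_def atLeast0LessThan)

lemma mult_vec_entry:
  assumes "A \<in> carrier_mat n n" "v \<in> carrier_vec n" "i < n"
  shows "vec_index (A *\<^sub>v v) i = (\<Sum>j<n. A $$ (i, j) * vec_index v j)"
  using assms by (simp add: scalar_prod_def atLeast0LessThan)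

text \<open>Schur triangularization of \<open>B\<close> turns the equation, column by column, into eigenvector equations
for \<open>A\<close>: once the earlier columns vanish, the next one is an eigenvector of \<open>A\<close> or zero, and the
spectral condition excludes the former. The scalars allow for the signs and the resonance shift
\<open>c\<close> that occur at poles of order \<open>- c\<close>.\<close>

lemma sylvester_zero:
  fixes A B X :: "complex mat"
  assumes A: "A \<in> carrier_mat n n" and B: "B \<in> carrier_mat n n" and X: "X \<in> carrier_mat n n"
    and eq: "\<alpha> \<cdot>\<^sub>m (A * X) + \<beta> \<cdot>\<^sub>m (X * B) = c \<cdot>\<^sub>m X" and "\<alpha> \<noteq> 0"
    and spec: "\<And>a b. eigenvalue A a \<Longrightarrow> eigenvalue B b \<Longrightarrow> \<alpha> * a + \<beta> * b \<noteq> c"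
  shows "X = 0\<^sub>m n n"
proof -
  obtain es where es: "char_poly B = (\<Prod>a\<leftarrow>es. [:- a, 1:])"
    using char_poly_factorized[OF B] by blast
  obtain T where T: "T \<in> carrier_mat n n" "upper_triangular T" "similar_mat B T"
    using schur_decomposition_exists[OF B es] by blast
  obtain P Q where "similar_mat_wit B T P Q" using T(3) by (auto simp: similar_mat_def)
  then have P: "P \<in> carrier_mat n n" and Q: "Q \<in> carrier_mat n n" and PQ: "P * Q = 1\<^sub>m n"
    and QP: "Q * P = 1\<^sub>m n" and BT: "B = P * T * Q"
    using similar_mat_witD2[OF B] by auto
  define Y where "Y = X * P"
  have Y: "Y \<in> carrier_mat n n" using X P by (simp add: Y_def)
  have "B * P = P * T"
    using P Q T(1) QP by (simp add: BT assoc_mult_mat[of _ n n _ n _ n])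
  then have YT: "X * B * P = Y * T"
    using X B P T by (simp add: Y_def assoc_mult_mat[of _ n n _ n _ n])
  have eqY: "\<alpha> \<cdot>\<^sub>m (A * Y) + \<beta> \<cdot>\<^sub>m (Y * T) = c \<cdot>\<^sub>m Y"
  proof -
    have "(\<alpha> \<cdot>\<^sub>m (A * X) + \<beta> \<cdot>\<^sub>m (X * B)) * P = \<alpha> \<cdot>\<^sub>m (A * Y) + \<beta> \<cdot>\<^sub>m (Y * T)"
      using A X B P
      by (simp add: add_mult_distrib_mat[of _ n n _ _ n] mult_smult_assoc_mat[of _ n n _ n] YT Y_def)
    then show ?thesis using eq X P by (simp add: Y_def mult_smult_assoc_mat[of _ n n _ n])
  qed
  have "\<forall>i<n. Y $$ (i, j) = 0" if "j < n" for j
    using that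
  proof (induction j rule: less_induct)
    case (less j)
    have row: "\<alpha> * (\<Sum>l<n. A $$ (i, l) * Y $$ (l, j)) = (c - \<beta> * T $$ (j, j)) * Y $$ (i, j)" if i: "i < n" for i
    proof -
      have "(\<Sum>l<n. Y $$ (i, l) * T $$ (l, j)) = (\<Sum>l<n. if l = j then Y $$ (i, j) * T $$ (j, j) else 0)"
      proof (rule sum.cong[OF refl])
        fix l assume l: "l \<in> {..<n}"
        consider "l < j" | "l = j" | "l > j" by linarith
        then show "Y $$ (i, l) * T $$ (l, j) = (if l = j then Y $$ (i, j) * T $$ (j, j) else 0)"
          using less l i upper_triangularD[OF T(2), of j l] T(1) by cases auto
      qed
      then have YTij: "(Y * T) $$ (i, j) = Y $$ (i, j) * T $$ (j, j)"
        using i less.prems Y T(1) by (simp add: scalar_prod_def atLeast0LessThan)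
      have "(\<alpha> \<cdot>\<^sub>m (A * Y) + \<beta> \<cdot>\<^sub>m (Y * T)) $$ (i, j) = (c \<cdot>\<^sub>m Y) $$ (i, j)" using eqY by simp
      then have "\<alpha> * (A * Y) $$ (i, j) + \<beta> * (Y * T) $$ (i, j) = c * Y $$ (i, j)"
        using i less.prems A Y T(1) by simp
      moreover have "(A * Y) $$ (i, j) = (\<Sum>l<n. A $$ (i, l) * Y $$ (l, j))"
        using i less.prems A Y by (simp add: scalar_prod_def atLeast0LessThan)
      ultimately show ?thesis by (simp add: YTij algebra_simps)
    qed
    have "col Y j = 0\<^sub>v n"
    proof (rule ccontr)
      assume nz: "col Y j \<noteq> 0\<^sub>v n"
      let ?a = "(c - \<beta> * T $$ (j, j)) / \<alpha>"
      have "A *\<^sub>v col Y j = ?a \<cdot>\<^sub>v col Y j"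
      proof (rule eq_vecI)
        fix i assume "i < dim_vec (?a \<cdot>\<^sub>v col Y j)"
        then have i: "i < n" using Y by simp
        have "vec_index (A *\<^sub>v col Y j) i = (\<Sum>l<n. A $$ (i, l) * Y $$ (l, j))"
          using i less.prems A Y by (simp add: scalar_prod_def atLeast0LessThan)
        then show "vec_index (A *\<^sub>v col Y j) i = vec_index (?a \<cdot>\<^sub>v col Y j) i"
          using row[OF i] i less.prems Y \<open>\<alpha> \<noteq> 0\<close> by (simp add: field_simps)
      qed (use A Y in simp)
      then have "eigenvalue A ?a"
        using nz A Y col_carrier_vec[OF less.prems Y] unfolding eigenvalue_def eigenvector_def by force
      moreover have "eigenvalue B (T $$ (j, j))"
      proof -
        have "char_poly B = (\<Prod>a\<leftarrow>diag_mat T. [:- a, 1:])"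
          using char_poly_similar[OF T(3)] char_poly_upper_triangular[OF T(1,2)] by simp
        moreover have "T $$ (j, j) \<in> set (diag_mat T)"
          using less.prems T(1) by (auto simp: diag_mat_def)
        ultimately have "poly (char_poly B) (T $$ (j, j)) = 0"
          by (auto simp: poly_prod_list prod_list_zero_iff intro!: image_eqI[where x = "[:- T $$ (j, j), 1:]"])
        then show ?thesis by (simp add: eigenvalue_root_char_poly[OF B])
      qed
      ultimately show False using spec \<open>\<alpha> \<noteq> 0\<close> by fastforce
    qed
    then show ?case using Y less.prems by (metis carrier_matD(1) index_col index_zero_vec(1) carrier_matD(2))
  qed
  then have "Y = 0\<^sub>m n n" using Y by (intro eq_matI) auto
  moreover have "X = Y * Q" using X P Q PQ by (simp add: Y_def assoc_mult_mat[of _ n n _ n _ n])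
  ultimately show ?thesis using Q by simp
qed

section \<open>Matrix-valued functions and the matrix exponential\<close>

text \<open>The dimension is an argument because the matrices carry it only as data; all values of \<open>F\<close> are
required to have it, so that products of matrix functions can be differentiated entrywise.\<close>

definition has_mat_deriv :: "nat \<Rightarrow> (complex \<Rightarrow> complex mat) \<Rightarrow> complex mat \<Rightarrow> complex \<Rightarrow> bool" where
  "has_mat_deriv n F F' v \<longleftrightarrow> F' \<in> carrier_mat n n \<and> (\<forall>v. F v \<in> carrier_mat n n) \<and>
     (\<forall>i<n. \<forall>j<n. ((\<lambda>v. F v $$ (i, j)) has_field_derivative F' $$ (i, j)) (at v))"

lemma has_mat_derivD:
  assumes "has_mat_deriv n F F' v"
  shows "F' \<in> carrier_mat n n" "F w \<in> carrier_mat n n"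
    "i < n \<Longrightarrow> j < n \<Longrightarrow> ((\<lambda>v. F v $$ (i, j)) has_field_derivative F' $$ (i, j)) (at v)"
  using assms by (auto simp: has_mat_deriv_def)

lemma has_mat_deriv_unique:
  assumes "has_mat_deriv n F F' v" "has_mat_deriv n F F'' v"
  shows "F' = F''"
proof (rule eq_matI)
  fix i j assume "i < dim_row F''" "j < dim_col F''"
  then have "i < n" "j < n" using has_mat_derivD(1)[OF assms(2)] by auto
  then show "F' $$ (i, j) = F'' $$ (i, j)"
    using has_mat_derivD(3)[OF assms(1)] has_mat_derivD(3)[OF assms(2)] DERIV_unique by blast
qed (use has_mat_derivD(1)[OF assms(1)] has_mat_derivD(1)[OF assms(2)] in auto)

lemma has_mat_deriv_mult:
  assumes F: "has_mat_deriv n F F' v" and G: "has_mat_deriv n G G' v"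
  shows "has_mat_deriv n (\<lambda>v. F v * G v) (F' * G v + F v * G') v"
  unfolding has_mat_deriv_def
proof (intro conjI allI impI)
  note FD = has_mat_derivD[OF F] and GD = has_mat_derivD[OF G]
  show "F' * G v + F v * G' \<in> carrier_mat n n" "\<And>v. F v * G v \<in> carrier_mat n n"
    using FD(1) GD(1) by (simp_all add: FD(2) GD(2) sq_mult[where n = n])
  fix i j assume ij: "i < n" "j < n"
  have prod: "(A * B) $$ (i, j) = (\<Sum>l<n. A $$ (i, l) * B $$ (l, j))"
    if "A \<in> carrier_mat n n" "B \<in> carrier_mat n n" for A B :: "complex mat"
    using that ij by (simp add: scalar_prod_def atLeast0LessThan)
  have "((\<lambda>v. \<Sum>l<n. F v $$ (i, l) * G v $$ (l, j)) has_field_derivative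
      (\<Sum>l<n. F' $$ (i, l) * G v $$ (l, j) + F v $$ (i, l) * G' $$ (l, j))) (at v)"
    by (rule DERIV_sum, rule derivative_eq_intros, rule FD(3), use ij in simp, simp, rule GD(3), simp,
        use ij in simp, simp add: algebra_simps)
  moreover have "(F' * G v + F v * G') $$ (i, j) =
      (\<Sum>l<n. F' $$ (i, l) * G v $$ (l, j) + F v $$ (i, l) * G' $$ (l, j))"
  proof -
    have "(F' * G v + F v * G') $$ (i, j) = (F' * G v) $$ (i, j) + (F v * G') $$ (i, j)"
      using FD(1) FD(2)[of v] GD(1) GD(2)[of v] ij by (subst index_add_mat) auto
    then show ?thesis using FD(1) GD(1) by (simp add: FD(2) GD(2) prod sum.distrib)
  qed
  moreover have "(\<lambda>v. (F v * G v) $$ (i, j)) = (\<lambda>v. \<Sum>l<n. F v $$ (i, l) * G v $$ (l, j))"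
    by (simp add: prod FD(2) GD(2))
  ultimately show "((\<lambda>v. (F v * G v) $$ (i, j)) has_field_derivative (F' * G v + F v * G') $$ (i, j)) (at v)"
    by simp
qed

lemma has_mat_deriv_chain:
  assumes F: "has_mat_deriv n F F' (g v)" and g: "(g has_field_derivative g') (at v)"
  shows "has_mat_deriv n (\<lambda>v. F (g v)) (g' \<cdot>\<^sub>m F') v"
  unfolding has_mat_deriv_def
proof (intro conjI allI impI)
  note FD = has_mat_derivD[OF F]
  show "g' \<cdot>\<^sub>m F' \<in> carrier_mat n n" "\<And>v. F (g v) \<in> carrier_mat n n" using FD(1) by (simp_all add: FD(2))
  fix i j assume "i < n" "j < n"
  then show "((\<lambda>v. F (g v) $$ (i, j)) has_field_derivative (g' \<cdot>\<^sub>m F') $$ (i, j)) (at v)"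
    using DERIV_chain2[OF FD(3) g] FD(1) by (simp add: mult.commute)
qed

lemma complex_deriv_zero_const:
  fixes f :: "complex \<Rightarrow> complex"
  assumes "\<And>x. (f has_field_derivative 0) (at x)"
  shows "f x = f y"
proof -
  have "\<exists>c. \<forall>x\<in>UNIV. f x = c"
    by (rule has_field_derivative_zero_constant) (use assms in simp_all)
  then show ?thesis by auto
qed

lemma has_mat_deriv_zero_const:
  assumes "\<And>v. has_mat_deriv n F (0\<^sub>m n n) v"
  shows "F v = F w"
proof (rule eq_matI)
  fix i j assume "i < dim_row (F w)" "j < dim_col (F w)"
  then have ij: "i < n" "j < n" using has_mat_derivD(2)[OF assms, where w = w] by auto
  have "((\<lambda>v. F v $$ (i, j)) has_field_derivative 0) (at x)" for x
    using has_mat_derivD(3)[OF assms ij] ij by simp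
  then show "F v $$ (i, j) = F w $$ (i, j)"
    by (rule complex_deriv_zero_const)
qed (use has_mat_derivD(2)[OF assms, where w = v] has_mat_derivD(2)[OF assms, where w = w] in auto)

lemma pow_smult_mat:
  assumes "A \<in> carrier_mat n n"
  shows "(x \<cdot>\<^sub>m A) ^\<^sub>m k = x ^ k \<cdot>\<^sub>m (A ^\<^sub>m k :: complex mat)"
proof (induction k)
  case (Suc k)
  have "A ^\<^sub>m k \<in> carrier_mat n n" using assms by simp
  then have "(x ^ k \<cdot>\<^sub>m A ^\<^sub>m k) * (x \<cdot>\<^sub>m A) = (x ^ k * x) \<cdot>\<^sub>m (A ^\<^sub>m k * A)"
    using assms
    by (simp add: mult_smult_assoc_mat[of _ n n _ n] mult_smult_distrib[of _ n n _ n]) (auto intro!: eq_matI)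
  then show ?case using Suc by (simp add: mult.commute)
qed (use assms in \<open>auto intro!: eq_matI\<close>)

lemma pow_mat_Suc_left:
  assumes A: "A \<in> carrier_mat n n"
  shows "(A :: complex mat) ^\<^sub>m Suc k = A * A ^\<^sub>m k"
proof (induction k)
  case (Suc k)
  have Ak: "A ^\<^sub>m k \<in> carrier_mat n n" using A by simp
  have "A ^\<^sub>m Suc (Suc k) = A * A ^\<^sub>m k * A" using Suc by simp
  also have "\<dots> = A * A ^\<^sub>m Suc k" using assoc_mult_mat[OF A Ak A] by simp
  finally show ?case .
qed (use A in auto)

lemma mat_exp_carrier: "A \<in> carrier_mat n n \<Longrightarrow> mat_exp A \<in> carrier_mat n n"
  by (simp add: mat_exp_def)

lemma pow_mat_entry_bound:
  assumes A: "A \<in> carrier_mat n n"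
  obtains b where "b \<ge> 0" "\<And>k i j. i < n \<Longrightarrow> j < n \<Longrightarrow> norm ((A ^\<^sub>m k) $$ (i, j) :: complex) \<le> b ^ k"
proof -
  define m where "m = (\<Sum>i<n. \<Sum>j<n. norm (A $$ (i, j)))"
  have m: "norm (A $$ (i, j)) \<le> m" if "i < n" "j < n" for i j
  proof -
    have "norm (A $$ (i, j)) \<le> (\<Sum>j<n. norm (A $$ (i, j)))"
      using that by (intro member_le_sum) auto
    also have "\<dots> \<le> m" unfolding m_def
      using that by (intro member_le_sum[where f = "\<lambda>i. \<Sum>j<n. norm (A $$ (i, j))"]) (auto intro: sum_nonneg)
    finally show ?thesis .
  qed
  have "m \<ge> 0" by (simp add: m_def sum_nonneg)
  have "norm ((A ^\<^sub>m k) $$ (i, j)) \<le> (real n * m) ^ k" if "i < n" "j < n" for k i j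
    using that
  proof (induction k arbitrary: j)
    case 0
    then show ?case using A by simp
  next
    case (Suc k)
    have "A ^\<^sub>m k \<in> carrier_mat n n" using A by simp
    then have "(A ^\<^sub>m Suc k) $$ (i, j) = (\<Sum>l<n. (A ^\<^sub>m k) $$ (i, l) * A $$ (l, j))"
      using A Suc.prems by (simp add: scalar_prod_def atLeast0LessThan)
    also have "norm \<dots> \<le> (\<Sum>l<n. (real n * m) ^ k * m)"
      by (rule sum_norm_le) (use Suc m \<open>m \<ge> 0\<close> in \<open>auto simp: norm_mult intro!: mult_mono\<close>)
    also have "\<dots> = (real n * m) ^ Suc k" by simp
    finally show ?case .
  qed
  then show ?thesis using that[of "real n * m"] \<open>m \<ge> 0\<close> by simp
qed

lemma has_mat_deriv_exp:
  assumes A: "A \<in> carrier_mat n n"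
  shows "has_mat_deriv n (\<lambda>x. mat_exp (x \<cdot>\<^sub>m A)) (mat_exp (x \<cdot>\<^sub>m A) * A) x" (is ?th1)
    and "A * mat_exp (x \<cdot>\<^sub>m A) = mat_exp (x \<cdot>\<^sub>m A) * A" (is ?th2)
proof -
  define c where "c i j k = (A ^\<^sub>m k) $$ (i, j) / fact k" for i j k
  have Ak: "A ^\<^sub>m k \<in> carrier_mat n n" for k using A by simp
  have ex: "mat_exp (x \<cdot>\<^sub>m A) $$ (i, j) = (\<Sum>k. c i j k * x ^ k)" if "i < n" "j < n" for i j x
  proof -
    have "((x \<cdot>\<^sub>m A) ^\<^sub>m k) $$ (i, j) / fact k = c i j k * x ^ k" for k
      using that carrier_matD[OF Ak[of k]] by (simp add: pow_smult_mat[OF A] c_def)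
    then show ?thesis using that A by (simp add: mat_exp_def)
  qed
  obtain b where b: "b \<ge> 0" "\<And>k i j. i < n \<Longrightarrow> j < n \<Longrightarrow> norm ((A ^\<^sub>m k) $$ (i, j)) \<le> b ^ k"
    using pow_mat_entry_bound[OF A] by blast
  have sm: "summable (\<lambda>k. c i j k * x ^ k)" if "i < n" "j < n" for i j x
  proof (rule summable_comparison_test')
    show "summable (\<lambda>k. (b * norm x) ^ k / fact k)"
      using summable_exp_generic[of "b * norm x"] by (simp add: divide_inverse mult.commute)
    show "norm (c i j k * x ^ k) \<le> (b * norm x) ^ k / fact k" for k
      using b(2)[OF that, of k]
      by (simp add: c_def norm_mult norm_divide norm_power power_mult_distrib divide_right_mono mult_right_mono)
  qed
  have dR: "diffs (c i j) k = (\<Sum>l<n. c i l k * A $$ (l, j))" 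
    and dL: "diffs (c i j) k = (\<Sum>l<n. A $$ (i, l) * c l j k)" if "i < n" "j < n" for i j k
  proof -
    have d: "diffs (c i j) k = (A ^\<^sub>m Suc k) $$ (i, j) / fact k"
      by (simp add: diffs_def c_def field_simps del: of_nat_Suc pow_mat.simps)
    show "diffs (c i j) k = (\<Sum>l<n. c i l k * A $$ (l, j))"
      unfolding d pow_mat.simps sq_mult_entry[OF Ak A that] by (simp add: c_def sum_divide_distrib)
    show "diffs (c i j) k = (\<Sum>l<n. A $$ (i, l) * c l j k)"
      unfolding d pow_mat_Suc_left[OF A] sq_mult_entry[OF A Ak that] by (simp add: c_def sum_divide_distrib)
  qed
  have car: "mat_exp (x \<cdot>\<^sub>m A) \<in> carrier_mat n n" for x using A by (simp add: mat_exp_carrier)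
  have R: "(mat_exp (x \<cdot>\<^sub>m A) * A) $$ (i, j) = (\<Sum>k. diffs (c i j) k * x ^ k)" if "i < n" "j < n" for i j x
  proof -
    have "(mat_exp (x \<cdot>\<^sub>m A) * A) $$ (i, j) = (\<Sum>l<n. (\<Sum>k. c i l k * x ^ k) * A $$ (l, j))"
      using that A car[of x] by (simp add: scalar_prod_def atLeast0LessThan ex)
    also have "\<dots> = (\<Sum>l<n. \<Sum>k. c i l k * x ^ k * A $$ (l, j))"
      using that by (intro sum.cong refl suminf_mult2 sm) auto
    also have "\<dots> = (\<Sum>k. \<Sum>l<n. c i l k * x ^ k * A $$ (l, j))"
      using that by (intro suminf_sum[symmetric] summable_mult2 sm) auto
    also have "\<dots> = (\<Sum>k. diffs (c i j) k * x ^ k)"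
      using that by (simp add: dR sum_distrib_right sum_distrib_left mult_ac)
    finally show ?thesis .
  qed
  have L: "(A * mat_exp (x \<cdot>\<^sub>m A)) $$ (i, j) = (\<Sum>k. diffs (c i j) k * x ^ k)" if "i < n" "j < n" for i j x
  proof -
    have "(A * mat_exp (x \<cdot>\<^sub>m A)) $$ (i, j) = (\<Sum>l<n. A $$ (i, l) * (\<Sum>k. c l j k * x ^ k))"
      using that A car[of x] by (simp add: scalar_prod_def atLeast0LessThan ex)
    also have "\<dots> = (\<Sum>l<n. \<Sum>k. A $$ (i, l) * (c l j k * x ^ k))"
      using that by (intro sum.cong refl suminf_mult[symmetric] sm) auto
    also have "\<dots> = (\<Sum>k. \<Sum>l<n. A $$ (i, l) * (c l j k * x ^ k))"
      using that by (intro suminf_sum[symmetric] summable_mult sm) auto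
    also have "\<dots> = (\<Sum>k. diffs (c i j) k * x ^ k)"
      using that by (simp add: dL sum_distrib_right sum_distrib_left mult_ac)
    finally show ?thesis .
  qed
  show ?th2
    by (rule eq_matI) (use car[of x] A L R in \<open>auto simp del: index_mult_mat(1)\<close>)
  show ?th1
    unfolding has_mat_deriv_def
  proof (intro conjI allI impI)
    show "mat_exp (x \<cdot>\<^sub>m A) * A \<in> carrier_mat n n" "\<And>v. mat_exp (v \<cdot>\<^sub>m A) \<in> carrier_mat n n"
      by (simp_all add: car A sq_mult)
    fix i j assume ij: "i < n" "j < n"
    have "((\<lambda>x. \<Sum>k. c i j k * x ^ k) has_field_derivative (\<Sum>k. diffs (c i j) k * x ^ k)) (at x)"
      by (rule termdiffs_strong_converges_everywhere) (rule sm[OF ij])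
    then show "((\<lambda>v. mat_exp (v \<cdot>\<^sub>m A) $$ (i, j)) has_field_derivative (mat_exp (x \<cdot>\<^sub>m A) * A) $$ (i, j)) (at x)"
      by (simp only: ex[OF ij] R[OF ij])
  qed
qed

lemma mat_exp_zero:
  assumes A: "A \<in> carrier_mat n n"
  shows "mat_exp (0 \<cdot>\<^sub>m A) = 1\<^sub>m n"
proof (rule eq_matI)
  fix i j assume ij: "i < dim_row (1\<^sub>m n :: complex mat)" "j < dim_col (1\<^sub>m n :: complex mat)"
  have "((0 \<cdot>\<^sub>m A) ^\<^sub>m k) $$ (i, j) / fact k = (if k = 0 then (1\<^sub>m n) $$ (i, j) else 0)" for k
    using ij A pow_carrier_mat[OF A, of k] by (cases k) (auto simp: pow_smult_mat[OF A] simp del: pow_mat.simps(2))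
  then show "mat_exp (0 \<cdot>\<^sub>m A) $$ (i, j) = (1\<^sub>m n) $$ (i, j)"
    using ij A suminf_finite[of "{0}" "\<lambda>k. if k = 0 then (1\<^sub>m n) $$ (i, j) else (0::complex)"]
    by (simp add: mat_exp_def)
qed (use A in \<open>auto simp: mat_exp_def\<close>)

lemma mat_exp_add:
  assumes A: "A \<in> carrier_mat n n"
  shows "mat_exp ((x + y) \<cdot>\<^sub>m A) = mat_exp (x \<cdot>\<^sub>m A) * mat_exp (y \<cdot>\<^sub>m A)"
    and "mat_exp (- x \<cdot>\<^sub>m A) * mat_exp (x \<cdot>\<^sub>m A) = 1\<^sub>m n"
    and "mat_exp (x \<cdot>\<^sub>m A) * mat_exp (- x \<cdot>\<^sub>m A) = 1\<^sub>m n"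
proof -
  let ?E = "\<lambda>x. mat_exp (x \<cdot>\<^sub>m A)"
  have E: "?E x \<in> carrier_mat n n" for x using A by (simp add: mat_exp_carrier)
  have key: "?E (- x) * ?E (x + y) = ?E y" for x y
  proof -
    have "has_mat_deriv n (\<lambda>x. ?E (- x) * ?E (x + y)) (0\<^sub>m n n) v" for v
    proof -
      have 1: "has_mat_deriv n (\<lambda>x. ?E (- x)) (- 1 \<cdot>\<^sub>m (?E (- v) * A)) v"
        by (rule has_mat_deriv_chain[where g = uminus, OF has_mat_deriv_exp(1)[OF A]]) (auto intro!: derivative_eq_intros)
      have 2: "has_mat_deriv n (\<lambda>x. ?E (x + y)) (1 \<cdot>\<^sub>m (?E (v + y) * A)) v"
        by (rule has_mat_deriv_chain[where g = "\<lambda>x. x + y", OF has_mat_deriv_exp(1)[OF A]]) (auto intro!: derivative_eq_intros)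
      have "- 1 \<cdot>\<^sub>m (?E (- v) * A) * ?E (v + y) + ?E (- v) * (1 \<cdot>\<^sub>m (?E (v + y) * A)) = 0\<^sub>m n n"
      proof -
        have "- 1 \<cdot>\<^sub>m (?E (- v) * A) * ?E (v + y) = - 1 \<cdot>\<^sub>m (?E (- v) * (A * ?E (v + y)))"
          using A by (simp add: E sq_mult[where n = n] mult_smult_assoc_mat[of _ n n _ n] assoc_mult_mat[of _ n n _ n _ n])
        moreover have "?E (- v) * (1 \<cdot>\<^sub>m (?E (v + y) * A)) = 1 \<cdot>\<^sub>m (?E (- v) * (A * ?E (v + y)))"
          using A by (simp add: E sq_mult[where n = n] mult_smult_distrib[of _ n n _ n] has_mat_deriv_exp(2)[OF A])
        moreover have "?E (- v) * (A * ?E (v + y)) \<in> carrier_mat n n"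
          using A by (simp add: E sq_mult[where n = n])
        moreover have "- 1 \<cdot>\<^sub>m Z + 1 \<cdot>\<^sub>m Z = 0\<^sub>m n n" if "Z \<in> carrier_mat n n" for Z :: "complex mat"
          using that by (intro eq_matI) auto
        ultimately show ?thesis by simp
      qed
      with has_mat_deriv_mult[OF 1 2] show ?thesis by simp
    qed
    from has_mat_deriv_zero_const[OF this, of x 0] show ?thesis
      using left_mult_one_mat[OF E] by (simp add: mat_exp_zero[OF A])
  qed
  show inv: "?E (- x) * ?E x = 1\<^sub>m n" for x using key[of x 0] by (simp add: mat_exp_zero[OF A])
  show inv2: "?E x * ?E (- x) = 1\<^sub>m n" for x using inv[of "- x"] by simp
  have "?E (x + y) = ?E x * (?E (- x) * ?E (x + y))"
    using E[of x] E[of "- x"] E[of "x + y"]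
    by (subst assoc_mult_mat[symmetric, of _ n n _ n _ n]) (simp_all add: inv2)
  then show "?E (x + y) = ?E x * ?E y" by (simp add: key)
qed

lemma DERIV_mult2:
  assumes "(f has_field_derivative f') (at x)" "(g has_field_derivative g') (at x)"
  shows "((\<lambda>x. f x * g x) has_field_derivative f' * g x + f x * g') (at x)"
  using DERIV_mult'[OF assms] by (simp add: algebra_simps)

text \<open>An eigenvector \<open>v\<close> of \<open>A\<close> is one of the exponential: the vector function
\<open>exp(- x a) exp(x A) v\<close> has derivative zero, so it keeps its value \<open>v\<close> at \<open>x = 0\<close>.\<close>

lemma eigenvalue_mat_exp:
  assumes A: "A \<in> carrier_mat n n" and ev: "eigenvalue A a"
  shows "eigenvalue (mat_exp (x \<cdot>\<^sub>m A)) (exp (x * a))"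
proof -
  obtain v where v: "v \<in> carrier_vec n" "v \<noteq> 0\<^sub>v n" "A *\<^sub>v v = a \<cdot>\<^sub>v v"
    using ev A by (auto simp: eigenvalue_def eigenvector_def)
  let ?E = "\<lambda>x. mat_exp (x \<cdot>\<^sub>m A)"
  have E: "?E x \<in> carrier_mat n n" for x using A by (simp add: mat_exp_carrier)
  have "vec_index (?E x *\<^sub>v v) i = vec_index (exp (x * a) \<cdot>\<^sub>v v) i" if i: "i < n" for i
  proof -
    define g where "g x = exp (- x * a) * (\<Sum>j<n. ?E x $$ (i, j) * vec_index v j)" for x
    have "(g has_field_derivative 0) (at x)" for x
    proof -
      have "(g has_field_derivative (exp (- x * a) * - a) * (\<Sum>j<n. ?E x $$ (i, j) * vec_index v j) +
          exp (- x * a) * (\<Sum>j<n. (?E x * A) $$ (i, j) * vec_index v j)) (at x)"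
        unfolding g_def
      proof (rule DERIV_mult2)
        show "((\<lambda>x. exp (- x * a)) has_field_derivative exp (- x * a) * - a) (at x)"
          by (auto intro!: derivative_eq_intros)
        show "((\<lambda>x. \<Sum>j<n. ?E x $$ (i, j) * vec_index v j) has_field_derivative (\<Sum>j<n. (?E x * A) $$ (i, j) * vec_index v j)) (at x)"
          by (rule DERIV_sum, rule DERIV_cmult_right)
             (rule has_mat_derivD(3)[OF has_mat_deriv_exp(1)[OF A] i], simp)
      qed
      moreover have "(\<Sum>j<n. (?E x * A) $$ (i, j) * vec_index v j) = a * (\<Sum>j<n. ?E x $$ (i, j) * vec_index v j)"
      proof -
        have EA: "?E x * A \<in> carrier_mat n n" using E[of x] A by simp
        have "?E x * A *\<^sub>v v = a \<cdot>\<^sub>v (?E x *\<^sub>v v)"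
          using E[of x] A v by (simp add: assoc_mult_mat_vec[of _ n n _ n] mult_mat_vec[of _ n n])
        then have "vec_index (?E x * A *\<^sub>v v) i = vec_index (a \<cdot>\<^sub>v (?E x *\<^sub>v v)) i" by simp
        then show ?thesis using i v(1) E[of x] EA
          by (simp add: mult_vec_entry[of _ n] del: index_mult_mat(1) index_mult_mat_vec)
      qed
      ultimately show ?thesis by (simp add: algebra_simps)
    qed
    then have "g x = g 0" by (rule complex_deriv_zero_const)
    moreover have "g 0 = vec_index v i"
      using i v(1) by (simp add: g_def mat_exp_zero[OF A] if_distrib[where f = "\<lambda>t. t * _"] sum.delta' cong: if_cong)
    ultimately have "(\<Sum>j<n. ?E x $$ (i, j) * vec_index v j) = exp (x * a) * vec_index v i"
      by (simp add: g_def exp_minus field_simps)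
    then show ?thesis using i v(1) E[of x] by (simp add: scalar_prod_def atLeast0LessThan)
  qed
  then have "?E x *\<^sub>v v = exp (x * a) \<cdot>\<^sub>v v" using v(1) E[of x] by (intro eq_vecI) auto
  then show ?thesis using v E[of x] by (auto simp: eigenvalue_def eigenvector_def)
qed

section \<open>Regular singular systems\<close>

text \<open>Along a ray towards \<open>0\<close> the square norm \<open>Y\<close> of a solution satisfies \<open>s Y' \<ge> - 2 N Y\<close> as soon as \<open>N\<close>
is at least the number of components times the bound on the coefficients. So
\<open>s\<^bsup>2N\<^esup> Y(s)\<close> increases with \<open>s\<close>, and its values are bounded by those on the outer circle.\<close>

lemma regular_singular_growth:
  fixes y :: "'i \<Rightarrow> complex \<Rightarrow> complex" and a :: "'i \<Rightarrow> 'i \<Rightarrow> complex \<Rightarrow> complex"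
  assumes I: "finite I" and r: "r > 0"
    and y': "\<And>i z. i \<in> I \<Longrightarrow> z \<in> cball 0 r - {0} \<Longrightarrow> (y i has_field_derivative y' i z) (at z)"
    and eq: "\<And>i z. i \<in> I \<Longrightarrow> z \<in> cball 0 r - {0} \<Longrightarrow> z * y' i z = (\<Sum>j\<in>I. a i j z * y j z)"
    and bd: "\<And>i j z. i \<in> I \<Longrightarrow> j \<in> I \<Longrightarrow> z \<in> cball 0 r \<Longrightarrow> norm (a i j z) \<le> C"
  obtains N :: nat and M where "\<And>i z. i \<in> I \<Longrightarrow> z \<in> cball 0 r - {0} \<Longrightarrow> norm (z ^ N * y i z) \<le> M"
proof -
  (* the exponent that beats the growth rate allowed by the coefficient bound *)
  obtain N :: nat where N: "of_nat (card I) * C \<le> of_nat N"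
    using real_arch_simple by blast
  define Y where "Y z = (\<Sum>i\<in>I. (norm (y i z))\<^sup>2)" for z
  have cont: "continuous_on (sphere 0 r) Y"
    unfolding Y_def
  proof (intro continuous_intros continuous_at_imp_continuous_on ballI)
    fix i z assume "i \<in> I" "z \<in> sphere (0::complex) r"
    then show "isCont (y i) z" using r by (intro DERIV_isCont[OF y']) auto
  qed
  then have "compact (Y ` sphere 0 r)"
    by (intro compact_continuous_image compact_sphere)
  then obtain M where M: "\<And>z. z \<in> sphere 0 r \<Longrightarrow> Y z \<le> M"
    by (meson bounded_imp_bdd_above compact_imp_bounded bdd_above.E imageI)
  have key: "norm z ^ (2 * N) * Y z \<le> r ^ (2 * N) * M" if z: "z \<in> cball 0 r - {0}" for z
  proof -
    (* the radial projection of z to the outer circle; the ray is s * \<zeta> with s0 <= s <= 1 *)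
    define \<zeta> where "\<zeta> = (of_real r / of_real (norm z)) * z"
    define s0 where "s0 = norm z / r"
    have s0: "0 < s0" "s0 \<le> 1" using z r by (auto simp: s0_def)
    have \<zeta>: "norm \<zeta> = r" using z r by (simp add: \<zeta>_def norm_mult norm_divide)
    have zs: "z = of_real s0 * \<zeta>" using z r by (simp add: \<zeta>_def s0_def)
    define g where "g s = s ^ (2 * N) * (\<Sum>i\<in>I. (norm (y i (of_real s * \<zeta>)))\<^sup>2)" for s
    have "g s0 \<le> g 1"
    proof (rule DERIV_nonneg_imp_nondecreasing[OF s0(2)])
      fix s assume s: "s0 \<le> s" "s \<le> 1"
      then have sp: "s > 0" using s0 by simp
      define w where "w = of_real s * \<zeta>"
      have w: "w \<in> cball 0 r - {0}"
        using sp s \<zeta> r by (auto simp: w_def norm_mult mult_left_le_one_le)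
      have d1: "((\<lambda>s. (norm (y i (of_real s * \<zeta>)))\<^sup>2) has_real_derivative
          2 * (y i w \<bullet> (\<zeta> * y' i w))) (at s)" if i: "i \<in> I" for i
      proof -
        have "((\<lambda>s. y i (of_real s * \<zeta>)) has_vector_derivative \<zeta> * y' i w) (at s)"
        proof -
          have "((\<lambda>s. of_real s * \<zeta>) has_vector_derivative \<zeta>) (at s)"
            by (auto intro!: derivative_eq_intros)
          from field_vector_diff_chain_at[OF this, of "y i" "y' i w"] y'[OF i w]
          show ?thesis by (simp add: w_def o_def)
        qed
        then have D: "((\<lambda>s. y i (of_real s * \<zeta>)) has_derivative (\<lambda>h. h *\<^sub>R (\<zeta> * y' i w))) (at s)"
          by (simp add: has_vector_derivative_def)
        have "((\<lambda>s. y i (of_real s * \<zeta>) \<bullet> y i (of_real s * \<zeta>)) has_derivative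
            (\<lambda>h. y i w \<bullet> (h *\<^sub>R (\<zeta> * y' i w)) + (h *\<^sub>R (\<zeta> * y' i w)) \<bullet> y i w)) (at s)"
          unfolding w_def by (rule has_derivative_inner[OF D D, unfolded w_def])
        then show ?thesis
          unfolding has_field_derivative_def
          by (simp add: power2_norm_eq_inner inner_commute algebra_simps mult_commute_abs)
      qed
      have d2: "(g has_real_derivative
          (real (2 * N) * s ^ (2 * N - 1)) * Y w + s ^ (2 * N) * (\<Sum>i\<in>I. 2 * (y i w \<bullet> (\<zeta> * y' i w)))) (at s)"
      proof -
        have 1: "((\<lambda>s. s ^ (2 * N)) has_real_derivative real (2 * N) * s ^ (2 * N - 1)) (at s)"
          using DERIV_pow[of "2 * N" s] by simp
        have 2: "((\<lambda>s. \<Sum>i\<in>I. (norm (y i (of_real s * \<zeta>)))\<^sup>2) has_real_derivative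
             (\<Sum>i\<in>I. 2 * (y i w \<bullet> (\<zeta> * y' i w)))) (at s)"
          by (rule DERIV_sum) (rule d1)
        from DERIV_mult'[OF 1 2] show ?thesis
          unfolding g_def Y_def w_def by (simp add: algebra_simps)
      qed
      have "- (real N * Y w) \<le> s * (\<Sum>i\<in>I. y i w \<bullet> (\<zeta> * y' i w))"
      proof -
        have "\<bar>s * (\<Sum>i\<in>I. y i w \<bullet> (\<zeta> * y' i w))\<bar> = \<bar>\<Sum>i\<in>I. y i w \<bullet> (w * y' i w)\<bar>"
          by (simp add: w_def sum_distrib_left inner_scaleR_right[symmetric] scaleR_conv_of_real mult.assoc)
        also have "\<dots> \<le> (\<Sum>i\<in>I. \<Sum>j\<in>I. C * (((norm (y i w))\<^sup>2 + (norm (y j w))\<^sup>2) / 2))"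
        proof (rule order_trans[OF sum_abs], rule sum_mono)
          fix i assume i: "i \<in> I"
          have "\<bar>y i w \<bullet> (w * y' i w)\<bar> \<le> norm (y i w) * norm (w * y' i w)"
            by (rule Cauchy_Schwarz_ineq2)
          also have "\<dots> \<le> norm (y i w) * (\<Sum>j\<in>I. C * norm (y j w))"
            unfolding eq[OF i w]
            by (intro mult_left_mono sum_norm_le) (use bd i w in \<open>auto simp: norm_mult intro!: mult_right_mono\<close>)
          also have "\<dots> = (\<Sum>j\<in>I. C * (norm (y i w) * norm (y j w)))"
            by (simp add: sum_distrib_left mult_ac)
          also have "\<dots> \<le> (\<Sum>j\<in>I. C * (((norm (y i w))\<^sup>2 + (norm (y j w))\<^sup>2) / 2))"
          proof (intro sum_mono mult_left_mono)
            show "norm (y i w) * norm (y j w) \<le> ((norm (y i w))\<^sup>2 + (norm (y j w))\<^sup>2) / 2" for j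
              using sum_squares_bound[of "norm (y i w)" "norm (y j w)"] by simp
            show "0 \<le> C" using order_trans[OF norm_ge_zero bd[OF i i, of w]] w by simp
          qed
          finally show "\<bar>y i w \<bullet> (w * y' i w)\<bar> \<le> (\<Sum>j\<in>I. C * (((norm (y i w))\<^sup>2 + (norm (y j w))\<^sup>2) / 2))" .
        qed
        also have "\<dots> = real (card I) * C * Y w"
          by (simp add: Y_def sum.distrib sum_distrib_left[symmetric] sum_divide_distrib[symmetric] add_divide_distrib)
        also have "\<dots> \<le> real N * Y w"
          using N by (intro mult_right_mono) (auto simp: Y_def sum_nonneg)
        finally show ?thesis by linarith
      qed
      then have "0 \<le> 2 * s ^ (2 * N) * (real N * Y w + s * (\<Sum>i\<in>I. y i w \<bullet> (\<zeta> * y' i w)))"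
        using sp by (intro mult_nonneg_nonneg) auto
      also have "\<dots> = s * ((real (2 * N) * s ^ (2 * N - 1)) * Y w + s ^ (2 * N) * (\<Sum>i\<in>I. 2 * (y i w \<bullet> (\<zeta> * y' i w))))"
      proof (cases "N = 0")
        case False
        then have "s ^ (2 * N) = s * s ^ (2 * N - 1)" by (simp add: power_eq_if)
        then show ?thesis by (simp add: sum_distrib_left[symmetric] algebra_simps)
      qed (simp add: sum_distrib_left[symmetric])
      finally have "0 \<le> (real (2 * N) * s ^ (2 * N - 1)) * Y w + s ^ (2 * N) * (\<Sum>i\<in>I. 2 * (y i w \<bullet> (\<zeta> * y' i w)))"
        using sp by (simp add: zero_le_mult_iff)
      with d2 show "\<exists>y. (g has_real_derivative y) (at s) \<and> 0 \<le> y" by blast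
    qed
    then have "s0 ^ (2 * N) * Y z \<le> Y \<zeta>" by (simp add: g_def Y_def zs)
    also have "\<dots> \<le> M" using M \<zeta> by simp
    finally have "s0 ^ (2 * N) * Y z \<le> M" .
    then have "r ^ (2 * N) * (s0 ^ (2 * N) * Y z) \<le> r ^ (2 * N) * M"
      using r by (intro mult_left_mono) auto
    moreover have "norm z = r * s0" using r by (simp add: s0_def)
    ultimately show ?thesis by (simp add: power_mult_distrib mult_ac)
  qed
  show ?thesis
  proof (rule that)
    fix i and z :: complex assume i: "i \<in> I" and z: "z \<in> cball 0 r - {0}"
    have "(norm (z ^ N * y i z))\<^sup>2 = norm z ^ (2 * N) * (norm (y i z))\<^sup>2"
      by (simp add: norm_mult norm_power power_mult_distrib power_mult[symmetric] mult.commute)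
    also have "\<dots> \<le> norm z ^ (2 * N) * Y z"
      unfolding Y_def using i I by (intro mult_left_mono member_le_sum) auto
    also have "\<dots> \<le> r ^ (2 * N) * M" using key[OF z] .
    finally show "norm (z ^ N * y i z) \<le> sqrt (r ^ (2 * N) * M)"
      by (rule real_le_rsqrt)
  qed
qed

text \<open>By the growth bound, the solution has at most a pole. If \<open>v z\<^sup>-\<^sup>k\<close> is its leading term, then comparing
leading coefficients gives \<open>a(0) v = - k v\<close>, so a pole of order \<open>k\<close> requires \<open>- k\<close> to be an
eigenvalue of \<open>a(0)\<close>. The hypothesis on \<open>K\<close> excludes this beyond \<open>K\<close>, so that the pole order can be
lowered step by step down to \<open>K\<close>.\<close>

lemma regular_singular_pole_order:
  fixes y :: "'i \<Rightarrow> complex \<Rightarrow> complex" and a :: "'i \<Rightarrow> 'i \<Rightarrow> complex \<Rightarrow> complex"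
  assumes I: "finite I"
    and a: "\<And>i j. i \<in> I \<Longrightarrow> j \<in> I \<Longrightarrow> a i j analytic_on {0}"
    and y: "\<And>i. i \<in> I \<Longrightarrow> \<forall>\<^sub>F z in at 0. (y i has_field_derivative y' i z) (at z)"
    and eq: "\<And>i. i \<in> I \<Longrightarrow> \<forall>\<^sub>F z in at 0. z * y' i z = (\<Sum>j\<in>I. a i j z * y j z)"
    and res: "\<And>k v. k > K \<Longrightarrow> (\<And>i. i \<in> I \<Longrightarrow> (\<Sum>j\<in>I. a i j 0 * v j) = - of_nat k * v i) \<Longrightarrow>
      (\<And>i. i \<in> I \<Longrightarrow> v i = 0)"
    and "i \<in> I"
  shows "\<exists>g. g analytic_on {0} \<and> (\<forall>\<^sub>F z in at 0. z ^ K * y i z = g z)"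
proof -
  have "\<forall>\<^sub>F z in at 0. (\<forall>i\<in>I. (y i has_field_derivative y' i z) (at z)) \<and>
      (\<forall>i\<in>I. z * y' i z = (\<Sum>j\<in>I. a i j z * y j z)) \<and>
      (\<forall>i\<in>I. \<forall>j\<in>I. norm (a i j z) < norm (a i j 0) + 1)"
    using I y eq
  proof (intro eventually_conj eventually_ball_finite ballI)
    fix i j assume ij: "i \<in> I" "j \<in> I"
    then have "isCont (a i j) 0" using a by (intro analytic_at_imp_isCont) 
    then have "((\<lambda>z. norm (a i j z)) \<longlongrightarrow> norm (a i j 0)) (at 0)"
      by (intro tendsto_norm) (simp add: isCont_def)
    then show "\<forall>\<^sub>F z in at 0. norm (a i j z) < norm (a i j 0) + 1"
      by (rule order_tendstoD) simp
  qed auto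
  then obtain d where d: "d > 0"
    and D: "\<And>z i. z \<in> ball 0 d - {0} \<Longrightarrow> i \<in> I \<Longrightarrow> (y i has_field_derivative y' i z) (at z)"
      "\<And>z i. z \<in> ball 0 d - {0} \<Longrightarrow> i \<in> I \<Longrightarrow> z * y' i z = (\<Sum>j\<in>I. a i j z * y j z)"
      "\<And>z i j. z \<in> ball 0 d - {0} \<Longrightarrow> i \<in> I \<Longrightarrow> j \<in> I \<Longrightarrow> norm (a i j z) < norm (a i j 0) + 1"
    unfolding eventually_at by (auto simp: dist_norm)
  define r where "r = d / 2"
  have r: "r > 0" "cball 0 r \<subseteq> ball (0::complex) d" using d by (auto simp: r_def)
  define C where "C = (\<Sum>i\<in>I. \<Sum>j\<in>I. norm (a i j 0) + 1)"
  have C: "norm (a i j z) \<le> C" if "i \<in> I" "j \<in> I" "z \<in> cball 0 r" for i j z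
  proof -
    have "norm (a i j z) \<le> norm (a i j 0) + 1"
      using D(3)[of z i j] that r by (cases "z = 0") (auto intro: less_imp_le simp: subset_iff)
    also have "\<dots> \<le> (\<Sum>j\<in>I. norm (a i j 0) + 1)"
      using that I by (intro member_le_sum) auto
    also have "\<dots> \<le> C" unfolding C_def
      using that I by (intro member_le_sum[where f = "\<lambda>i. \<Sum>j\<in>I. norm (a i j 0) + 1"]) (auto intro!: sum_nonneg add_nonneg_nonneg)
    finally show ?thesis .
  qed
  obtain N M where NM: "\<And>i z. i \<in> I \<Longrightarrow> z \<in> cball 0 r - {0} \<Longrightarrow> norm (z ^ N * y i z) \<le> M"
  proof (rule regular_singular_growth[of I r y y' a C])
    fix i and z :: complex assume i: "i \<in> I" and "z \<in> cball 0 r - {0}"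
    then have z: "z \<in> ball 0 d - {0}" using subsetD[OF r(2), of z] by simp
    show "(y i has_field_derivative y' i z) (at z)" "z * y' i z = (\<Sum>j\<in>I. a i j z * y j z)"
      using D(1,2)[OF z i] by auto
  qed (use I r(1) C in auto)
  let ?ext = "\<lambda>k i. \<exists>g. g analytic_on {0} \<and> (\<forall>\<^sub>F z in at 0. z ^ k * y i z = g z)"
  have start: "?ext N i" if i: "i \<in> I" for i
  proof -
    let ?f = "\<lambda>z. z ^ N * y i z"
    have hol: "?f holomorphic_on ball 0 r - {0}"
    proof -
      have "y i holomorphic_on ball 0 r - {0}"
        unfolding holomorphic_on_open[OF open_delete[OF open_ball]]
      proof
        fix z :: complex assume "z \<in> ball 0 r - {0}"
        then have "z \<in> ball 0 d - {0}" using subsetD[OF r(2), of z] by simp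
        then show "\<exists>f'. (y i has_field_derivative f') (at z)" using D(1) i by blast
      qed
      then show ?thesis by (intro holomorphic_intros)
    qed
    have "\<forall>\<^sub>F z in at 0. norm (?f z) \<le> M"
      unfolding eventually_at using NM[OF i] r(1) by (auto simp: dist_norm intro!: exI[of _ r])
    then obtain g where g: "g holomorphic_on ball 0 r" "\<And>z. z \<in> ball 0 r - {0} \<Longrightarrow> g z = ?f z"
      using holomorphic_on_extend_bounded[OF hol] r(1) by auto
    have "g analytic_on {0}" using g(1) r(1) by (auto simp: analytic_at intro!: exI[of _ "ball 0 r"])
    moreover have "\<forall>\<^sub>F z in at 0. ?f z = g z"
      unfolding eventually_at using g(2) r(1) by (auto intro!: exI[of _ r])
    ultimately show ?thesis by blast
  qed
  have step: "\<forall>i\<in>I. ?ext k i" if k: "k \<ge> K" and ext: "\<forall>i\<in>I. ?ext (Suc k) i" for k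
  proof -
    obtain G where G: "\<And>i. i \<in> I \<Longrightarrow> G i analytic_on {0}"
      "\<And>i. i \<in> I \<Longrightarrow> \<forall>\<^sub>F z in at 0. z ^ Suc k * y i z = G i z"
      using bchoice[OF ext] by blast
    have "\<forall>\<^sub>F z in at 0. \<forall>i\<in>I. z ^ Suc k * y i z = G i z"
      using G(2) I by (intro eventually_ball_finite) auto
    then obtain e0 where e0: "e0 > 0" "\<And>z i. z \<in> ball 0 e0 - {0} \<Longrightarrow> i \<in> I \<Longrightarrow> z ^ Suc k * y i z = G i z"
      unfolding eventually_at by (auto simp: dist_norm)
    define e where "e = min e0 d"
    have e: "e > 0" "\<And>z i. z \<in> ball 0 e - {0} \<Longrightarrow> i \<in> I \<Longrightarrow> z ^ Suc k * y i z = G i z"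
      "ball (0::complex) e \<subseteq> ball 0 d"
      using e0 d by (auto simp: e_def)
    (* the equation z G' = (k + 1) G + a G, evaluated at 0 *)
    have zero: "(\<Sum>j\<in>I. a i j 0 * G j 0) = - of_nat (Suc k) * G i 0" if i: "i \<in> I" for i
    proof -
      define E where "E z = z * deriv (G i) z - (of_nat (Suc k) * G i z + (\<Sum>j\<in>I. a i j z * G j z))" for z
      have "E z = 0" if z: "z \<in> ball 0 e - {0}" for z
      proof -
        have zd: "z \<in> ball 0 d - {0}" using z e(3) by auto
        have "((\<lambda>z. z ^ Suc k * y i z) has_field_derivative
            of_nat (Suc k) * z ^ k * y i z + z ^ Suc k * y' i z) (at z)"
          by (rule derivative_eq_intros D(1)[OF zd i] refl | simp)+
        moreover have "\<forall>\<^sub>F z in nhds z. z ^ Suc k * y i z = G i z"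
          using eventually_nhds_in_open[OF open_delete[OF open_ball] z]
          by (rule eventually_mono) (rule e(2)[OF _ i])
        ultimately have "(G i has_field_derivative
            of_nat (Suc k) * z ^ k * y i z + z ^ Suc k * y' i z) (at z)"
          by (subst (asm) DERIV_cong_ev[OF refl _ refl])
        then have "deriv (G i) z = of_nat (Suc k) * z ^ k * y i z + z ^ Suc k * y' i z"
          by (rule DERIV_imp_deriv)
        moreover have "G i z = z ^ Suc k * y i z" using e(2)[OF z i] by simp
        ultimately have "z * deriv (G i) z = of_nat (Suc k) * G i z + z ^ Suc k * (z * y' i z)"
          by (simp add: algebra_simps)
        also have "z ^ Suc k * (z * y' i z) = (\<Sum>j\<in>I. a i j z * G j z)"
          unfolding D(2)[OF zd i] sum_distrib_left
          by (intro sum.cong refl) (simp add: e(2)[OF z, symmetric])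
        finally show ?thesis by (simp add: E_def)
      qed
      then have "\<forall>\<^sub>F z in at 0. E z = 0"
        unfolding eventually_at using e(1) by (auto intro!: exI[of _ e])
      then have "(E \<longlongrightarrow> 0) (at 0)" by (rule tendsto_eventually)
      moreover have "E analytic_on {0}"
        unfolding E_def using G(1) a i I by (intro analytic_intros) auto
      then have "(E \<longlongrightarrow> E 0) (at 0)" by (simp add: analytic_at_imp_isCont isContD)
      ultimately have "E 0 = 0" using tendsto_unique trivial_limit_at by metis
      then show ?thesis by (simp add: E_def algebra_simps eq_neg_iff_add_eq_0)
    qed
    have G0: "G i 0 = 0" if "i \<in> I" for i
      by (rule res[of "Suc k" "\<lambda>i. G i 0"]) (use k zero that in auto)
    show ?thesis
    proof
      fix i assume i: "i \<in> I"
      obtain S where S: "open S" "0 \<in> S" "G i holomorphic_on S"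
        using G(1)[OF i] by (auto simp: analytic_at)
      define h where "h z = (if z = 0 then deriv (G i) 0 else (G i z - G i 0) / (z - 0))" for z
      have "h holomorphic_on S"
        unfolding h_def[abs_def] using S by (intro pole_lemma) (auto simp: interior_open)
      then have "h analytic_on {0}" using S by (auto simp: analytic_at)
      moreover have "\<forall>\<^sub>F z in at 0. z ^ k * y i z = h z"
        using G(2)[OF i] eventually_neq_at_within[of 0]
        by eventually_elim (simp add: h_def G0[OF i] field_simps)
      ultimately show "?ext k i" by blast
    qed
  qed
  have "\<forall>i\<in>I. ?ext (K + N) i"
  proof
    fix i assume "i \<in> I"
    then obtain g where g: "g analytic_on {0}" "\<forall>\<^sub>F z in at 0. z ^ N * y i z = g z" using start by blast
    have "(\<lambda>z. z ^ K * g z) analytic_on {0}" using g(1) by (intro analytic_intros)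
    moreover have "\<forall>\<^sub>F z in at 0. z ^ (K + N) * y i z = z ^ K * g z"
      using g(2) by eventually_elim (simp add: power_add mult.assoc)
    ultimately show "?ext (K + N) i" by blast
  qed
  moreover have "\<forall>i\<in>I. ?ext (K + m) i \<Longrightarrow> \<forall>i\<in>I. ?ext K i" for m
    by (induction m) (use step in auto)
  ultimately show ?thesis using \<open>i \<in> I\<close> by blast
qed

section \<open>Matrix equations with a logarithmic pole\<close>

lemma smult_add_entry:
  assumes "X \<in> carrier_mat n n" "Y \<in> carrier_mat n n" "i < n" "j < n"
  shows "(a \<cdot>\<^sub>m X + b \<cdot>\<^sub>m Y) $$ (i, j) = a * X $$ (i, j) + b * Y $$ (i, j)"
  using assms by simp

lemma affine_mat_add:
  assumes "A \<in> carrier_mat n n" "B \<in> carrier_mat n n" "C \<in> carrier_mat n n" "D \<in> carrier_mat n n"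
  shows "(A + z \<cdot>\<^sub>m B) + (C + z \<cdot>\<^sub>m D) = (A + C) + z \<cdot>\<^sub>m (B + D :: complex mat)"
  by (rule eq_matI) (use assms in \<open>auto simp: algebra_simps\<close>)

text \<open>The entries of \<open>X\<close> form a regular singular system of size \<open>n\<^sup>2\<close>. An eigenvector of its residue for
\<open>- k\<close> is a solution of a Sylvester equation with the matrices \<open>A 0\<close> and \<open>B 0\<close>, which has only the
zero solution.\<close>

lemma matrix_ode_pole_order:
  fixes X A B :: "complex \<Rightarrow> complex mat"
  assumes A: "\<And>z. A z \<in> carrier_mat n n" "\<And>i j. i < n \<Longrightarrow> j < n \<Longrightarrow> (\<lambda>z. A z $$ (i, j)) analytic_on {0}"
    and B: "\<And>z. B z \<in> carrier_mat n n" "\<And>i j. i < n \<Longrightarrow> j < n \<Longrightarrow> (\<lambda>z. B z $$ (i, j)) analytic_on {0}"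
    and X: "\<forall>\<^sub>F z in at 0. has_mat_deriv n X (X' z) z"
    and eq: "\<forall>\<^sub>F z in at 0. z \<cdot>\<^sub>m X' z = \<alpha> \<cdot>\<^sub>m (A z * X z) + \<beta> \<cdot>\<^sub>m (X z * B z)"
    and "\<alpha> \<noteq> 0"
    and spec: "\<And>a b k. eigenvalue (A 0) a \<Longrightarrow> eigenvalue (B 0) b \<Longrightarrow> k > K \<Longrightarrow> \<alpha> * a + \<beta> * b \<noteq> - of_nat k"
    and ij: "i < n" "j < n"
  shows "\<exists>g. g analytic_on {0} \<and> (\<forall>\<^sub>F z in at 0. z ^ K * X z $$ (i, j) = g z)"
proof -
  define I where "I = {..<n} \<times> {..<n}"
  (* matrix of the linear map Y |-> \<alpha> A Y + \<beta> Y B in the basis of matrix units *)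
  define a where "a p q z = (if snd q = snd p then \<alpha> * A z $$ (fst p, fst q) else 0) +
    (if fst q = fst p then \<beta> * B z $$ (snd q, snd p) else 0)" for p q z
  define y where "y p z = X z $$ p" for p z
  have Xc: "X z \<in> carrier_mat n n" for z
    using eventually_happens[OF X] by (auto simp: has_mat_deriv_def)
  have sum: "(\<Sum>q\<in>I. a p q z * Y $$ q) = (\<alpha> \<cdot>\<^sub>m (A z * Y) + \<beta> \<cdot>\<^sub>m (Y * B z)) $$ p"
    if p: "p \<in> I" and Y: "Y \<in> carrier_mat n n" for p z Y
  proof -
    obtain i j where p': "p = (i, j)" "i < n" "j < n" using p by (auto simp: I_def)
    have "(\<Sum>q\<in>I. a p q z * Y $$ q) =
      (\<Sum>l<n. \<Sum>m<n. (if m = j then \<alpha> * A z $$ (i, l) * Y $$ (l, j) else 0) + (if l = i then \<beta> * B z $$ (m, j) * Y $$ (i, m) else 0))"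
      unfolding I_def sum.cartesian_product
      by (intro sum.cong refl) (auto simp: a_def p'(1) algebra_simps)
    also have "\<dots> = (\<Sum>l<n. \<alpha> * A z $$ (i, l) * Y $$ (l, j)) + (\<Sum>m<n. \<beta> * B z $$ (m, j) * Y $$ (i, m))"
      using p'(2,3)
      by (simp add: sum.distrib sum.delta sum.swap[of "\<lambda>l m. if l = i then \<beta> * B z $$ (m, j) * Y $$ (i, m) else 0"])
    also have "\<dots> = \<alpha> * (A z * Y) $$ (i, j) + \<beta> * (Y * B z) $$ (i, j)"
      by (simp add: sq_mult_entry[OF A(1) Y p'(2,3)] sq_mult_entry[OF Y B(1) p'(2,3)] sum_distrib_left mult_ac)
    also have "\<dots> = (\<alpha> \<cdot>\<^sub>m (A z * Y) + \<beta> \<cdot>\<^sub>m (Y * B z)) $$ p"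
      unfolding p'(1) by (rule smult_add_entry[OF sq_mult[OF A(1) Y] sq_mult[OF Y B(1)] p'(2,3), symmetric])
    finally show ?thesis .
  qed
  have "\<exists>g. g analytic_on {0} \<and> (\<forall>\<^sub>F z in at 0. z ^ K * y (i, j) z = g z)"
  proof (rule regular_singular_pole_order[where I = I and a = a and y' = "\<lambda>p z. X' z $$ p"])
    show "finite I" "(i, j) \<in> I" using ij by (auto simp: I_def)
    show "a p q analytic_on {0}" if "p \<in> I" "q \<in> I" for p q
      using that unfolding a_def[abs_def] I_def
      by (cases "snd q = snd p"; cases "fst q = fst p") (auto intro!: analytic_intros A(2) B(2))
    show "\<forall>\<^sub>F z in at 0. (y p has_field_derivative X' z $$ p) (at z)" if "p \<in> I" for p
      using X by eventually_elim (use that in \<open>auto simp: I_def y_def[abs_def] has_mat_deriv_def\<close>)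
    show "\<forall>\<^sub>F z in at 0. z * X' z $$ p = (\<Sum>q\<in>I. a p q z * y q z)" if "p \<in> I" for p
      using X eq
    proof eventually_elim
      case (elim z)
      have "z * X' z $$ p = (z \<cdot>\<^sub>m X' z) $$ p"
        using that has_mat_derivD(1)[OF elim(1)] by (auto simp: I_def)
      then show ?case unfolding elim(2) y_def sum[OF that Xc] .
    qed
  next
    fix k v p assume k: "k > K" and p: "p \<in> I"
      and v: "\<And>p. p \<in> I \<Longrightarrow> (\<Sum>q\<in>I. a p q 0 * v q) = - of_nat k * v p"
    define V where "V = Matrix.mat n n v"
    have V: "V \<in> carrier_mat n n" "\<And>q. q \<in> I \<Longrightarrow> V $$ q = v q" by (auto simp: V_def I_def)
    have "\<alpha> \<cdot>\<^sub>m (A 0 * V) + \<beta> \<cdot>\<^sub>m (V * B 0) = - of_nat k \<cdot>\<^sub>m V" (is "?l = ?r")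
    proof (rule eq_matI)
      fix i j assume "i < dim_row ?r" "j < dim_col ?r"
      then have ij: "(i, j) \<in> I" using V(1) by (auto simp: I_def)
      have "?l $$ (i, j) = (\<Sum>q\<in>I. a (i, j) q 0 * V $$ q)" using sum[OF ij V(1)] by simp
      also have "\<dots> = - of_nat k * v (i, j)" using v[OF ij] by (simp add: V(2))
      finally show "?l $$ (i, j) = ?r $$ (i, j)" using ij V by (auto simp: I_def)
    qed (use V(1) A(1)[of 0] B(1)[of 0] in auto)
    then have "V = 0\<^sub>m n n"
      using spec k by (intro sylvester_zero[OF A(1)[of 0] B(1)[of 0] V(1) _ \<open>\<alpha> \<noteq> 0\<close>]) auto
    then show "v p = 0" using V(2)[OF p] p by (auto simp: I_def)
  qed
  then show ?thesis by (simp add: y_def)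
qed

section \<open>Transition matrices between two logarithms\<close>

text \<open>By Liouville: \<open>p\<close> extends to an entire function, and \<open>w p(1 / w)\<close> is bounded near \<open>w = 0\<close>.\<close>

lemma entire_of_linear_growth:
  assumes p: "\<And>z. z \<noteq> 0 \<Longrightarrow> p field_differentiable at z"
    and g: "g analytic_on {0}" "\<forall>\<^sub>F z in at 0. p z = g z"
    and h: "h analytic_on {0}" "\<forall>\<^sub>F w in at 0. w * p (1 / w) = h w"
  shows "\<exists>c d. \<forall>z. z \<noteq> 0 \<longrightarrow> p z = c + z * d"
proof -
  define f where "f z = (if z = 0 then g 0 else p z)" for z
  have f: "f holomorphic_on UNIV"
    unfolding holomorphic_on_def
  proof
    fix z :: complex
    show "f field_differentiable at z within UNIV"
    proof (cases "z = 0")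
      case True
      have "\<forall>\<^sub>F z in nhds 0. f z = g z"
        using g(2) by (auto simp: eventually_at_filter f_def elim: eventually_mono)
      then have "f analytic_on {0}" using g(1) analytic_at_cong[of f g 0 0] by simp
      then show ?thesis using True by (simp add: analytic_on_imp_differentiable_at)
    next
      case False
      have "\<forall>\<^sub>F w in nhds z. f w = p w"
        using False
        by (intro eventually_mono[OF eventually_nhds_in_open[of "- {0}" z]]) (auto simp: f_def)
      then have "(f has_field_derivative deriv p z) (at z)"
        using p[OF False] by (subst DERIV_cong_ev[OF refl _ refl]) (auto simp: DERIV_deriv_iff_field_differentiable)
      then show ?thesis by (auto simp: field_differentiable_def)
    qed
  qed
  have "(h \<longlongrightarrow> h 0) (at 0)" using h(1) by (simp add: analytic_at_imp_isCont isContD)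
  then have "\<forall>\<^sub>F w in at 0. norm (h w) < norm (h 0) + 1"
    by (intro order_tendstoD(2)[OF tendsto_norm]) auto
  with h(2) have "\<forall>\<^sub>F w in at 0. norm (w * p (1 / w)) < norm (h 0) + 1"
    by eventually_elim simp
  then obtain \<delta> where \<delta>: "\<delta> > 0" "\<And>w. w \<noteq> 0 \<Longrightarrow> norm w < \<delta> \<Longrightarrow> norm (w * p (1 / w)) < norm (h 0) + 1"
    unfolding eventually_at by (auto simp: dist_norm)
  have Liou: "f z = (\<Sum>k\<le>1. (deriv ^^ k) f 0 / fact k * z ^ k)" for z
  proof (rule Liouville_polynomial[OF f, of "2 / \<delta>" "norm (h 0) + 1"])
    fix z :: complex assume z: "2 / \<delta> \<le> norm z"
    then have z0: "z \<noteq> 0" using \<delta>(1) by (auto simp: divide_le_0_iff)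
    have "norm (1 / z) < \<delta>" using z \<delta>(1) z0 by (simp add: norm_divide field_simps)
    then have "norm (1 / z * p z) < norm (h 0) + 1" using \<delta>(2)[of "1 / z"] z0 by simp
    then show "norm (f z) \<le> (norm (h 0) + 1) * norm z ^ 1"
      using z0 by (simp add: f_def norm_mult norm_divide field_simps)
  qed
  have f2: "f z = f 0 + z * deriv f 0" for z using Liou[of z] by (simp add: mult.commute)
  have "p z = f 0 + z * deriv f 0" if "z \<noteq> 0" for z
    using that f2[of z] by (simp add: f_def[of z])
  then show ?thesis by blast
qed

text \<open>At \<open>0\<close>, a pole of order \<open>k\<close> of \<open>P\<close> needs eigenvalues with \<open>a + b = - k\<close>; at \<open>\<infinity>\<close>, in the coordinate
\<open>1 / z\<close>, it needs \<open>a + b = k\<close>. As the real parts of \<open>a + b\<close> lie in \<open>[0, 2)\<close>, the order is at most \<open>0\<close>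
at \<open>0\<close> and at most \<open>1\<close> at \<open>\<infinity>\<close>. The two Sylvester equations are the coefficients of \<open>1\<close> and \<open>z\<close> in
the differential equation.\<close>

lemma log_transition_linear:
  assumes Lz: "Lz \<in> carrier_mat n n" and Lw: "Lw \<in> carrier_mat n n"
    and strip: "\<And>a. eigenvalue Lz a \<Longrightarrow> 0 \<le> Re a \<and> Re a < 1" "\<And>a. eigenvalue Lw a \<Longrightarrow> 0 \<le> Re a \<and> Re a < 1"
    and P: "\<And>z. z \<noteq> 0 \<Longrightarrow> has_mat_deriv n P (P' z) z"
    and eq: "\<And>z. z \<noteq> 0 \<Longrightarrow> z \<cdot>\<^sub>m P' z = Lw * P z + P z * Lz"
  obtains P0 P1 where "P0 \<in> carrier_mat n n" "P1 \<in> carrier_mat n n" "\<And>z. z \<noteq> 0 \<Longrightarrow> P z = P0 + z \<cdot>\<^sub>m P1"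
    "Lw * P0 + P0 * Lz = 0\<^sub>m n n" "Lw * P1 + P1 * Lz = P1"
proof -
  have Pc: "P z \<in> carrier_mat n n" for z using P[of 1] by (auto simp: has_mat_deriv_def)
  have one: "1 \<cdot>\<^sub>m Z = Z" for Z :: "complex mat" by (auto intro!: eq_matI)
  have ev0: "\<forall>\<^sub>F z in at 0. z \<noteq> (0::complex)" by (simp add: eventually_at_filter)
  have lin: "\<exists>c d. \<forall>z. z \<noteq> 0 \<longrightarrow> P z $$ (i, j) = c + z * d" if ij: "i < n" "j < n" for i j
  proof -
    have "\<exists>g. g analytic_on {0} \<and> (\<forall>\<^sub>F z in at 0. z ^ 0 * P z $$ (i, j) = g z)"
    proof (rule matrix_ode_pole_order[where A = "\<lambda>_. Lw" and B = "\<lambda>_. Lz" and \<alpha> = 1 and \<beta> = 1 and X' = P'])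
      show "\<forall>\<^sub>F z in at 0. has_mat_deriv n P (P' z) z" using ev0 by eventually_elim (rule P)
      show "\<forall>\<^sub>F z in at 0. z \<cdot>\<^sub>m P' z = 1 \<cdot>\<^sub>m (Lw * P z) + 1 \<cdot>\<^sub>m (P z * Lz)"
        using ev0 by eventually_elim (simp add: eq one)
      show "1 * a + 1 * b \<noteq> - of_nat k" if "eigenvalue Lw a" "eigenvalue Lz b" "k > 0" for a b k
        using strip(1)[OF that(2)] strip(2)[OF that(1)] that(3) by (auto simp: complex_eq_iff)
    qed (use Lz Lw ij in auto)
    then obtain g where g: "g analytic_on {0}" "\<forall>\<^sub>F z in at 0. P z $$ (i, j) = g z" by auto
    define X where "X w = P (1 / w)" for w
    have X: "has_mat_deriv n X ((- 1 / w\<^sup>2) \<cdot>\<^sub>m P' (1 / w)) w" if "w \<noteq> 0" for w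
      unfolding X_def[abs_def]
      by (rule has_mat_deriv_chain[where g = "\<lambda>w. 1 / w"])
         (use that P in \<open>auto intro!: derivative_eq_intros simp: power2_eq_square\<close>)
    have "\<exists>h. h analytic_on {0} \<and> (\<forall>\<^sub>F w in at 0. w ^ 1 * X w $$ (i, j) = h w)"
    proof (rule matrix_ode_pole_order[where A = "\<lambda>_. Lw" and B = "\<lambda>_. Lz" and \<alpha> = "- 1" and \<beta> = "- 1"
          and X' = "\<lambda>w. (- 1 / w\<^sup>2) \<cdot>\<^sub>m P' (1 / w)"])
      show "\<forall>\<^sub>F w in at 0. has_mat_deriv n X ((- 1 / w\<^sup>2) \<cdot>\<^sub>m P' (1 / w)) w"
        using ev0 by eventually_elim (rule X)
      show "\<forall>\<^sub>F w in at 0. w \<cdot>\<^sub>m ((- 1 / w\<^sup>2) \<cdot>\<^sub>m P' (1 / w)) = - 1 \<cdot>\<^sub>m (Lw * X w) + - 1 \<cdot>\<^sub>m (X w * Lz)"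
        using ev0
      proof eventually_elim
        case (elim w)
        have "P' (1 / w) \<in> carrier_mat n n" using P[of "1 / w"] elim by (auto simp: has_mat_deriv_def)
        then have "w \<cdot>\<^sub>m ((- 1 / w\<^sup>2) \<cdot>\<^sub>m P' (1 / w)) = - 1 \<cdot>\<^sub>m ((1 / w) \<cdot>\<^sub>m P' (1 / w))"
          using elim by (intro eq_matI) (auto simp: power2_eq_square)
        also have "\<dots> = - 1 \<cdot>\<^sub>m (Lw * X w + X w * Lz)" using eq[of "1 / w"] elim by (simp add: X_def)
        also have "\<dots> = - 1 \<cdot>\<^sub>m (Lw * X w) + - 1 \<cdot>\<^sub>m (X w * Lz)"
          using add_smult_distrib_left_mat[of "Lw * X w" n n "X w * Lz" "- 1"] Lw Lz Pc[of "1 / w"] by (simp add: X_def)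
        finally show ?case .
      qed
      show "- 1 * a + - 1 * b \<noteq> - of_nat k" if "eigenvalue Lw a" "eigenvalue Lz b" "k > 1" for a b k
      proof
        assume "- 1 * a + - 1 * b = - of_nat k"
        then have "Re a + Re b = real k" by (simp add: complex_eq_iff)
        then show False using strip(1)[OF that(2)] strip(2)[OF that(1)] that(3) by linarith
      qed
    qed (use Lz Lw ij in auto)
    then obtain h where h: "h analytic_on {0}" "\<forall>\<^sub>F w in at 0. w * P (1 / w) $$ (i, j) = h w"
      by (auto simp: X_def)
    show ?thesis
      by (rule entire_of_linear_growth[OF _ g h])
         (use has_mat_derivD(3)[OF P ij] in \<open>auto simp: field_differentiable_def\<close>)
  qed
  obtain c d where cd: "\<And>i j z. i < n \<Longrightarrow> j < n \<Longrightarrow> z \<noteq> 0 \<Longrightarrow> P z $$ (i, j) = c i j + z * d i j"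
    using lin by metis
  define P0 where "P0 = Matrix.mat n n (\<lambda>(i, j). c i j)"
  define P1 where "P1 = Matrix.mat n n (\<lambda>(i, j). d i j)"
  have c01: "P0 \<in> carrier_mat n n" "P1 \<in> carrier_mat n n" by (auto simp: P0_def P1_def)
  have PP: "P z = P0 + z \<cdot>\<^sub>m P1" if "z \<noteq> 0" for z
    using that Pc[of z] by (intro eq_matI) (auto simp: P0_def P1_def cd)
  have P'1: "P' z = P1" if z: "z \<noteq> 0" for z
  proof (rule eq_matI)
    fix i j assume "i < dim_row P1" "j < dim_col P1"
    then have ij: "i < n" "j < n" using c01 by auto
    have "((\<lambda>z. P z $$ (i, j)) has_field_derivative P' z $$ (i, j)) (at z)"
      using has_mat_derivD(3)[OF P[OF z] ij] .
    moreover have "\<forall>\<^sub>F w in nhds z. P w $$ (i, j) = c i j + w * d i j"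
      using z cd[OF ij] by (intro eventually_mono[OF eventually_nhds_in_open[of "- {0}" z]]) auto
    ultimately have "((\<lambda>w. c i j + w * d i j) has_field_derivative P' z $$ (i, j)) (at z)"
      by (subst (asm) DERIV_cong_ev[OF refl _ refl])
    moreover have "((\<lambda>w. c i j + w * d i j) has_field_derivative d i j) (at z)"
      by (auto intro!: derivative_eq_intros)
    ultimately show "P' z $$ (i, j) = P1 $$ (i, j)" using ij by (auto simp: P1_def dest: DERIV_unique)
  qed (use has_mat_derivD(1)[OF P[OF z]] c01 in auto)
  define U V where "U = Lw * P0 + P0 * Lz" and "V = Lw * P1 + P1 * Lz"
  have UV: "U \<in> carrier_mat n n" "V \<in> carrier_mat n n" using c01 Lz Lw by (auto simp: U_def V_def)
  have zUV: "z \<cdot>\<^sub>m P1 = U + z \<cdot>\<^sub>m V" if "z \<noteq> 0" for z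
  proof -
    have "Lw * (P0 + z \<cdot>\<^sub>m P1) = Lw * P0 + z \<cdot>\<^sub>m (Lw * P1)"
      using mult_add_distrib_mat[OF Lw c01(1), of "z \<cdot>\<^sub>m P1"] mult_smult_distrib[OF Lw c01(2), of z] c01 by simp
    moreover have "(P0 + z \<cdot>\<^sub>m P1) * Lz = P0 * Lz + z \<cdot>\<^sub>m (P1 * Lz)"
      using add_mult_distrib_mat[OF c01(1) _ Lz, of "z \<cdot>\<^sub>m P1"] mult_smult_assoc_mat[OF c01(2) Lz, of z] c01 by simp
    ultimately have "z \<cdot>\<^sub>m P1 = (Lw * P0 + z \<cdot>\<^sub>m (Lw * P1)) + (P0 * Lz + z \<cdot>\<^sub>m (P1 * Lz))"
      using eq[OF that] P'1[OF that] PP[OF that] by simp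
    also have "\<dots> = U + z \<cdot>\<^sub>m V"
      unfolding U_def V_def
      by (intro affine_mat_add[where n = n] sq_mult Lw Lz c01)
    finally show ?thesis .
  qed
  have "U $$ (i, j) = 0 \<and> V $$ (i, j) = P1 $$ (i, j)" if ij: "i < n" "j < n" for i j
  proof -
    have "z * P1 $$ (i, j) = U $$ (i, j) + z * V $$ (i, j)" if "z \<noteq> 0" for z
      using arg_cong[OF zUV[OF that], of "\<lambda>M. M $$ (i, j)"] ij UV c01 by simp
    then have e1: "P1 $$ (i, j) = U $$ (i, j) + V $$ (i, j)" and e2: "2 * P1 $$ (i, j) = U $$ (i, j) + 2 * V $$ (i, j)"
      by force+
    have "U $$ (i, j) = 2 * (U $$ (i, j) + V $$ (i, j)) - (U $$ (i, j) + 2 * V $$ (i, j))" by simp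
    also have "\<dots> = 2 * P1 $$ (i, j) - 2 * P1 $$ (i, j)" by (simp only: e1[symmetric] e2[symmetric])
    finally show ?thesis using e1 by simp
  qed
  then have "U = 0\<^sub>m n n" "V = P1" using UV c01 by (auto intro!: eq_matI)
  then show ?thesis using that[OF c01 PP] unfolding U_def V_def by blast
qed


text \<open>Comparing coefficients in \<open>P Q = 1\<close> and \<open>Q P = 1\<close> gives \<open>P\<^sub>0 Q\<^sub>1 = P\<^sub>1 Q\<^sub>0 = Q\<^sub>0 P\<^sub>1 = 0\<close>. Together
with the values at \<open>z = 1\<close>, this yields \<open>P\<^sub>0 = P\<^sub>0 Q\<^sub>0 = Q\<^sub>0\<close>, so \<open>P\<^sub>0 P\<^sub>1 = 0\<close> and
\<open>P\<^sub>1 = (P\<^sub>0 + P\<^sub>1) P\<^sub>1 = P\<^sub>1 P\<^sub>1\<close>.\<close>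

lemma log_transition_idempotent:
  assumes P: "P0 \<in> carrier_mat n n" "P1 \<in> carrier_mat n n" and Q: "Q0 \<in> carrier_mat n n" "Q1 \<in> carrier_mat n n"
    and PQ: "\<And>z. z \<noteq> 0 \<Longrightarrow> (P0 + z \<cdot>\<^sub>m P1) * (Q0 + (1 / z) \<cdot>\<^sub>m Q1) = 1\<^sub>m n"
    and QP: "\<And>z. z \<noteq> 0 \<Longrightarrow> (Q0 + (1 / z) \<cdot>\<^sub>m Q1) * (P0 + z \<cdot>\<^sub>m P1) = 1\<^sub>m n"
    and P1': "P0 + P1 = 1\<^sub>m n" and Q1': "Q0 + Q1 = (1\<^sub>m n :: complex mat)"
  shows "P1 * P1 = P1"
proof -
  (* the coefficients of z and 1 / z in the product vanish *)
  have cross: "A0 * B1 = 0\<^sub>m n n \<and> A1 * B0 = 0\<^sub>m n n"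
    if A: "A0 \<in> carrier_mat n n" "A1 \<in> carrier_mat n n" and B: "B0 \<in> carrier_mat n n" "B1 \<in> carrier_mat n n"
      and eq: "\<And>z. z \<noteq> 0 \<Longrightarrow> (A0 + z \<cdot>\<^sub>m A1) * (B0 + (1 / z) \<cdot>\<^sub>m B1) = (1\<^sub>m n :: complex mat)"
    for A0 A1 B0 B1
  proof -
    have "(A0 * B1) $$ (i, j) = 0 \<and> (A1 * B0) $$ (i, j) = 0" if ij: "i < n" "j < n" for i j
    proof -
      have ex: "(A0 * B0) $$ (i, j) + (A1 * B1) $$ (i, j) + z * (A1 * B0) $$ (i, j) + (1 / z) * (A0 * B1) $$ (i, j)
          = (1\<^sub>m n) $$ (i, j)" if z: "z \<noteq> 0" for z
      proof -
        have sc: "(a0 + z * a1) * (b0 + (1 / z) * b1) = a0 * b0 + a1 * b1 + z * (a1 * b0) + (1 / z) * (a0 * b1)"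
          for a0 a1 b0 b1 using z by (simp add: field_simps)
        have "(1\<^sub>m n) $$ (i, j) = ((A0 + z \<cdot>\<^sub>m A1) * (B0 + (1 / z) \<cdot>\<^sub>m B1)) $$ (i, j)" using eq[OF z] by simp
        also have "\<dots> = (\<Sum>l<n. (A0 + z \<cdot>\<^sub>m A1) $$ (i, l) * (B0 + (1 / z) \<cdot>\<^sub>m B1) $$ (l, j))"
          using A B ij by (intro sq_mult_entry) auto
        also have "\<dots> = (\<Sum>l<n. (A0 $$ (i, l) + z * A1 $$ (i, l)) * (B0 $$ (l, j) + (1 / z) * B1 $$ (l, j)))"
          using A B ij by (intro sum.cong refl) auto
        also have "\<dots> = (\<Sum>l<n. A0 $$ (i, l) * B0 $$ (l, j)) + (\<Sum>l<n. A1 $$ (i, l) * B1 $$ (l, j)) +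
            z * (\<Sum>l<n. A1 $$ (i, l) * B0 $$ (l, j)) + (1 / z) * (\<Sum>l<n. A0 $$ (i, l) * B1 $$ (l, j))"
          by (simp only: sc sum.distrib sum_distrib_left)
        finally show ?thesis
          using sq_mult_entry[OF A(1) B(1) ij] sq_mult_entry[OF A(1) B(2) ij]
            sq_mult_entry[OF A(2) B(1) ij] sq_mult_entry[OF A(2) B(2) ij] by simp
      qed
      define a b c where "a = (A0 * B0) $$ (i, j) + (A1 * B1) $$ (i, j) - (1\<^sub>m n) $$ (i, j)"
        and "b = (A1 * B0) $$ (i, j)" and "c = (A0 * B1) $$ (i, j)"
      have e: "a + z * b + c / z = 0" if "z \<noteq> 0" for z
        unfolding a_def b_def c_def ex[OF that, symmetric] by simp
      have e1: "a + b + c = 0" and e2: "a - b - c = 0" and e3: "a + 2 * b + c / 2 = 0"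
        using e[of 1] e[of "- 1"] e[of 2] by (simp_all add: mult.commute)
      have "2 * a = (a + b + c) + (a - b - c)" by simp
      then have a0: "a = 0" using e1 e2 by simp
      have "3 * b = 2 * (a + 2 * b + c / 2) - (a + b + c) - a" by simp
      also have "\<dots> = 2 * 0 - 0 - 0" by (simp only: e1 e3) (simp add: a0)
      finally have b0: "b = 0" by simp
      then have "c = 0" using e1 a0 by simp
      with b0 have "b = 0" "c = 0" by auto
      then show ?thesis by (simp add: b_def c_def)
    qed
    then show ?thesis using A B by (auto intro!: eq_matI simp del: index_mult_mat(1))
  qed
  note c1 = cross[OF P Q PQ]
  have c2: "Q0 * P1 = 0\<^sub>m n n"
  proof -
    have "Q0 * P1 = 0\<^sub>m n n \<and> Q1 * P0 = 0\<^sub>m n n"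
    proof (rule cross[OF Q P])
      fix z :: complex assume "z \<noteq> 0"
      then show "(Q0 + z \<cdot>\<^sub>m Q1) * (P0 + (1 / z) \<cdot>\<^sub>m P1) = 1\<^sub>m n" using QP[of "1 / z"] by simp
    qed
    then show ?thesis ..
  qed
  have "P0 = P0 * (Q0 + Q1)" using P Q1' by simp
  also have "\<dots> = P0 * Q0 + P0 * Q1" using mult_add_distrib_mat[OF P(1) Q] .
  also have "\<dots> = P0 * Q0 + P1 * Q0" using c1 P Q by simp
  also have "\<dots> = (P0 + P1) * Q0" using add_mult_distrib_mat[OF P Q(1)] by simp
  also have "\<dots> = Q0" using P1' Q by simp
  finally have "P0 = Q0" .
  then have "(P0 + P1) * P1 = P1 * P1"
    using add_mult_distrib_mat[OF P P(2)] c2 P by simp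
  then show ?thesis using P1' P by simp
qed

text \<open>In an idempotent Jordan block the diagonal entry satisfies \<open>a\<^sup>2 = a\<close>, and a superdiagonal entry would
require \<open>2 a = 1\<close>, so all blocks have size 1.\<close>

lemma idempotent_jordan_matrix:
  fixes n_as :: "(nat \<times> complex) list"
  assumes "0 \<notin> fst ` set n_as" "jordan_matrix n_as * jordan_matrix n_as = jordan_matrix n_as"
    and "i < sum_list (map fst n_as)" "j < sum_list (map fst n_as)"
  shows "jordan_matrix n_as $$ (i, j) = (if i = j then jordan_matrix n_as $$ (i, i) else 0)
    \<and> jordan_matrix n_as $$ (i, i) \<in> {0, 1}"
  using assms
proof (induction n_as arbitrary: i j)
  case (Cons ka xs)
  obtain k a where ka: "ka = (k, a)" by force
  let ?N = "sum_list (map fst xs)"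
  let ?B = "jordan_block k a" and ?J = "jordan_matrix xs"
  have J: "?J \<in> carrier_mat ?N ?N" and B: "?B \<in> carrier_mat k k" by auto
  have eq: "jordan_matrix (ka # xs) = four_block_mat ?B (0\<^sub>m k ?N) (0\<^sub>m ?N k) ?J"
    by (simp add: jordan_matrix_def ka Let_def jordan_matrix_dim[unfolded jordan_matrix_def])
  have "four_block_mat ?B (0\<^sub>m k ?N) (0\<^sub>m ?N k) ?J * four_block_mat ?B (0\<^sub>m k ?N) (0\<^sub>m ?N k) ?J
      = four_block_mat (?B * ?B) (0\<^sub>m k ?N) (0\<^sub>m ?N k) (?J * ?J)"
    using mult_four_block_mat[OF B zero_carrier_mat zero_carrier_mat J B zero_carrier_mat zero_carrier_mat J] J B
    by (simp add: sq_mult)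
  then have sq: "four_block_mat (?B * ?B) (0\<^sub>m k ?N) (0\<^sub>m ?N k) (?J * ?J) = four_block_mat ?B (0\<^sub>m k ?N) (0\<^sub>m ?N k) ?J"
    using Cons.prems(2) by (simp add: eq)
  have BB: "(?B * ?B) $$ (i, j) = ?B $$ (i, j)" if "i < k" "j < k" for i j
    using arg_cong[OF sq, of "\<lambda>M. M $$ (i, j)"] that J by (simp del: index_mult_mat(1))
  have JJ: "?J * ?J = ?J"
  proof (rule eq_matI)
    fix i j assume "i < dim_row ?J" "j < dim_col ?J"
    then show "(?J * ?J) $$ (i, j) = ?J $$ (i, j)"
      using arg_cong[OF sq, of "\<lambda>M. M $$ (k + i, k + j)"] J by (simp del: index_mult_mat(1))
  qed auto
  have "k \<noteq> 0" using Cons.prems(1) ka by auto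
  have a: "a * a = a" 
  proof -
    have "(?B * ?B) $$ (0, 0) = (\<Sum>l<k. if l = 0 then a * a else 0)"
      unfolding sq_mult_entry[OF B B \<open>k \<noteq> 0\<close>[unfolded neq0_conv] \<open>k \<noteq> 0\<close>[unfolded neq0_conv]]
      using \<open>k \<noteq> 0\<close> by (intro sum.cong refl) auto
    then show ?thesis using BB[of 0 0] \<open>k \<noteq> 0\<close> by simp
  qed
  have "k = 1"
  proof (rule ccontr)
    assume "k \<noteq> 1"
    with \<open>k \<noteq> 0\<close> have k: "0 < k" "1 < k" by auto
    have "(?B * ?B) $$ (0, 1) = (\<Sum>l\<in>{0, 1}. ?B $$ (0, l) * ?B $$ (l, 1))"
      unfolding sq_mult_entry[OF B B k] using k by (intro sum.mono_neutral_right) auto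
    then have "a + a = 1" using BB[of 0 1] k by simp
    moreover have "a = 0 \<or> a = 1" using a by simp
    ultimately show False by auto
  qed
  have a01: "a \<in> {0, 1}" using a by auto
  have IH: "?J $$ (i, j) = (if i = j then ?J $$ (i, i) else 0) \<and> ?J $$ (i, i) \<in> {0, 1}" if "i < ?N" "j < ?N" for i j
    using Cons.IH[OF _ JJ that] Cons.prems(1) by auto
  have ent: "four_block_mat ?B (0\<^sub>m k ?N) (0\<^sub>m ?N k) ?J $$ (i, j) =
      (if i = 0 then if j = 0 then a else 0 else if j = 0 then 0 else ?J $$ (i - 1, j - 1))"
    if "i < Suc ?N" "j < Suc ?N" for i j
    using that \<open>k = 1\<close> by auto
  have ij: "i < Suc ?N" "j < Suc ?N" using Cons.prems(3,4) \<open>k = 1\<close> ka by auto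
  show ?case
  proof (cases "i = 0 \<or> j = 0")
    case True
    then show ?thesis unfolding eq ent[OF ij] ent[OF ij(1) ij(1)] 
      using a01 IH[of "i - 1" "i - 1"] ij by auto
  next
    case False
    then have "i - 1 < ?N" "j - 1 < ?N" "i = j \<longleftrightarrow> i - 1 = j - 1" using ij by auto
    with IH[OF this(1,2)] False show ?thesis
      unfolding eq ent[OF ij] ent[OF ij(1) ij(1)] by simp
  qed
qed simp

text \<open>The Jordan form of \<open>E\<close> is diagonal with entries \<open>0\<close> and \<open>1\<close>. A permutation of the basis puts the
entries \<open>1\<close> first; the columns of \<open>S\<close> are then a basis of the image, followed by one of the kernel.\<close>

lemma idempotent_diagonalize:
  assumes E: "E \<in> carrier_mat n n" "E * E = (E :: complex mat)"
  obtains S T m where "S \<in> carrier_mat n n" "T \<in> carrier_mat n n" "S * T = 1\<^sub>m n" "T * S = 1\<^sub>m n" "m \<le> n"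
    "\<And>i j. i < n \<Longrightarrow> j < n \<Longrightarrow> (E * S) $$ (i, j) = (if j < m then S $$ (i, j) else 0)"
proof -
  obtain es where "char_poly E = (\<Prod>a\<leftarrow>es. [:- a, 1:])"
    using char_poly_factorized[OF E(1)] by blast
  then obtain n_as where "jordan_nf E n_as" using jordan_nf_exists[OF E(1)] by blast
  then have n0: "0 \<notin> fst ` set n_as" and sim: "similar_mat E (jordan_matrix n_as)"
    by (auto simp: jordan_nf_def)
  define J where "J = jordan_matrix n_as"
  obtain S T where "similar_mat_wit E J S T" using sim by (auto simp: similar_mat_def J_def)
  from similar_mat_witD2[OF E(1) this]
  have J: "J \<in> carrier_mat n n" and S: "S \<in> carrier_mat n n" and T: "T \<in> carrier_mat n n"
    and ST: "S * T = 1\<^sub>m n" and TS: "T * S = 1\<^sub>m n" and EJ: "E = S * J * T" by auto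
  have nn: "sum_list (map fst n_as) = n" using J jordan_matrix_dim(1)[of n_as] by (auto simp: J_def)
  have ES: "E * S = S * J"
    using S J T TS by (simp add: EJ assoc_mult_mat[of _ n n _ n _ n])
  have "S * (J * J) = E * S * J" using assoc_mult_mat[OF S J J] by (simp add: ES)
  also have "\<dots> = E * (E * S)" using assoc_mult_mat[OF E(1) S J] by (simp add: ES)
  also have "\<dots> = S * J" using assoc_mult_mat[OF E(1) E(1) S] by (simp add: E(2) ES)
  finally have "T * (S * (J * J)) = T * (S * J)" by simp
  then have "J * J = J"
    using assoc_mult_mat[OF T S J] assoc_mult_mat[OF T S sq_mult[OF J J]] TS J by (simp add: sq_mult)
  then have Jd': "J $$ (i, j) = (if i = j then J $$ (i, i) else 0) \<and> J $$ (i, i) \<in> {0, 1}" if "i < n" "j < n" for i j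
    by (rule idempotent_jordan_matrix[OF n0, folded J_def, unfolded nn, OF _ that])
  have Jd: "J $$ (i, j) = 0" if "i < n" "j < n" "i \<noteq> j" for i j using Jd'[OF that(1,2)] that(3) by simp
  have Jd2: "J $$ (i, i) \<in> {0, 1}" if "i < n" for i using Jd'[OF that that] by blast
  define A where "A = {i. i < n \<and> J $$ (i, i) = 1}"
  define m where "m = card A"
  have A: "finite A" "A \<subseteq> {..<n}" by (auto simp: A_def)
  then have m: "m \<le> n" using card_mono[of "{..<n}" A] by (simp add: m_def)
  obtain f where f: "bij_betw f {..<m} A"
    using bij_betw_from_nat_into_finite[OF A(1)] by (auto simp: m_def)
  have "card ({..<n} - A) = card {m..<n}" using A by (simp add: card_Diff_subset m_def)
  then obtain g where g: "bij_betw g {m..<n} ({..<n} - A)"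
    using finite_same_card_bij[of "{m..<n}" "{..<n} - A"] by auto
  (* enumerates the indices with diagonal entry 1 first *)
  define p where "p i = (if i < m then f i else g i)" for i
  have p: "bij_betw p {..<n} {..<n}"
  proof -
    have "bij_betw p {..<m} A" using f by (rule bij_betw_cong[THEN iffD1, rotated]) (simp add: p_def)
    moreover have "bij_betw p {m..<n} ({..<n} - A)" 
      using g by (rule bij_betw_cong[THEN iffD1, rotated]) (simp add: p_def)
    ultimately have "bij_betw p ({..<m} \<union> {m..<n}) (A \<union> ({..<n} - A))"
      by (rule bij_betw_combine) auto
    moreover have "{..<m} \<union> {m..<n} = {..<n}" "A \<union> ({..<n} - A) = {..<n}" using m A by auto
    ultimately show ?thesis by simp
  qed
  have pn: "p i < n" if "i < n" for i using bij_betwE[OF p] that by auto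
  have pinj: "p i = p j \<longleftrightarrow> i = j" if "i < n" "j < n" for i j
    using p that by (auto simp: bij_betw_def inj_on_def)
  have pJ: "J $$ (p i, p i) = (if i < m then 1 else 0)" if "i < n" for i
  proof (cases "i < m")
    case True
    then have "p i \<in> A" using bij_betwE[OF f] by (auto simp: p_def)
    then show ?thesis using True by (simp add: A_def)
  next
    case False
    then have "p i \<in> {..<n} - A" using bij_betwE[OF g] that by (auto simp: p_def)
    then show ?thesis using False Jd2[of "p i"] by (auto simp: A_def)
  qed
  define S' where "S' = Matrix.mat n n (\<lambda>(i, j). S $$ (i, p j))"
  define T' where "T' = Matrix.mat n n (\<lambda>(i, j). T $$ (p i, j))"
  have S': "S' \<in> carrier_mat n n" and T': "T' \<in> carrier_mat n n" by (auto simp: S'_def T'_def)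
  show ?thesis
  proof (rule that[OF S' T' _ _ m])
    show "S' * T' = 1\<^sub>m n"
    proof (rule eq_matI)
      fix i j assume "i < dim_row (1\<^sub>m n :: complex mat)" "j < dim_col (1\<^sub>m n :: complex mat)"
      then have ij: "i < n" "j < n" by auto
      have "(S' * T') $$ (i, j) = (\<Sum>l<n. S $$ (i, p l) * T $$ (p l, j))"
        unfolding sq_mult_entry[OF S' T' ij] using ij by (intro sum.cong refl) (auto simp: S'_def T'_def)
      also have "\<dots> = (\<Sum>l<n. S $$ (i, l) * T $$ (l, j))" by (rule sum.reindex_bij_betw[OF p])
      also have "\<dots> = (S * T) $$ (i, j)" using sq_mult_entry[OF S T ij] by simp
      finally show "(S' * T') $$ (i, j) = (1\<^sub>m n) $$ (i, j)" by (simp add: ST)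
    qed (use S' T' in auto)
    show "T' * S' = 1\<^sub>m n"
    proof (rule eq_matI)
      fix i j assume "i < dim_row (1\<^sub>m n :: complex mat)" "j < dim_col (1\<^sub>m n :: complex mat)"
      then have ij: "i < n" "j < n" by auto
      have "(T' * S') $$ (i, j) = (\<Sum>l<n. T $$ (p i, l) * S $$ (l, p j))"
        unfolding sq_mult_entry[OF T' S' ij] using ij by (intro sum.cong refl) (auto simp: S'_def T'_def)
      also have "\<dots> = (T * S) $$ (p i, p j)" using sq_mult_entry[OF T S pn pn] ij by simp
      finally show "(T' * S') $$ (i, j) = (1\<^sub>m n) $$ (i, j)" using ij pn pinj by (simp add: TS)
    qed (use S' T' in auto)
    fix i j assume ij: "i < n" "j < n"
    have "(E * S') $$ (i, j) = (\<Sum>l<n. E $$ (i, l) * S $$ (l, p j))"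
      unfolding sq_mult_entry[OF E(1) S' ij] using ij by (intro sum.cong refl) (auto simp: S'_def)
    also have "\<dots> = (S * J) $$ (i, p j)" using sq_mult_entry[OF E(1) S ij(1) pn[OF ij(2)]] by (simp add: ES)
    also have "\<dots> = (\<Sum>l<n. if l = p j then S $$ (i, p j) * J $$ (p j, p j) else 0)"
      unfolding sq_mult_entry[OF S J ij(1) pn[OF ij(2)]]
      by (intro sum.cong refl) (use Jd pn[OF ij(2)] in auto)
    also have "\<dots> = (if j < m then S' $$ (i, j) else 0)"
      using pJ[OF ij(2)] pn[OF ij(2)] ij by (simp add: S'_def)
    finally show "(E * S') $$ (i, j) = (if j < m then S' $$ (i, j) else 0)" .
  qed
qed

section \<open>The topology of the projective line\<close>

lemma open_cp1_iff: "open U \<longleftrightarrow> (\<forall>p\<in>U. \<forall>\<^sub>F t in nhds 0. chart p t \<in> U)"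
  by (simp add: open_cp1_def)

lemma chart_zero [simp]: "chart p 0 = p"
  by (cases p) auto

lemma inj_chart: "inj (chart p)"
  by (cases p) (auto simp: inj_def)

lemma eventually_chart_notin_finite:
  assumes "finite T"
  shows "\<forall>\<^sub>F t in at 0. chart p t \<notin> T"
proof -
  let ?S = "chart p -` T - {0}"
  have "finite ?S" using finite_vimageI[OF assms inj_chart] by simp
  then have "open (- ?S)" by (rule open_Compl[OF finite_imp_closed])
  then have "\<forall>\<^sub>F t in nhds 0. t \<in> - ?S" by (rule eventually_nhds_in_open) simp
  then show ?thesis by (auto simp: eventually_at_filter elim: eventually_mono)
qed

lemma open_Diff_finite:
  fixes U :: "cp1 set"
  assumes "open U" "finite T"
  shows "open (U - T)"
  unfolding open_cp1_iff
proof
  fix p assume p: "p \<in> U - T"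
  have "\<forall>\<^sub>F t in nhds 0. chart p t \<notin> T"
    using eventually_chart_notin_finite[OF assms(2), of p] p
    by (auto simp: eventually_at_filter elim!: eventually_mono)
  moreover have "\<forall>\<^sub>F t in nhds 0. chart p t \<in> U"
    using assms(1) p by (auto simp: open_cp1_iff)
  ultimately show "\<forall>\<^sub>F t in nhds 0. chart p t \<in> U - T"
    by eventually_elim auto
qed

lemma open_Compl_finite: "finite T \<Longrightarrow> open (- T :: cp1 set)"
  using open_Diff_finite[of UNIV T] by (simp add: Compl_eq_Diff_UNIV)

lemma open_punctured_line [simp]: "open punctured_line"
  by (simp add: punctured_line_def open_Compl_finite)

lemma eventually_chart_in:
  assumes "open U" "p \<in> U"
  shows "\<forall>\<^sub>F t in nhds 0. chart p t \<in> U" "\<forall>\<^sub>F t in at 0. chart p t \<in> U"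
  using assms by (auto simp: open_cp1_iff eventually_at_filter elim: eventually_mono)

lemma hol_on_chart_analytic:
  assumes "hol_on f U" "chart p t \<in> U"
  shows "(\<lambda>t. f (chart p t)) analytic_on {t}"
proof (cases "p = Infty \<and> t = 0")
  case True
  then show ?thesis using assms by (auto simp: hol_on_def)
next
  case nontriv: False
  obtain z where z: "chart p t = Affine z" using nontriv by (cases p) auto
  define \<phi> where "\<phi> s = (case p of Affine a \<Rightarrow> a + s - z | Infty \<Rightarrow> 1 / s - z)" for s
  have "\<phi> analytic_on {t}" using nontriv unfolding \<phi>_def
    by (cases p) (auto intro!: analytic_intros)
  moreover have \<phi>t: "\<phi> t = 0" using z nontriv by (cases p) (auto simp: \<phi>_def split: if_splits)
  moreover have "(\<lambda>s. f (chart (Affine z) s)) analytic_on {0}" using assms z by (auto simp: hol_on_def)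
  ultimately have "((\<lambda>s. f (chart (Affine z) s)) \<circ> \<phi>) analytic_on {t}"
    by (intro analytic_on_compose) auto
  moreover have "\<forall>\<^sub>F s in nhds t. ((\<lambda>s. f (chart (Affine z) s)) \<circ> \<phi>) s = f (chart p s)"
  proof (cases p)
    case (Affine a)
    then show ?thesis by (auto simp: \<phi>_def)
  next
    case Infty
    then have "\<forall>\<^sub>F s in nhds t. s \<noteq> 0"
      using nontriv eventually_nhds_in_open[of "- {0}" t] by auto
    then show ?thesis by eventually_elim (simp add: Infty \<phi>_def)
  qed
  ultimately show ?thesis using analytic_at_cong by fastforce
qed

section \<open>Rings of holomorphic functions\<close>

lemma hol_ring_iff: "f \<in> carrier (hol_ring U) \<longleftrightarrow> hol_on f U \<and> (\<forall>x. x \<notin> U \<longrightarrow> f x = 0)"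
  by (simp add: hol_ring_def)

lemma hol_ring_ops [simp]:
  "f \<oplus>\<^bsub>hol_ring U\<^esub> g = (\<lambda>x. f x + g x)" "f \<otimes>\<^bsub>hol_ring U\<^esub> g = (\<lambda>x. f x * g x)"
  "\<zero>\<^bsub>hol_ring U\<^esub> = (\<lambda>_. 0)" "\<one>\<^bsub>hol_ring U\<^esub> = zero_off U (\<lambda>_. 1)"
  by (simp_all add: hol_ring_def)

lemma zero_off_apply: "x \<in> U \<Longrightarrow> zero_off U f x = f x" "x \<notin> U \<Longrightarrow> zero_off U f x = 0"
  by (simp_all add: zero_off_def)

lemma hol_on_cong:
  assumes "open U" "\<And>x. x \<in> U \<Longrightarrow> f x = g x"
  shows "hol_on f U \<longleftrightarrow> hol_on g U"
proof -
  have "(\<lambda>t. f (chart p t)) analytic_on {0} \<longleftrightarrow> (\<lambda>t. g (chart p t)) analytic_on {0}" if "p \<in> U" for p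
    using eventually_chart_in(1)[OF assms(1) that] assms(2)
    by (intro analytic_at_cong) (auto elim: eventually_mono)
  then show ?thesis by (simp add: hol_on_def)
qed

lemma hol_on_subset: "hol_on f U \<Longrightarrow> V \<subseteq> U \<Longrightarrow> hol_on f V"
  by (auto simp: hol_on_def)

lemma zero_off_hol_ring: "open V \<Longrightarrow> hol_on f V \<Longrightarrow> zero_off V f \<in> carrier (hol_ring V)"
  using hol_on_cong[of V "zero_off V f" f] by (simp add: hol_ring_iff zero_off_def)

lemma zero_off_restrict:
  "open V \<Longrightarrow> V \<subseteq> U \<Longrightarrow> f \<in> carrier (hol_ring U) \<Longrightarrow> zero_off V f \<in> carrier (hol_ring V)"
  by (rule zero_off_hol_ring) (auto simp: hol_ring_iff intro: hol_on_subset)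

lemma hol_ring_add: "f \<in> carrier (hol_ring U) \<Longrightarrow> g \<in> carrier (hol_ring U) \<Longrightarrow> (\<lambda>x. f x + g x) \<in> carrier (hol_ring U)"
  by (auto simp: hol_ring_iff hol_on_def intro: analytic_intros)

lemma hol_ring_mult: "f \<in> carrier (hol_ring U) \<Longrightarrow> g \<in> carrier (hol_ring U) \<Longrightarrow> (\<lambda>x. f x * g x) \<in> carrier (hol_ring U)"
  by (auto simp: hol_ring_iff hol_on_def intro: analytic_intros)

lemma hol_ring_zero: "(\<lambda>_. 0) \<in> carrier (hol_ring U)"
  by (auto simp: hol_ring_iff hol_on_def)

lemma hol_ring_const: "open U \<Longrightarrow> zero_off U (\<lambda>_. c) \<in> carrier (hol_ring U)"
  by (rule zero_off_hol_ring) (auto simp: hol_on_def)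

lemma hol_ring_sum: 
  "(\<And>i. i \<in> I \<Longrightarrow> f i \<in> carrier (hol_ring U)) \<Longrightarrow> (\<lambda>x. \<Sum>i\<in>I. f i x) \<in> carrier (hol_ring U)"
  by (induction I rule: infinite_finite_induct) (auto intro: hol_ring_zero hol_ring_add)

lemma hol_ring_glue:
  assumes "open V" "open W" "f \<in> carrier (hol_ring V)" "g \<in> carrier (hol_ring W)"
    and "\<And>x. x \<in> V \<inter> W \<Longrightarrow> f x = g x"
  shows "(\<lambda>x. if x \<in> V then f x else g x) \<in> carrier (hol_ring (V \<union> W))" (is "?h \<in> _")
proof -
  have "hol_on ?h V" using assms hol_on_cong[of V ?h f] by (simp add: hol_ring_iff)
  moreover have "hol_on ?h W" using assms hol_on_cong[of W ?h g] by (simp add: hol_ring_iff)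
  ultimately show ?thesis using assms(4) by (auto simp: hol_ring_iff hol_on_def)
qed

text \<open>By continuity, the values at the finitely many exceptional points vanish as well.\<close>

lemma hol_ring_eq_zero:
  assumes U: "open U" and f: "f \<in> carrier (hol_ring U)" and "finite T" and zero: "\<And>x. x \<in> U - T \<Longrightarrow> f x = 0"
  shows "f = (\<lambda>_. 0)"
proof
  fix p
  show "f p = 0"
  proof (cases "p \<in> U")
    case True
    have "(\<lambda>t. f (chart p t)) analytic_on {0}" using f True by (auto simp: hol_ring_iff hol_on_def)
    then have "((\<lambda>t. f (chart p t)) \<longlongrightarrow> f (chart p 0)) (at 0)"
      by (rule isContD[OF analytic_at_imp_isCont])
    moreover have "\<forall>\<^sub>F t in at 0. f (chart p t) = 0"
      using eventually_chart_in(2)[OF U True] eventually_chart_notin_finite[OF assms(3), of p]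
      by eventually_elim (use zero in auto)
    ultimately show ?thesis
      using tendsto_eventually tendsto_unique trivial_limit_at chart_zero by metis
  qed (use f in \<open>auto simp: hol_ring_iff\<close>)
qed

section \<open>Linear combinations of sections\<close>

text \<open>Linear combinations are indexed by natural numbers below \<open>n\<close>, with the coefficients as total
functions, so that changes of frame become matrix computations.\<close>

definition lincomb :: "'s osheaf \<Rightarrow> cp1 set \<Rightarrow> nat \<Rightarrow> (nat \<Rightarrow> cp1 \<Rightarrow> complex) \<Rightarrow> (nat \<Rightarrow> 's) \<Rightarrow> 's" where
  "lincomb E U n c e = (\<Oplus>\<^bsub>Sec E U\<^esub>i\<in>{..<n}. c i \<odot>\<^bsub>Sec E U\<^esub> e i)"

context omodule_sheaf
begin

lemma sec_group: "open U \<Longrightarrow> U \<subseteq> X \<Longrightarrow> abelian_group (Sec E U)"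
  using module_Sec module.axioms(2) by blast

lemma smult_closed:
  "open U \<Longrightarrow> U \<subseteq> X \<Longrightarrow> f \<in> carrier (hol_ring U) \<Longrightarrow> s \<in> carrier (Sec E U) \<Longrightarrow> f \<odot>\<^bsub>Sec E U\<^esub> s \<in> carrier (Sec E U)"
  using module.smult_closed[OF module_Sec] by blast

lemma add_closed:
  "open U \<Longrightarrow> U \<subseteq> X \<Longrightarrow> t \<in> carrier (Sec E U) \<Longrightarrow> s \<in> carrier (Sec E U) \<Longrightarrow> t \<oplus>\<^bsub>Sec E U\<^esub> s \<in> carrier (Sec E U)"
  by (rule abelian_monoid.a_closed[OF abelian_group.axioms(1)[OF sec_group]])

lemma sec_zero_closed: "open U \<Longrightarrow> U \<subseteq> X \<Longrightarrow> \<zero>\<^bsub>Sec E U\<^esub> \<in> carrier (Sec E U)"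
  by (rule abelian_monoid.zero_closed[OF abelian_group.axioms(1)[OF sec_group]])

lemma lincomb_rec:
  assumes "open U" "U \<subseteq> X"
  shows lincomb_0: "lincomb E U 0 c e = \<zero>\<^bsub>Sec E U\<^esub>"
    and lincomb_Suc: "(\<And>i. i < Suc n \<Longrightarrow> c i \<in> carrier (hol_ring U)) \<Longrightarrow> (\<And>i. i < Suc n \<Longrightarrow> e i \<in> carrier (Sec E U)) \<Longrightarrow>
      lincomb E U (Suc n) c e = lincomb E U n c e \<oplus>\<^bsub>Sec E U\<^esub> c n \<odot>\<^bsub>Sec E U\<^esub> e n"
proof -
  interpret M: abelian_group "Sec E U" by (rule sec_group[OF assms])
  show "lincomb E U 0 c e = \<zero>\<^bsub>Sec E U\<^esub>" by (simp add: lincomb_def)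
  assume c: "\<And>i. i < Suc n \<Longrightarrow> c i \<in> carrier (hol_ring U)" and e: "\<And>i. i < Suc n \<Longrightarrow> e i \<in> carrier (Sec E U)"
  have cl: "c i \<odot>\<^bsub>Sec E U\<^esub> e i \<in> carrier (Sec E U)" if "i < Suc n" for i
    using smult_closed[OF assms c e] that by blast
  then have "lincomb E U (Suc n) c e = c n \<odot>\<^bsub>Sec E U\<^esub> e n \<oplus>\<^bsub>Sec E U\<^esub> lincomb E U n c e"
    unfolding lincomb_def lessThan_Suc by (subst M.finsum_insert) (auto simp: Pi_def)
  also have "\<dots> = lincomb E U n c e \<oplus>\<^bsub>Sec E U\<^esub> c n \<odot>\<^bsub>Sec E U\<^esub> e n"
    unfolding lincomb_def using cl by (intro M.a_comm M.finsum_closed) (auto simp: Pi_def)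
  finally show "lincomb E U (Suc n) c e = lincomb E U n c e \<oplus>\<^bsub>Sec E U\<^esub> c n \<odot>\<^bsub>Sec E U\<^esub> e n" .
qed

lemma lincomb_closed:
  assumes "open U" "U \<subseteq> X" "\<And>i. i < n \<Longrightarrow> c i \<in> carrier (hol_ring U)" "\<And>i. i < n \<Longrightarrow> e i \<in> carrier (Sec E U)"
  shows "lincomb E U n c e \<in> carrier (Sec E U)"
  using assms(3,4)
  by (induction n) (simp_all add: lincomb_0 lincomb_Suc assms(1,2) sec_zero_closed add_closed smult_closed)

lemma lincomb_cong:
  assumes "open U" "U \<subseteq> X" "\<And>i. i < n \<Longrightarrow> c i \<in> carrier (hol_ring U)" "\<And>i. i < n \<Longrightarrow> e i \<in> carrier (Sec E U)"
    and "\<And>i. i < n \<Longrightarrow> c i = d i" "\<And>i. i < n \<Longrightarrow> e i = f i"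
  shows "lincomb E U n c e = lincomb E U n d f"
  using assms(3-)
  by (induction n) (simp_all add: lincomb_0 lincomb_Suc assms(1,2))

lemma Res_zero:
  assumes "open U" "open V" "V \<subseteq> U" "U \<subseteq> X"
  shows "Res E U V \<zero>\<^bsub>Sec E U\<^esub> = \<zero>\<^bsub>Sec E V\<^esub>"
proof -
  interpret M: abelian_group "Sec E U" by (rule sec_group) (use assms in auto)
  interpret N: abelian_group "Sec E V" by (rule sec_group) (use assms in auto)
  have "Res E U V \<zero>\<^bsub>Sec E U\<^esub> \<oplus>\<^bsub>Sec E V\<^esub> Res E U V \<zero>\<^bsub>Sec E U\<^esub> = Res E U V \<zero>\<^bsub>Sec E U\<^esub>"
    using Res_add[OF assms M.zero_closed M.zero_closed] by simp
  then show ?thesis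
    using Res_closed[OF assms M.zero_closed] N.add.r_cancel_one' by (metis N.add.l_cancel_one)
qed

lemma lincomb_Res:
  assumes "open U" "open V" "V \<subseteq> U" "U \<subseteq> X"
    and "\<And>i. i < n \<Longrightarrow> c i \<in> carrier (hol_ring U)" "\<And>i. i < n \<Longrightarrow> e i \<in> carrier (Sec E U)"
  shows "Res E U V (lincomb E U n c e) = lincomb E V n (\<lambda>i. zero_off V (c i)) (\<lambda>i. Res E U V (e i))"
  using assms(5,6)
proof (induction n)
  case 0
  then show ?case using assms by (simp add: lincomb_0 Res_zero)
next
  case (Suc n)
  have V: "V \<subseteq> X" using assms by auto
  show ?case
    using Suc assms(1-4) V
    by (simp add: lincomb_Suc Res_add lincomb_closed smult_closed Res_smult Res_closed zero_off_restrict)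
qed

lemma lincomb_add:
  assumes "open U" "U \<subseteq> X" "\<And>i. i < n \<Longrightarrow> c i \<in> carrier (hol_ring U)" "\<And>i. i < n \<Longrightarrow> d i \<in> carrier (hol_ring U)"
    "\<And>i. i < n \<Longrightarrow> e i \<in> carrier (Sec E U)"
  shows "lincomb E U n (\<lambda>i x. c i x + d i x) e = lincomb E U n c e \<oplus>\<^bsub>Sec E U\<^esub> lincomb E U n d e"
  using assms(3-)
proof (induction n)
  interpret M: module "hol_ring U" "Sec E U" by (rule module_Sec[OF assms(1,2)])
  {
    case 0
    then show ?case using assms by (simp add: lincomb_0)
  next
    case (Suc n)
    have cl: "lincomb E U n c e \<in> carrier (Sec E U)" "lincomb E U n d e \<in> carrier (Sec E U)"
      using lincomb_closed[OF assms(1,2)] Suc.prems by auto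
    have "(\<lambda>x. c n x + d n x) \<odot>\<^bsub>Sec E U\<^esub> e n = c n \<odot>\<^bsub>Sec E U\<^esub> e n \<oplus>\<^bsub>Sec E U\<^esub> d n \<odot>\<^bsub>Sec E U\<^esub> e n"
      using M.smult_l_distr[of "c n" "d n" "e n"] Suc.prems by simp
    then show ?case
      using Suc cl assms(1,2) by (simp add: lincomb_Suc hol_ring_add M.a_ac)
  }
qed

lemma lincomb_smult:
  assumes "open U" "U \<subseteq> X" "f \<in> carrier (hol_ring U)" "\<And>i. i < n \<Longrightarrow> c i \<in> carrier (hol_ring U)"
    "\<And>i. i < n \<Longrightarrow> e i \<in> carrier (Sec E U)"
  shows "lincomb E U n (\<lambda>i x. f x * c i x) e = f \<odot>\<^bsub>Sec E U\<^esub> lincomb E U n c e"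
  using assms(4-)
proof (induction n)
  interpret M: module "hol_ring U" "Sec E U" by (rule module_Sec[OF assms(1,2)])
  {
    case 0
    then show ?case using assms by (simp add: lincomb_0)
  next
    case (Suc n)
    have cl: "lincomb E U n c e \<in> carrier (Sec E U)"
      using lincomb_closed[OF assms(1,2)] Suc.prems by auto
    have "(\<lambda>x. f x * c n x) \<odot>\<^bsub>Sec E U\<^esub> e n = f \<odot>\<^bsub>Sec E U\<^esub> (c n \<odot>\<^bsub>Sec E U\<^esub> e n)"
      using M.smult_assoc1[of f "c n" "e n"] Suc.prems assms(3) by simp
    then show ?case
      using Suc cl assms(1-3) by (simp add: lincomb_Suc hol_ring_mult M.smult_r_distr smult_closed)
  }
qed

lemma lincomb_zero_coeffs:
  assumes "open U" "U \<subseteq> X" "\<And>i. i < n \<Longrightarrow> e i \<in> carrier (Sec E U)"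
  shows "lincomb E U n (\<lambda>i x. 0) e = \<zero>\<^bsub>Sec E U\<^esub>"
proof -
  interpret M: module "hol_ring U" "Sec E U" by (rule module_Sec[OF assms(1,2)])
  have "(\<lambda>x. 0) \<odot>\<^bsub>Sec E U\<^esub> s = \<zero>\<^bsub>Sec E U\<^esub>" if "s \<in> carrier (Sec E U)" for s
    using M.smult_l_null[OF that] by simp
  then show ?thesis using assms(3)
    by (induction n) (simp_all add: lincomb_0 lincomb_Suc assms(1,2) hol_ring_zero)
qed

lemma lincomb_lincomb:
  assumes "open U" "U \<subseteq> X" "\<And>i j. i < n \<Longrightarrow> j < m \<Longrightarrow> A i j \<in> carrier (hol_ring U)"
    "\<And>j. j < m \<Longrightarrow> c j \<in> carrier (hol_ring U)" "\<And>i. i < n \<Longrightarrow> e i \<in> carrier (Sec E U)"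
  shows "lincomb E U m c (\<lambda>j. lincomb E U n (\<lambda>i. A i j) e) = lincomb E U n (\<lambda>i x. \<Sum>j<m. A i j x * c j x) e"
  using assms(3,4)
proof (induction m)
  case 0
  then show ?case using assms by (simp add: lincomb_0 lincomb_zero_coeffs)
next
  case (Suc m)
  have "lincomb E U (Suc m) c (\<lambda>j. lincomb E U n (\<lambda>i. A i j) e) =
      lincomb E U m c (\<lambda>j. lincomb E U n (\<lambda>i. A i j) e) \<oplus>\<^bsub>Sec E U\<^esub> c m \<odot>\<^bsub>Sec E U\<^esub> lincomb E U n (\<lambda>i. A i m) e"
    using Suc.prems assms(1,2,5) by (intro lincomb_Suc lincomb_closed) auto
  also have "\<dots> = lincomb E U n (\<lambda>i x. \<Sum>j<m. A i j x * c j x) e \<oplus>\<^bsub>Sec E U\<^esub> lincomb E U n (\<lambda>i x. c m x * A i m x) e"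
    using Suc assms(1,2,5) by (simp add: lincomb_smult)
  also have "\<dots> = lincomb E U n (\<lambda>i x. (\<Sum>j<m. A i j x * c j x) + c m x * A i m x) e"
    using Suc.prems assms(1,2,5)
    by (intro lincomb_add[symmetric] hol_ring_sum hol_ring_mult) auto
  finally show ?case by (simp add: mult.commute)
qed

lemma lincomb_delta:
  assumes "open U" "U \<subseteq> X" "\<And>i. i < n \<Longrightarrow> e i \<in> carrier (Sec E U)" "j < n"
  shows "lincomb E U n (\<lambda>i. zero_off U (\<lambda>_. if i = j then 1 else 0)) e = e j"
proof -
  interpret M: module "hol_ring U" "Sec E U" by (rule module_Sec[OF assms(1,2)])
  have zero: "zero_off U (\<lambda>_. 0) \<odot>\<^bsub>Sec E U\<^esub> s = \<zero>\<^bsub>Sec E U\<^esub>" if "s \<in> carrier (Sec E U)" for s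
    using M.smult_l_null[OF that] by (simp add: zero_off_def)
  have one: "zero_off U (\<lambda>_. 1) \<odot>\<^bsub>Sec E U\<^esub> s = s" if "s \<in> carrier (Sec E U)" for s
    using M.smult_one[OF that] by simp
  have "lincomb E U m (\<lambda>i. zero_off U (\<lambda>_. if i = j then 1 else 0)) e = (if j < m then e j else \<zero>\<^bsub>Sec E U\<^esub>)"
    if "m \<le> n" for m
    using that
  proof (induction m)
    case (Suc m)
    then show ?case
      using assms by (auto simp: lincomb_Suc hol_ring_const zero one less_Suc_eq)
  qed (use assms in \<open>simp add: lincomb_0\<close>)
  from this[of n] show ?thesis using assms(4) by simp
qed

end

section \<open>Local frames\<close>

lemma is_frame_iff:
  "is_frame E U n e \<longleftrightarrow> (\<forall>i<n. e i \<in> carrier (Sec E U)) \<and>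
     (\<forall>V. open V \<and> V \<subseteq> U \<longrightarrow> (\<forall>s\<in>carrier (Sec E V).
        \<exists>!c. c \<in> {..<n} \<rightarrow>\<^sub>E carrier (hol_ring V) \<and> s = lincomb E V n c (\<lambda>i. Res E U V (e i))))"
  by (simp add: is_frame_def lincomb_def)

lemma is_frame_closed: "is_frame E U n e \<Longrightarrow> i < n \<Longrightarrow> e i \<in> carrier (Sec E U)"
  by (simp add: is_frame_def)

context omodule_sheaf
begin

lemma frame_coeffs:
  assumes "is_frame E U n e" "open V" "V \<subseteq> U" "s \<in> carrier (Sec E V)"
  obtains c where "\<And>i. i < n \<Longrightarrow> c i \<in> carrier (hol_ring V)" "s = lincomb E V n c (\<lambda>i. Res E U V (e i))"
proof -
  obtain c where "c \<in> {..<n} \<rightarrow>\<^sub>E carrier (hol_ring V)" "s = lincomb E V n c (\<lambda>i. Res E U V (e i))"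
    using assms unfolding is_frame_iff by blast
  then show ?thesis using that by (auto simp: PiE_iff)
qed

lemma frame_unique:
  assumes fr: "is_frame E U n e" and U: "open U" "U \<subseteq> X" and V: "open V" "V \<subseteq> U"
    and c: "\<And>i. i < n \<Longrightarrow> c i \<in> carrier (hol_ring V)" and d: "\<And>i. i < n \<Longrightarrow> d i \<in> carrier (hol_ring V)"
    and eq: "lincomb E V n c (\<lambda>i. Res E U V (e i)) = lincomb E V n d (\<lambda>i. Res E U V (e i))"
    and "i < n"
  shows "c i = d i"
proof -
  have VX: "V \<subseteq> X" using U V by auto
  have e: "Res E U V (e i) \<in> carrier (Sec E V)" if "i < n" for i
    using is_frame_closed[OF fr that] U V by (intro Res_closed) auto
  let ?r = "\<lambda>c i. if i < n then c i else undefined"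
  have 1: "lincomb E V n (?r c) (\<lambda>i. Res E U V (e i)) = lincomb E V n c (\<lambda>i. Res E U V (e i))"
    if "\<And>i. i < n \<Longrightarrow> c i \<in> carrier (hol_ring V)" for c
    by (rule lincomb_cong[OF V(1) VX]) (use that e in auto)
  have "lincomb E V n c (\<lambda>i. Res E U V (e i)) \<in> carrier (Sec E V)"
    by (intro lincomb_closed V(1) VX c e)
  then have "\<exists>!c'. c' \<in> {..<n} \<rightarrow>\<^sub>E carrier (hol_ring V) \<and>
      lincomb E V n c (\<lambda>i. Res E U V (e i)) = lincomb E V n c' (\<lambda>i. Res E U V (e i))"
    using fr V unfolding is_frame_iff by blast
  moreover have "?r c \<in> {..<n} \<rightarrow>\<^sub>E carrier (hol_ring V)" "?r d \<in> {..<n} \<rightarrow>\<^sub>E carrier (hol_ring V)"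
    using c d by (auto simp: PiE_iff extensional_def)
  moreover have "lincomb E V n c (\<lambda>i. Res E U V (e i)) = lincomb E V n (?r c) (\<lambda>i. Res E U V (e i))"
    using 1[of c] c by simp
  moreover have "lincomb E V n c (\<lambda>i. Res E U V (e i)) = lincomb E V n (?r d) (\<lambda>i. Res E U V (e i))"
    using 1[of d] d eq by simp
  ultimately have "?r c = ?r d" by blast
  then show ?thesis using \<open>i < n\<close> by (metis (full_types))
qed

lemma is_frameI:
  assumes U: "open U" "U \<subseteq> X" and e: "\<And>i. i < n \<Longrightarrow> e i \<in> carrier (Sec E U)"
    and ex: "\<And>V s. open V \<Longrightarrow> V \<subseteq> U \<Longrightarrow> s \<in> carrier (Sec E V) \<Longrightarrow>
      \<exists>c. (\<forall>i<n. c i \<in> carrier (hol_ring V)) \<and> s = lincomb E V n c (\<lambda>i. Res E U V (e i))"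
    and uniq: "\<And>V c d. open V \<Longrightarrow> V \<subseteq> U \<Longrightarrow> \<forall>i<n. c i \<in> carrier (hol_ring V) \<Longrightarrow> \<forall>i<n. d i \<in> carrier (hol_ring V) \<Longrightarrow>
      lincomb E V n c (\<lambda>i. Res E U V (e i)) = lincomb E V n d (\<lambda>i. Res E U V (e i)) \<Longrightarrow> \<forall>i<n. c i = d i"
  shows "is_frame E U n e"
  unfolding is_frame_iff
proof (intro conjI allI impI ballI)
  fix V s assume V: "open V \<and> V \<subseteq> U" and s: "s \<in> carrier (Sec E V)"
  then have VX: "V \<subseteq> X" using U by auto
  obtain c where c: "\<forall>i<n. c i \<in> carrier (hol_ring V)" "s = lincomb E V n c (\<lambda>i. Res E U V (e i))"
    using ex[of V s] V s by blast
  let ?r = "\<lambda>c i. if i < n then c i else undefined"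
  have "s = lincomb E V n (?r c) (\<lambda>i. Res E U V (e i))"
    unfolding c(2) by (rule lincomb_cong) (use V VX c U e Res_closed in auto)
  moreover have "?r c \<in> {..<n} \<rightarrow>\<^sub>E carrier (hol_ring V)" using c by (auto simp: PiE_iff extensional_def)
  moreover have "c' = d'" if "c' \<in> {..<n} \<rightarrow>\<^sub>E carrier (hol_ring V)" "s = lincomb E V n c' (\<lambda>i. Res E U V (e i))"
    "d' \<in> {..<n} \<rightarrow>\<^sub>E carrier (hol_ring V)" "s = lincomb E V n d' (\<lambda>i. Res E U V (e i))" for c' d'
  proof -
    have "\<forall>i<n. c' i = d' i" using uniq[of V c' d'] that V by (auto simp: PiE_iff)
    then show ?thesis using that by (auto intro!: PiE_ext[OF that(1) that(3)])
  qed
  ultimately show "\<exists>!c. c \<in> {..<n} \<rightarrow>\<^sub>E carrier (hol_ring V) \<and> s = lincomb E V n c (\<lambda>i. Res E U V (e i))"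
    by blast
qed (use e in blast)

lemma frame_Res:
  assumes fr: "is_frame E U n e" and U: "open U" "U \<subseteq> X" and V: "open V" "V \<subseteq> U"
  shows "is_frame E V n (\<lambda>i. Res E U V (e i))"
proof -
  have eq: "lincomb E W n c (\<lambda>i. Res E V W (Res E U V (e i))) = lincomb E W n c (\<lambda>i. Res E U W (e i))"
    if "open W" "W \<subseteq> V" "\<forall>i<n. c i \<in> carrier (hol_ring W)" for W c
    using that U V is_frame_closed[OF fr]
    by (intro lincomb_cong) (auto intro!: Res_closed Res_Res)
  show ?thesis
  proof (rule is_frameI)
    fix W s assume W: "open W" "W \<subseteq> V" and s: "s \<in> carrier (Sec E W)"
    obtain c where "\<And>i. i < n \<Longrightarrow> c i \<in> carrier (hol_ring W)" "s = lincomb E W n c (\<lambda>i. Res E U W (e i))"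
      using frame_coeffs[OF fr W(1) _ s] W V by auto
    then show "\<exists>c. (\<forall>i<n. c i \<in> carrier (hol_ring W)) \<and> s = lincomb E W n c (\<lambda>i. Res E V W (Res E U V (e i)))"
      by (intro exI[of _ c]) (simp add: eq[OF W])
  next
    fix W c d assume W: "open W" "W \<subseteq> V" and c: "\<forall>i<n. c i \<in> carrier (hol_ring W)"
      and d: "\<forall>i<n. d i \<in> carrier (hol_ring W)"
      and "lincomb E W n c (\<lambda>i. Res E V W (Res E U V (e i))) = lincomb E W n d (\<lambda>i. Res E V W (Res E U V (e i)))"
    then have "lincomb E W n c (\<lambda>i. Res E U W (e i)) = lincomb E W n d (\<lambda>i. Res E U W (e i))"
      using eq[OF W] by simp
    then show "\<forall>i<n. c i = d i"
      using frame_unique[OF fr U W(1), of c d] W V c d by auto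
  qed (use U V is_frame_closed[OF fr] in \<open>auto intro: Res_closed\<close>)
qed

lemma section_eqI:
  assumes "open U" "open V" "U \<union> V \<subseteq> X" "s \<in> carrier (Sec E (U \<union> V))" "t \<in> carrier (Sec E (U \<union> V))"
    and "Res E (U \<union> V) U s = Res E (U \<union> V) U t" "Res E (U \<union> V) V s = Res E (U \<union> V) V t"
  shows "s = t"
proof -
  have UV: "open (U \<union> V)" using assms by auto
  have "\<exists>!r. r \<in> carrier (Sec E (\<Union>{U, V})) \<and> (\<forall>W\<in>{U, V}. Res E (\<Union>{U, V}) W r = Res E (U \<union> V) W s)"
  proof (rule gluing)
    show "\<forall>W\<in>{U, V}. open W \<and> W \<subseteq> X \<and> Res E (U \<union> V) W s \<in> carrier (Sec E W)"
      using assms UV by (auto intro: Res_closed)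
    show "\<forall>W\<in>{U, V}. \<forall>W'\<in>{U, V}. Res E W (W \<inter> W') (Res E (U \<union> V) W s) = Res E W' (W \<inter> W') (Res E (U \<union> V) W' s)"
      using assms UV by (auto simp: Res_Res open_Int)
  qed
  then show ?thesis using assms by (auto simp: ball_simps)
qed

lemma section_glue:
  assumes "open U" "open V" "U \<union> V \<subseteq> X" "s \<in> carrier (Sec E U)" "t \<in> carrier (Sec E V)"
    and "Res E U (U \<inter> V) s = Res E V (U \<inter> V) t"
  obtains r where "r \<in> carrier (Sec E (U \<union> V))" "Res E (U \<union> V) U r = s" "Res E (U \<union> V) V r = t"
proof (cases "U = V")
  case True
  then have "s = t" using assms Res_id[of U] by auto
  then show ?thesis using that[of s] True assms Res_id[of U] by auto
next
  case False
  let ?s = "\<lambda>W. if W = U then s else t"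
  have "\<exists>!r. r \<in> carrier (Sec E (\<Union>{U, V})) \<and> (\<forall>W\<in>{U, V}. Res E (\<Union>{U, V}) W r = ?s W)"
    by (rule gluing) (use assms False in \<open>auto simp: Int_commute\<close>)
  then obtain r where "r \<in> carrier (Sec E (U \<union> V))" "\<forall>W\<in>{U, V}. Res E (U \<union> V) W r = ?s W" by auto
  then show ?thesis using that[of r] False by auto
qed

lemma lincomb_Res_Res:
  assumes A: "open A" "A \<subseteq> X" and V: "open V" "V \<subseteq> A" and W: "open W" "W \<subseteq> V"
    and c: "\<And>i. i < n \<Longrightarrow> c i \<in> carrier (hol_ring V)" and e: "\<And>i. i < n \<Longrightarrow> e i \<in> carrier (Sec E A)"
  shows "Res E V W (lincomb E V n c (\<lambda>i. Res E A V (e i))) =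
    lincomb E W n (\<lambda>i. zero_off W (c i)) (\<lambda>i. Res E A W (e i))"
proof -
  have VX: "V \<subseteq> X" "W \<subseteq> X" using A V W by auto
  have eV: "Res E A V (e i) \<in> carrier (Sec E V)" if "i < n" for i
    by (rule Res_closed[OF A(1) V(1,2) A(2) e[OF that]])
  have "Res E V W (lincomb E V n c (\<lambda>i. Res E A V (e i))) =
      lincomb E W n (\<lambda>i. zero_off W (c i)) (\<lambda>i. Res E V W (Res E A V (e i)))"
    by (rule lincomb_Res[OF V(1) W VX(1) c eV])
  also have "\<dots> = lincomb E W n (\<lambda>i. zero_off W (c i)) (\<lambda>i. Res E A W (e i))"
    by (rule lincomb_cong[OF W(1) VX(2) zero_off_restrict[OF W c] Res_closed[OF V(1) W VX(1) eV] refl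
        Res_Res[OF A(1) V(1) W(1,2) V(2) A(2) e]])
  finally show ?thesis .
qed

text \<open>On an open set \<open>W\<close>, the coefficients of a section over the two parts agree on the overlap, because
coefficients are unique there, and so they glue to coefficients on \<open>W\<close>.\<close>

lemma frame_union:
  assumes U: "open U" "open V" "U \<union> V \<subseteq> X" and e: "\<And>i. i < n \<Longrightarrow> e i \<in> carrier (Sec E (U \<union> V))"
    and fU: "is_frame E U n (\<lambda>i. Res E (U \<union> V) U (e i))" and fV: "is_frame E V n (\<lambda>i. Res E (U \<union> V) V (e i))"
  shows "is_frame E (U \<union> V) n e"
proof (rule is_frameI)
  have UV: "open (U \<union> V)" and UX: "U \<subseteq> X" "V \<subseteq> X" using U by auto
  fix W assume W: "open W" "W \<subseteq> U \<union> V"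
  define WU WV Z where "WU = W \<inter> U" and "WV = W \<inter> V" and "Z = WU \<inter> WV"
  have o: "open WU" "open WV" "open Z" and
    sub: "WU \<subseteq> U" "WV \<subseteq> V" "WU \<subseteq> W" "WV \<subseteq> W" "Z \<subseteq> WU" "Z \<subseteq> WV" "WU \<subseteq> U \<union> V" "WV \<subseteq> U \<union> V" "Z \<subseteq> U" "Z \<subseteq> V" "Z \<subseteq> W"
    and WX: "W \<subseteq> X" "WU \<union> WV \<subseteq> X" and WUX: "WU \<subseteq> X" and WVX: "WV \<subseteq> X"
    using U W by (auto simp: WU_def WV_def Z_def)
  have WUV: "WU \<union> WV = W" using W by (auto simp: WU_def WV_def)
  have via: "lincomb E A n c (\<lambda>i. Res E Y A (Res E (U \<union> V) Y (e i))) = lincomb E A n c (\<lambda>i. Res E (U \<union> V) A (e i))"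
    if Y: "open Y" "Y \<subseteq> U \<union> V" and A: "open A" "A \<subseteq> Y" and c: "\<And>i. i < n \<Longrightarrow> c i \<in> carrier (hol_ring A)" for A Y c
  proof (rule lincomb_cong[OF A(1) _ c _ refl])
    show "A \<subseteq> X" using A Y U by auto
    show "Res E Y A (Res E (U \<union> V) Y (e i)) \<in> carrier (Sec E A)" if "i < n" for i
      by (rule Res_closed[OF Y(1) A _ Res_closed[OF UV Y U(3) e[OF that]]]) (use Y U in auto)
    show "Res E Y A (Res E (U \<union> V) Y (e i)) = Res E (U \<union> V) A (e i)" if "i < n" for i
      by (rule Res_Res[OF UV Y(1) A Y(2) U(3) e[OF that]])
  qed
  have res: "Res E W A (lincomb E W n c (\<lambda>i. Res E (U \<union> V) W (e i))) =
      lincomb E A n (\<lambda>i. zero_off A (c i)) (\<lambda>i. Res E (U \<union> V) A (e i))"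
    if "open A" "A \<subseteq> W" "\<And>i. i < n \<Longrightarrow> c i \<in> carrier (hol_ring W)" for A c
    by (rule lincomb_Res_Res[OF UV U(3) W that e])
  have eW: "Res E (U \<union> V) W (e i) \<in> carrier (Sec E W)" if "i < n" for i
    by (rule Res_closed[OF UV W U(3) e[OF that]])
  {
    fix s assume s: "s \<in> carrier (Sec E W)"
    obtain c1 where c1: "\<And>i. i < n \<Longrightarrow> c1 i \<in> carrier (hol_ring WU)"
      "Res E W WU s = lincomb E WU n c1 (\<lambda>i. Res E U WU (Res E (U \<union> V) U (e i)))"
      using frame_coeffs[OF fU o(1) sub(1) Res_closed[OF W(1) o(1) sub(3) WX(1) s]] by blast
    obtain c2 where c2: "\<And>i. i < n \<Longrightarrow> c2 i \<in> carrier (hol_ring WV)"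
      "Res E W WV s = lincomb E WV n c2 (\<lambda>i. Res E V WV (Res E (U \<union> V) V (e i)))"
      using frame_coeffs[OF fV o(2) sub(2) Res_closed[OF W(1) o(2) sub(4) WX(1) s]] by blast
    have s1: "Res E W WU s = lincomb E WU n c1 (\<lambda>i. Res E (U \<union> V) WU (e i))"
      unfolding c1(2) by (rule via[OF U(1) Un_upper1 o(1) sub(1) c1(1)])
    have s2: "Res E W WV s = lincomb E WV n c2 (\<lambda>i. Res E (U \<union> V) WV (e i))"
      unfolding c2(2) by (rule via[OF U(2) Un_upper2 o(2) sub(2) c2(1)])
    have z1: "zero_off Z (c1 i) \<in> carrier (hol_ring Z)" and z2: "zero_off Z (c2 i) \<in> carrier (hol_ring Z)" if "i < n" for i
      using zero_off_restrict[OF o(3) sub(5) c1(1)[OF that]] zero_off_restrict[OF o(3) sub(6) c2(1)[OF that]] .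
    have "lincomb E Z n (\<lambda>i. zero_off Z (c1 i)) (\<lambda>i. Res E (U \<union> V) Z (e i)) = Res E WU Z (Res E W WU s)"
      unfolding s1 by (rule lincomb_Res_Res[OF UV U(3) o(1) sub(7) o(3) sub(5) c1(1) e, symmetric])
    also have "\<dots> = Res E WV Z (Res E W WV s)"
      using Res_Res[OF W(1) o(1,3) sub(5,3) WX(1) s] Res_Res[OF W(1) o(2,3) sub(6,4) WX(1) s] by simp
    also have "\<dots> = lincomb E Z n (\<lambda>i. zero_off Z (c2 i)) (\<lambda>i. Res E (U \<union> V) Z (e i))"
      unfolding s2 by (rule lincomb_Res_Res[OF UV U(3) o(2) sub(8) o(3) sub(6) c2(1) e])
    finally have "lincomb E Z n (\<lambda>i. zero_off Z (c1 i)) (\<lambda>i. Res E U Z (Res E (U \<union> V) U (e i))) =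
        lincomb E Z n (\<lambda>i. zero_off Z (c2 i)) (\<lambda>i. Res E U Z (Res E (U \<union> V) U (e i)))"
      using via[OF U(1) Un_upper1 o(3) sub(9), of "\<lambda>i. zero_off Z (c1 i)", OF z1]
        via[OF U(1) Un_upper1 o(3) sub(9), of "\<lambda>i. zero_off Z (c2 i)", OF z2] by simp
    note eqZ = this
    have zz: "zero_off Z (c1 i) = zero_off Z (c2 i)" if "i < n" for i
      by (rule frame_unique[OF fU U(1) UX(1) o(3) sub(9), where c = "\<lambda>i. zero_off Z (c1 i)" and d = "\<lambda>i. zero_off Z (c2 i)",
          OF z1 z2 eqZ that])
    have agree: "c1 i x = c2 i x" if "i < n" "x \<in> WU \<inter> WV" for i x
      using fun_cong[OF zz[OF that(1)], of x] that(2) by (simp add: zero_off_apply Z_def)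
    define c where "c i x = (if x \<in> WU then c1 i x else c2 i x)" for i x
    have c: "c i \<in> carrier (hol_ring W)" if "i < n" for i
      using hol_ring_glue[OF o(1,2) c1(1)[OF that] c2(1)[OF that] agree[OF that]] by (simp add: WUV c_def[abs_def])
    have cc: "zero_off WU (c i) = c1 i" "zero_off WV (c i) = c2 i" if "i < n" for i
      using c1(1)[OF that] c2(1)[OF that] agree[OF that] by (auto simp: zero_off_def c_def hol_ring_iff)
    have eA: "Res E (U \<union> V) A (e i) \<in> carrier (Sec E A)" if "i < n" "open A" "A \<subseteq> U \<union> V" for A i
      by (rule Res_closed[OF UV that(2,3) U(3) e[OF that(1)]])
    have "s = lincomb E W n c (\<lambda>i. Res E (U \<union> V) W (e i))"
    proof (rule section_eqI[OF o(1,2) WX(2), unfolded WUV])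
      have "Res E W WU (lincomb E W n c (\<lambda>i. Res E (U \<union> V) W (e i))) =
          lincomb E WU n (\<lambda>i. zero_off WU (c i)) (\<lambda>i. Res E (U \<union> V) WU (e i))"
        by (rule res[OF o(1) sub(3) c])
      also have "\<dots> = Res E W WU s"
        unfolding s1 using c1(1) by (intro lincomb_cong[OF o(1) WUX _ eA[OF _ o(1) sub(7)] _ refl]) (simp_all add: cc)
      finally show "Res E W WU s = Res E W WU (lincomb E W n c (\<lambda>i. Res E (U \<union> V) W (e i)))" ..
      have "Res E W WV (lincomb E W n c (\<lambda>i. Res E (U \<union> V) W (e i))) =
          lincomb E WV n (\<lambda>i. zero_off WV (c i)) (\<lambda>i. Res E (U \<union> V) WV (e i))"
        by (rule res[OF o(2) sub(4) c])
      also have "\<dots> = Res E W WV s"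
        unfolding s2 using c2(1) by (intro lincomb_cong[OF o(2) WVX _ eA[OF _ o(2) sub(8)] _ refl]) (simp_all add: cc)
      finally show "Res E W WV s = Res E W WV (lincomb E W n c (\<lambda>i. Res E (U \<union> V) W (e i)))" ..
      show "s \<in> carrier (Sec E W)" by (rule s)
      show "lincomb E W n c (\<lambda>i. Res E (U \<union> V) W (e i)) \<in> carrier (Sec E W)"
        by (rule lincomb_closed[OF W(1) WX(1) c eW])
    qed
    with c show "\<exists>c. (\<forall>i<n. c i \<in> carrier (hol_ring W)) \<and> s = lincomb E W n c (\<lambda>i. Res E (U \<union> V) W (e i))"
      by blast
  next
    fix c d assume c: "\<forall>i<n. c i \<in> carrier (hol_ring W)" and d: "\<forall>i<n. d i \<in> carrier (hol_ring W)"
      and eq: "lincomb E W n c (\<lambda>i. Res E (U \<union> V) W (e i)) = lincomb E W n d (\<lambda>i. Res E (U \<union> V) W (e i))"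
    have part: "zero_off A (c i) = zero_off A (d i)"
      if A: "open A" "A \<subseteq> W" "A \<subseteq> Y" and Y: "open Y" "Y \<subseteq> U \<union> V" "is_frame E Y n (\<lambda>i. Res E (U \<union> V) Y (e i))"
        and i: "i < n" for A Y i
    proof -
      have rc: "zero_off A (c i) \<in> carrier (hol_ring A)" and rd: "zero_off A (d i) \<in> carrier (hol_ring A)" if "i < n" for i
        using c d that zero_off_restrict[OF A(1,2)] by blast+
      have "lincomb E A n (\<lambda>i. zero_off A (c i)) (\<lambda>i. Res E Y A (Res E (U \<union> V) Y (e i))) =
          lincomb E A n (\<lambda>i. zero_off A (d i)) (\<lambda>i. Res E Y A (Res E (U \<union> V) Y (e i)))"
        using via[OF Y(1,2) A(1,3), of "\<lambda>i. zero_off A (c i)", OF rc] via[OF Y(1,2) A(1,3), of "\<lambda>i. zero_off A (d i)", OF rd]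
          res[OF A(1,2), of c] res[OF A(1,2), of d] c d eq by simp
      note eqA = this
      have YX: "Y \<subseteq> X" using Y U by auto
      show ?thesis
        by (rule frame_unique[OF Y(3,1) YX A(1,3), where c = "\<lambda>i. zero_off A (c i)" and d = "\<lambda>i. zero_off A (d i)",
            OF rc rd eqA i])
    qed
    show "\<forall>i<n. c i = d i"
    proof (intro allI impI ext)
      fix i x assume i: "i < n"
      consider "x \<in> WU" | "x \<in> WV" | "x \<notin> W" using WUV by auto
      then show "c i x = d i x"
        using fun_cong[OF part[OF o(1) sub(3,1) U(1) Un_upper1 fU i], of x]
          fun_cong[OF part[OF o(2) sub(4,2) U(2) Un_upper2 fV i], of x] c d i
        by cases (auto simp: zero_off_apply hol_ring_iff)
    qed
  }
qed (use U e in auto)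

text \<open>The new coefficients of a section are obtained from the old ones by the inverse matrix \<open>B\<close>.\<close>

lemma frame_transform:
  assumes fr: "is_frame E U n e" and U: "open U" "U \<subseteq> X"
    and A: "\<And>i j. i < n \<Longrightarrow> j < n \<Longrightarrow> A i j \<in> carrier (hol_ring U)"
    and B: "\<And>i j. i < n \<Longrightarrow> j < n \<Longrightarrow> B i j \<in> carrier (hol_ring U)"
    and AB: "\<And>i j x. i < n \<Longrightarrow> j < n \<Longrightarrow> x \<in> U \<Longrightarrow> (\<Sum>l<n. A i l x * B l j x) = (if i = j then 1 else 0)"
    and BA: "\<And>i j x. i < n \<Longrightarrow> j < n \<Longrightarrow> x \<in> U \<Longrightarrow> (\<Sum>l<n. B i l x * A l j x) = (if i = j then 1 else 0)"
  shows "is_frame E U n (\<lambda>j. lincomb E U n (\<lambda>i. A i j) e)"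
proof (rule is_frameI)
  note e = is_frame_closed[OF fr]
  show "lincomb E U n (\<lambda>i. A i j) e \<in> carrier (Sec E U)" if "j < n" for j
    using U A e that by (intro lincomb_closed) auto
  fix V assume V: "open V" "V \<subseteq> U"
  then have VX: "V \<subseteq> X" using U by auto
  have rA: "zero_off V (A i j) \<in> carrier (hol_ring V)" if "i < n" "j < n" for i j
    using A[OF that] V by (intro zero_off_restrict) auto
  have rB: "zero_off V (B i j) \<in> carrier (hol_ring V)" if "i < n" "j < n" for i j
    using B[OF that] V by (intro zero_off_restrict) auto
  have re: "Res E U V (e i) \<in> carrier (Sec E V)" if "i < n" for i
    using e[OF that] U V by (intro Res_closed) auto
  have lin: "lincomb E V n c (\<lambda>j. Res E U V (lincomb E U n (\<lambda>i. A i j) e)) =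
      lincomb E V n (\<lambda>i x. \<Sum>j<n. zero_off V (A i j) x * c j x) (\<lambda>i. Res E U V (e i))"
    if c: "\<forall>i<n. c i \<in> carrier (hol_ring V)" for c
  proof -
    have R: "Res E U V (lincomb E U n (\<lambda>i. A i j) e) = lincomb E V n (\<lambda>i. zero_off V (A i j)) (\<lambda>i. Res E U V (e i))"
      if "j < n" for j using U V A e that by (intro lincomb_Res) auto
    have "lincomb E V n c (\<lambda>j. Res E U V (lincomb E U n (\<lambda>i. A i j) e)) =
       lincomb E V n c (\<lambda>j. lincomb E V n (\<lambda>i. zero_off V (A i j)) (\<lambda>i. Res E U V (e i)))"
      by (rule lincomb_cong) (use V VX c R rA re in \<open>auto intro!: lincomb_closed\<close>)
    also have "\<dots> = lincomb E V n (\<lambda>i x. \<Sum>j<n. zero_off V (A i j) x * c j x) (\<lambda>i. Res E U V (e i))"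
      by (rule lincomb_lincomb) (use V VX c rA re in auto)
    finally show ?thesis .
  qed
  have swap: "(\<Sum>j<n. zero_off V (P i j) x * (\<Sum>l<n. zero_off V (Q j l) x * c l x)) = c i x"
    if PQ: "\<And>i j x. i < n \<Longrightarrow> j < n \<Longrightarrow> x \<in> U \<Longrightarrow> (\<Sum>l<n. P i l x * Q l j x) = (if i = j then 1 else 0)"
      and c: "\<forall>i<n. c i \<in> carrier (hol_ring V)" and i: "i < n" for P Q :: "nat \<Rightarrow> nat \<Rightarrow> cp1 \<Rightarrow> complex" and c i x
  proof (cases "x \<in> V")
    case True
    have "(\<Sum>j<n. zero_off V (P i j) x * (\<Sum>l<n. zero_off V (Q j l) x * c l x)) = (\<Sum>j<n. \<Sum>l<n. P i j x * Q j l x * c l x)"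
      using True by (simp add: zero_off_apply sum_distrib_left mult.assoc)
    also have "\<dots> = (\<Sum>l<n. (\<Sum>j<n. P i j x * Q j l x) * c l x)"
      by (subst sum.swap) (simp add: sum_distrib_right)
    also have "\<dots> = (\<Sum>l<n. if i = l then c l x else 0)"
      using PQ[OF i] True V by (intro sum.cong refl) auto
    finally show ?thesis using i by simp
  next
    case False
    then show ?thesis using c i by (auto simp: zero_off_apply hol_ring_iff)
  qed
  {
    fix s assume s: "s \<in> carrier (Sec E V)"
    obtain c where c: "\<And>i. i < n \<Longrightarrow> c i \<in> carrier (hol_ring V)" "s = lincomb E V n c (\<lambda>i. Res E U V (e i))"
      using frame_coeffs[OF fr V s] by blast
    define d where "d j x = (\<Sum>l<n. zero_off V (B j l) x * c l x)" for j x
    have d: "\<forall>i<n. d i \<in> carrier (hol_ring V)"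
      unfolding d_def using rB c by (auto intro!: hol_ring_sum hol_ring_mult)
    have "lincomb E V n d (\<lambda>j. Res E U V (lincomb E U n (\<lambda>i. A i j) e)) = s"
      unfolding lin[OF d] c(2)
    proof (rule lincomb_cong[OF V(1) VX _ re _ refl])
      have c': "\<forall>i<n. c i \<in> carrier (hol_ring V)" using c(1) by blast
      show "(\<lambda>x. \<Sum>j<n. zero_off V (A i j) x * d j x) = c i" if "i < n" for i
        using swap[where P = A and Q = B and c = c, OF AB c' that] by (simp add: d_def fun_eq_iff)
      show "(\<lambda>x. \<Sum>j<n. zero_off V (A i j) x * d j x) \<in> carrier (hol_ring V)" if "i < n" for i
        using rA[OF that] d by (auto intro!: hol_ring_sum hol_ring_mult)
    qed
    with d show "\<exists>c. (\<forall>i<n. c i \<in> carrier (hol_ring V)) \<and>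
        s = lincomb E V n c (\<lambda>i. Res E U V (lincomb E U n (\<lambda>ia. A ia i) e))" by auto
  next
    fix c d assume c: "\<forall>i<n. c i \<in> carrier (hol_ring V)" and d: "\<forall>i<n. d i \<in> carrier (hol_ring V)"
      and "lincomb E V n c (\<lambda>i. Res E U V (lincomb E U n (\<lambda>ia. A ia i) e)) =
           lincomb E V n d (\<lambda>i. Res E U V (lincomb E U n (\<lambda>ia. A ia i) e))"
    then have eq: "lincomb E V n (\<lambda>i x. \<Sum>j<n. zero_off V (A i j) x * c j x) (\<lambda>i. Res E U V (e i)) =
        lincomb E V n (\<lambda>i x. \<Sum>j<n. zero_off V (A i j) x * d j x) (\<lambda>i. Res E U V (e i))"
      by (simp add: lin)
    have hA: "(\<lambda>x. \<Sum>j<n. zero_off V (A i j) x * f j x) \<in> carrier (hol_ring V)"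
      if "i < n" "\<forall>i<n. f i \<in> carrier (hol_ring V)" for i f
      using rA[OF that(1)] that(2) by (auto intro!: hol_ring_sum hol_ring_mult)
    have *: "(\<Sum>j<n. zero_off V (A i j) x * c j x) = (\<Sum>j<n. zero_off V (A i j) x * d j x)" if "i < n" for i x
      by (rule fun_cong[OF frame_unique[OF fr U V hA[OF _ c] hA[OF _ d] eq that]])
    show "\<forall>i<n. c i = d i"
    proof (intro allI impI ext)
      fix i x assume i: "i < n"
      show "c i x = d i x"
        using swap[where P = B and Q = A and c = c and x = x, OF BA c i] swap[where P = B and Q = A and c = d and x = x, OF BA d i] by (simp add: *)
    qed
  }
qed (rule U)+

text \<open>The two matrices are mutually inverse because the coefficients of \<open>e\<close> and \<open>e'\<close> in themselves are
the Kronecker delta.\<close>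

lemma frame_transition:
  assumes e: "is_frame E U n e" and e': "is_frame E U n' e'" and U: "open U" "U \<subseteq> X"
  shows "\<exists>A B. (\<forall>i<n. \<forall>j<n'. A i j \<in> carrier (hol_ring U)) \<and> (\<forall>i<n'. \<forall>j<n. B i j \<in> carrier (hol_ring U)) \<and>
    (\<forall>j<n'. e' j = lincomb E U n (\<lambda>i. A i j) e) \<and> (\<forall>j<n. e j = lincomb E U n' (\<lambda>i. B i j) e') \<and>
    (\<forall>i<n. \<forall>j<n. \<forall>x\<in>U. (\<Sum>l<n'. A i l x * B l j x) = (if i = j then 1 else 0)) \<and>
    (\<forall>i<n'. \<forall>j<n'. \<forall>x\<in>U. (\<Sum>l<n. B i l x * A l j x) = (if i = j then 1 else 0))"
proof -
  have ex: "\<exists>A. \<forall>j<n'. (\<forall>i<n. A i j \<in> carrier (hol_ring U)) \<and> e' j = lincomb E U n (\<lambda>i. A i j) e"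
    if e: "is_frame E U n e" and e': "is_frame E U n' e'" for n n' e e'
  proof -
    have "\<exists>c. (\<forall>i<n. c i \<in> carrier (hol_ring U)) \<and> e' j = lincomb E U n c e" if j: "j < n'" for j
    proof -
      obtain c where c: "\<And>i. i < n \<Longrightarrow> c i \<in> carrier (hol_ring U)" "e' j = lincomb E U n c (\<lambda>i. Res E U U (e i))"
        using frame_coeffs[OF e U(1) order_refl is_frame_closed[OF e' j]] by blast
      have "lincomb E U n c (\<lambda>i. Res E U U (e i)) = lincomb E U n c e"
        by (rule lincomb_cong[OF U c(1) Res_closed[OF U(1,1) order_refl U(2) is_frame_closed[OF e]] refl
            Res_id[OF U is_frame_closed[OF e]]])
      with c show ?thesis by auto
    qed
    then have "\<forall>j. \<exists>c. j < n' \<longrightarrow> (\<forall>i<n. c i \<in> carrier (hol_ring U)) \<and> e' j = lincomb E U n c e" by blast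
    from choice[OF this] obtain A
      where "\<forall>j. j < n' \<longrightarrow> (\<forall>i<n. A j i \<in> carrier (hol_ring U)) \<and> e' j = lincomb E U n (A j) e" ..
    then show ?thesis by (intro exI[of _ "\<lambda>i j. A j i"])
  qed
  have inv: "(\<Sum>l<n'. A i l x * B l j x) = (if i = j then 1 else 0)"
    if e: "is_frame E U n e" and e': "is_frame E U n' e'"
      and A: "\<forall>j<n'. (\<forall>i<n. A i j \<in> carrier (hol_ring U)) \<and> e' j = lincomb E U n (\<lambda>i. A i j) e"
      and B: "\<forall>j<n. (\<forall>i<n'. B i j \<in> carrier (hol_ring U)) \<and> e j = lincomb E U n' (\<lambda>i. B i j) e'"
      and ij: "i < n" "j < n" and x: "x \<in> U" for n n' e e' A B i j x
  proof -
    note ce = is_frame_closed[OF e] and ce' = is_frame_closed[OF e']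
    have cA: "A i l \<in> carrier (hol_ring U)" if "i < n" "l < n'" for i l
      by (rule A[rule_format, THEN conjunct1, rule_format, OF that(2,1)])
    have eA: "e' l = lincomb E U n (\<lambda>i. A i l) e" if "l < n'" for l
      by (rule A[rule_format, THEN conjunct2, OF that])
    have cB: "B l j \<in> carrier (hol_ring U)" if "l < n'" for l
      by (rule B[rule_format, THEN conjunct1, rule_format, OF ij(2) that])
    have "e j = lincomb E U n' (\<lambda>i. B i j) e'" by (rule B[rule_format, THEN conjunct2, OF ij(2)])
    also have "\<dots> = lincomb E U n' (\<lambda>i. B i j) (\<lambda>l. lincomb E U n (\<lambda>i. A i l) e)"
      by (rule lincomb_cong[OF U cB ce' refl eA])
    also have "\<dots> = lincomb E U n (\<lambda>i x. \<Sum>l<n'. A i l x * B l j x) e"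
      by (rule lincomb_lincomb[OF U cA cB ce])
    finally have 1: "e j = \<dots>" .
    have RR: "lincomb E U n c (\<lambda>i. Res E U U (e i)) = lincomb E U n c e"
      if "\<And>i. i < n \<Longrightarrow> c i \<in> carrier (hol_ring U)" for c
      by (rule lincomb_cong[OF U that Res_closed[OF U(1,1) order_refl U(2) ce] refl Res_id[OF U ce]])
    have "(\<lambda>x. \<Sum>l<n'. A i l x * B l j x) = zero_off U (\<lambda>_. if i = j then 1 else 0)"
    proof (rule frame_unique[OF e U U(1) order_refl, where i = i])
      show c: "\<And>i. i < n \<Longrightarrow> (\<lambda>x. \<Sum>l<n'. A i l x * B l j x) \<in> carrier (hol_ring U)"
        using cA cB by (intro hol_ring_sum hol_ring_mult) auto
      show d: "\<And>i. i < n \<Longrightarrow> zero_off U (\<lambda>_. if i = j then 1 else 0) \<in> carrier (hol_ring U)"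
        by (rule hol_ring_const[OF U(1)])
      show "lincomb E U n (\<lambda>i x. \<Sum>l<n'. A i l x * B l j x) (\<lambda>i. Res E U U (e i)) =
          lincomb E U n (\<lambda>i. zero_off U (\<lambda>_. if i = j then 1 else 0)) (\<lambda>i. Res E U U (e i))"
        using RR[OF c] RR[OF d] 1 lincomb_delta[OF U ce ij(2)] by simp
    qed (rule ij)
    from fun_cong[OF this, of x] show ?thesis using x by (simp add: zero_off_apply)
  qed
  obtain A where A: "\<forall>j<n'. (\<forall>i<n. A i j \<in> carrier (hol_ring U)) \<and> e' j = lincomb E U n (\<lambda>i. A i j) e"
    using ex[OF e e'] by blast
  obtain B where B: "\<forall>j<n. (\<forall>i<n'. B i j \<in> carrier (hol_ring U)) \<and> e j = lincomb E U n' (\<lambda>i. B i j) e'"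
    using ex[OF e' e] by blast
  show ?thesis
  proof (rule exI[of _ A], rule exI[of _ B], intro conjI)
    show "\<forall>i<n. \<forall>j<n'. A i j \<in> carrier (hol_ring U)"
      by (intro allI impI) (rule A[rule_format, THEN conjunct1, rule_format])
    show "\<forall>j<n'. e' j = lincomb E U n (\<lambda>i. A i j) e"
      by (intro allI impI) (rule A[rule_format, THEN conjunct2])
    show "\<forall>i<n'. \<forall>j<n. B i j \<in> carrier (hol_ring U)"
      by (intro allI impI) (rule B[rule_format, THEN conjunct1, rule_format])
    show "\<forall>j<n. e j = lincomb E U n' (\<lambda>i. B i j) e'"
      by (intro allI impI) (rule B[rule_format, THEN conjunct2])
    show "\<forall>i<n. \<forall>j<n. \<forall>x\<in>U. (\<Sum>l<n'. A i l x * B l j x) = (if i = j then 1 else 0)"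
      by (intro allI impI ballI inv[OF e e' A B])
    show "\<forall>i<n'. \<forall>j<n'. \<forall>x\<in>U. (\<Sum>l<n. B i l x * A l j x) = (if i = j then 1 else 0)"
      by (intro allI impI ballI inv[OF e' e B A])
  qed
qed

text \<open>At a point \<open>x\<close>, the two products of the transition matrices are identity matrices of sizes \<open>n\<close> and \<open>n'\<close>,
and they have the same trace.\<close>

lemma frame_rank_unique:
  assumes e: "is_frame E U n e" and e': "is_frame E U n' e'" and U: "open U" "U \<subseteq> X" "x \<in> U"
  shows "n = n'"
proof -
  obtain A B where AB: "\<forall>i<n. \<forall>j<n. \<forall>x\<in>U. (\<Sum>l<n'. A i l x * B l j x) = (if i = j then 1 else 0 :: complex)"
    and BA: "\<forall>i<n'. \<forall>j<n'. \<forall>x\<in>U. (\<Sum>l<n. B i l x * A l j x) = (if i = j then 1 else 0 :: complex)"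
    using frame_transition[OF e e' U(1,2)] by (elim exE conjE) (rule that)
  have "(\<Sum>i<n. \<Sum>l<n'. A i l x * B l i x) = (\<Sum>i<n. 1)"
    using AB U(3) by (intro sum.cong refl) simp
  moreover have "(\<Sum>l<n'. \<Sum>i<n. B l i x * A i l x) = (\<Sum>l<n'. 1)"
    using BA U(3) by (intro sum.cong refl) simp
  moreover have "(\<Sum>i<n. \<Sum>l<n'. A i l x * B l i x) = (\<Sum>l<n'. \<Sum>i<n. B l i x * A i l x)"
    by (subst sum.swap) (simp add: mult.commute)
  ultimately have "(of_nat n :: complex) = of_nat n'" by simp
  then show ?thesis by (simp only: of_nat_eq_iff)
qed

end

section \<open>Bundles with a diagonal transition matrix\<close>

text \<open>The value at infinity is a default; the coordinate is only used on the punctured line.\<close>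

fun affine_coord :: "cp1 \<Rightarrow> complex" where
  "affine_coord (Affine z) = z"
| "affine_coord Infty = 0"

lemma hol_ring_coord_powi:
  assumes "open W" "W \<subseteq> punctured_line"
  shows "zero_off W (\<lambda>x. affine_coord x powi k) \<in> carrier (hol_ring W)"
proof (rule zero_off_hol_ring[OF assms(1)])
  show "hol_on (\<lambda>x. affine_coord x powi k) W"
    unfolding hol_on_def
  proof
    fix p assume "p \<in> W"
    then obtain z where "p = Affine z" "z \<noteq> 0" using assms(2) by (cases p) (auto simp: punctured_line_def)
    then show "(\<lambda>t. affine_coord (chart p t) powi k) analytic_on {0}"
      by (auto intro!: analytic_intros)
  qed
qed

context omodule_sheaf
begin

lemma lincomb_scale:
  assumes "open U" "U \<subseteq> X" "\<And>i. i < n \<Longrightarrow> c i \<in> carrier (hol_ring U)" "\<And>i. i < n \<Longrightarrow> f i \<in> carrier (hol_ring U)"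
    "\<And>i. i < n \<Longrightarrow> e i \<in> carrier (Sec E U)"
  shows "lincomb E U n c (\<lambda>i. f i \<odot>\<^bsub>Sec E U\<^esub> e i) = lincomb E U n (\<lambda>i x. c i x * f i x) e"
  using assms(3-)
proof (induction n)
  interpret M: module "hol_ring U" "Sec E U" by (rule module_Sec[OF assms(1,2)])
  {
    case 0
    then show ?case using assms by (simp add: lincomb_0)
  next
    case (Suc n)
    have "(\<lambda>x. c n x * f n x) \<odot>\<^bsub>Sec E U\<^esub> e n = c n \<odot>\<^bsub>Sec E U\<^esub> (f n \<odot>\<^bsub>Sec E U\<^esub> e n)"
      using M.smult_assoc1[of "c n" "f n" "e n"] Suc.prems by simp
    then show ?case
      using Suc assms(1,2) by (simp add: lincomb_Suc smult_closed hol_ring_mult)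
  }
qed

end

text \<open>The bundle is glued from trivial bundles on the two affine lines by the transition matrix with
diagonal entries \<open>z powi a i\<close>.\<close>

locale two_frames = omodule_sheaf UNIV E for E :: "'s osheaf" +
  fixes n :: nat and e0 e1 :: "nat \<Rightarrow> 's" and a :: "nat \<Rightarrow> int"
  assumes frame0: "is_frame E (- {Infty}) n e0" and frame1: "is_frame E (- {Affine 0}) n e1"
    and transition: "\<And>i. i < n \<Longrightarrow> Res E (- {Infty}) punctured_line (e0 i) =
      zero_off punctured_line (\<lambda>x. affine_coord x powi a i) \<odot>\<^bsub>Sec E punctured_line\<^esub> Res E (- {Affine 0}) punctured_line (e1 i)"
begin

abbreviation "U0 \<equiv> - {Infty}"
abbreviation "U1 \<equiv> - {Affine 0}"

lemma open01 [simp]: "open U0" "open U1" by (simp_all add: open_Compl_finite)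

lemma punctured_sub: "punctured_line \<subseteq> U0" "punctured_line \<subseteq> U1"
  by (auto simp: punctured_line_def)

lemma e_closed: "i < n \<Longrightarrow> e0 i \<in> carrier (Sec E U0)" "i < n \<Longrightarrow> e1 i \<in> carrier (Sec E U1)"
  using is_frame_closed[OF frame0] is_frame_closed[OF frame1] by auto

lemma Res_e_closed: "i < n \<Longrightarrow> open V \<Longrightarrow> V \<subseteq> U0 \<Longrightarrow> Res E U0 V (e0 i) \<in> carrier (Sec E V)"
  "i < n \<Longrightarrow> open V \<Longrightarrow> V \<subseteq> U1 \<Longrightarrow> Res E U1 V (e1 i) \<in> carrier (Sec E V)"
  using Res_closed[OF open01(1) _ _ subset_UNIV e_closed(1)] Res_closed[OF open01(2) _ _ subset_UNIV e_closed(2)] by auto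

lemma transition_on:
  assumes W: "open W" "W \<subseteq> punctured_line" and i: "i < n"
  shows "Res E U0 W (e0 i) = zero_off W (\<lambda>x. affine_coord x powi a i) \<odot>\<^bsub>Sec E W\<^esub> Res E U1 W (e1 i)"
proof -
  have "Res E U0 W (e0 i) = Res E punctured_line W (Res E U0 punctured_line (e0 i))"
    using Res_Res[OF open01(1) open_punctured_line W(1) W(2) punctured_sub(1) subset_UNIV e_closed(1)[OF i]] by simp
  also have "\<dots> = zero_off W (zero_off punctured_line (\<lambda>x. affine_coord x powi a i)) \<odot>\<^bsub>Sec E W\<^esub>
      Res E punctured_line W (Res E U1 punctured_line (e1 i))"
    unfolding transition[OF i]
    by (rule Res_smult[OF open_punctured_line W(1,2) subset_UNIV hol_ring_coord_powi[OF open_punctured_line order_refl]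
        Res_e_closed(2)[OF i open_punctured_line punctured_sub(2)]])
  also have "Res E punctured_line W (Res E U1 punctured_line (e1 i)) = Res E U1 W (e1 i)"
    by (rule Res_Res[OF open01(2) open_punctured_line W(1) W(2) punctured_sub(2) subset_UNIV e_closed(2)[OF i]])
  also have "zero_off W (zero_off punctured_line (\<lambda>x. affine_coord x powi a i)) = zero_off W (\<lambda>x. affine_coord x powi a i)"
    using W(2) by (auto simp: zero_off_def fun_eq_iff)
  finally show ?thesis .
qed

lemma lincomb_transition:
  assumes W: "open W" "W \<subseteq> punctured_line" and c: "\<And>i. i < n \<Longrightarrow> c i \<in> carrier (hol_ring W)"
  shows "lincomb E W n c (\<lambda>i. Res E U0 W (e0 i)) =
    lincomb E W n (\<lambda>i x. affine_coord x powi a i * c i x) (\<lambda>i. Res E U1 W (e1 i))"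
    and "i < n \<Longrightarrow> (\<lambda>x. affine_coord x powi a i * c i x) \<in> carrier (hol_ring W)"
proof -
  have W01: "W \<subseteq> U0" "W \<subseteq> U1" using W punctured_sub by auto
  have eq: "(\<lambda>x. c i x * zero_off W (\<lambda>x. affine_coord x powi a i) x) = (\<lambda>x. affine_coord x powi a i * c i x)" if "i < n" for i
    using c[OF that] by (auto simp: zero_off_def hol_ring_iff fun_eq_iff)
  show cl: "(\<lambda>x. affine_coord x powi a i * c i x) \<in> carrier (hol_ring W)" if "i < n" for i
    using hol_ring_mult[OF c[OF that] hol_ring_coord_powi[OF W, of "a i"]] by (simp add: eq[OF that])
  have "lincomb E W n c (\<lambda>i. Res E U0 W (e0 i)) =
      lincomb E W n c (\<lambda>i. zero_off W (\<lambda>x. affine_coord x powi a i) \<odot>\<^bsub>Sec E W\<^esub> Res E U1 W (e1 i))"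
    by (rule lincomb_cong[OF W(1) subset_UNIV c Res_e_closed(1)[OF _ W(1) W01(1)] refl transition_on[OF W]])
  also have "\<dots> = lincomb E W n (\<lambda>i x. c i x * zero_off W (\<lambda>x. affine_coord x powi a i) x) (\<lambda>i. Res E U1 W (e1 i))"
    by (rule lincomb_scale) (use W W01 c hol_ring_coord_powi[OF W] Res_e_closed in auto)
  also have "\<dots> = lincomb E W n (\<lambda>i x. affine_coord x powi a i * c i x) (\<lambda>i. Res E U1 W (e1 i))"
    by (rule lincomb_cong[OF W(1) subset_UNIV hol_ring_mult[OF c hol_ring_coord_powi[OF W]]
        Res_e_closed(2)[OF _ W(1) W01(2)] eq refl])
  finally show "lincomb E W n c (\<lambda>i. Res E U0 W (e0 i)) = \<dots>" .
qed

text \<open>The coefficients of a section over \<open>U\<close> in the frame \<open>e0\<close>, which are functions on \<open>U\<close> without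
infinity.\<close>

definition coeffs :: "cp1 set \<Rightarrow> 's \<Rightarrow> nat \<Rightarrow> cp1 \<Rightarrow> complex" where
  "coeffs U s = restrict (SOME c. (\<forall>i<n. c i \<in> carrier (hol_ring (U - {Infty}))) \<and>
     Res E U (U - {Infty}) s = lincomb E (U - {Infty}) n c (\<lambda>i. Res E U0 (U - {Infty}) (e0 i))) {..<n}"

context
  fixes U :: "cp1 set" assumes U: "open U"
begin

lemma U_opens: "open (U - {Infty})" "open (U - {Affine 0})" "open (U \<inter> punctured_line)"
  "U - {Infty} \<subseteq> U0" "U - {Affine 0} \<subseteq> U1" "U \<inter> punctured_line \<subseteq> U - {Infty}" "U \<inter> punctured_line \<subseteq> U - {Affine 0}"
  "U \<inter> punctured_line \<subseteq> punctured_line"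
  using U open_Int[OF U open_punctured_line] by (auto simp: open_Diff_finite punctured_line_def)

lemma U_cover: "(U - {Infty}) \<inter> (U - {Affine 0}) = U \<inter> punctured_line" "(U - {Infty}) \<union> (U - {Affine 0}) = U"
  by (auto simp: punctured_line_def)

lemma coeffs:
  assumes s: "s \<in> carrier (Sec E U)"
  shows "i < n \<Longrightarrow> coeffs U s i \<in> carrier (hol_ring (U - {Infty}))"
    and "Res E U (U - {Infty}) s = lincomb E (U - {Infty}) n (coeffs U s) (\<lambda>i. Res E U0 (U - {Infty}) (e0 i))"
proof -
  let ?P = "\<lambda>c. (\<forall>i<n. c i \<in> carrier (hol_ring (U - {Infty}))) \<and>
     Res E U (U - {Infty}) s = lincomb E (U - {Infty}) n c (\<lambda>i. Res E U0 (U - {Infty}) (e0 i))"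
  have "Res E U (U - {Infty}) s \<in> carrier (Sec E (U - {Infty}))"
    using U U_opens s by (intro Res_closed) auto
  from frame_coeffs[OF frame0 U_opens(1,4) this] have "\<exists>c. ?P c" by metis
  then have P: "?P (SOME c. ?P c)" by (rule someI_ex)
  then show 1: "coeffs U s i \<in> carrier (hol_ring (U - {Infty}))" if "i < n" for i
    using that by (simp add: coeffs_def)
  have "lincomb E (U - {Infty}) n (SOME c. ?P c) (\<lambda>i. Res E U0 (U - {Infty}) (e0 i)) =
      lincomb E (U - {Infty}) n (coeffs U s) (\<lambda>i. Res E U0 (U - {Infty}) (e0 i))"
    by (rule lincomb_cong[OF U_opens(1) subset_UNIV _ Res_e_closed(1)[OF _ U_opens(1,4)] _ refl])
      (use P in \<open>auto simp: coeffs_def\<close>)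
  then show "Res E U (U - {Infty}) s = lincomb E (U - {Infty}) n (coeffs U s) (\<lambda>i. Res E U0 (U - {Infty}) (e0 i))"
    using P by simp
qed

lemma coeffs_unique:
  assumes s: "s \<in> carrier (Sec E U)" and c: "\<And>i. i < n \<Longrightarrow> c i \<in> carrier (hol_ring (U - {Infty}))"
    and eq: "Res E U (U - {Infty}) s = lincomb E (U - {Infty}) n c (\<lambda>i. Res E U0 (U - {Infty}) (e0 i))"
    and i: "i < n"
  shows "coeffs U s i = c i"
  by (rule frame_unique[OF frame0 open01(1) subset_UNIV U_opens(1,4) coeffs(1)[OF s] c _ i])
     (use eq coeffs(2)[OF s] in simp_all)

lemma coeffs_at_infinity:
  assumes s: "s \<in> carrier (Sec E U)"
  obtains d where "\<And>i. i < n \<Longrightarrow> d i \<in> carrier (hol_ring (U - {Affine 0}))"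
    "Res E U (U - {Affine 0}) s = lincomb E (U - {Affine 0}) n d (\<lambda>i. Res E U1 (U - {Affine 0}) (e1 i))"
    "\<And>i x. i < n \<Longrightarrow> x \<in> U \<inter> punctured_line \<Longrightarrow> d i x = affine_coord x powi a i * coeffs U s i x"
proof -
  note o = U_opens
  let ?W = "U \<inter> punctured_line"
  have "Res E U (U - {Affine 0}) s \<in> carrier (Sec E (U - {Affine 0}))"
    using U o s by (intro Res_closed) auto
  from frame_coeffs[OF frame1 o(2,5) this] obtain d where
    d: "\<And>i. i < n \<Longrightarrow> d i \<in> carrier (hol_ring (U - {Affine 0}))"
    "Res E U (U - {Affine 0}) s = lincomb E (U - {Affine 0}) n d (\<lambda>i. Res E U1 (U - {Affine 0}) (e1 i))"
    by metis
  have W01: "?W \<subseteq> U0" "?W \<subseteq> U1" using o by auto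
  have rc: "zero_off ?W (coeffs U s i) \<in> carrier (hol_ring ?W)" if "i < n" for i
    by (rule zero_off_restrict[OF o(3,6) coeffs(1)[OF s that]])
  have rd: "zero_off ?W (d i) \<in> carrier (hol_ring ?W)" if "i < n" for i
    by (rule zero_off_restrict[OF o(3,7) d(1)[OF that]])
  have "lincomb E ?W n (\<lambda>i. zero_off ?W (coeffs U s i)) (\<lambda>i. Res E U0 ?W (e0 i)) = Res E U ?W s"
  proof -
    have "Res E U ?W s = Res E (U - {Infty}) ?W (Res E U (U - {Infty}) s)"
      by (rule Res_Res[OF U o(1,3,6) Diff_subset subset_UNIV s, symmetric])
    also have "\<dots> = lincomb E ?W n (\<lambda>i. zero_off ?W (coeffs U s i)) (\<lambda>i. Res E U0 ?W (e0 i))"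
      unfolding coeffs(2)[OF s]
      by (rule lincomb_Res_Res[OF open01(1) subset_UNIV o(1,4,3,6) coeffs(1)[OF s] e_closed(1)])
    finally show ?thesis by simp
  qed
  moreover have "lincomb E ?W n (\<lambda>i. zero_off ?W (d i)) (\<lambda>i. Res E U1 ?W (e1 i)) = Res E U ?W s"
  proof -
    have "Res E U ?W s = Res E (U - {Affine 0}) ?W (Res E U (U - {Affine 0}) s)"
      by (rule Res_Res[OF U o(2,3,7) Diff_subset subset_UNIV s, symmetric])
    also have "\<dots> = lincomb E ?W n (\<lambda>i. zero_off ?W (d i)) (\<lambda>i. Res E U1 ?W (e1 i))"
      unfolding d(2) by (rule lincomb_Res_Res[OF open01(2) subset_UNIV o(2,5,3,7) d(1) e_closed(2)])
    finally show ?thesis by simp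
  qed
  ultimately have eq: "lincomb E ?W n (\<lambda>i x. affine_coord x powi a i * zero_off ?W (coeffs U s i) x) (\<lambda>i. Res E U1 ?W (e1 i)) =
      lincomb E ?W n (\<lambda>i. zero_off ?W (d i)) (\<lambda>i. Res E U1 ?W (e1 i))"
    using lincomb_transition(1)[OF o(3) Int_lower2, where c = "\<lambda>i. zero_off ?W (coeffs U s i)", OF rc] by simp
  have eqf: "(\<lambda>x. affine_coord x powi a i * zero_off ?W (coeffs U s i) x) = zero_off ?W (d i)" if "i < n" for i
    by (rule frame_unique[OF frame1 open01(2) subset_UNIV o(3) W01(2) lincomb_transition(2)[OF o(3) Int_lower2, where c = "\<lambda>i. zero_off ?W (coeffs U s i)", OF rc] rd eq that])
  then have "d i x = affine_coord x powi a i * coeffs U s i x" if "i < n" "x \<in> ?W" for i x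
    using fun_cong[OF eqf[OF that(1)], of x] that(2) by (simp add: zero_off_apply)
  with d that show ?thesis by blast
qed

lemma coeffs_inj:
  assumes s: "s \<in> carrier (Sec E U)" and t: "t \<in> carrier (Sec E U)"
    and eq: "\<And>i. i < n \<Longrightarrow> coeffs U s i = coeffs U t i"
  shows "s = t"
proof -
  note o = U_opens
  obtain d where d: "\<And>i. i < n \<Longrightarrow> d i \<in> carrier (hol_ring (U - {Affine 0}))"
    "Res E U (U - {Affine 0}) s = lincomb E (U - {Affine 0}) n d (\<lambda>i. Res E U1 (U - {Affine 0}) (e1 i))"
    "\<And>i x. i < n \<Longrightarrow> x \<in> U \<inter> punctured_line \<Longrightarrow> d i x = affine_coord x powi a i * coeffs U s i x"
    using coeffs_at_infinity[OF s] by blast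
  obtain d' where d': "\<And>i. i < n \<Longrightarrow> d' i \<in> carrier (hol_ring (U - {Affine 0}))"
    "Res E U (U - {Affine 0}) t = lincomb E (U - {Affine 0}) n d' (\<lambda>i. Res E U1 (U - {Affine 0}) (e1 i))"
    "\<And>i x. i < n \<Longrightarrow> x \<in> U \<inter> punctured_line \<Longrightarrow> d' i x = affine_coord x powi a i * coeffs U t i x"
    using coeffs_at_infinity[OF t] by blast
  have dd: "d i = d' i" if i: "i < n" for i
  proof -
    let ?g = "\<lambda>x. d i x + - 1 * d' i x"
    have g: "?g \<in> carrier (hol_ring (U - {Affine 0}))"
      using d(1)[OF i] d'(1)[OF i] by (auto simp: hol_ring_iff hol_on_def intro!: analytic_intros)
    have "?g = (\<lambda>_. 0)"
    proof (rule hol_ring_eq_zero[OF o(2) g, of "{Infty}"])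
      fix x assume "x \<in> U - {Affine 0} - {Infty}"
      then have "x \<in> U \<inter> punctured_line" by (auto simp: punctured_line_def)
      then show "?g x = 0" using d(3)[OF i] d'(3)[OF i] eq[OF i] by simp
    qed simp
    then show ?thesis by (auto simp: fun_eq_iff)
  qed
  have "Res E U (U - {Affine 0}) s = Res E U (U - {Affine 0}) t"
    unfolding d(2) d'(2)
    by (rule lincomb_cong[OF o(2) subset_UNIV d(1) Res_e_closed(2)[OF _ o(2,5)] dd refl])
  moreover have "Res E U (U - {Infty}) s = Res E U (U - {Infty}) t"
    unfolding coeffs(2)[OF s] coeffs(2)[OF t]
    by (rule lincomb_cong[OF o(1) subset_UNIV coeffs(1)[OF s] Res_e_closed(1)[OF _ o(1,4)] eq refl])
  ultimately show ?thesis
    using section_eqI[OF o(1,2), unfolded U_cover(2), OF subset_UNIV s t] by blast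
qed

text \<open>At infinity, \<open>z powi a\<close> times the coefficient with respect to \<open>e0\<close> is the coefficient with respect to
\<open>e1\<close>, which is holomorphic.\<close>

lemma coeffs_growth:
  assumes s: "s \<in> carrier (Sec E U)" and i: "i < n" and inf: "Infty \<in> U"
  shows "\<exists>h. h analytic_on {0} \<and> (\<forall>\<^sub>F w in at 0. w powi (- a i) * coeffs U s i (chart Infty w) = h w)"
proof -
  obtain d where d: "\<And>i. i < n \<Longrightarrow> d i \<in> carrier (hol_ring (U - {Affine 0}))"
    "\<And>i x. i < n \<Longrightarrow> x \<in> U \<inter> punctured_line \<Longrightarrow> d i x = affine_coord x powi a i * coeffs U s i x"
    using coeffs_at_infinity[OF s] by metis
  have "(\<lambda>w. d i (chart Infty w)) analytic_on {0}"
    using d(1)[OF i] inf unfolding hol_ring_iff hol_on_def by blast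
  moreover have "\<forall>\<^sub>F w in at 0. w powi (- a i) * coeffs U s i (chart Infty w) = d i (chart Infty w)"
    using eventually_chart_in(2)[OF U inf] eventually_neq_at_within[of 0]
  proof eventually_elim
    case (elim w)
    then have "chart Infty w \<in> U \<inter> punctured_line" by (auto simp: punctured_line_def)
    from d(2)[OF i this] show ?case using elim by (simp add: power_int_minus power_int_divide_distrib field_simps)
  qed
  ultimately show ?thesis by blast
qed

lemma coeffs_surj:
  assumes f: "\<And>i. i < n \<Longrightarrow> f i \<in> carrier (hol_ring (U - {Infty}))"
    and h: "\<And>i. Infty \<in> U \<Longrightarrow> i < n \<Longrightarrow>
      \<exists>h. h analytic_on {0} \<and> (\<forall>\<^sub>F w in at 0. w powi (- a i) * f i (chart Infty w) = h w)"
  shows "\<exists>s\<in>carrier (Sec E U). \<forall>i<n. coeffs U s i = f i"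
proof -
  note o = U_opens
  let ?W = "U \<inter> punctured_line"
  have W01: "?W \<subseteq> U0" "?W \<subseteq> U1" using o by auto
  obtain hh where hh: "\<And>i. Infty \<in> U \<Longrightarrow> i < n \<Longrightarrow> hh i analytic_on {0}"
    "\<And>i. Infty \<in> U \<Longrightarrow> i < n \<Longrightarrow> \<forall>\<^sub>F w in at 0. w powi (- a i) * f i (chart Infty w) = hh i w"
    using h by metis
  define d where "d i x = (if x = Infty then if Infty \<in> U then hh i 0 else 0
    else if x \<in> ?W then affine_coord x powi a i * f i x else 0)" for i x
  have rf: "zero_off ?W (f i) \<in> carrier (hol_ring ?W)" if "i < n" for i
    by (rule zero_off_restrict[OF o(3,6) f[OF that]])
  have d: "d i \<in> carrier (hol_ring (U - {Affine 0}))" if i: "i < n" for i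
    unfolding hol_ring_iff
  proof (intro conjI allI impI)
    show "d i x = 0" if "x \<notin> U - {Affine 0}" for x
      using that by (auto simp: d_def punctured_line_def)
    have "hol_on (\<lambda>x. affine_coord x powi a i * zero_off ?W (f i) x) ?W"
      using lincomb_transition(2)[OF o(3) Int_lower2, where c = "\<lambda>i. zero_off ?W (f i)", OF rf i] by (simp add: hol_ring_iff)
    then have W: "hol_on (d i) ?W"
      using hol_on_cong[OF o(3), of "d i" "\<lambda>x. affine_coord x powi a i * zero_off ?W (f i) x"]
      by (auto simp: d_def zero_off_def punctured_line_def)
    show "hol_on (d i) (U - {Affine 0})"
      unfolding hol_on_def
    proof
      fix p assume p: "p \<in> U - {Affine 0}"
      show "(\<lambda>t. d i (chart p t)) analytic_on {0}"
      proof (cases "p = Infty")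
        case False
        then have "p \<in> ?W" using p by (auto simp: punctured_line_def)
        then show ?thesis using W by (auto simp: hol_on_def)
      next
        case True
        then have inf: "Infty \<in> U" using p by auto
        have "\<forall>\<^sub>F w in at 0. d i (chart Infty w) = hh i w"
          using hh(2)[OF inf i] eventually_chart_in(2)[OF U inf] eventually_neq_at_within[of 0]
        proof eventually_elim
          case (elim w)
          then have "chart Infty w \<in> ?W" by (auto simp: punctured_line_def)
          then have "d i (chart Infty w) = (1 / w) powi a i * f i (chart Infty w)"
            using elim by (simp add: d_def)
          also have "(1 / w) powi a i = w powi (- a i)"
            by (simp add: power_int_minus power_int_divide_distrib field_simps)
          finally show ?case using elim by simp
        qed
        then have "\<forall>\<^sub>F w in nhds 0. d i (chart Infty w) = hh i w"
          by (auto simp: eventually_at_filter d_def inf elim!: eventually_mono)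
        then show ?thesis using hh(1)[OF inf i] True analytic_at_cong[of "\<lambda>w. d i (chart Infty w)" "hh i" 0 0] by simp
      qed
    qed
  qed
  define s0 where "s0 = lincomb E (U - {Infty}) n f (\<lambda>i. Res E U0 (U - {Infty}) (e0 i))"
  define s1 where "s1 = lincomb E (U - {Affine 0}) n d (\<lambda>i. Res E U1 (U - {Affine 0}) (e1 i))"
  have s0: "s0 \<in> carrier (Sec E (U - {Infty}))"
    unfolding s0_def by (rule lincomb_closed[OF o(1) subset_UNIV f Res_e_closed(1)[OF _ o(1,4)]])
  have s1: "s1 \<in> carrier (Sec E (U - {Affine 0}))"
    unfolding s1_def by (rule lincomb_closed[OF o(2) subset_UNIV d Res_e_closed(2)[OF _ o(2,5)]])
  have "Res E (U - {Infty}) ?W s0 = lincomb E ?W n (\<lambda>i. zero_off ?W (f i)) (\<lambda>i. Res E U0 ?W (e0 i))"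
    unfolding s0_def by (rule lincomb_Res_Res[OF open01(1) subset_UNIV o(1,4,3,6) f e_closed(1)])
  also have "\<dots> = lincomb E ?W n (\<lambda>i x. affine_coord x powi a i * zero_off ?W (f i) x) (\<lambda>i. Res E U1 ?W (e1 i))"
    by (rule lincomb_transition(1)[OF o(3) Int_lower2, where c = "\<lambda>i. zero_off ?W (f i)", OF rf])
  also have "\<dots> = lincomb E ?W n (\<lambda>i. zero_off ?W (d i)) (\<lambda>i. Res E U1 ?W (e1 i))"
  proof (rule lincomb_cong[OF o(3) subset_UNIV _ Res_e_closed(2)[OF _ o(3) W01(2)] _ refl])
    show "(\<lambda>x. affine_coord x powi a i * zero_off ?W (f i) x) = zero_off ?W (d i)" if "i < n" for i
      by (auto simp: zero_off_def d_def punctured_line_def)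
    show "(\<lambda>x. affine_coord x powi a i * zero_off ?W (f i) x) \<in> carrier (hol_ring ?W)" if "i < n" for i
      by (rule lincomb_transition(2)[OF o(3) Int_lower2, where c = "\<lambda>i. zero_off ?W (f i)", OF rf that])
  qed
  also have "\<dots> = Res E (U - {Affine 0}) ?W s1"
    unfolding s1_def by (rule lincomb_Res_Res[OF open01(2) subset_UNIV o(2,5,3,7) d e_closed(2), symmetric])
  finally have agree: "Res E (U - {Infty}) ?W s0 = Res E (U - {Affine 0}) ?W s1" .
  obtain s where s: "s \<in> carrier (Sec E U)" "Res E U (U - {Infty}) s = s0"
    using section_glue[OF o(1,2) subset_UNIV s0 s1, unfolded U_cover, OF agree] by blast
  have "coeffs U s i = f i" if "i < n" for i
    by (rule coeffs_unique[OF s(1) f _ that]) (simp_all add: s(2) s0_def)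
  with s(1) show ?thesis by blast
qed

end

lemma twisting_carrier:
  "f \<in> carrier (Sec (twisting_sheaf k) U) \<longleftrightarrow> f \<in> carrier (hol_ring (U - {Infty})) \<and>
    (Infty \<in> U \<longrightarrow> (\<exists>h. h analytic_on {0} \<and> (\<forall>\<^sub>F w in at 0. w powi k * f (chart Infty w) = h w)))"
  by (auto simp: twisting_sheaf_def function_sheaf_def hol_ring_iff)

text \<open>The isomorphism sends a section to its coefficients in the frame \<open>e0\<close>: the growth condition at
infinity is the one that defines the sections of the twisting sheaf \<open>O(- a i)\<close>.\<close>

theorem isomorphic_direct_sum_twisting:
  "isomorphic_sheaves E (Defs.direct_sum n (\<lambda>i. twisting_sheaf (- a i)))" (is "isomorphic_sheaves E ?F")
  unfolding isomorphic_sheaves_def sheaf_iso_def sheaf_hom_def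
proof (intro exI[of _ coeffs] conjI allI impI ballI; (elim conjE)?)
  have ext: "coeffs U s \<in> extensional {..<n}" for U s by (simp add: coeffs_def)
  have eqI: "x = y" if "\<And>i. i < n \<Longrightarrow> x i = y i" "x \<in> extensional {..<n}" "y \<in> extensional {..<n}" for x y :: "nat \<Rightarrow> cp1 \<Rightarrow> complex"
    using that by (metis extensionalityI lessThan_iff)
  have carr: "coeffs U s \<in> carrier (Sec ?F U)" if "open U" "s \<in> carrier (Sec E U)" for U s
    using coeffs(1)[OF that] coeffs_growth[OF that] ext[of U s]
    by (auto simp: Defs.direct_sum_def twisting_carrier PiE_iff)
  fix U :: "cp1 set" assume U: "open U"
  note oU = U_opens[OF U]
  show "coeffs U s \<in> carrier (Sec ?F U)" if "s \<in> carrier (Sec E U)" for s by (rule carr[OF U that])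
  show "coeffs U (s \<oplus>\<^bsub>Sec E U\<^esub> t) = coeffs U s \<oplus>\<^bsub>Sec ?F U\<^esub> coeffs U t"
    if s: "s \<in> carrier (Sec E U)" and t: "t \<in> carrier (Sec E U)" for s t
  proof (rule eqI[OF _ ext])
    note cs = coeffs[OF U s] and ct = coeffs[OF U t]
    fix i assume i: "i < n"
    have "coeffs U (s \<oplus>\<^bsub>Sec E U\<^esub> t) i = (\<lambda>x. coeffs U s i x + coeffs U t i x)"
    proof (rule coeffs_unique[OF U _ _ _ i])
      show "Res E U (U - {Infty}) (s \<oplus>\<^bsub>Sec E U\<^esub> t) =
          lincomb E (U - {Infty}) n (\<lambda>i x. coeffs U s i x + coeffs U t i x) (\<lambda>i. Res E U0 (U - {Infty}) (e0 i))"
        using lincomb_add[OF oU(1) subset_UNIV cs(1) ct(1) Res_e_closed(1)[OF _ oU(1,4)]]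
          Res_add[OF U oU(1) _ subset_UNIV s t] cs(2) ct(2) by auto
    qed (use U s t cs(1) ct(1) in \<open>auto intro: add_closed hol_ring_add\<close>)
    then show "coeffs U (s \<oplus>\<^bsub>Sec E U\<^esub> t) i = (coeffs U s \<oplus>\<^bsub>Sec ?F U\<^esub> coeffs U t) i"
      using i by (simp add: Defs.direct_sum_def twisting_sheaf_def function_sheaf_def)
  qed (simp add: Defs.direct_sum_def)
  show "coeffs U (f \<odot>\<^bsub>Sec E U\<^esub> s) = f \<odot>\<^bsub>Sec ?F U\<^esub> coeffs U s"
    if f: "f \<in> carrier (hol_ring U)" and s: "s \<in> carrier (Sec E U)" for f s
  proof (rule eqI[OF _ ext])
    note cs = coeffs[OF U s]
    have rf: "zero_off (U - {Infty}) f \<in> carrier (hol_ring (U - {Infty}))"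
      by (rule zero_off_restrict[OF oU(1) _ f]) auto
    fix i assume i: "i < n"
    have "coeffs U (f \<odot>\<^bsub>Sec E U\<^esub> s) i = (\<lambda>x. zero_off (U - {Infty}) f x * coeffs U s i x)"
    proof (rule coeffs_unique[OF U _ _ _ i])
      show "Res E U (U - {Infty}) (f \<odot>\<^bsub>Sec E U\<^esub> s) =
          lincomb E (U - {Infty}) n (\<lambda>i x. zero_off (U - {Infty}) f x * coeffs U s i x) (\<lambda>i. Res E U0 (U - {Infty}) (e0 i))"
        using lincomb_smult[OF oU(1) subset_UNIV rf cs(1) Res_e_closed(1)[OF _ oU(1,4)]]
          Res_smult[OF U oU(1) _ subset_UNIV f s] cs(2) by auto
    qed (use U s f cs(1) rf in \<open>auto intro: smult_closed hol_ring_mult\<close>)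
    also have "\<dots> = (\<lambda>x. f x * coeffs U s i x)"
      using cs(1)[OF i] by (auto simp: fun_eq_iff zero_off_def hol_ring_iff)
    finally show "coeffs U (f \<odot>\<^bsub>Sec E U\<^esub> s) i = (f \<odot>\<^bsub>Sec ?F U\<^esub> coeffs U s) i"
      using i by (simp add: Defs.direct_sum_def twisting_sheaf_def function_sheaf_def)
  qed (simp add: Defs.direct_sum_def)
  show "coeffs V (Res E U V s) = Res ?F U V (coeffs U s)"
    if V: "open V" "V \<subseteq> U" and s: "s \<in> carrier (Sec E U)" for V s
  proof (rule eqI[OF _ ext])
    note cs = coeffs[OF U s] and oV = U_opens[OF V(1)]
    have VU: "V - {Infty} \<subseteq> U - {Infty}" using V by auto
    fix i assume i: "i < n"
    have "coeffs V (Res E U V s) i = zero_off (V - {Infty}) (coeffs U s i)"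
    proof (rule coeffs_unique[OF V(1) _ _ _ i])
      have "Res E V (V - {Infty}) (Res E U V s) = Res E U (V - {Infty}) s"
        by (rule Res_Res[OF U V(1) oV(1) Diff_subset V(2) subset_UNIV s])
      also have "\<dots> = Res E (U - {Infty}) (V - {Infty}) (Res E U (U - {Infty}) s)"
        by (rule Res_Res[OF U oU(1) oV(1) VU Diff_subset subset_UNIV s, symmetric])
      also have "\<dots> = lincomb E (V - {Infty}) n (\<lambda>i. zero_off (V - {Infty}) (coeffs U s i)) (\<lambda>i. Res E U0 (V - {Infty}) (e0 i))"
        unfolding cs(2) by (rule lincomb_Res_Res[OF open01(1) subset_UNIV oU(1,4) oV(1) VU cs(1) e_closed(1)])
      finally show "Res E V (V - {Infty}) (Res E U V s) =
          lincomb E (V - {Infty}) n (\<lambda>i. zero_off (V - {Infty}) (coeffs U s i)) (\<lambda>i. Res E U0 (V - {Infty}) (e0 i))" .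
      show "zero_off (V - {Infty}) (coeffs U s i) \<in> carrier (hol_ring (V - {Infty}))" if "i < n" for i
        by (rule zero_off_restrict[OF oV(1) VU cs(1)[OF that]])
    qed (use U V s in \<open>auto intro: Res_closed\<close>)
    also have "\<dots> = zero_off V (coeffs U s i)"
      using cs(1)[OF i] by (auto simp: fun_eq_iff zero_off_def hol_ring_iff)
    finally show "coeffs V (Res E U V s) i = Res ?F U V (coeffs U s) i"
      using i by (simp add: Defs.direct_sum_def twisting_sheaf_def function_sheaf_def)
  qed (simp add: Defs.direct_sum_def)
  show "bij_betw (coeffs U) (carrier (Sec E U)) (carrier (Sec ?F U))"
  proof (rule bij_betw_imageI)
    show "inj_on (coeffs U) (carrier (Sec E U))"
      by (rule inj_onI) (rule coeffs_inj[OF U], simp_all)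
    show "coeffs U ` carrier (Sec E U) = carrier (Sec ?F U)"
    proof
      show "coeffs U ` carrier (Sec E U) \<subseteq> carrier (Sec ?F U)" using carr[OF U] by auto
      show "carrier (Sec ?F U) \<subseteq> coeffs U ` carrier (Sec E U)"
      proof
        fix f assume f: "f \<in> carrier (Sec ?F U)"
        then have f1: "\<And>i. i < n \<Longrightarrow> f i \<in> carrier (Sec (twisting_sheaf (- a i)) U)" and f2: "f \<in> extensional {..<n}"
          by (auto simp: Defs.direct_sum_def PiE_iff)
        have "\<exists>s\<in>carrier (Sec E U). \<forall>i<n. coeffs U s i = f i"
          by (rule coeffs_surj[OF U]) (use f1 in \<open>auto simp: twisting_carrier\<close>)
        then obtain s where s: "s \<in> carrier (Sec E U)" "\<And>i. i < n \<Longrightarrow> coeffs U s i = f i" by blast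
        then have "coeffs U s = f" using eqI[OF _ ext f2] by blast
        with s(1) show "f \<in> coeffs U ` carrier (Sec E U)" by blast
      qed
    qed
  qed
qed

end

section \<open>The degree\<close>

text \<open>The order is witnessed by a factorization, so that it is additive for products and a punctured
neighbourhood suffices.\<close>

definition has_order :: "(complex \<Rightarrow> complex) \<Rightarrow> int \<Rightarrow> bool" where
  "has_order f k \<longleftrightarrow> (\<exists>h. h analytic_on {0} \<and> h 0 \<noteq> 0 \<and> (\<forall>\<^sub>F t in at 0. f t = h t * t powi k))"

lemma has_order_zorder:
  assumes "f meromorphic_on {0}" "\<forall>\<^sub>F t in at 0. f t \<noteq> 0"
  shows "has_order f (zorder f 0)"
proof -
  have "isolated_singularity_at f 0" "not_essential f 0"
    using assms(1) by (auto simp: meromorphic_at_iff)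
  moreover have "\<exists>\<^sub>F t in at 0. f t \<noteq> 0" using assms(2) by (simp add: eventually_frequently)
  ultimately have "zor_poly f 0 0 \<noteq> 0 \<and> (\<exists>r>0. zor_poly f 0 holomorphic_on cball 0 r \<and>
      (\<forall>w\<in>cball 0 r - {0}. f w = zor_poly f 0 w * (w - 0) powi zorder f 0 \<and> zor_poly f 0 w \<noteq> 0))"
    using zorder_exist[of f 0] by (auto simp: Let_def)
  then obtain r where r: "zor_poly f 0 0 \<noteq> 0" "r > 0" "zor_poly f 0 holomorphic_on cball 0 r"
    "\<And>w. w \<in> cball 0 r - {0} \<Longrightarrow> f w = zor_poly f 0 w * w powi zorder f 0" by auto
  have "zor_poly f 0 analytic_on {0}"
    using r(2,3) holomorphic_on_subset[OF r(3) ball_subset_cball] by (auto simp: analytic_at intro!: exI[of _ "ball 0 r"])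
  moreover have "\<forall>\<^sub>F t in at 0. f t = zor_poly f 0 t * t powi zorder f 0"
    unfolding eventually_at using r(2,4) by (auto intro!: exI[of _ r])
  ultimately show ?thesis using r(1) unfolding has_order_def by blast
qed

text \<open>Otherwise \<open>G\<close> would tend to \<open>0\<close> at infinity, hence be bounded and constant, thus zero.\<close>

lemma entire_order_at_infinity:
  assumes G: "G holomorphic_on UNIV" "\<And>z. G z \<noteq> 0" and N: "N \<ge> 0"
    and H: "H analytic_on {0}" "\<forall>\<^sub>F t in at 0. G (1 / t) = H t * t powi N"
  shows "N = 0"
proof (rule ccontr)
  assume "N \<noteq> 0"
  with N have Np: "N > 0" by simp
  have "(\<lambda>t. H t * t powi N) analytic_on {0}" using H(1) N by (auto intro!: analytic_intros)
  then have "((\<lambda>t. H t * t powi N) \<longlongrightarrow> H 0 * 0 powi N) (at 0)"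
    by (rule isContD[OF analytic_at_imp_isCont])
  then have lim: "((\<lambda>t. G (1 / t)) \<longlongrightarrow> 0) (at 0)"
    using Np H(2) by (subst tendsto_cong[OF H(2)]) (simp add: power_int_0_left)
  then have "\<forall>\<^sub>F t in at 0. norm (G (1 / t)) < 1" by (intro order_tendstoD(2)[OF tendsto_norm_zero]) auto
  then obtain \<delta> where \<delta>: "\<delta> > 0" "\<And>t. t \<noteq> 0 \<Longrightarrow> norm t < \<delta> \<Longrightarrow> norm (G (1 / t)) < 1"
    unfolding eventually_at by (auto simp: dist_norm)
  have "G z = (\<Sum>k\<le>0. (deriv ^^ k) G 0 / fact k * z ^ k)" for z
  proof (rule Liouville_polynomial[OF G(1), of "2 / \<delta>" 1])
    fix z :: complex assume z: "2 / \<delta> \<le> norm z"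
    then have z0: "z \<noteq> 0" using \<delta>(1) by (auto simp: divide_le_0_iff)
    have "norm (1 / z) < \<delta>" using z \<delta>(1) z0 by (simp add: norm_divide field_simps)
    then show "norm (G z) \<le> 1 * norm z ^ 0" using \<delta>(2)[of "1 / z"] z0 by simp
  qed
  note Liou = this
  have "G (1 / t) = G 0" for t using Liou[of "1 / t"] by simp
  then have "((\<lambda>t. G (1 / t)) \<longlongrightarrow> G 0) (at 0)" by simp
  with lim have "G 0 = 0" using tendsto_unique trivial_limit_at by metis
  with G(2) show False by blast
qed

lemma prod_power_int:
  "t \<noteq> 0 \<Longrightarrow> (\<Prod>a\<in>S. t powi k a) = (t :: complex) powi (\<Sum>a\<in>S. k a)"
  by (induction S rule: infinite_finite_induct) (simp_all add: power_int_add)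

text \<open>Dividing \<open>f\<close> by the product of the \<open>(z - a) powi k(a)\<close> over the finite zeros and poles leaves an entire
function \<open>G\<close> without zeros, whose order at infinity is the total degree. If the degree is
nonnegative, the previous lemma applies to \<open>G\<close>, otherwise to its inverse.\<close>

theorem degree_of_meromorphic_function:
  assumes f: "hol_on f (- T)" and T: "finite T"
    and ord: "\<And>p. has_order (\<lambda>t. f (chart p t)) (k p)" and fin: "finite {p. k p \<noteq> 0}"
  shows "(\<Sum>p\<in>{p. k p \<noteq> 0}. k p) = 0"
proof -
  define S where "S = {a. k (Affine a) \<noteq> 0}"
  have S: "finite S"
    using finite_vimageI[OF fin, of Affine] by (simp add: S_def inj_def vimage_def)
  define q where "q z = (\<Prod>a\<in>S. (z - a) powi (- k (Affine a)))" for z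
  define g where "g z = f (Affine z) * q z" for z
  define T' where "T' = S \<union> Affine -` T"
  have T': "finite T'" using S finite_vimageI[OF T, of Affine] by (simp add: T'_def inj_def)
  have g_an: "g analytic_on {z}" if "z \<notin> T'" for z
  proof -
    have "(\<lambda>t. f (chart (Affine 0) t)) analytic_on {z}"
      using hol_on_chart_analytic[OF f, of "Affine 0" z] that by (auto simp: T'_def)
    then have "(\<lambda>z. f (Affine z)) analytic_on {z}" by simp
    moreover have "q analytic_on {z}"
      unfolding q_def[abs_def] using that by (auto intro!: analytic_intros simp: T'_def)
    ultimately show ?thesis unfolding g_def[abs_def] by (rule analytic_on_mult)
  qed
  have g_lim: "\<exists>h. h analytic_on {b} \<and> h b \<noteq> 0 \<and> (\<forall>\<^sub>F z in at b. g z = h z)" for b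
  proof -
    obtain h where h: "h analytic_on {0}" "h 0 \<noteq> 0" "\<forall>\<^sub>F t in at 0. f (Affine (b + t)) = h t * t powi k (Affine b)"
      using ord[of "Affine b"] by (auto simp: has_order_def)
    define q' where "q' z = (\<Prod>a\<in>S - {b}. (z - a) powi (- k (Affine a)))" for z
    define h' where "h' z = h (z - b) * q' z" for z
    have "(h \<circ> (\<lambda>z. z - b)) analytic_on {b}"
      by (rule analytic_on_compose) (use h(1) in \<open>auto intro!: analytic_intros\<close>)
    then have "h' analytic_on {b}"
      unfolding h'_def[abs_def] q'_def by (auto intro!: analytic_intros simp: o_def)
    moreover have "h' b \<noteq> 0" using h(2) S by (auto simp: h'_def q'_def)
    moreover have "\<forall>\<^sub>F z in at b. g z = h' z"
    proof -
      have "\<forall>\<^sub>F t in at 0. g (t + b) = h' (t + b)"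
        using h(3) eventually_neq_at_within[of 0]
      proof eventually_elim
        case (elim t)
        have "q (t + b) = t powi (- k (Affine b)) * q' (t + b)"
        proof (cases "b \<in> S")
          case True
          then show ?thesis unfolding q_def q'_def using S by (subst prod.remove[of S b]) auto
        next
          case False
          then show ?thesis by (simp add: q_def q'_def S_def)
        qed
        then show ?case using elim
          by (simp add: g_def h'_def add.commute power_int_minus field_simps)
      qed
      then show ?thesis by (subst at_to_0) (simp add: eventually_filtermap)
    qed
    ultimately show ?thesis by blast
  qed
  define G where "G = remove_sings g"
  have G: "G analytic_on {b} \<and> G b \<noteq> 0" for b
  proof -
    obtain h where h: "h analytic_on {b}" "h b \<noteq> 0" "\<forall>\<^sub>F z in at b. g z = h z" using g_lim by blast
    have l: "h \<midarrow>b\<rightarrow> h b" using h(1) by (intro isContD analytic_at_imp_isCont)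
    then have "g \<midarrow>b\<rightarrow> h b" by (subst tendsto_cong[OF h(3)])
    moreover have "isolated_singularity_at g b"
      using isolated_singularity_at_cong[OF h(3) refl] isolated_singularity_at_analytic[OF h(1)] by simp
    ultimately show ?thesis
      using h(2) remove_sings_analytic_at[of g b "h b"] remove_sings_eqI[OF \<open>g \<midarrow>b\<rightarrow> h b\<close>] by (simp add: G_def)
  qed
  have Gg: "G z = g z" if "z \<notin> T'" for z using remove_sings_at_analytic[OF g_an[OF that]] by (simp add: G_def)
  obtain h where h: "h analytic_on {0}" "h 0 \<noteq> 0" "\<forall>\<^sub>F t in at 0. f (chart Infty t) = h t * t powi k Infty"
    using ord[of Infty] by (auto simp: has_order_def)
  define N where "N = k Infty + (\<Sum>a\<in>S. k (Affine a))"
  define H where "H t = h t * (\<Prod>a\<in>S. (1 - a * t) powi (- k (Affine a)))" for t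
  have H: "H analytic_on {0}" "H 0 \<noteq> 0"
    unfolding H_def[abs_def] using h S by (auto intro!: analytic_intros)
  have ev: "\<forall>\<^sub>F t in at 0. G (1 / t) = H t * t powi N"
  proof -
    have "finite ((\<lambda>t. 1 / t) -` T')" by (rule finite_vimageI[OF T']) (auto simp: inj_def)
    then have "\<forall>\<^sub>F t in at 0. 1 / t \<notin> T'"
      by (intro eventually_mono[OF eventually_chart_notin_finite[of "Affine ` ((\<lambda>t. 1 / t) -` T')" "Affine 0"]]) auto
    with h(3) eventually_neq_at_within[of 0] show ?thesis
    proof eventually_elim
      case (elim t)
      have "q (1 / t) = (\<Prod>a\<in>S. (1 - a * t) powi (- k (Affine a)) * t powi k (Affine a))"
        unfolding q_def
      proof (rule prod.cong[OF refl])
        fix a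
        have "1 / t - a = (1 - a * t) / t" using elim by (simp add: field_simps)
        then show "(1 / t - a) powi (- k (Affine a)) = (1 - a * t) powi (- k (Affine a)) * t powi k (Affine a)"
          by (simp add: power_int_divide_distrib power_int_minus field_simps)
      qed
      also have "\<dots> = (\<Prod>a\<in>S. (1 - a * t) powi (- k (Affine a))) * t powi (\<Sum>a\<in>S. k (Affine a))"
        using elim by (simp add: prod.distrib prod_power_int)
      finally have "g (1 / t) = H t * t powi N"
        using elim by (simp add: g_def H_def N_def power_int_add)
      then show ?case using Gg[of "1 / t"] elim by simp
    qed
  qed
  have hol: "G holomorphic_on UNIV"
    using G by (intro analytic_imp_holomorphic) (subst analytic_on_analytic_at, blast)
  have "N = 0"
  proof (cases "N \<ge> 0")
    case True
    then show ?thesis using entire_order_at_infinity[OF hol _ True H(1) ev] G by blast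
  next
    case False
    have "- N = 0"
    proof (rule entire_order_at_infinity)
      show "(\<lambda>z. inverse (G z)) holomorphic_on UNIV" using hol G by (intro holomorphic_intros) auto
      show "(\<lambda>t. inverse (H t)) analytic_on {0}" using H by (intro analytic_intros) auto
      show "\<forall>\<^sub>F t in at 0. inverse (G (1 / t)) = inverse (H t) * t powi (- N)"
        using ev by eventually_elim (simp add: power_int_minus)
    qed (use G False in auto)
    then show ?thesis by simp
  qed
  moreover have "(\<Sum>p\<in>{p. k p \<noteq> 0}. k p) = N"
  proof -
    have "(\<Sum>p\<in>{p. k p \<noteq> 0}. k p) = (\<Sum>p\<in>insert Infty (Affine ` S). k p)"
    proof (rule sum.mono_neutral_left)
      show "{p. k p \<noteq> 0} \<subseteq> insert Infty (Affine ` S)"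
      proof
        fix p assume "p \<in> {p. k p \<noteq> 0}"
        then show "p \<in> insert Infty (Affine ` S)" by (cases p) (auto simp: S_def)
      qed
    qed (use S in auto)
    also have "\<dots> = k Infty + (\<Sum>p\<in>Affine ` S. k p)" using S by (subst sum.insert) auto
    also have "(\<Sum>p\<in>Affine ` S. k p) = (\<Sum>a\<in>S. k (Affine a))"
      by (subst sum.reindex) (auto simp: inj_on_def)
    finally show ?thesis by (simp add: N_def)
  qed
  ultimately show ?thesis by simp
qed

lemma analytic_on_det:
  assumes "\<And>i j. i < n \<Longrightarrow> j < n \<Longrightarrow> (\<lambda>t. f i j t) analytic_on S"
  shows "(\<lambda>t. Determinant.det (Matrix.mat n n (\<lambda>(i, j). f i j t))) analytic_on S"
proof -
  have det: "Determinant.det (Matrix.mat n n (\<lambda>(i, j). f i j t)) =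
      (\<Sum>p\<in>{p. p permutes {0..<n}}. signof p * (\<Prod>i = 0..<n. f i (p i) t))" for t
    unfolding Determinant.det_def by (auto intro!: sum.cong prod.cong simp: permutes_in_image)
  show ?thesis
    unfolding det using assms
    by (intro analytic_on_sum analytic_on_mult analytic_on_const analytic_on_prod) (auto simp: permutes_in_image)
qed

text \<open>Changing the frame multiplies the determinant by that of the transition matrix, which is holomorphic
and has no zero, so the order can be computed in any local frame.\<close>

lemma wedge_order_has_order:
  assumes os: "omodule_sheaf UNIV E" and wo: "wedge_order E n T s p k" and T: "finite T"
    and s: "\<And>j. j < n \<Longrightarrow> s j \<in> carrier (Sec E (- T))"
    and W: "open W" "p \<in> W" and fr: "is_frame E W n e'"
    and c: "\<And>i j. i < n \<Longrightarrow> j < n \<Longrightarrow> c i j \<in> carrier (hol_ring (W - T))"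
    and sc: "\<And>j. j < n \<Longrightarrow> Res E (- T) (W - T) (s j) = lincomb E (W - T) n (\<lambda>i. c i j) (\<lambda>i. Res E W (W - T) (e' i))"
  shows "has_order (\<lambda>t. Determinant.det (Matrix.mat n n (\<lambda>(i, j). c i j (chart p t)))) k"
proof -
  interpret omodule_sheaf UNIV E by (rule os)
  note UX = subset_UNIV
  obtain U e F D where
    *: "open U \<and> p \<in> U \<and> is_frame E U n e \<and> (\<forall>i<n. \<forall>j<n. F i j \<in> carrier (hol_ring (U - T))) \<and>
     (\<forall>j<n. Res E (- T) (U - T) (s j) = lincomb E (U - T) n (\<lambda>i. F i j) (\<lambda>i. Res E U (U - T) (e i))) \<and>
     D = (\<lambda>t. Determinant.det (Matrix.mat n n (\<lambda>(i, j). F i j (chart p t)))) \<and>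
     D meromorphic_on {0} \<and> (\<forall>\<^sub>F t in at 0. D t \<noteq> 0) \<and> k = zorder D 0"
    using wo unfolding wedge_order_def lincomb_def[symmetric] by (elim exE) (rule that)
  have U: "open U" "p \<in> U" and e: "is_frame E U n e"
    using conjunct1[OF *] conjunct1[OF conjunct2[OF *]] conjunct1[OF conjunct2[OF conjunct2[OF *]]] by auto
  have F: "F i j \<in> carrier (hol_ring (U - T))" if "i < n" "j < n" for i j
    using conjunct1[OF conjunct2[OF conjunct2[OF conjunct2[OF *]]]] that by blast
  have sF: "Res E (- T) (U - T) (s j) = lincomb E (U - T) n (\<lambda>i. F i j) (\<lambda>i. Res E U (U - T) (e i))" if "j < n" for j
    by (rule conjunct1[OF conjunct2[OF conjunct2[OF conjunct2[OF conjunct2[OF *]]]], rule_format, OF that])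
  have D: "has_order (\<lambda>t. Determinant.det (Matrix.mat n n (\<lambda>(i, j). F i j (chart p t)))) k"
  proof -
    have "has_order D k" using * has_order_zorder[of D] by (elim conjE) simp
    moreover have "D = (\<lambda>t. Determinant.det (Matrix.mat n n (\<lambda>(i, j). F i j (chart p t))))"
      using * by (elim conjE)
    ultimately show ?thesis by simp
  qed
  define V where "V = U \<inter> W"
  define Z where "Z = V - T"
  have V: "open V" "V \<subseteq> U" "V \<subseteq> W" "p \<in> V" using U W by (auto simp: V_def)
  have Z: "open Z" "Z \<subseteq> V" "Z \<subseteq> U - T" "Z \<subseteq> W - T" "Z \<subseteq> - T"
    using V open_Diff_finite[OF V(1) T] by (auto simp: Z_def)
  have oT: "open (- T)" "open (U - T)" "open (W - T)"
    using T U W by (auto simp: open_Compl_finite open_Diff_finite)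
  note ce = is_frame_closed[OF e] and ce' = is_frame_closed[OF fr]
  obtain A B where AB: "\<forall>i<n. \<forall>j<n. A i j \<in> carrier (hol_ring V)"
    "\<forall>j<n. Res E U V (e j) = lincomb E V n (\<lambda>i. A i j) (\<lambda>i. Res E W V (e' i))"
    "\<forall>i<n. \<forall>j<n. \<forall>x\<in>V. (\<Sum>l<n. A i l x * B l j x) = (if i = j then 1 else 0)"
    using frame_transition[OF frame_Res[OF fr W(1) UX V(1,3)] frame_Res[OF e U(1) UX V(1,2)] V(1) UX]
    by (elim exE conjE) (rule that)
  have A: "A i j \<in> carrier (hol_ring V)" if "i < n" "j < n" for i j using AB(1) that by blast
  have reU: "Res E U Z (e i) \<in> carrier (Sec E Z)" and reW: "Res E W Z (e' i) \<in> carrier (Sec E Z)" if "i < n" for i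
    using Res_closed[OF U(1) Z(1) _ UX ce[OF that]] Res_closed[OF W(1) Z(1) _ UX ce'[OF that]] Z V by auto
  have rA: "zero_off Z (A i j) \<in> carrier (hol_ring Z)" if "i < n" "j < n" for i j
    by (rule zero_off_restrict[OF Z(1,2) A[OF that]])
  have rF: "zero_off Z (F i j) \<in> carrier (hol_ring Z)" if "i < n" "j < n" for i j
    by (rule zero_off_restrict[OF Z(1,3) F[OF that]])
  have rc: "zero_off Z (c i j) \<in> carrier (hol_ring Z)" if "i < n" "j < n" for i j
    by (rule zero_off_restrict[OF Z(1,4) c[OF that]])
  have eA: "Res E U Z (e j) = lincomb E Z n (\<lambda>i. zero_off Z (A i j)) (\<lambda>i. Res E W Z (e' i))" if j: "j < n" for j
  proof -
    have "Res E U Z (e j) = Res E V Z (Res E U V (e j))"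
      by (rule Res_Res[OF U(1) V(1) Z(1,2) V(2) UX ce[OF j], symmetric])
    also have "\<dots> = lincomb E Z n (\<lambda>i. zero_off Z (A i j)) (\<lambda>i. Res E W Z (e' i))"
      unfolding AB(2)[rule_format, OF j] by (rule lincomb_Res_Res[OF W(1) UX V(1,3) Z(1,2) A[OF _ j] ce'])
    finally show ?thesis .
  qed
  have cAF: "zero_off Z (c i j) = (\<lambda>x. \<Sum>l<n. zero_off Z (A i l) x * zero_off Z (F l j) x)" if ij: "i < n" "j < n" for i j
  proof (rule frame_unique[OF fr W(1) UX Z(1) _ rc[OF _ ij(2)] _ _ ij(1)])
    show "Z \<subseteq> W" using Z by auto
    show "(\<lambda>x. \<Sum>l<n. zero_off Z (A i l) x * zero_off Z (F l j) x) \<in> carrier (hol_ring Z)" if "i < n" for i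
      using rA[OF that] rF[OF _ ij(2)] by (auto intro!: hol_ring_sum hol_ring_mult)
    have "lincomb E Z n (\<lambda>i. zero_off Z (c i j)) (\<lambda>i. Res E W Z (e' i)) = Res E (W - T) Z (Res E (- T) (W - T) (s j))"
      unfolding sc[OF ij(2)]
      by (rule lincomb_Res_Res[OF W(1) UX oT(3) Diff_subset Z(1,4) c[OF _ ij(2)] ce', symmetric])
    also have "\<dots> = Res E (- T) Z (s j)"
      by (rule Res_Res[OF oT(1,3) Z(1,4) _ UX s[OF ij(2)]]) auto
    also have "\<dots> = Res E (U - T) Z (Res E (- T) (U - T) (s j))"
      by (rule Res_Res[OF oT(1,2) Z(1,3) _ UX s[OF ij(2)], symmetric]) auto
    also have "\<dots> = lincomb E Z n (\<lambda>i. zero_off Z (F i j)) (\<lambda>i. Res E U Z (e i))"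
      unfolding sF[OF ij(2)]
      by (rule lincomb_Res_Res[OF U(1) UX oT(2) Diff_subset Z(1,3) F[OF _ ij(2)] ce])
    also have "\<dots> = lincomb E Z n (\<lambda>i. zero_off Z (F i j)) (\<lambda>l. lincomb E Z n (\<lambda>i. zero_off Z (A i l)) (\<lambda>i. Res E W Z (e' i)))"
      by (rule lincomb_cong[OF Z(1) UX rF[OF _ ij(2)] reU refl eA])
    also have "\<dots> = lincomb E Z n (\<lambda>i x. \<Sum>l<n. zero_off Z (A i l) x * zero_off Z (F l j) x) (\<lambda>i. Res E W Z (e' i))"
      by (rule lincomb_lincomb[OF Z(1) UX rA rF[OF _ ij(2)] reW])
    finally show "lincomb E Z n (\<lambda>i. zero_off Z (c i j)) (\<lambda>i. Res E W Z (e' i)) =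
        lincomb E Z n (\<lambda>i x. \<Sum>l<n. zero_off Z (A i l) x * zero_off Z (F l j) x) (\<lambda>i. Res E W Z (e' i))" .
  qed
  let ?M = "\<lambda>f x. Matrix.mat n n (\<lambda>(i, j). f i j x)"
  have prod: "Determinant.det (?M P x) * Determinant.det (?M Q x) = Determinant.det (?M R x)"
    if "\<And>i j. i < n \<Longrightarrow> j < n \<Longrightarrow> (\<Sum>l<n. P i l x * Q l j x) = R i j x" for P Q R :: "nat \<Rightarrow> nat \<Rightarrow> cp1 \<Rightarrow> complex" and x
  proof -
    have M: "?M f x \<in> carrier_mat n n" for f :: "nat \<Rightarrow> nat \<Rightarrow> cp1 \<Rightarrow> complex" by simp
    have "?M P x * ?M Q x = ?M R x"
      by (rule eq_matI) (use sq_mult_entry[OF M[of P] M[of Q]] that in \<open>auto simp del: index_mult_mat(1)\<close>)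
    then show ?thesis using det_mult[OF M[of P] M[of Q]] by simp
  qed
  have detc: "Determinant.det (?M c x) = Determinant.det (?M A x) * Determinant.det (?M F x)" if "x \<in> Z" for x
    using prod[of A x F c] fun_cong[OF cAF, of _ _ x] that by (simp add: zero_off_apply)
  obtain h where h: "h analytic_on {0}" "h 0 \<noteq> 0" "\<forall>\<^sub>F t in at 0. Determinant.det (?M F (chart p t)) = h t * t powi k"
    using D by (auto simp: has_order_def)
  have "(\<lambda>t. Determinant.det (?M A (chart p t))) analytic_on {0}"
    by (rule analytic_on_det) (use A V(4) in \<open>auto simp: hol_ring_iff hol_on_def\<close>)
  moreover have "Determinant.det (?M A p) \<noteq> 0"
  proof -
    have "Determinant.det (?M A p) * Determinant.det (?M B p) = Determinant.det (?M (\<lambda>i j x. if i = j then 1 else 0) p)"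
      by (rule prod) (use AB(3) V(4) in auto)
    also have "?M (\<lambda>i j x. if i = j then 1 else 0) p = 1\<^sub>m n" by (auto intro!: eq_matI)
    finally show ?thesis by auto
  qed
  moreover have "\<forall>\<^sub>F t in at 0. Determinant.det (?M c (chart p t)) = (Determinant.det (?M A (chart p t)) * h t) * t powi k"
    using h(3) eventually_chart_in(2)[OF V(1,4)] eventually_chart_notin_finite[OF T, of p]
    by eventually_elim (simp add: detc Z_def)
  ultimately show ?thesis
    unfolding has_order_def using h(1,2)
    by (intro exI[of _ "\<lambda>t. Determinant.det (?M A (chart p t)) * h t"]) (auto intro!: analytic_on_mult)
qed

context two_frames
begin

lemma locally_free_UNIV: "locally_free UNIV n E"
  unfolding locally_free_def
proof (intro conjI ballI)
  show "omodule_sheaf UNIV E" by unfold_locales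
  fix p :: cp1
  show "\<exists>U e. open U \<and> p \<in> U \<and> U \<subseteq> UNIV \<and> is_frame E U n e"
  proof (cases "p = Infty")
    case True
    then show ?thesis using frame1 by (intro exI[of _ U1] exI[of _ e1]) auto
  next
    case False
    then show ?thesis using frame0 by (intro exI[of _ U0] exI[of _ e0]) auto
  qed
qed

text \<open>The sections \<open>e0\<close> form a frame off infinity, where their wedge product has order \<open>0\<close>. At infinity, in
the frame \<open>e1\<close>, the determinant of their coefficients is \<open>z\<close> to the sum of the \<open>a i\<close>, with
\<open>z = 1 / t\<close>.\<close>

lemma has_degree_sum: "has_degree E (- (\<Sum>i<n. a i))"
proof -
  define k :: "cp1 \<Rightarrow> int" where "k p = (if p = Infty then - (\<Sum>i<n. a i) else 0)" for p
  have wedge: "wedge_order E n {Infty} e0 p (k p)" for p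
  proof (cases "p = Infty")
    case False
    define F where "F i j = zero_off U0 (\<lambda>_. if i = j then 1 else 0 :: complex)" for i j :: nat
    define D where "D t = Determinant.det (Matrix.mat n n (\<lambda>(i, j). F i j (chart p t)))" for t
    have pU: "p \<in> U0" using False by simp
    have ev1: "\<forall>\<^sub>F t in at 0. D t = 1"
      using eventually_chart_in(2)[OF open01(1) pU]
    proof eventually_elim
      case (elim t)
      then have "Matrix.mat n n (\<lambda>(i, j). F i j (chart p t)) = 1\<^sub>m n"
        by (intro eq_matI) (auto simp: F_def zero_off_def)
      then show ?case by (simp add: D_def)
    qed
    have D1: "D meromorphic_on {0}"
      by (subst meromorphic_on_cong[of _ D "\<lambda>_. 1", OF _ refl]) (use ev1 in auto)
    have D2: "\<forall>\<^sub>F t in at 0. D t \<noteq> 0" using ev1 by (rule eventually_mono) simp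
    have D3: "k p = zorder D 0" using zorder_cong[OF ev1 refl] False by (simp add: k_def)
    have D0: "D = (\<lambda>t. Determinant.det (Matrix.mat n n (\<lambda>(i, j). F i j (chart p t))))"
      by (rule ext) (rule D_def)
    have e: "Res E U0 U0 (e0 j) = lincomb E U0 n (\<lambda>i. F i j) (\<lambda>i. Res E U0 U0 (e0 i))" if "j < n" for j
      unfolding F_def
      by (rule lincomb_delta[OF open01(1) subset_UNIV Res_e_closed(1)[OF _ open01(1) order_refl] that, symmetric])
    have F: "F i j \<in> carrier (hol_ring U0)" for i j unfolding F_def by (rule hol_ring_const) simp
    have U: "U0 - {Infty} = U0" by auto
    show ?thesis
      unfolding wedge_order_def lincomb_def[symmetric]
      by (rule exI[of _ U0], rule exI[of _ e0], rule exI[of _ F], rule exI[of _ D], unfold U, intro conjI allI impI)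
         (rule open01 pU frame0 F e D0 D1 D2 D3 | assumption)+
  next
    case True
    define F where "F i j = zero_off punctured_line (\<lambda>x. if i = j then affine_coord x powi a i else 0 :: complex)" for i j :: nat
    define D where "D t = Determinant.det (Matrix.mat n n (\<lambda>(i, j). F i j (chart p t)))" for t
    have Dt: "\<forall>\<^sub>F t in at 0. D t = t powi (- (\<Sum>i<n. a i))"
      using eventually_neq_at_within[of 0]
    proof eventually_elim
      case (elim t)
      have "D t = Determinant.det (Matrix.mat n n (\<lambda>(i, j). if i = j then (1 / t) powi a i else 0))"
        unfolding D_def using elim True
        by (intro arg_cong[where f = Determinant.det] eq_matI) (auto simp: F_def zero_off_def punctured_line_def)
      also have "\<dots> = (\<Prod>i\<leftarrow>diag_mat (Matrix.mat n n (\<lambda>(i, j). if i = j then (1 / t) powi a i else 0)). i)"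
        by (simp, rule det_upper_triangular[of _ n]) auto
      also have "\<dots> = (\<Prod>i<n. (1 / t) powi a i)"
        by (simp add: diag_mat_def prod.distinct_set_conv_list[symmetric] atLeast0LessThan)
      also have "\<dots> = (1 / t) powi (\<Sum>i<n. a i)" using elim by (simp add: prod_power_int)
      finally show ?case by (simp add: power_int_minus power_int_divide_distrib field_simps)
    qed
    have m: "(\<lambda>t :: complex. t powi (- (\<Sum>i<n. a i))) meromorphic_on {0}" by (intro meromorphic_intros)
    have "zorder (\<lambda>t :: complex. t powi (- (\<Sum>i<n. a i))) 0 = - (\<Sum>i<n. a i)"
      by (rule zorder_eqI[of UNIV 0 "\<lambda>_. 1"]) auto
    then have D3: "k p = zorder D 0" using zorder_cong[OF Dt refl] True by (simp add: k_def)
    have D1: "D meromorphic_on {0}"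
      by (subst meromorphic_on_cong[of _ D "\<lambda>t. t powi (- (\<Sum>i<n. a i))", OF _ refl]) (use Dt m in auto)
    have D2: "\<forall>\<^sub>F t in at 0. D t \<noteq> 0"
      using Dt eventually_neq_at_within[of 0] by eventually_elim simp
    have D0: "D = (\<lambda>t. Determinant.det (Matrix.mat n n (\<lambda>(i, j). F i j (chart p t))))"
      by (rule ext) (rule D_def)
    have F: "F i j \<in> carrier (hol_ring punctured_line)" for i j
      unfolding F_def using hol_ring_coord_powi[of punctured_line "a i"] hol_ring_const[of punctured_line 0]
      by (cases "i = j") auto
    have e: "Res E U0 punctured_line (e0 j) = lincomb E punctured_line n (\<lambda>i. F i j) (\<lambda>i. Res E U1 punctured_line (e1 i))"
      if j: "j < n" for j
    proof -
      let ?\<delta> = "\<lambda>i. zero_off punctured_line (\<lambda>_. if i = j then 1 else 0 :: complex)"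
      have "Res E U0 punctured_line (e0 j) = lincomb E punctured_line n ?\<delta> (\<lambda>i. Res E U0 punctured_line (e0 i))"
        by (rule lincomb_delta[OF open_punctured_line subset_UNIV Res_e_closed(1)[OF _ open_punctured_line punctured_sub(1)] j, symmetric])
      also have "\<dots> = lincomb E punctured_line n (\<lambda>i x. affine_coord x powi a i * ?\<delta> i x) (\<lambda>i. Res E U1 punctured_line (e1 i))"
        by (rule lincomb_transition(1)[OF open_punctured_line order_refl hol_ring_const[OF open_punctured_line]])
      also have "(\<lambda>i x. affine_coord x powi a i * ?\<delta> i x) = (\<lambda>i. F i j)"
        by (auto simp: fun_eq_iff F_def zero_off_def)
      finally show ?thesis .
    qed
    have U: "U1 - {Infty} = punctured_line" by (auto simp: punctured_line_def)
    have pU: "p \<in> U1" using True by simp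
    show ?thesis
      unfolding wedge_order_def lincomb_def[symmetric]
      by (rule exI[of _ U1], rule exI[of _ e1], rule exI[of _ F], rule exI[of _ D], unfold U, intro conjI allI impI)
         (rule open01 pU frame1 F e D0 D1 D2 D3 | assumption)+
  qed
  have kS: "{p. k p \<noteq> 0} \<subseteq> {Infty}" by (auto simp: k_def split: if_splits)
  then have "finite {p. k p \<noteq> 0}" by (rule finite_subset) simp
  moreover have "(\<Sum>p\<in>{p. k p \<noteq> 0}. k p) = (\<Sum>p\<in>{Infty}. k p)"
    using kS by (intro sum.mono_neutral_left) auto
  ultimately show ?thesis
    unfolding has_degree_def using locally_free_UNIV wedge e_closed(1)
    by (intro exI[of _ n] exI[of _ "{Infty}"] exI[of _ e0] exI[of _ k]) (simp add: k_def)
qed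

text \<open>For arbitrary meromorphic sections \<open>s\<close>, the determinant \<open>f\<close> of their coefficients in the frame \<open>e0\<close> is
a meromorphic function on the line. Its orders are those of the wedge product of \<open>s\<close>, except for the
shift by the sum of the \<open>a i\<close> at infinity, where the coefficients in the frame \<open>e1\<close> have to be used.\<close>

lemma has_degree_unique:
  assumes "has_degree E d"
  shows "d = - (\<Sum>i<n. a i)"
proof -
  obtain n' T s k where lf: "locally_free UNIV n' E" and T: "finite T"
    and s': "\<And>j. j < n' \<Longrightarrow> s j \<in> carrier (Sec E (- T))" and wo': "\<And>p. wedge_order E n' T s p (k p)"
    and fin: "finite {p. k p \<noteq> 0}" and d: "d = (\<Sum>p\<in>{p. k p \<noteq> 0}. k p)"
    using assms unfolding has_degree_def by blast
  have "n = n'"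
  proof -
    obtain U e where U: "open U" "Affine 0 \<in> U" "is_frame E U n' e"
      using lf unfolding locally_free_def by blast
    have o: "open (U \<inter> U0)" using U(1) by auto
    show ?thesis
      by (rule frame_rank_unique[OF frame_Res[OF frame0 open01(1) subset_UNIV o Int_lower2]
          frame_Res[OF U(3,1) subset_UNIV o Int_lower1] o subset_UNIV, of "Affine 0"]) (use U in auto)
  qed
  note s = s'[folded \<open>n = n'\<close>] and wo = wo'[folded \<open>n = n'\<close>]
  have oT: "open (- T)" using T by (rule open_Compl_finite)
  define c where "c i j = coeffs (- T) (s j) i" for i j
  note cf = coeffs[OF oT s]
  define f where "f x = Determinant.det (Matrix.mat n n (\<lambda>(i, j). c i j x))" for x
  have f: "hol_on f (- (insert Infty T))"
    unfolding hol_on_def f_def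
  proof (intro ballI analytic_on_det)
    fix p i j assume "p \<in> - insert Infty T" "i < n" "j < n"
    then show "(\<lambda>t. c i j (chart p t)) analytic_on {0}"
      using cf(1)[of j i] by (auto simp: c_def hol_ring_iff hol_on_def)
  qed
  let ?a = "\<Sum>i<n. a i"
  define k' where "k' p = k p + (if p = Infty then ?a else 0)" for p
  have "(\<Sum>p\<in>{p. k' p \<noteq> 0}. k' p) = 0"
  proof (rule degree_of_meromorphic_function[OF f])
    show "finite (insert Infty T)" using T by simp
    show "finite {p. k' p \<noteq> 0}"
      by (rule finite_subset[of _ "insert Infty {p. k p \<noteq> 0}"]) (use fin in \<open>auto simp: k'_def\<close>)
    fix p
    show "has_order (\<lambda>t. f (chart p t)) (k' p)"
    proof (cases "p = Infty")
      case False
      have eqU: "U0 - T = - T - {Infty}" by auto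
      have "has_order (\<lambda>t. f (chart p t)) (k p)"
        unfolding f_def
      proof (rule wedge_order_has_order[OF omodule_sheaf_axioms wo T s open01(1) _ frame0])
        show "c i j \<in> carrier (hol_ring (U0 - T))" if "i < n" "j < n" for i j
          using cf(1)[OF that(2,1)] by (simp add: c_def eqU)
        show "Res E (- T) (U0 - T) (s j) = lincomb E (U0 - T) n (\<lambda>i. c i j) (\<lambda>i. Res E U0 (U0 - T) (e0 i))" if "j < n" for j
          using cf(2)[OF that] by (simp add: c_def eqU)
      qed (use False in auto)
      then show ?thesis using False by (simp add: k'_def)
    next
      case True
      have eqU: "U1 - T = - T - {Affine 0}" by auto
      have "\<forall>j. \<exists>d. j < n \<longrightarrow> (\<forall>i<n. d i \<in> carrier (hol_ring (- T - {Affine 0}))) \<and>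
          Res E (- T) (- T - {Affine 0}) (s j) = lincomb E (- T - {Affine 0}) n d (\<lambda>i. Res E U1 (- T - {Affine 0}) (e1 i)) \<and>
          (\<forall>i<n. \<forall>x\<in>- T \<inter> punctured_line. d i x = affine_coord x powi a i * coeffs (- T) (s j) i x)"
      proof (intro allI)
        fix j
        show "\<exists>d. j < n \<longrightarrow> (\<forall>i<n. d i \<in> carrier (hol_ring (- T - {Affine 0}))) \<and>
          Res E (- T) (- T - {Affine 0}) (s j) = lincomb E (- T - {Affine 0}) n d (\<lambda>i. Res E U1 (- T - {Affine 0}) (e1 i)) \<and>
          (\<forall>i<n. \<forall>x\<in>- T \<inter> punctured_line. d i x = affine_coord x powi a i * coeffs (- T) (s j) i x)"
        proof (cases "j < n")
          case True
          show ?thesis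
          proof (rule coeffs_at_infinity[OF oT s[OF True]])
            fix d assume "\<And>i. i < n \<Longrightarrow> d i \<in> carrier (hol_ring (- T - {Affine 0}))"
              "Res E (- T) (- T - {Affine 0}) (s j) = lincomb E (- T - {Affine 0}) n d (\<lambda>i. Res E U1 (- T - {Affine 0}) (e1 i))"
              "\<And>i x. i < n \<Longrightarrow> x \<in> - T \<inter> punctured_line \<Longrightarrow> d i x = affine_coord x powi a i * coeffs (- T) (s j) i x"
            note d = this
            show ?thesis by (intro exI[of _ d] impI conjI allI ballI d)
          qed
        qed simp
      qed
      from choice[OF this] obtain dd where dd': "\<forall>j. j < n \<longrightarrow> (\<forall>i<n. dd j i \<in> carrier (hol_ring (- T - {Affine 0}))) \<and>
          Res E (- T) (- T - {Affine 0}) (s j) = lincomb E (- T - {Affine 0}) n (dd j) (\<lambda>i. Res E U1 (- T - {Affine 0}) (e1 i)) \<and>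
          (\<forall>i<n. \<forall>x\<in>- T \<inter> punctured_line. dd j i x = affine_coord x powi a i * coeffs (- T) (s j) i x)" ..
      have dd1: "dd j i \<in> carrier (hol_ring (- T - {Affine 0}))" if "i < n" "j < n" for i j
        by (rule dd'[rule_format, THEN conjunct1, rule_format, OF that(2,1)])
      have dd2: "Res E (- T) (- T - {Affine 0}) (s j) = lincomb E (- T - {Affine 0}) n (dd j) (\<lambda>i. Res E U1 (- T - {Affine 0}) (e1 i))"
        if "j < n" for j by (rule dd'[rule_format, THEN conjunct2, THEN conjunct1, OF that])
      have dd3: "dd j i x = affine_coord x powi a i * c i j x" if "i < n" "j < n" "x \<in> - T \<inter> punctured_line" for i j x
        unfolding c_def by (rule dd'[rule_format, THEN conjunct2, THEN conjunct2, rule_format, OF that(2,1,3)])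
      have "has_order (\<lambda>t. Determinant.det (Matrix.mat n n (\<lambda>(i, j). dd j i (chart p t)))) (k p)"
      proof (rule wedge_order_has_order[OF omodule_sheaf_axioms wo T s open01(2) _ frame1])
        show "dd j i \<in> carrier (hol_ring (U1 - T))" if "i < n" "j < n" for i j
          using dd1[OF that] by (simp add: eqU)
        show "Res E (- T) (U1 - T) (s j) = lincomb E (U1 - T) n (\<lambda>i. dd j i) (\<lambda>i. Res E U1 (U1 - T) (e1 i))" if "j < n" for j
          using dd2[OF that] by (simp add: eqU)
      qed (use True in auto)
      then obtain h where h: "h analytic_on {0}" "h 0 \<noteq> 0"
        "\<forall>\<^sub>F t in at 0. Determinant.det (Matrix.mat n n (\<lambda>(i, j). dd j i (chart p t))) = h t * t powi k p"
        by (auto simp: has_order_def)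
      have "\<forall>\<^sub>F t in at 0. f (chart p t) = h t * t powi k' p"
        using h(3) eventually_neq_at_within[of 0] eventually_chart_notin_finite[OF T, of p]
      proof eventually_elim
        case (elim t)
        let ?x = "chart p t"
        have x: "?x \<in> - T \<inter> punctured_line" "affine_coord ?x = 1 / t"
          using elim True by (auto simp: punctured_line_def)
        let ?A = "Matrix.mat n n (\<lambda>(i, j). if i = j then (1 / t) powi a i else 0)"
        let ?C = "Matrix.mat n n (\<lambda>(i, j). c i j ?x)"
        have "Matrix.mat n n (\<lambda>(i, j). dd j i ?x) = ?A * ?C"
        proof (rule eq_matI)
          fix i j assume "i < dim_row (?A * ?C)" "j < dim_col (?A * ?C)"
          then have ij: "i < n" "j < n" by auto
          have "(?A * ?C) $$ (i, j) = (\<Sum>l<n. ?A $$ (i, l) * ?C $$ (l, j))"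
            by (rule sq_mult_entry) (use ij in auto)
          also have "\<dots> = (\<Sum>l<n. if l = i then (1 / t) powi a i * c i j ?x else 0)"
            by (rule sum.cong[OF refl]) (use ij in auto)
          also have "\<dots> = dd j i ?x" using dd3[OF ij x(1)] ij by (simp add: x(2))
          finally show "Matrix.mat n n (\<lambda>(i, j). dd j i ?x) $$ (i, j) = (?A * ?C) $$ (i, j)" using ij by simp
        qed auto
        then have "h t * t powi k p = Determinant.det ?A * f ?x"
          using elim det_mult[of ?A n ?C] by (simp add: f_def)
        also have "Determinant.det ?A = (1 / t) powi ?a"
        proof -
          have "Determinant.det ?A = prod_list (diag_mat ?A)" by (rule det_upper_triangular[of _ n]) auto
          also have "\<dots> = (\<Prod>i<n. (1 / t) powi a i)"
            by (simp add: diag_mat_def prod.distinct_set_conv_list[symmetric] atLeast0LessThan)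
          finally show ?thesis using elim by (simp add: prod_power_int)
        qed
        finally have "f ?x = t powi ?a * (h t * t powi k p)"
          using elim by (simp add: power_int_divide_distrib field_simps)
        then show ?case using elim True by (simp add: k'_def power_int_add mult_ac)
      qed
      with h(1,2) show ?thesis unfolding has_order_def by blast
    qed
  qed
  moreover have "(\<Sum>p\<in>{p. k' p \<noteq> 0}. k' p) = d + ?a"
  proof -
    let ?S = "insert Infty {p. k p \<noteq> 0}"
    have S: "finite ?S" using fin by simp
    have "(\<Sum>p\<in>{p. k' p \<noteq> 0}. k' p) = (\<Sum>p\<in>?S. k' p)"
      using S by (intro sum.mono_neutral_left) (auto simp: k'_def)
    also have "\<dots> = (\<Sum>p\<in>?S. k p) + (\<Sum>p\<in>?S. if p = Infty then ?a else 0)"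
      by (simp only: k'_def sum.distrib)
    also have "(\<Sum>p\<in>?S. k p) = d"
      unfolding d using S by (intro sum.mono_neutral_right) auto
    also have "(\<Sum>p\<in>?S. if p = Infty then ?a else 0) = ?a"
      using S by (subst sum.delta) auto
    finally show ?thesis .
  qed
  ultimately show ?thesis by simp
qed

theorem c1_eq: "c1 E = - (\<Sum>i<n. a i)"
  unfolding c1_def using has_degree_sum has_degree_unique by blast

end

section \<open>Frames of the bundle of a representation\<close>

lemma cover_in_punctured [simp]: "cover u \<in> punctured_line"
  by (simp add: cover_def punctured_line_def)

lemma punctured_cover:
  assumes "x \<in> punctured_line"
  obtains u where "x = cover u"
proof -
  obtain z where "x = Affine z" "z \<noteq> 0" using assms by (cases x) (auto simp: punctured_line_def)
  then have "x = cover (Ln z / (2 * of_real pi * \<i>))" by (simp add: cover_def)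
  then show ?thesis using that by blast
qed

lemma int_translates:
  assumes mr: "monodromy_rep n \<rho>" and f: "\<And>u. f u \<in> carrier_vec n"
    and 1: "\<And>u. f (u + 1) = \<rho> 1 *\<^sub>v f u"
  shows "f (u + of_int k) = \<rho> k *\<^sub>v f (u :: complex)"
proof -
  have \<rho>: "\<rho> k \<in> carrier_mat n n" "\<rho> 0 = 1\<^sub>m n" "\<rho> (k + l) = \<rho> k * \<rho> l" for k l
    using mr by (auto simp: monodromy_rep_def)
  show ?thesis
  proof (induction k rule: int_induct[where k = 0])
    case base
    then show ?case using f by (simp add: \<rho>(2))
  next
    case (step1 k)
    have "f (u + of_int (k + 1)) = \<rho> 1 *\<^sub>v f (u + of_int k)" using 1[of "u + of_int k"] by (simp add: add.assoc)
    also have "\<dots> = (\<rho> 1 * \<rho> k) *\<^sub>v f u" using step1 assoc_mult_mat_vec[OF \<rho>(1) \<rho>(1) f] by simp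
    finally show ?case using \<rho>(3)[of 1 k] by (simp add: add.commute)
  next
    case (step2 k)
    have "\<rho> 1 *\<^sub>v f (u + of_int (k - 1)) = \<rho> k *\<^sub>v f u" using 1[of "u + of_int (k - 1)"] step2 by simp
    then have "\<rho> (- 1) *\<^sub>v (\<rho> 1 *\<^sub>v f (u + of_int (k - 1))) = \<rho> (- 1) *\<^sub>v (\<rho> k *\<^sub>v f u)" by simp
    then have "(\<rho> (- 1) * \<rho> 1) *\<^sub>v f (u + of_int (k - 1)) = (\<rho> (- 1) * \<rho> k) *\<^sub>v f u"
      using assoc_mult_mat_vec[OF \<rho>(1) \<rho>(1) f] by simp
    then show ?case using \<rho>(3)[of "- 1" 1, symmetric] \<rho>(3)[of "- 1" k, symmetric] \<rho>(2) f by (simp add: add.commute)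
  qed
qed

text \<open>A periodic function on the universal cover is a function of \<open>exp(2 \<pi> i u)\<close>. Globally the principal
branch of the logarithm serves as a set-theoretic section of the cover; for the holomorphy at a
point, it is replaced by a branch near that point, which gives the same value by periodicity.\<close>

lemma descend_periodic:
  assumes V: "open V" "V \<subseteq> punctured_line" and per: "\<And>u. g (u + 1) = g u"
    and an: "\<And>u. cover u \<in> V \<Longrightarrow> g analytic_on {u}" and zero: "\<And>u. cover u \<notin> V \<Longrightarrow> g u = 0"
  shows "\<exists>c\<in>carrier (hol_ring V). \<forall>u. c (cover u) = g u"
proof -
  have perk: "g (u + of_int k) = g u" for u k
  proof (induction k rule: int_induct[where k = 0])
    case (step1 k)
    then show ?case using per[of "u + of_int k"] by (simp add: add.assoc)
  next
    case (step2 k)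
    then show ?case using per[of "u + of_int (k - 1)"] by simp
  qed simp
  let ?p = "2 * complex_of_real pi * \<i>"
  define c where "c x = (case x of Affine z \<Rightarrow> if z = 0 then 0 else g (Ln z / ?p) | Infty \<Rightarrow> 0)" for x
  have cg: "c (cover u) = g u" for u
  proof -
    have "exp (Ln (exp (?p * u))) = exp (?p * u)" by simp
    then obtain k :: int where "Ln (exp (?p * u)) = ?p * u + of_real (of_int (2 * k) * pi) * \<i>"
      unfolding exp_eq by blast
    then have "Ln (exp (?p * u)) / ?p = u + of_int k" by (simp add: field_simps)
    then show ?thesis by (simp add: c_def cover_def perk)
  qed
  have "c \<in> carrier (hol_ring V)"
    unfolding hol_ring_iff hol_on_def
  proof (intro conjI ballI allI impI)
    fix x assume x: "x \<notin> V"
    show "c x = 0"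
    proof (cases "x \<in> punctured_line")
      case True
      then obtain u where "x = cover u" by (rule punctured_cover)
      then show ?thesis using x zero cg by simp
    next
      case False
      then show ?thesis by (auto simp: c_def punctured_line_def)
    qed
  next
    fix q assume q: "q \<in> V"
    then obtain u0 where u0: "q = cover u0" using V(2) punctured_cover by blast
    define z0 where "z0 = exp (?p * u0)"
    have z0: "z0 \<noteq> 0" "q = Affine z0" by (simp_all add: z0_def u0 cover_def)
    define l where "l t = u0 + Ln (1 + t / z0) / ?p" for t
    have "l analytic_on {0}"
      unfolding l_def[abs_def] by (intro analytic_intros) (auto simp: z0)
    moreover have "g analytic_on l ` {0}" using an[of u0] q u0 by (simp add: l_def)
    ultimately have "(g \<circ> l) analytic_on {0}" by (intro analytic_on_compose)
    moreover have ev: "\<forall>\<^sub>F t in nhds 0. (g \<circ> l) t = c (chart q t)"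
    proof -
      have "\<forall>\<^sub>F t in nhds 0. t \<in> - {- z0}" by (rule eventually_nhds_in_open) (use z0 in auto)
      then have "\<forall>\<^sub>F t in nhds 0. 1 + t / z0 \<noteq> 0"
        by (rule eventually_mono) (use z0 in \<open>auto simp: field_simps eq_neg_iff_add_eq_0\<close>)
      then show ?thesis
      proof eventually_elim
        case (elim t)
        have "exp (?p * l t) = z0 * (1 + t / z0)"
          using elim by (simp add: l_def distrib_left exp_add z0_def)
        also have "\<dots> = z0 + t" using z0 by (simp add: distrib_left)
        finally have "cover (l t) = chart q t" by (simp only: cover_def z0 chart.simps)
        then show ?case using cg[of "l t"] by simp
      qed
    qed
    ultimately show "(\<lambda>t. c (chart q t)) analytic_on {0}" using analytic_at_cong[OF ev refl] by simp
  qed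
  then show ?thesis using cg by blast
qed

lemma rep_bundle_carrier:
  "f \<in> carrier (Sec (rep_bundle n \<rho>) U) \<longleftrightarrow> (\<forall>u. f u \<in> carrier_vec n) \<and> (\<forall>u. cover u \<notin> U \<longrightarrow> f u = 0\<^sub>v n) \<and>
    (\<forall>i<n. \<forall>u. cover u \<in> U \<longrightarrow> (\<lambda>v. vec_index (f v) i) analytic_on {u}) \<and>
    (\<forall>k u. f (u + of_int k) = \<rho> k *\<^sub>v f u)"
  by (simp add: rep_bundle_def)

text \<open>The sheaf \<open>E\<close> is defined on the whole line; only its restriction to the punctured line is identified
with the bundle of the representation.\<close>

locale rep_realization = omodule_sheaf UNIV E for E :: "'s osheaf" +
  fixes n :: nat and \<rho> :: "int \<Rightarrow> complex mat" and \<phi> :: "cp1 set \<Rightarrow> 's \<Rightarrow> complex \<Rightarrow> complex Matrix.vec"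
  assumes mrep: "monodromy_rep n \<rho>" and iso: "sheaf_iso punctured_line E (rep_bundle n \<rho>) \<phi>"
begin

lemma rho: "\<rho> k \<in> carrier_mat n n" "\<rho> 0 = 1\<^sub>m n" "\<rho> (k + l) = \<rho> k * \<rho> l"
  using mrep by (auto simp: monodromy_rep_def)

context
  fixes V :: "cp1 set" assumes V: "open V" "V \<subseteq> punctured_line"
begin

lemma \<phi>_closed: "s \<in> carrier (Sec E V) \<Longrightarrow> \<phi> V s \<in> carrier (Sec (rep_bundle n \<rho>) V)"
  and \<phi>_add: "s \<in> carrier (Sec E V) \<Longrightarrow> t \<in> carrier (Sec E V) \<Longrightarrow> \<phi> V (s \<oplus>\<^bsub>Sec E V\<^esub> t) = (\<lambda>u. \<phi> V s u + \<phi> V t u)"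
  and \<phi>_smult: "f \<in> carrier (hol_ring V) \<Longrightarrow> s \<in> carrier (Sec E V) \<Longrightarrow> \<phi> V (f \<odot>\<^bsub>Sec E V\<^esub> s) = (\<lambda>u. f (cover u) \<cdot>\<^sub>v \<phi> V s u)"
  and \<phi>_inj: "s \<in> carrier (Sec E V) \<Longrightarrow> t \<in> carrier (Sec E V) \<Longrightarrow> \<phi> V s = \<phi> V t \<Longrightarrow> s = t"
  and \<phi>_surj: "g \<in> carrier (Sec (rep_bundle n \<rho>) V) \<Longrightarrow> \<exists>s\<in>carrier (Sec E V). \<phi> V s = g"
proof -
  have hom: "sheaf_hom punctured_line E (rep_bundle n \<rho>) \<phi>"
    using iso unfolding sheaf_iso_def by (rule conjunct1)
  have bij: "bij_betw (\<phi> V) (carrier (Sec E V)) (carrier (Sec (rep_bundle n \<rho>) V))"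
    by (rule iso[unfolded sheaf_iso_def, THEN conjunct2, THEN spec, THEN mp, OF conjI[OF V]])
  note H = hom[unfolded sheaf_hom_def, THEN spec, THEN mp, OF conjI[OF V]]
  note H1 = H[THEN conjunct1] and H2 = H[THEN conjunct2, THEN conjunct1] and H3 = H[THEN conjunct2, THEN conjunct2, THEN conjunct1]
  show "\<phi> V s \<in> carrier (Sec (rep_bundle n \<rho>) V)" if "s \<in> carrier (Sec E V)" for s
    by (rule H1[THEN bspec, OF that])
  show "\<phi> V (s \<oplus>\<^bsub>Sec E V\<^esub> t) = (\<lambda>u. \<phi> V s u + \<phi> V t u)"
    if "s \<in> carrier (Sec E V)" "t \<in> carrier (Sec E V)" for s t
    unfolding H2[THEN bspec, THEN bspec, OF that] by (simp add: rep_bundle_def)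
  show "\<phi> V (f \<odot>\<^bsub>Sec E V\<^esub> s) = (\<lambda>u. f (cover u) \<cdot>\<^sub>v \<phi> V s u)"
    if "f \<in> carrier (hol_ring V)" "s \<in> carrier (Sec E V)" for f s
    unfolding H3[THEN bspec, THEN bspec, OF that] by (simp add: rep_bundle_def)
  show "s = t" if "s \<in> carrier (Sec E V)" "t \<in> carrier (Sec E V)" "\<phi> V s = \<phi> V t" for s t
    using bij that unfolding bij_betw_def inj_on_def by blast
  show "\<exists>s\<in>carrier (Sec E V). \<phi> V s = g" if "g \<in> carrier (Sec (rep_bundle n \<rho>) V)" for g
  proof -
    have "g \<in> \<phi> V ` carrier (Sec E V)" using bij that unfolding bij_betw_def by simp
    then show ?thesis by (rule imageE) blast
  qed
qed

lemma \<phi>_vec: "s \<in> carrier (Sec E V) \<Longrightarrow> \<phi> V s u \<in> carrier_vec n"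
  using \<phi>_closed by (simp add: rep_bundle_carrier)

lemma \<phi>_lincomb:
  assumes c: "\<And>i. i < k \<Longrightarrow> c i \<in> carrier (hol_ring V)" and e: "\<And>i. i < k \<Longrightarrow> e i \<in> carrier (Sec E V)"
  shows "\<phi> V (lincomb E V k c e) u = Matrix.vec n (\<lambda>r. \<Sum>i<k. c i (cover u) * vec_index (\<phi> V (e i) u) r)"
  using c e
proof (induction k)
  case 0
  let ?z = "\<zero>\<^bsub>Sec E V\<^esub>"
  have z: "?z \<in> carrier (Sec E V)" by (rule sec_zero_closed[OF V(1) subset_UNIV])
  interpret M: abelian_group "Sec E V" by (rule sec_group[OF V(1) subset_UNIV])
  have dbl: "\<phi> V ?z u = \<phi> V ?z u + \<phi> V ?z u" 
    using fun_cong[OF \<phi>_add[OF z z], of u] unfolding M.l_zero[OF z] .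
  have "vec_index (\<phi> V ?z u) r = vec_index (\<phi> V ?z u) r + vec_index (\<phi> V ?z u) r" if "r < n" for r
  proof -
    have "vec_index (\<phi> V ?z u) r = vec_index (\<phi> V ?z u + \<phi> V ?z u) r" by (rule arg_cong[OF dbl])
    also have "\<dots> = vec_index (\<phi> V ?z u) r + vec_index (\<phi> V ?z u) r"
      using that carrier_vecD[OF \<phi>_vec[OF z, of u]] by (intro index_add_vec(1)) simp
    finally show ?thesis .
  qed
  then have "vec_index (\<phi> V ?z u) r = 0" if "r < n" for r using that by simp
  then show ?case using \<phi>_vec[OF z, of u] by (auto simp: lincomb_0[OF V(1) subset_UNIV] intro!: eq_vecI)
next
  case (Suc k)
  have e: "e k \<in> carrier (Sec E V)" and c: "c k \<in> carrier (hol_ring V)" using Suc.prems by auto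
  have l: "lincomb E V k c e \<in> carrier (Sec E V)"
    by (rule lincomb_closed[OF V(1) subset_UNIV]) (use Suc.prems in auto)
  have "\<phi> V (lincomb E V (Suc k) c e) u = \<phi> V (lincomb E V k c e) u + c k (cover u) \<cdot>\<^sub>v \<phi> V (e k) u"
    using lincomb_Suc[OF V(1) subset_UNIV Suc.prems] \<phi>_add[OF l smult_closed[OF V(1) subset_UNIV c e]]
      \<phi>_smult[OF c e] by simp
  also have "\<phi> V (lincomb E V k c e) u = Matrix.vec n (\<lambda>r. \<Sum>i<k. c i (cover u) * vec_index (\<phi> V (e i) u) r)"
    by (rule Suc.IH) (use Suc.prems in auto)
  finally show ?case using \<phi>_vec[OF e, of u] by (auto intro!: eq_vecI)
qed

end

lemma \<phi>_Res:
  assumes "open U" "U \<subseteq> punctured_line" "open V" "V \<subseteq> U" "s \<in> carrier (Sec E U)"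
  shows "\<phi> V (Res E U V s) u = (if cover u \<in> V then \<phi> U s u else 0\<^sub>v n)"
proof -
  have hom: "sheaf_hom punctured_line E (rep_bundle n \<rho>) \<phi>"
    using iso unfolding sheaf_iso_def by (rule conjunct1)
  have "\<phi> V (Res E U V s) = Res (rep_bundle n \<rho>) U V (\<phi> U s)"
    by (rule hom[unfolded sheaf_hom_def, THEN spec, THEN mp, OF conjI[OF assms(1,2)], THEN conjunct2, THEN conjunct2, THEN conjunct2,
        THEN spec, THEN mp, OF conjI[OF assms(3,4)], THEN bspec, OF assms(5)])
  then show ?thesis by (simp add: rep_bundle_def)
qed

text \<open>The columns of \<open>b\<close> are sections by the transformation rule. The coefficients of a section \<open>f\<close> are the
entries of \<open>b(u)\<^sup>-\<^sup>1 f(u)\<close>, which are periodic and hence functions on the punctured line.\<close>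

lemma frame_of_fundamental_matrix:
  assumes b: "\<And>u. b u \<in> carrier_mat n n" "\<And>u. b' u \<in> carrier_mat n n"
    and inv: "\<And>u. b u * b' u = 1\<^sub>m n" "\<And>u. b' u * b u = 1\<^sub>m n"
    and an: "\<And>i j. i < n \<Longrightarrow> j < n \<Longrightarrow> (\<lambda>u. b u $$ (i, j)) analytic_on UNIV"
      "\<And>i j. i < n \<Longrightarrow> j < n \<Longrightarrow> (\<lambda>u. b' u $$ (i, j)) analytic_on UNIV"
    and trans: "\<And>u. b (u + 1) = \<rho> 1 * b u"
  obtains s where "is_frame E punctured_line n s" "\<And>j u. j < n \<Longrightarrow> \<phi> punctured_line (s j) u = col (b u) j"
proof -
  let ?Y = punctured_line
  note Y = open_punctured_line order_refl[of ?Y]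
  have bsec: "(\<lambda>u. col (b u) j) \<in> carrier (Sec (rep_bundle n \<rho>) ?Y)" if j: "j < n" for j
    unfolding rep_bundle_carrier
  proof (intro conjI allI impI)
    show c: "col (b u) j \<in> carrier_vec n" for u using b(1)[of u] j by auto
    show "(\<lambda>v. vec_index (col (b v) j) i) analytic_on {u}" if "i < n" for i u
    proof -
      have "(\<lambda>v. vec_index (col (b v) j) i) = (\<lambda>v. b v $$ (i, j))"
        using that j by (simp add: carrier_matD[OF b(1)])
      then show ?thesis using analytic_on_subset[OF an(1)[OF that j] subset_UNIV] by simp
    qed
    show "col (b (u + of_int k)) j = \<rho> k *\<^sub>v col (b u) j" for k u
    proof (rule int_translates[OF mrep c])
      show "col (b (u + 1)) j = \<rho> 1 *\<^sub>v col (b u) j" for u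
        unfolding trans using col_mult2[OF rho(1) b(1) j] .
    qed
  qed simp
  have "\<forall>j. \<exists>s. j < n \<longrightarrow> s \<in> carrier (Sec E ?Y) \<and> \<phi> ?Y s = (\<lambda>u. col (b u) j)"
  proof
    fix j
    show "\<exists>s. j < n \<longrightarrow> s \<in> carrier (Sec E ?Y) \<and> \<phi> ?Y s = (\<lambda>u. col (b u) j)"
    proof (cases "j < n")
      case True
      from \<phi>_surj[OF Y bsec[OF this]] show ?thesis by (elim bexE) (rule exI, rule impI, rule conjI)
    qed simp
  qed
  from choice[OF this] obtain s where s': "\<forall>j. j < n \<longrightarrow> s j \<in> carrier (Sec E ?Y) \<and> \<phi> ?Y (s j) = (\<lambda>u. col (b u) j)" ..
  then have s: "s j \<in> carrier (Sec E ?Y)" "\<phi> ?Y (s j) = (\<lambda>u. col (b u) j)" if "j < n" for j using that by auto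
  have lin: "\<phi> V (lincomb E V n c (\<lambda>i. Res E ?Y V (s i))) u =
      (if cover u \<in> V then b u *\<^sub>v Matrix.vec n (\<lambda>i. c i (cover u)) else 0\<^sub>v n)"
    if V: "open V" "V \<subseteq> ?Y" and c: "\<forall>i<n. c i \<in> carrier (hol_ring V)" for V c u
  proof -
    have rs: "Res E ?Y V (s i) \<in> carrier (Sec E V)" if "i < n" for i
      by (rule Res_closed[OF Y(1) V subset_UNIV s(1)[OF that]])
    have "\<phi> V (lincomb E V n c (\<lambda>i. Res E ?Y V (s i))) u =
        Matrix.vec n (\<lambda>r. \<Sum>i<n. c i (cover u) * vec_index (\<phi> V (Res E ?Y V (s i)) u) r)"
      by (rule \<phi>_lincomb[OF V]) (use c rs in auto)
    also have "\<dots> = (if cover u \<in> V then b u *\<^sub>v Matrix.vec n (\<lambda>i. c i (cover u)) else 0\<^sub>v n)"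
    proof (cases "cover u \<in> V")
      case True
      have "(\<Sum>i<n. c i (cover u) * vec_index (\<phi> V (Res E ?Y V (s i)) u) r) =
          vec_index (b u *\<^sub>v Matrix.vec n (\<lambda>i. c i (cover u))) r" if r: "r < n" for r
        unfolding mult_vec_entry[OF b(1) vec_carrier r]
        using True r carrier_matD[OF b(1)] by (intro sum.cong refl) (simp add: \<phi>_Res[OF Y V s(1)] s(2))
      then show ?thesis using True carrier_matD[OF b(1)[of u]] by (auto intro!: eq_vecI)
    next
      case False
      then have "c i (cover u) = 0" if "i < n" for i using c that by (auto simp: hol_ring_iff)
      then show ?thesis using False by (auto intro!: eq_vecI)
    qed
    finally show ?thesis .
  qed
  have fr: "is_frame E ?Y n s"
  proof (rule is_frameI[OF Y(1) subset_UNIV s(1)])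
    fix V t assume V: "open V" "V \<subseteq> ?Y" and t: "t \<in> carrier (Sec E V)"
    note tc = \<phi>_closed[OF V t, unfolded rep_bundle_carrier]
    define g where "g i u = vec_index (b' u *\<^sub>v \<phi> V t u) i" for i u
    have tv: "\<phi> V t u \<in> carrier_vec n" for u using tc by blast
    have "\<exists>c\<in>carrier (hol_ring V). \<forall>u. c (cover u) = g i u" if i: "i < n" for i
    proof (rule descend_periodic[OF V])
      fix u
      have "b' (u + 1) *\<^sub>v \<phi> V t (u + 1) = b' u *\<^sub>v \<phi> V t u"
      proof -
        have "\<phi> V t (u + of_int 1) = \<rho> 1 *\<^sub>v \<phi> V t u" using tc by blast
        then have "\<phi> V t (u + 1) = \<rho> 1 *\<^sub>v \<phi> V t u" by simp
        also have "\<dots> = \<rho> 1 *\<^sub>v (b u *\<^sub>v (b' u *\<^sub>v \<phi> V t u))"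
          using assoc_mult_mat_vec[OF b(1) b(2) tv, of u u u] inv(1)[of u] tv[of u] by simp
        also have "\<dots> = b (u + 1) *\<^sub>v (b' u *\<^sub>v \<phi> V t u)"
          unfolding trans by (rule assoc_mult_mat_vec[OF rho(1) b(1) mult_mat_vec_carrier[OF b(2) tv], symmetric])
        finally have "b' (u + 1) *\<^sub>v \<phi> V t (u + 1) = b' (u + 1) *\<^sub>v (b (u + 1) *\<^sub>v (b' u *\<^sub>v \<phi> V t u))" by simp
        also have "\<dots> = (b' (u + 1) * b (u + 1)) *\<^sub>v (b' u *\<^sub>v \<phi> V t u)"
          by (rule assoc_mult_mat_vec[OF b(2) b(1) mult_mat_vec_carrier[OF b(2) tv], symmetric])
        also have "\<dots> = b' u *\<^sub>v \<phi> V t u" 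
          using mult_mat_vec_carrier[OF b(2) tv] by (simp add: inv(2))
        finally show ?thesis .
      qed
      then show "g i (u + 1) = g i u" by (simp add: g_def)
    next
      fix u assume u: "cover u \<in> V"
      have "g i = (\<lambda>u. \<Sum>j<n. b' u $$ (i, j) * vec_index (\<phi> V t u) j)"
        by (rule ext) (simp only: g_def mult_vec_entry[OF b(2) tv i])
      moreover have "(\<lambda>u. \<Sum>j<n. b' u $$ (i, j) * vec_index (\<phi> V t u) j) analytic_on {u}"
      proof (intro analytic_on_sum analytic_on_mult)
        fix j assume "j \<in> {..<n}"
        then have j: "j < n" by simp
        show "(\<lambda>u. b' u $$ (i, j)) analytic_on {u}" by (rule analytic_on_subset[OF an(2)[OF i j] subset_UNIV])
        show "(\<lambda>u. vec_index (\<phi> V t u) j) analytic_on {u}" using tc u j by blast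
      qed
      ultimately show "g i analytic_on {u}" by simp
    next
      fix u assume "cover u \<notin> V"
      then have "\<phi> V t u = 0\<^sub>v n" using tc by blast
      then show "g i u = 0" using mult_vec_entry[OF b(2) zero_carrier_vec i, of u] by (simp add: g_def)
    qed
    then have "\<forall>i. \<exists>c. i < n \<longrightarrow> c \<in> carrier (hol_ring V) \<and> (\<forall>u. c (cover u) = g i u)" by blast
    from choice[OF this] obtain c where c: "\<forall>i. i < n \<longrightarrow> c i \<in> carrier (hol_ring V) \<and> (\<forall>u. c i (cover u) = g i u)" ..
    then have c1: "\<forall>i<n. c i \<in> carrier (hol_ring V)" by blast
    have "t = lincomb E V n c (\<lambda>i. Res E ?Y V (s i))"
    proof (rule \<phi>_inj[OF V t])
      show "lincomb E V n c (\<lambda>i. Res E ?Y V (s i)) \<in> carrier (Sec E V)"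
        using lincomb_closed[OF V(1) subset_UNIV c1[rule_format] Res_closed[OF Y(1) V subset_UNIV s(1)]] .
      show "\<phi> V t = \<phi> V (lincomb E V n c (\<lambda>i. Res E ?Y V (s i)))"
      proof
        fix u
        show "\<phi> V t u = \<phi> V (lincomb E V n c (\<lambda>i. Res E ?Y V (s i))) u"
        proof (cases "cover u \<in> V")
          case True
          have "Matrix.vec n (\<lambda>i. c i (cover u)) = b' u *\<^sub>v \<phi> V t u"
            using c carrier_matD[OF b(2)[of u]] by (intro eq_vecI) (auto simp: g_def)
          then have "b u *\<^sub>v Matrix.vec n (\<lambda>i. c i (cover u)) = \<phi> V t u"
            using assoc_mult_mat_vec[OF b(1) b(2) tv, of u u u] inv(1)[of u] tv[of u] by simp
          then show ?thesis using True lin[OF V c1] by simp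
        next
          case False
          then show ?thesis using tc lin[OF V c1] by simp
        qed
      qed
    qed
    with c1 show "\<exists>c. (\<forall>i<n. c i \<in> carrier (hol_ring V)) \<and> t = lincomb E V n c (\<lambda>i. Res E ?Y V (s i))" by blast
  next
    fix V c d assume V: "open V" "V \<subseteq> ?Y" and c: "\<forall>i<n. c i \<in> carrier (hol_ring V)" and d: "\<forall>i<n. d i \<in> carrier (hol_ring V)"
      and eq: "lincomb E V n c (\<lambda>i. Res E ?Y V (s i)) = lincomb E V n d (\<lambda>i. Res E ?Y V (s i))"
    show "\<forall>i<n. c i = d i"
    proof (intro allI impI ext)
      fix i x assume i: "i < n"
      show "c i x = d i x"
      proof (cases "x \<in> V")
        case True
        then obtain u where u: "x = cover u" using V(2) punctured_cover by blast
        let ?v = "\<lambda>c. Matrix.vec n (\<lambda>i. c i x)"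
        have "b u *\<^sub>v ?v c = b u *\<^sub>v ?v d" using lin[OF V c, of u] lin[OF V d, of u] eq True u by simp
        then have "b' u *\<^sub>v (b u *\<^sub>v ?v c) = b' u *\<^sub>v (b u *\<^sub>v ?v d)" by simp
        then have "(b' u * b u) *\<^sub>v ?v c = (b' u * b u) *\<^sub>v ?v d"
          using assoc_mult_mat_vec[OF b(2) b(1) vec_carrier, of u u] by simp
        then have "?v c = ?v d" by (simp add: inv(2))
        then have "vec_index (?v c) i = vec_index (?v d) i" by simp
        then show ?thesis using i by simp
      next
        case False
        then show ?thesis using c d i by (auto simp: hol_ring_iff)
      qed
    qed
  qed
  show ?thesis by (rule that[OF fr]) (simp add: s(2))
qed

end

section \<open>Quotients of fundamental matrices\<close>

text \<open>The multivalued matrix function \<open>z\<^sup>L\<close> with \<open>z = exp(2 \<pi> i v)\<close>, as a function on the universal cover.\<close>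

abbreviation log_exp :: "complex mat \<Rightarrow> complex \<Rightarrow> complex mat" where
  "log_exp L v \<equiv> mat_exp ((2 * of_real pi * \<i> * v) \<cdot>\<^sub>m L)"

lemma log_exp:
  assumes L: "L \<in> carrier_mat n n"
  shows log_exp_carrier: "log_exp L v \<in> carrier_mat n n"
    and log_exp_deriv: "has_mat_deriv n (log_exp L) ((2 * of_real pi * \<i>) \<cdot>\<^sub>m (log_exp L v * L)) v"
    and log_exp_inverse: "log_exp L v * log_exp L (- v) = 1\<^sub>m n" "log_exp L (- v) * log_exp L v = 1\<^sub>m n"
    and log_exp_add: "log_exp L (v + w) = log_exp L v * log_exp L w"
    and log_exp_zero: "log_exp L 0 = 1\<^sub>m n"
proof -
  show c: "log_exp L v \<in> carrier_mat n n" using L by (simp add: mat_exp_carrier)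
  show "has_mat_deriv n (log_exp L) ((2 * of_real pi * \<i>) \<cdot>\<^sub>m (log_exp L v * L)) v"
    by (rule has_mat_deriv_chain[where g = "\<lambda>v. 2 * of_real pi * \<i> * v", OF has_mat_deriv_exp(1)[OF L]])
       (auto intro!: derivative_eq_intros)
  show "log_exp L v * log_exp L (- v) = 1\<^sub>m n" "log_exp L (- v) * log_exp L v = 1\<^sub>m n"
    using mat_exp_add(2,3)[OF L, of "2 * of_real pi * \<i> * v"] by simp_all
  show "log_exp L (v + w) = log_exp L v * log_exp L w"
    using mat_exp_add(1)[OF L] by (simp add: distrib_left)
  show "log_exp L 0 = 1\<^sub>m n" using mat_exp_zero[OF L] by simp
qed

lemma log_exp_analytic:
  assumes L: "L \<in> carrier_mat n n" and f: "\<And>u. (f has_field_derivative a) (at u)" and ij: "i < n" "j < n"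
  shows "(\<lambda>u. log_exp L (f u) $$ (i, j)) analytic_on UNIV"
proof -
  have "has_mat_deriv n (\<lambda>u. log_exp L (f u)) (a \<cdot>\<^sub>m ((2 * of_real pi * \<i>) \<cdot>\<^sub>m (log_exp L (f u) * L))) u" for u
    by (rule has_mat_deriv_chain[OF log_exp_deriv[OF L] f])
  from has_mat_derivD(3)[OF this ij] show ?thesis
    by (subst analytic_on_open[OF open_UNIV]) (auto simp: holomorphic_on_def field_differentiable_def)
qed

text \<open>If both \<open>log_exp L\<close> and its product with \<open>H\<close> are fundamental matrices, with connection matrices
\<open>L dt / t\<close> and \<open>M dt / t\<close>, then \<open>H\<close> intertwines the two connections.\<close>

lemma quotient_ode:
  assumes L: "L \<in> carrier_mat n n" and M: "M \<in> carrier_mat n n"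
    and H: "has_mat_deriv n H H' t" and t: "t = exp (2 * of_real pi * \<i> * v)"
    and F: "has_mat_deriv n (\<lambda>v. log_exp L v * H (exp (2 * of_real pi * \<i> * v))) ((2 * of_real pi * \<i>) \<cdot>\<^sub>m (log_exp L v * H t * M)) v"
  shows "t \<cdot>\<^sub>m H' = - 1 \<cdot>\<^sub>m (L * H t) + 1 \<cdot>\<^sub>m (H t * M)"
proof -
  let ?p = "2 * complex_of_real pi * \<i>"
  let ?E = "log_exp L v"
  note HD = has_mat_derivD[OF H]
  have Ec: "?E \<in> carrier_mat n n" "log_exp L (- v) \<in> carrier_mat n n" by (rule log_exp_carrier[OF L])+
  have Hc: "has_mat_deriv n (\<lambda>v. H (exp (?p * v))) ((?p * t) \<cdot>\<^sub>m H') v"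
    by (rule has_mat_deriv_chain) (use H t in \<open>auto intro!: derivative_eq_intros\<close>)
  have X: "(?p \<cdot>\<^sub>m (?E * L)) * H (exp (?p * v)) + ?E * ((?p * t) \<cdot>\<^sub>m H') = ?p \<cdot>\<^sub>m (?E * H t * M)"
    by (rule has_mat_deriv_unique[OF has_mat_deriv_mult[OF log_exp_deriv[OF L] Hc] F])
  have "?E * ((?p * t) \<cdot>\<^sub>m H') = ?p \<cdot>\<^sub>m (?E * (t \<cdot>\<^sub>m H'))"
    using HD(1) Ec by (intro eq_matI) (auto simp: mult_smult_distrib[of _ n n _ n])
  moreover have "(?p \<cdot>\<^sub>m (?E * L)) * H (exp (?p * v)) = ?p \<cdot>\<^sub>m (?E * (L * H t))"
    using Ec L HD(2)[of t] t
    by (simp add: mult_smult_assoc_mat[of _ n n _ n] assoc_mult_mat[of _ n n _ n _ n])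
  moreover have "?E * H t * M = ?E * (H t * M)" using Ec M HD(2)[of t] by (intro assoc_mult_mat) auto
  ultimately have X': "?p \<cdot>\<^sub>m (?E * (L * H t)) + ?p \<cdot>\<^sub>m (?E * (t \<cdot>\<^sub>m H')) = ?p \<cdot>\<^sub>m (?E * (H t * M))"
    using X by simp
  define A B C where "A = L * H t" and "B = t \<cdot>\<^sub>m H'" and "C = H t * M"
  have abc: "A \<in> carrier_mat n n" "B \<in> carrier_mat n n" "C \<in> carrier_mat n n"
    using L M HD(1) HD(2)[of t] by (auto simp: A_def B_def C_def)
  have "?E * A + ?E * B = ?E * C"
  proof (rule eq_matI)
    fix i j assume "i < dim_row (?E * C)" "j < dim_col (?E * C)"
    then have ij: "i < n" "j < n" using Ec abc by auto
    have cc: "?E * A \<in> carrier_mat n n" "?E * B \<in> carrier_mat n n" "?E * C \<in> carrier_mat n n"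
      using Ec abc by (auto simp: sq_mult)
    have "(?p \<cdot>\<^sub>m (?E * A) + ?p \<cdot>\<^sub>m (?E * B)) $$ (i, j) = (?p \<cdot>\<^sub>m (?E * C)) $$ (i, j)"
      using X' by (simp only: A_def B_def C_def)
    then have "?p * (?E * A) $$ (i, j) + ?p * (?E * B) $$ (i, j) = ?p * (?E * C) $$ (i, j)"
      using smult_add_entry[OF cc(1,2) ij] carrier_matD[OF cc(3)] ij by (simp del: index_mult_mat(1))
    then have "?p * ((?E * A) $$ (i, j) + (?E * B) $$ (i, j)) = ?p * (?E * C) $$ (i, j)"
      by (simp only: distrib_left)
    then have "(?E * A) $$ (i, j) + (?E * B) $$ (i, j) = (?E * C) $$ (i, j)" by (simp del: index_mult_mat(1))
    then show "(?E * A + ?E * B) $$ (i, j) = (?E * C) $$ (i, j)"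
      using carrier_matD[OF cc(2)] ij by (simp del: index_mult_mat(1))
  qed (use Ec abc in auto)
  then have "?E * (A + B) = ?E * C" using mult_add_distrib_mat[OF Ec(1) abc(1,2)] by simp
  then have "log_exp L (- v) * (?E * (A + B)) = log_exp L (- v) * (?E * C)" by simp
  then have "A + B = C"
    using assoc_mult_mat[OF Ec(2,1) add_carrier_mat[OF abc(2)], of A] assoc_mult_mat[OF Ec(2,1) abc(3)]
      log_exp_inverse(2)[OF L, of v] abc by simp
  then have sum: "(A + B) $$ (i, j) = C $$ (i, j)" for i j by simp
  have "B = - 1 \<cdot>\<^sub>m A + 1 \<cdot>\<^sub>m C"
  proof (rule eq_matI)
    fix i j assume "i < dim_row (- 1 \<cdot>\<^sub>m A + 1 \<cdot>\<^sub>m C)" "j < dim_col (- 1 \<cdot>\<^sub>m A + 1 \<cdot>\<^sub>m C)"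
    then have ij: "i < n" "j < n" using abc by auto
    have "A $$ (i, j) + B $$ (i, j) = C $$ (i, j)" using sum[of i j] ij abc by simp
    then show "B $$ (i, j) = (- 1 \<cdot>\<^sub>m A + 1 \<cdot>\<^sub>m C) $$ (i, j)" using ij abc by (simp add: algebra_simps)
  qed (use abc in auto)
  then show ?thesis by (simp add: A_def B_def C_def)
qed

text \<open>Differentiating \<open>H G = 1\<close> gives \<open>G' = - G H' G\<close>.\<close>

lemma inverse_ode:
  assumes L: "L \<in> carrier_mat n n" and M: "M \<in> carrier_mat n n"
    and H: "has_mat_deriv n H H' t" and G: "has_mat_deriv n G G' t"
    and HG: "\<forall>\<^sub>F s in nhds t. H s * G s = 1\<^sub>m n" and GH: "G t * H t = 1\<^sub>m n"
    and ode: "t \<cdot>\<^sub>m H' = - 1 \<cdot>\<^sub>m (L * H t) + 1 \<cdot>\<^sub>m (H t * M)"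
  shows "t \<cdot>\<^sub>m G' = - 1 \<cdot>\<^sub>m (M * G t) + 1 \<cdot>\<^sub>m (G t * L)"
proof -
  note HD = has_mat_derivD[OF H] and GD = has_mat_derivD[OF G]
  have c: "H t \<in> carrier_mat n n" "G t \<in> carrier_mat n n" "H' \<in> carrier_mat n n" "G' \<in> carrier_mat n n"
    using HD(1,2) GD(1,2) by auto
  have HGt: "H t * G t = 1\<^sub>m n" using HG by (rule eventually_nhds_x_imp_x)
  have zero: "H' * G t + H t * G' = 0\<^sub>m n n"
  proof (rule eq_matI)
    fix i j assume "i < dim_row (0\<^sub>m n n :: complex mat)" "j < dim_col (0\<^sub>m n n :: complex mat)"
    then have ij: "i < n" "j < n" by auto
    have "((\<lambda>s. (H s * G s) $$ (i, j)) has_field_derivative (H' * G t + H t * G') $$ (i, j)) (at t)"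
      by (rule has_mat_derivD(3)[OF has_mat_deriv_mult[OF H G] ij])
    moreover have "\<forall>\<^sub>F s in nhds t. (H s * G s) $$ (i, j) = (1\<^sub>m n) $$ (i, j)"
      using HG by eventually_elim simp
    ultimately have "((\<lambda>s. (1\<^sub>m n) $$ (i, j)) has_field_derivative (H' * G t + H t * G') $$ (i, j)) (at t)"
      by (simp only: DERIV_cong_ev[OF refl _ refl])
    from DERIV_unique[OF this DERIV_const] show "(H' * G t + H t * G') $$ (i, j) = 0\<^sub>m n n $$ (i, j)"
      using ij by (simp del: index_mult_mat(1) index_add_mat(1))
  qed (use c in auto)
  define X where "X = t \<cdot>\<^sub>m G'"
  have X: "X \<in> carrier_mat n n" using c by (simp add: X_def)
  have z1: "G t * (t \<cdot>\<^sub>m (H' * G t + H t * G')) = 0\<^sub>m n n"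
    unfolding zero smult_zero_mat by (rule right_mult_zero_mat[OF c(2)])
  have z2: "t \<cdot>\<^sub>m (H' * G t + H t * G') = (t \<cdot>\<^sub>m H') * G t + H t * X"
    unfolding X_def mult_smult_assoc_mat[OF c(3,2)] mult_smult_distrib[OF c(1,4)]
    by (rule add_smult_distrib_left_mat[OF sq_mult[OF c(3,2)] sq_mult[OF c(1,4)]])
  have z3: "G t * ((t \<cdot>\<^sub>m H') * G t + H t * X) = G t * ((t \<cdot>\<^sub>m H') * G t) + X"
  proof -
    have "(t \<cdot>\<^sub>m H') * G t \<in> carrier_mat n n" using c by (intro sq_mult) auto
    from mult_add_distrib_mat[OF c(2) this sq_mult[OF c(1) X]]
    show ?thesis unfolding assoc_mult_mat[OF c(2,1) X, symmetric] GH left_mult_one_mat[OF X] .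
  qed
  have z4: "G t * ((t \<cdot>\<^sub>m H') * G t) = - 1 \<cdot>\<^sub>m (G t * L) + 1 \<cdot>\<^sub>m (M * G t)"
  proof -
    note LH = sq_mult[OF L c(1)] and HM = sq_mult[OF c(1) M]
    have s0: "(t \<cdot>\<^sub>m H') * G t = (- 1 \<cdot>\<^sub>m (L * H t)) * G t + (1 \<cdot>\<^sub>m (H t * M)) * G t"
      unfolding ode by (rule add_mult_distrib_mat[OF smult_carrier_mat[OF LH] smult_carrier_mat[OF HM] c(2)])
    have s1: "(- 1 \<cdot>\<^sub>m (L * H t)) * G t = - 1 \<cdot>\<^sub>m L"
      unfolding mult_smult_assoc_mat[OF LH c(2)] assoc_mult_mat[OF L c(1,2)] HGt right_mult_one_mat[OF L] ..
    have s2: "(1 \<cdot>\<^sub>m (H t * M)) * G t = 1 \<cdot>\<^sub>m (H t * (M * G t))"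
      unfolding mult_smult_assoc_mat[OF HM c(2)] assoc_mult_mat[OF c(1) M c(2)] ..
    have MG: "G t * (H t * (M * G t)) = M * G t"
      unfolding assoc_mult_mat[OF c(2,1) sq_mult[OF M c(2)], symmetric] GH by (rule left_mult_one_mat[OF sq_mult[OF M c(2)]])
    have "G t * ((t \<cdot>\<^sub>m H') * G t) = G t * (- 1 \<cdot>\<^sub>m L) + G t * (1 \<cdot>\<^sub>m (H t * (M * G t)))"
      unfolding s0 s1 s2 by (rule mult_add_distrib_mat[OF c(2) smult_carrier_mat[OF L] smult_carrier_mat[OF sq_mult[OF c(1) sq_mult[OF M c(2)]]]])
    also have "G t * (- 1 \<cdot>\<^sub>m L) = - 1 \<cdot>\<^sub>m (G t * L)" by (rule mult_smult_distrib[OF c(2) L])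
    also have "G t * (1 \<cdot>\<^sub>m (H t * (M * G t))) = 1 \<cdot>\<^sub>m (M * G t)"
      unfolding mult_smult_distrib[OF c(2) sq_mult[OF c(1) sq_mult[OF M c(2)]], of 1] MG ..
    finally show ?thesis .
  qed
  note e = z1[unfolded z2 z3 z4]
  define A B where "A = G t * L" and "B = M * G t"
  have AB: "A \<in> carrier_mat n n" "B \<in> carrier_mat n n" unfolding A_def B_def by (intro sq_mult c L M)+
  have "X = - 1 \<cdot>\<^sub>m B + 1 \<cdot>\<^sub>m A"
  proof (rule eq_matI)
    fix i j assume "i < dim_row (- 1 \<cdot>\<^sub>m B + 1 \<cdot>\<^sub>m A)" "j < dim_col (- 1 \<cdot>\<^sub>m B + 1 \<cdot>\<^sub>m A)"
    then have ij: "i < n" "j < n" using AB by auto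
    have "(- 1 \<cdot>\<^sub>m A + 1 \<cdot>\<^sub>m B + X) $$ (i, j) = - A $$ (i, j) + B $$ (i, j) + X $$ (i, j)" using ij AB X by simp
    moreover have "(- 1 \<cdot>\<^sub>m A + 1 \<cdot>\<^sub>m B + X) $$ (i, j) = 0" unfolding A_def B_def e using ij by simp
    ultimately have z: "- A $$ (i, j) + B $$ (i, j) + X $$ (i, j) = 0" by (rule subst)
    have "X $$ (i, j) = (- A $$ (i, j) + B $$ (i, j) + X $$ (i, j)) + (A $$ (i, j) - B $$ (i, j))" by simp
    then have "X $$ (i, j) = A $$ (i, j) - B $$ (i, j)" unfolding z by simp
    then show "X $$ (i, j) = (- 1 \<cdot>\<^sub>m B + 1 \<cdot>\<^sub>m A) $$ (i, j)" using ij AB by simp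
  qed (simp_all add: carrier_matD[OF AB(1)] carrier_matD[OF AB(2)] carrier_matD[OF X])
  then show ?thesis unfolding A_def B_def X_def .
qed

lemma hol_ring_extend:
  assumes W: "open W" "p \<in> W" and f: "f \<in> carrier (hol_ring (W - {p}))"
    and g: "g analytic_on {0}" "\<forall>\<^sub>F t in at 0. f (chart p t) = g t"
  shows "(\<lambda>x. if x = p then g 0 else f x) \<in> carrier (hol_ring W)" (is "?h \<in> _")
  unfolding hol_ring_iff
proof (intro conjI allI impI)
  have o: "open (W - {p})" using W by (simp add: open_Diff_finite)
  have off: "hol_on ?h (W - {p})"
    using f hol_on_cong[OF o, of ?h f] by (simp add: hol_ring_iff)
  show "hol_on ?h W"
    unfolding hol_on_def
  proof
    fix q assume q: "q \<in> W"
    show "(\<lambda>t. ?h (chart q t)) analytic_on {0}"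
    proof (cases "q = p")
      case False
      then show ?thesis using off q unfolding hol_on_def by blast
    next
      case True
      have "\<forall>\<^sub>F t in at 0. chart p t \<noteq> p"
        using eventually_chart_notin_finite[OF finite.insertI[OF finite.emptyI], of p p] by simp
      with g(2) have "\<forall>\<^sub>F t in at 0. ?h (chart p t) = g t" by eventually_elim simp
      then have "\<forall>\<^sub>F t in nhds 0. ?h (chart p t) = g t"
        unfolding eventually_nhds_conv_at by (simp add: chart_zero)
      from analytic_at_cong[OF this refl] show ?thesis unfolding True using g(1) by simp
    qed
  qed
  show "?h x = 0" if "x \<notin> W" for x using that f W by (auto simp: hol_ring_iff)
qed

lemma (in omodule_sheaf) is_frame_cong:
  assumes fr: "is_frame E U n e" and U: "open U" "U \<subseteq> X" and eq: "\<And>i. i < n \<Longrightarrow> e i = e' i"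
  shows "is_frame E U n e'"
proof (rule is_frameI[OF U])
  note ce = is_frame_closed[OF fr]
  show "e' i \<in> carrier (Sec E U)" if "i < n" for i using ce[OF that] eq[OF that] by simp
  fix V assume V: "open V" "V \<subseteq> U"
  have VX: "V \<subseteq> X" using V U by auto
  have l: "lincomb E V n c (\<lambda>i. Res E U V (e i)) = lincomb E V n c (\<lambda>i. Res E U V (e' i))"
    if "\<forall>i<n. c i \<in> carrier (hol_ring V)" for c
    by (rule lincomb_cong[OF V(1) VX _ Res_closed[OF U(1) V U(2) ce] refl]) (use that eq in auto)
  show "\<exists>c. (\<forall>i<n. c i \<in> carrier (hol_ring V)) \<and> s = lincomb E V n c (\<lambda>i. Res E U V (e' i))" if s: "s \<in> carrier (Sec E V)" for s
  proof -
    obtain c where c: "\<And>i. i < n \<Longrightarrow> c i \<in> carrier (hol_ring V)" "s = lincomb E V n c (\<lambda>i. Res E U V (e i))"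
      by (rule frame_coeffs[OF fr V s]) blast
    have cc: "\<forall>i<n. c i \<in> carrier (hol_ring V)" using c(1) by blast
    show ?thesis
    proof (intro exI conjI)
      show "s = lincomb E V n c (\<lambda>i. Res E U V (e' i))" unfolding c(2) by (rule l[OF cc])
    qed (rule cc)
  qed
  show "\<forall>i<n. c i = d i" if c: "\<forall>i<n. c i \<in> carrier (hol_ring V)" and d: "\<forall>i<n. d i \<in> carrier (hol_ring V)"
    and eq: "lincomb E V n c (\<lambda>i. Res E U V (e' i)) = lincomb E V n d (\<lambda>i. Res E U V (e' i))" for c d
  proof (intro allI impI)
    fix i assume i: "i < n"
    have eq': "lincomb E V n c (\<lambda>i. Res E U V (e i)) = lincomb E V n d (\<lambda>i. Res E U V (e i))"
      unfolding l[OF c] l[OF d] by (rule eq)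
    show "c i = d i" by (rule frame_unique[OF fr U V _ _ eq' i]) (use c d in blast)+
  qed
qed

lemma eventually_cover_in:
  assumes V: "open V" and f: "isCont f v" and v: "cover (f v) \<in> V"
  shows "\<forall>\<^sub>F w in nhds v. cover (f w) \<in> V"
proof -
  let ?z = "\<lambda>w. exp (2 * of_real pi * \<i> * f w)"
  have "\<forall>\<^sub>F t in nhds 0. chart (cover (f v)) t \<in> V" using V v by (rule eventually_chart_in(1))
  then have ev: "\<forall>\<^sub>F t in nhds 0. Affine (?z v + t) \<in> V" by (simp add: cover_def)
  define g where "g = (\<lambda>w. ?z w - ?z v)"
  have "isCont g v" unfolding g_def using f by (intro continuous_diff continuous_exp continuous_mult continuous_const)
  then have "filterlim g (nhds (g v)) (nhds v)"
    unfolding isCont_def by (rule tendsto_at_iff_tendsto_nhds[THEN iffD1])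
  moreover have "g v = 0" by (simp add: g_def)
  ultimately have "filterlim g (nhds 0) (nhds v)" by simp
  from eventually_compose_filterlim[OF ev this] have "\<forall>\<^sub>F w in nhds v. Affine (?z v + g w) \<in> V" .
  then show ?thesis by (simp add: cover_def g_def)
qed

section \<open>Extension of the canonical frame across a pole\<close>

lemma has_mat_deriv_entries:
  assumes "\<And>i j. i < n \<Longrightarrow> j < n \<Longrightarrow> F i j analytic_on {t}"
  shows "has_mat_deriv n (\<lambda>t. Matrix.mat n n (\<lambda>(i, j). F i j t)) (Matrix.mat n n (\<lambda>(i, j). deriv (F i j) t)) t"
  unfolding has_mat_deriv_def
proof (intro conjI allI impI)
  fix i j assume ij: "i < n" "j < n"
  have "(F i j has_field_derivative deriv (F i j) t) (at t)"
    using analytic_on_imp_differentiable_at[OF assms[OF ij]] by (simp add: DERIV_deriv_iff_field_differentiable)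
  then show "((\<lambda>v. Matrix.mat n n (\<lambda>(i, j). F i j v) $$ (i, j)) has_field_derivative
      Matrix.mat n n (\<lambda>(i, j). deriv (F i j) t) $$ (i, j)) (at t)"
    using ij by simp
qed simp_all

text \<open>The spectra of the two residues lie in the same strip of width one, so no difference of eigenvalues
is a nonzero integer, and \<open>matrix_ode_pole_order\<close> with \<open>K = 0\<close> excludes poles.\<close>

lemma hol_ring_extend_ode:
  fixes A B :: "complex \<Rightarrow> complex mat"
  assumes W: "open W" "p \<in> W" and Z: "\<And>i j. i < n \<Longrightarrow> j < n \<Longrightarrow> Z i j \<in> carrier (hol_ring (W - {p}))"
    and A: "\<And>z. A z \<in> carrier_mat n n" "\<And>i j. i < n \<Longrightarrow> j < n \<Longrightarrow> (\<lambda>z. A z $$ (i, j)) analytic_on {0}"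
    and B: "\<And>z. B z \<in> carrier_mat n n" "\<And>i j. i < n \<Longrightarrow> j < n \<Longrightarrow> (\<lambda>z. B z $$ (i, j)) analytic_on {0}"
    and strip: "\<And>a. eigenvalue (A 0) a \<Longrightarrow> 0 \<le> Re a \<and> Re a < 1" "\<And>b. eigenvalue (B 0) b \<Longrightarrow> 0 \<le> Re b \<and> Re b < 1"
    and ode: "\<forall>\<^sub>F t in at 0. t \<cdot>\<^sub>m Matrix.mat n n (\<lambda>(i, j). deriv (\<lambda>t. Z i j (chart p t)) t) =
      - 1 \<cdot>\<^sub>m (A t * Matrix.mat n n (\<lambda>(i, j). Z i j (chart p t))) + 1 \<cdot>\<^sub>m (Matrix.mat n n (\<lambda>(i, j). Z i j (chart p t)) * B t)"
    and ij: "i < n" "j < n"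
  shows "\<exists>f\<in>carrier (hol_ring W). \<forall>x. x \<noteq> p \<longrightarrow> f x = Z i j x"
proof -
  have "\<forall>\<^sub>F t in at 0. chart p t \<notin> {p}" by (rule eventually_chart_notin_finite) simp
  with eventually_chart_in(2)[OF W] have "\<forall>\<^sub>F t in at 0. chart p t \<in> W - {p}" by eventually_elim simp
  then have X: "\<forall>\<^sub>F t in at 0. has_mat_deriv n (\<lambda>t. Matrix.mat n n (\<lambda>(i, j). Z i j (chart p t)))
      (Matrix.mat n n (\<lambda>(i, j). deriv (\<lambda>t. Z i j (chart p t)) t)) t"
  proof eventually_elim
    case (elim t)
    show ?case
    proof (rule has_mat_deriv_entries)
      fix i j assume "i < n" "j < n"
      from Z[OF this] show "(\<lambda>t. Z i j (chart p t)) analytic_on {t}"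
        using hol_on_chart_analytic[of "Z i j" "W - {p}" p t] elim unfolding hol_ring_iff by blast
    qed
  qed
  have "\<exists>g. g analytic_on {0} \<and> (\<forall>\<^sub>F z in at 0. z ^ 0 * Matrix.mat n n (\<lambda>(i, j). Z i j (chart p z)) $$ (i, j) = g z)"
  proof (rule matrix_ode_pole_order[OF A B X ode _ _ ij])
    fix a b :: complex and k :: nat assume ab: "eigenvalue (A 0) a" "eigenvalue (B 0) b" and k: "0 < k"
    show "- 1 * a + 1 * b \<noteq> - of_nat k"
    proof
      assume "- 1 * a + 1 * b = - of_nat k"
      from arg_cong[OF this, of Re] have "Re b - Re a = - real k" by simp
      moreover have "real k \<ge> 1" using k by simp
      ultimately show False using strip(1)[OF ab(1)] strip(2)[OF ab(2)] by linarith
    qed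
  qed simp_all
  then obtain g where g: "g analytic_on {0}" "\<forall>\<^sub>F t in at 0. Z i j (chart p t) = g t" using ij by auto
  show ?thesis
    by (rule bexI[OF _ hol_ring_extend[OF W Z[OF ij] g]]) simp
qed

lemma hol_ring_product_extends:
  assumes W: "open W" and A: "\<And>i j. i < n \<Longrightarrow> j < n \<Longrightarrow> A i j \<in> carrier (hol_ring W)"
    and B: "\<And>i j. i < n \<Longrightarrow> j < n \<Longrightarrow> B i j \<in> carrier (hol_ring W)"
    and eq: "\<And>x. x \<in> W \<Longrightarrow> x \<noteq> p \<Longrightarrow> (\<Sum>l<n. A i l x * B l j x) = c"
    and ij: "i < n" "j < n" and x: "x \<in> W"
  shows "(\<Sum>l<n. A i l x * B l j x) = c"
proof -
  let ?f = "\<lambda>x. (\<Sum>l<n. A i l x * B l j x) + zero_off W (\<lambda>_. - c) x"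
  have "?f \<in> carrier (hol_ring W)"
    by (intro hol_ring_add hol_ring_sum hol_ring_mult A B ij hol_ring_const W) auto
  from hol_ring_eq_zero[OF W this, of "{p}"] have "?f = (\<lambda>_. 0)" using eq by (simp add: zero_off_apply)
  then have "?f x = 0" by (rule fun_cong)
  then show ?thesis using x by (simp add: zero_off_apply)
qed

context rep_realization
begin

text \<open>The matrix \<open>H\<close> that expresses \<open>e\<close> in the canonical frame, whose components are the columns of
\<open>log_exp L\<close>, satisfies \<open>t H' = - L H + H h\<close>, and its inverse \<open>G\<close> satisfies the equation with the roles
exchanged. So both extend holomorphically over \<open>p\<close>, and the canonical frame extends as the
transform of \<open>e\<close> by \<open>G\<close>. The sign \<open>\<sigma>\<close> accounts for the orientation: in terms of the
local coordinate \<open>t = exp(2 \<pi> i v)\<close> at \<open>p\<close>, the point of the universal cover is \<open>u = \<sigma> v\<close>.\<close>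

lemma local_frame_extension:
  fixes \<sigma> :: int
  assumes sp: "\<sigma> = 1 \<and> p = Affine 0 \<or> \<sigma> = - 1 \<and> p = Infty"
    and L: "L \<in> carrier_mat n n" and expL: "log_exp L 1 = \<rho> \<sigma>"
    and Lstrip: "\<And>a. eigenvalue L a \<Longrightarrow> 0 \<le> Re a \<and> Re a < 1"
    and U: "open U" "p \<in> U" and fr: "is_frame E U n e"
    and h: "\<And>i j. i < n \<Longrightarrow> j < n \<Longrightarrow> h i j analytic_on {0}"
    and hstrip: "\<And>a. eigenvalue (Matrix.mat n n (\<lambda>(i, j). h i j 0)) a \<Longrightarrow> 0 \<le> Re a \<and> Re a < 1"
    and ode: "\<forall>\<^sub>F t in at 0. \<forall>v. exp (2 * of_real pi * \<i> * v) = t \<longrightarrow> (\<forall>r<n. \<forall>j<n.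
      deriv (\<lambda>v. vec_index (\<phi> (U \<inter> punctured_line) (Res E U (U \<inter> punctured_line) (e j)) (of_int \<sigma> * v)) r) v =
      2 * of_real pi * \<i> * (\<Sum>i<n. h i j t * vec_index (\<phi> (U \<inter> punctured_line) (Res E U (U \<inter> punctured_line) (e i)) (of_int \<sigma> * v)) r))"
  obtains \<epsilon> where "is_frame E (punctured_line \<union> {p}) n \<epsilon>"
    "\<And>j u. j < n \<Longrightarrow> \<phi> punctured_line (Res E (punctured_line \<union> {p}) punctured_line (\<epsilon> j)) u = col (log_exp L (of_int \<sigma> * u)) j"
proof -
  let ?Y = punctured_line
  define V where "V = U \<inter> ?Y"
  define W where "W = U \<inter> (?Y \<union> {p})"
  have pY: "p \<notin> ?Y" using sp by (auto simp: punctured_line_def)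
  have "?Y \<union> {p} = - {if p = Infty then Affine 0 else Infty}" using sp by (auto simp: punctured_line_def)
  then have oYp: "open (?Y \<union> {p})" by (simp add: open_Compl_finite)
  have V: "open V" "V \<subseteq> ?Y" "V \<subseteq> U" using U by (auto simp: V_def)
  have W: "open W" "p \<in> W" "W \<subseteq> U"
    using open_Int[OF U(1) oYp] U(2) unfolding W_def by blast+
  have WV: "W - {p} = V" "V \<subseteq> W" "W \<inter> ?Y = V" "W \<union> ?Y = ?Y \<union> {p}" using pY U by (auto simp: W_def V_def)
  note oY = open_punctured_line
  have \<sigma>2: "of_int \<sigma> * (of_int \<sigma> * x) = (x :: complex)" for x using sp by auto
  have chart: "chart p (exp (2 * of_real pi * \<i> * v)) = cover (of_int \<sigma> * v)" for v
    using sp by (auto simp: cover_def exp_minus inverse_eq_divide)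
  (* the columns transform by \<rho> 1 at both poles: at infinity both \<sigma> and the monodromy are inverted *)
  have L1: "log_exp L (of_int \<sigma>) = \<rho> 1"
  proof (cases "\<sigma> = 1")
    case False
    then have \<sigma>: "\<sigma> = - 1" using sp by auto
    note r = rho(1)[of 1] rho(1)[of "- 1"] log_exp_carrier[OF L, of "- 1"]
    have 1: "\<rho> 1 * \<rho> (- 1) = 1\<^sub>m n" using rho(3)[of 1 "- 1"] rho(2) by simp
    have 2: "\<rho> (- 1) * log_exp L (- 1) = 1\<^sub>m n" using log_exp_inverse(1)[OF L, of 1] unfolding expL \<sigma> .
    have "log_exp L (- 1) = \<rho> 1"
      using assoc_mult_mat[OF r] unfolding 1 2 left_mult_one_mat[OF r(3)] right_mult_one_mat[OF r(1)] .
    then show ?thesis using \<sigma> by simp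
  qed (use expL in simp)
  obtain s where s: "is_frame E ?Y n s" "\<And>j u. j < n \<Longrightarrow> \<phi> ?Y (s j) u = col (log_exp L (of_int \<sigma> * u)) j"
  proof (rule frame_of_fundamental_matrix[of "\<lambda>u. log_exp L (of_int \<sigma> * u)" "\<lambda>u. log_exp L (- (of_int \<sigma> * u))"])
    show "log_exp L (of_int \<sigma> * (u + 1)) = \<rho> 1 * log_exp L (of_int \<sigma> * u)" for u
    proof -
      have u: "of_int \<sigma> * (u + 1) = of_int \<sigma> + of_int \<sigma> * u" by (simp add: distrib_left)
      show ?thesis unfolding u log_exp_add[OF L] L1 ..
    qed
    show "(\<lambda>u. log_exp L (of_int \<sigma> * u) $$ (i, j)) analytic_on UNIV" if "i < n" "j < n" for i j
      by (rule log_exp_analytic[OF L _ that, of _ "of_int \<sigma>"]) (auto intro!: derivative_eq_intros)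
    show "(\<lambda>u. log_exp L (- (of_int \<sigma> * u)) $$ (i, j)) analytic_on UNIV" if "i < n" "j < n" for i j
      by (rule log_exp_analytic[OF L _ that, of _ "- of_int \<sigma>"]) (auto intro!: derivative_eq_intros)
    show "log_exp L (of_int \<sigma> * u) \<in> carrier_mat n n" for u by (rule log_exp_carrier[OF L])
    show "log_exp L (- (of_int \<sigma> * u)) \<in> carrier_mat n n" for u by (rule log_exp_carrier[OF L])
    show "log_exp L (of_int \<sigma> * u) * log_exp L (- (of_int \<sigma> * u)) = 1\<^sub>m n" for u by (rule log_exp_inverse(1)[OF L])
    show "log_exp L (- (of_int \<sigma> * u)) * log_exp L (of_int \<sigma> * u) = 1\<^sub>m n" for u by (rule log_exp_inverse(2)[OF L])
  qed (rule that)
  note sc = is_frame_closed[OF s(1)] and ec = is_frame_closed[OF fr]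
  have fs: "is_frame E V n (\<lambda>i. Res E ?Y V (s i))" by (rule frame_Res[OF s(1) oY subset_UNIV V(1,2)])
  have fe: "is_frame E V n (\<lambda>i. Res E U V (e i))" by (rule frame_Res[OF fr U(1) subset_UNIV V(1,3)])
  obtain H G where H: "\<forall>i<n. \<forall>j<n. H i j \<in> carrier (hol_ring V)" and G: "\<forall>i<n. \<forall>j<n. G i j \<in> carrier (hol_ring V)"
    and eH: "\<forall>j<n. Res E U V (e j) = lincomb E V n (\<lambda>i. H i j) (\<lambda>i. Res E ?Y V (s i))"
    and sG: "\<forall>j<n. Res E ?Y V (s j) = lincomb E V n (\<lambda>i. G i j) (\<lambda>i. Res E U V (e i))"
    and HG: "\<forall>i<n. \<forall>j<n. \<forall>x\<in>V. (\<Sum>l<n. H i l x * G l j x) = (if i = j then 1 else 0)"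
    and GH: "\<forall>i<n. \<forall>j<n. \<forall>x\<in>V. (\<Sum>l<n. G i l x * H l j x) = (if i = j then 1 else 0)"
    using frame_transition[OF fs fe V(1) subset_UNIV] by (elim exE conjE) (rule that)
  define Hm where "Hm = (\<lambda>t. Matrix.mat n n (\<lambda>(i, j). H i j (chart p t)))"
  define Gm where "Gm = (\<lambda>t. Matrix.mat n n (\<lambda>(i, j). G i j (chart p t)))"
  define M where "M = (\<lambda>t. Matrix.mat n n (\<lambda>(i, j). h i j t))"
  define Hd where "Hd = (\<lambda>t. Matrix.mat n n (\<lambda>(i, j). deriv (\<lambda>t. H i j (chart p t)) t))"
  define Gd where "Gd = (\<lambda>t. Matrix.mat n n (\<lambda>(i, j). deriv (\<lambda>t. G i j (chart p t)) t))"
  have cM: "Hm t \<in> carrier_mat n n" "Gm t \<in> carrier_mat n n" "M t \<in> carrier_mat n n" for t by (simp_all add: Hm_def Gm_def M_def)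
  define f where "f = (\<lambda>j v r. vec_index (\<phi> V (Res E U V (e j)) (of_int \<sigma> * v)) r)"
  (* components of e on the universal cover *)
  have f: "f j v r = (log_exp L v * Hm (exp (2 * of_real pi * \<i> * v))) $$ (r, j)"
    if v: "cover (of_int \<sigma> * v) \<in> V" and rj: "r < n" "j < n" for j v r
  proof -
    let ?u = "of_int \<sigma> * v"
    have "\<phi> V (Res E U V (e j)) ?u = Matrix.vec n (\<lambda>r. \<Sum>i<n. H i j (cover ?u) * vec_index (\<phi> V (Res E ?Y V (s i)) ?u) r)"
      unfolding eH[THEN spec, THEN mp, OF rj(2)]
    proof (rule \<phi>_lincomb[OF V(1,2)])
      show "H i j \<in> carrier (hol_ring V)" if "i < n" for i using H that rj by blast
      show "Res E ?Y V (s i) \<in> carrier (Sec E V)" if "i < n" for i by (rule is_frame_closed[OF fs that])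
    qed
    then have "f j v r = (\<Sum>i<n. H i j (cover ?u) * vec_index (\<phi> V (Res E ?Y V (s i)) ?u) r)"
      using rj by (simp add: f_def)
    also have "\<dots> = (\<Sum>i<n. log_exp L v $$ (r, i) * Hm (exp (2 * of_real pi * \<i> * v)) $$ (i, j))"
    proof (rule sum.cong[OF refl])
      fix i assume "i \<in> {..<n}"
      then have i: "i < n" by simp
      have "\<phi> V (Res E ?Y V (s i)) ?u = col (log_exp L v) i"
        unfolding \<phi>_Res[OF oY order_refl V(1,2) sc[OF i]] using v s(2)[OF i, of ?u] \<sigma>2 by simp
      moreover have "vec_index (col (log_exp L v) i) r = log_exp L v $$ (r, i)"
        using carrier_matD[OF log_exp_carrier[OF L, of v]] rj i by simp
      moreover have "Hm (exp (2 * of_real pi * \<i> * v)) $$ (i, j) = H i j (cover ?u)" using i rj chart by (simp add: Hm_def)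
      ultimately show "H i j (cover ?u) * vec_index (\<phi> V (Res E ?Y V (s i)) ?u) r =
          log_exp L v $$ (r, i) * Hm (exp (2 * of_real pi * \<i> * v)) $$ (i, j)" by simp
    qed
    also have "\<dots> = (log_exp L v * Hm (exp (2 * of_real pi * \<i> * v))) $$ (r, j)"
      by (rule sq_mult_entry[OF log_exp_carrier[OF L] cM(1) rj, symmetric])
    finally show ?thesis .
  qed
  have "\<forall>\<^sub>F t in at 0. chart p t \<notin> {p}" by (rule eventually_chart_notin_finite) simp
  with eventually_chart_in(2)[OF W(1,2)] have evV: "\<forall>\<^sub>F t in at 0. chart p t \<in> V"
    by eventually_elim (use WV(1) in blast)
  then obtain d where d: "d > 0" "\<And>t. t \<noteq> 0 \<Longrightarrow> dist t 0 < d \<Longrightarrow> chart p t \<in> V"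
    unfolding eventually_at by blast
  have HmD: "has_mat_deriv n Hm (Hd t) t" if "chart p t \<in> V" for t
    unfolding Hm_def Hd_def
  proof (rule has_mat_deriv_entries)
    fix i j assume "i < n" "j < n"
    then have "hol_on (H i j) V" using H unfolding hol_ring_iff by blast
    then show "(\<lambda>t. H i j (chart p t)) analytic_on {t}" using that by (rule hol_on_chart_analytic)
  qed
  have GmD: "has_mat_deriv n Gm (Gd t) t" if "chart p t \<in> V" for t
    unfolding Gm_def Gd_def
  proof (rule has_mat_deriv_entries)
    fix i j assume "i < n" "j < n"
    then have "hol_on (G i j) V" using G unfolding hol_ring_iff by blast
    then show "(\<lambda>t. G i j (chart p t)) analytic_on {t}" using that by (rule hol_on_chart_analytic)
  qed
  have HGm: "Hm t * Gm t = 1\<^sub>m n" if "chart p t \<in> V" for t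
  proof (rule eq_matI)
    fix i j assume "i < dim_row (1\<^sub>m n :: complex mat)" "j < dim_col (1\<^sub>m n :: complex mat)"
    then have ij: "i < n" "j < n" by auto
    have "(\<Sum>l<n. Hm t $$ (i, l) * Gm t $$ (l, j)) = (\<Sum>l<n. H i l (chart p t) * G l j (chart p t))"
      using ij by (intro sum.cong refl) (simp add: Hm_def Gm_def)
    then show "(Hm t * Gm t) $$ (i, j) = 1\<^sub>m n $$ (i, j)"
      unfolding sq_mult_entry[OF cM(1,2) ij] using HG that ij by simp
  qed (simp_all add: carrier_matD[OF cM(1)] carrier_matD[OF cM(2)])
  have GHm: "Gm t * Hm t = 1\<^sub>m n" if "chart p t \<in> V" for t
  proof (rule eq_matI)
    fix i j assume "i < dim_row (1\<^sub>m n :: complex mat)" "j < dim_col (1\<^sub>m n :: complex mat)"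
    then have ij: "i < n" "j < n" by auto
    have "(\<Sum>l<n. Gm t $$ (i, l) * Hm t $$ (l, j)) = (\<Sum>l<n. G i l (chart p t) * H l j (chart p t))"
      using ij by (intro sum.cong refl) (simp add: Hm_def Gm_def)
    then show "(Gm t * Hm t) $$ (i, j) = 1\<^sub>m n $$ (i, j)"
      unfolding sq_mult_entry[OF cM(2,1) ij] using GH that ij by simp
  qed (simp_all add: carrier_matD[OF cM(1)] carrier_matD[OF cM(2)])
  have ev0: "\<forall>\<^sub>F t in at (0 :: complex). t \<noteq> 0 \<and> dist t 0 < d"
    unfolding eventually_at using d(1) by blast
  have odeH: "\<forall>\<^sub>F t in at 0. t \<cdot>\<^sub>m Hd t = - 1 \<cdot>\<^sub>m (L * Hm t) + 1 \<cdot>\<^sub>m (Hm t * M t)"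
    using ode ev0
  proof eventually_elim
    case (elim t)
    then have t: "t \<noteq> 0" "chart p t \<in> V" using d(2) by auto
    define v where "v = Ln t / (2 * of_real pi * \<i>)"
    have v: "t = exp (2 * of_real pi * \<i> * v)" using t by (simp add: v_def)
    have cv: "cover (of_int \<sigma> * v) \<in> V" using t(2) unfolding v chart .
    let ?p = "2 * complex_of_real pi * \<i>"
    let ?F = "\<lambda>v. log_exp L v * Hm (exp (?p * v))"
    have Hc: "has_mat_deriv n (\<lambda>v. Hm (exp (?p * v))) ((?p * t) \<cdot>\<^sub>m Hd t) v"
      by (rule has_mat_deriv_chain) (use HmD[OF t(2)] v in \<open>auto intro!: derivative_eq_intros\<close>)
    define D where "D = (?p \<cdot>\<^sub>m (log_exp L v * L)) * Hm (exp (?p * v)) + log_exp L v * ((?p * t) \<cdot>\<^sub>m Hd t)"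
    have FD: "has_mat_deriv n ?F D v"
      unfolding D_def by (rule has_mat_deriv_mult[OF log_exp_deriv[OF L] Hc])
    have cE: "log_exp L v * Hm t \<in> carrier_mat n n" by (rule sq_mult[OF log_exp_carrier[OF L] cM(1)])
    have cEM: "log_exp L v * Hm t * M t \<in> carrier_mat n n" by (rule sq_mult[OF cE cM(3)])
    have "D = ?p \<cdot>\<^sub>m (log_exp L v * Hm t * M t)"
    proof (rule eq_matI)
      fix r j assume "r < dim_row (?p \<cdot>\<^sub>m (log_exp L v * Hm t * M t))" "j < dim_col (?p \<cdot>\<^sub>m (log_exp L v * Hm t * M t))"
      then have rj: "r < n" "j < n" using carrier_matD[OF cEM] by auto
      have "isCont (\<lambda>v. of_int \<sigma> * v) v" by simp
      from eventually_cover_in[OF V(1) this cv]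
      have "\<forall>\<^sub>F w in nhds v. f j w r = ?F w $$ (r, j)" by (rule eventually_mono) (rule f[OF _ rj])
      from deriv_cong_ev[OF this refl] have "deriv (\<lambda>w. f j w r) v = D $$ (r, j)"
        unfolding DERIV_imp_deriv[OF has_mat_derivD(3)[OF FD rj]] .
      moreover have "deriv (\<lambda>w. f j w r) v = ?p * (\<Sum>i<n. h i j t * f i v r)"
        using elim(1)[unfolded V_def[symmetric], THEN spec, THEN mp, OF v[symmetric], THEN spec, THEN mp, OF rj(1), THEN spec, THEN mp, OF rj(2)]
        unfolding f_def .
      moreover have "(\<Sum>i<n. h i j t * f i v r) = (\<Sum>i<n. (log_exp L v * Hm t) $$ (r, i) * M t $$ (i, j))"
      proof (rule sum.cong[OF refl])
        fix i assume "i \<in> {..<n}"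
        then show "h i j t * f i v r = (log_exp L v * Hm t) $$ (r, i) * M t $$ (i, j)"
          using f[OF cv rj(1), of i] rj by (simp add: M_def v[symmetric] del: index_mult_mat(1))
      qed
      moreover have "\<dots> = (log_exp L v * Hm t * M t) $$ (r, j)" by (rule sq_mult_entry[OF cE cM(3) rj, symmetric])
      ultimately have "D $$ (r, j) = ?p * (log_exp L v * Hm t * M t) $$ (r, j)" by (simp only:)
      then show "D $$ (r, j) = (?p \<cdot>\<^sub>m (log_exp L v * Hm t * M t)) $$ (r, j)"
        using carrier_matD[OF cEM] rj by (simp del: index_mult_mat(1))
    qed (use carrier_matD[OF cEM] carrier_matD[OF has_mat_derivD(1)[OF FD]] in simp_all)
    with FD have F': "has_mat_deriv n ?F (?p \<cdot>\<^sub>m (log_exp L v * Hm t * M t)) v" by (rule subst[rotated])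
    show ?case by (rule quotient_ode[OF L cM(3) HmD[OF t(2)] v F'])
  qed
  have odeG: "\<forall>\<^sub>F t in at 0. t \<cdot>\<^sub>m Gd t = - 1 \<cdot>\<^sub>m (M t * Gm t) + 1 \<cdot>\<^sub>m (Gm t * L)"
    using odeH ev0
  proof eventually_elim
    case (elim t)
    then have t: "chart p t \<in> V" using d(2) by auto
    have "\<forall>\<^sub>F s in nhds t. s \<in> ball 0 d - {0}"
      by (rule eventually_nhds_in_open) (use elim in \<open>auto simp: dist_commute\<close>)
    then have "\<forall>\<^sub>F s in nhds t. Hm s * Gm s = 1\<^sub>m n"
      by (rule eventually_mono) (rule HGm, rule d(2), auto simp: dist_commute)
    from inverse_ode[OF L cM(3) HmD[OF t] GmD[OF t] this GHm[OF t] elim(1)] show ?case .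
  qed
  have LA: "(\<lambda>z. L $$ (i, j)) analytic_on {0}" for i j by (rule analytic_on_const)
  have MA: "(\<lambda>z. M z $$ (i, j)) analytic_on {0}" if "i < n" "j < n" for i j using h that by (simp add: M_def)
  have Mstrip: "0 \<le> Re a \<and> Re a < 1" if "eigenvalue (M 0) a" for a using that hstrip unfolding M_def by blast
  have exH: "\<exists>f\<in>carrier (hol_ring W). \<forall>x. x \<noteq> p \<longrightarrow> f x = H i j x" if ij: "i < n" "j < n" for i j
  proof (rule hol_ring_extend_ode[where Z = H and A = "\<lambda>_. L" and B = M, OF W(1,2) _ L LA cM(3) MA Lstrip Mstrip odeH[unfolded Hd_def Hm_def] ij])
    show "H i j \<in> carrier (hol_ring (W - {p}))" if "i < n" "j < n" for i j unfolding WV(1) using H that by blast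
  qed
  have exG: "\<exists>f\<in>carrier (hol_ring W). \<forall>x. x \<noteq> p \<longrightarrow> f x = G i j x" if ij: "i < n" "j < n" for i j
  proof (rule hol_ring_extend_ode[where Z = G and A = M and B = "\<lambda>_. L", OF W(1,2) _ cM(3) MA L LA Mstrip Lstrip odeG[unfolded Gd_def Gm_def] ij])
    show "G i j \<in> carrier (hol_ring (W - {p}))" if "i < n" "j < n" for i j unfolding WV(1) using G that by blast
  qed
  define H' where "H' = (\<lambda>i j. SOME f. f \<in> carrier (hol_ring W) \<and> (\<forall>x. x \<noteq> p \<longrightarrow> f x = H i j x))"
  define G' where "G' = (\<lambda>i j. SOME f. f \<in> carrier (hol_ring W) \<and> (\<forall>x. x \<noteq> p \<longrightarrow> f x = G i j x))"
  have H'12: "H' i j \<in> carrier (hol_ring W) \<and> (\<forall>x. x \<noteq> p \<longrightarrow> H' i j x = H i j x)" if "i < n" "j < n" for i j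
    unfolding H'_def by (rule someI_ex[OF exH[OF that, unfolded Bex_def]])
  have G'12: "G' i j \<in> carrier (hol_ring W) \<and> (\<forall>x. x \<noteq> p \<longrightarrow> G' i j x = G i j x)" if "i < n" "j < n" for i j
    unfolding G'_def by (rule someI_ex[OF exG[OF that, unfolded Bex_def]])
  note H'c = H'12[THEN conjunct1] and G'c = G'12[THEN conjunct1]
  have H'x: "H' i j x = H i j x" if "i < n" "j < n" "x \<noteq> p" for i j x using H'12[OF that(1,2)] that(3) by blast
  have G'x: "G' i j x = G i j x" if "i < n" "j < n" "x \<noteq> p" for i j x using G'12[OF that(1,2)] that(3) by blast
  have GH': "(\<Sum>l<n. G' i l x * H' l j x) = (if i = j then 1 else 0)" if ij: "i < n" "j < n" and x: "x \<in> W" for i j x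
  proof (rule hol_ring_product_extends[where p = p, OF W(1) G'c H'c _ ij x])
    fix x assume x: "x \<in> W" "x \<noteq> p"
    then have xV: "x \<in> V" using WV(1) by blast
    have "(\<Sum>l<n. G' i l x * H' l j x) = (\<Sum>l<n. G i l x * H l j x)"
      using ij x(2) by (intro sum.cong refl) (simp add: G'x H'x)
    then show "(\<Sum>l<n. G' i l x * H' l j x) = (if i = j then 1 else 0)" using GH ij xV by simp
  qed
  have HG': "(\<Sum>l<n. H' i l x * G' l j x) = (if i = j then 1 else 0)" if ij: "i < n" "j < n" and x: "x \<in> W" for i j x
  proof (rule hol_ring_product_extends[where p = p, OF W(1) H'c G'c _ ij x])
    fix x assume x: "x \<in> W" "x \<noteq> p"
    then have xV: "x \<in> V" using WV(1) by blast
    have "(\<Sum>l<n. H' i l x * G' l j x) = (\<Sum>l<n. H i l x * G l j x)"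
      using ij x(2) by (intro sum.cong refl) (simp add: G'x H'x)
    then show "(\<Sum>l<n. H' i l x * G' l j x) = (if i = j then 1 else 0)" using HG ij xV by simp
  qed
  have feW: "is_frame E W n (\<lambda>i. Res E U W (e i))" by (rule frame_Res[OF fr U(1) subset_UNIV W(1,3)])
  define e' where "e' = (\<lambda>j. lincomb E W n (\<lambda>i. G' i j) (\<lambda>i. Res E U W (e i)))"
  have fe': "is_frame E W n e'"
    unfolding e'_def by (rule frame_transform[OF feW W(1) subset_UNIV G'c H'c GH' HG'])
  note e'c = is_frame_closed[OF fe']
  (* over the punctured part, the transform of e by G is the canonical frame *)
  have agree: "Res E W (W \<inter> ?Y) (e' j) = Res E ?Y (W \<inter> ?Y) (s j)" if j: "j < n" for j
  proof -
    have "Res E W V (e' j) = lincomb E V n (\<lambda>i. zero_off V (G' i j)) (\<lambda>i. Res E U V (e i))"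
      unfolding e'_def by (rule lincomb_Res_Res[OF U(1) subset_UNIV W(1,3) V(1) WV(2)]) (use G'c j ec in auto)
    also have "\<dots> = lincomb E V n (\<lambda>i. G i j) (\<lambda>i. Res E U V (e i))"
    proof (rule lincomb_cong[OF V(1) subset_UNIV _ _ _ refl])
      fix i assume i: "i < n"
      show "zero_off V (G' i j) \<in> carrier (hol_ring V)" by (rule zero_off_restrict[OF V(1) WV(2) G'c[OF i j]])
      show "Res E U V (e i) \<in> carrier (Sec E V)" by (rule is_frame_closed[OF fe i])
      show "zero_off V (G' i j) = G i j"
      proof
        fix x
        have "G i j x = 0" if "x \<notin> V" using G i j that unfolding hol_ring_iff by blast
        moreover have "x \<noteq> p" if "x \<in> V" using that pY V(2) by blast
        ultimately show "zero_off V (G' i j) x = G i j x" using G'x[OF i j] by (auto simp: zero_off_def)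
      qed
    qed
    also have "\<dots> = Res E ?Y V (s j)" using sG j by simp
    finally show ?thesis unfolding WV(3) .
  qed
  have "\<forall>j. \<exists>r. j < n \<longrightarrow> r \<in> carrier (Sec E (W \<union> ?Y)) \<and> Res E (W \<union> ?Y) W r = e' j \<and> Res E (W \<union> ?Y) ?Y r = s j"
  proof
    fix j
    show "\<exists>r. j < n \<longrightarrow> r \<in> carrier (Sec E (W \<union> ?Y)) \<and> Res E (W \<union> ?Y) W r = e' j \<and> Res E (W \<union> ?Y) ?Y r = s j"
    proof (cases "j < n")
      case True
      obtain r where "r \<in> carrier (Sec E (W \<union> ?Y))" "Res E (W \<union> ?Y) W r = e' j" "Res E (W \<union> ?Y) ?Y r = s j"
        by (rule section_glue[OF W(1) oY subset_UNIV e'c[OF True] sc[OF True] agree[OF True]])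
      then show ?thesis by (intro exI[of _ r] impI conjI)
    qed simp
  qed
  from choice[OF this] obtain \<epsilon> where \<epsilon>: "\<forall>j. j < n \<longrightarrow> \<epsilon> j \<in> carrier (Sec E (W \<union> ?Y)) \<and> Res E (W \<union> ?Y) W (\<epsilon> j) = e' j \<and> Res E (W \<union> ?Y) ?Y (\<epsilon> j) = s j" ..
  have f\<epsilon>: "is_frame E (W \<union> ?Y) n \<epsilon>"
  proof (rule frame_union[OF W(1) oY subset_UNIV])
    show "\<epsilon> i \<in> carrier (Sec E (W \<union> ?Y))" if "i < n" for i using \<epsilon> that by blast
    show "is_frame E W n (\<lambda>i. Res E (W \<union> ?Y) W (\<epsilon> i))"
      by (rule is_frame_cong[OF fe' W(1) subset_UNIV]) (use \<epsilon> in simp)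
    show "is_frame E ?Y n (\<lambda>i. Res E (W \<union> ?Y) ?Y (\<epsilon> i))"
      by (rule is_frame_cong[OF s(1) oY subset_UNIV]) (use \<epsilon> in simp)
  qed
  show ?thesis
  proof (rule that)
    show "is_frame E (?Y \<union> {p}) n \<epsilon>" using f\<epsilon> unfolding WV(4) .
    show "\<phi> ?Y (Res E (?Y \<union> {p}) ?Y (\<epsilon> j)) u = col (log_exp L (of_int \<sigma> * u)) j" if j: "j < n" for j u
    proof -
      have "Res E (?Y \<union> {p}) ?Y (\<epsilon> j) = s j" using \<epsilon> j unfolding WV(4) by blast
      then show ?thesis using s(2)[OF j] by simp
    qed
  qed
qed

end

section \<open>The connection near a pole\<close>

text \<open>This transfers the compatibilities of linear combinations to plain sums.\<close>

lemma (in omodule_sheaf) finsum_eq_lincomb: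
  assumes U: "open U" "U \<subseteq> X" and g: "\<And>i. i < n \<Longrightarrow> g i \<in> carrier (Sec E U)"
  shows "(\<Oplus>\<^bsub>Sec E U\<^esub>i\<in>{..<n}. g i) = lincomb E U n (\<lambda>_. zero_off U (\<lambda>_. 1)) g"
proof -
  interpret M: module "hol_ring U" "Sec E U" by (rule module_Sec[OF U])
  have one: "zero_off U (\<lambda>_. 1) \<odot>\<^bsub>Sec E U\<^esub> g i = g i" if "i < n" for i
    using M.smult_one[OF g[OF that]] by simp
  show ?thesis
    unfolding lincomb_def
  proof (rule M.finsum_cong'[OF refl, symmetric])
    show "g \<in> {..<n} \<rightarrow> carrier (Sec E U)" using g by simp
    show "zero_off U (\<lambda>_. 1) \<odot>\<^bsub>Sec E U\<^esub> g i = g i" if "i \<in> {..<n}" for i using one that by simp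
  qed
qed

lemma log_forms_carrier:
  "\<eta> \<in> carrier (Sec (log_forms S) U) \<longleftrightarrow> hol_on \<eta> (U - S - {Infty}) \<and> (\<forall>x. x \<notin> U - S - {Infty} \<longrightarrow> \<eta> x = 0) \<and>
    (\<forall>p\<in>U. \<exists>h. h analytic_on {0} \<and> (\<forall>\<^sub>F t in at 0. form_at p \<eta> t = (if p \<in> S then h t / t else h t)))"
  by (simp add: log_forms_def function_sheaf_def)

text \<open>The isomorphism of connections is compatible with tensoring only for holomorphic forms, so the
connection forms have to be restricted to a set away from the poles.\<close>

lemma log_forms_restrict_holomorphic:
  assumes \<eta>: "\<eta> \<in> carrier (Sec (log_forms {Affine 0, Infty}) U)" and V: "open V" "V \<subseteq> U" "V \<subseteq> punctured_line"
  shows "zero_off V \<eta> \<in> carrier (Sec (log_forms {}) V)"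
proof -
  have VS: "V \<subseteq> U - {Affine 0, Infty} - {Infty}" "V - {} - {Infty} = V" using V by (auto simp: punctured_line_def)
  have "hol_on \<eta> (U - {Affine 0, Infty} - {Infty})" using \<eta> unfolding log_forms_carrier by blast
  then have "hol_on \<eta> V" using VS(1) by (rule hol_on_subset)
  then have hol: "hol_on (zero_off V \<eta>) V" using zero_off_hol_ring[OF V(1)] unfolding hol_ring_iff by blast
  show ?thesis
    unfolding log_forms_carrier VS(2)
  proof (intro conjI allI impI ballI)
    show "zero_off V \<eta> x = 0" if "x \<notin> V" for x using that by (rule zero_off_apply)
    fix p assume p: "p \<in> V"
    then obtain a where a: "p = Affine a" using V(3) by (cases p) (auto simp: punctured_line_def)
    have "(\<lambda>t. zero_off V \<eta> (chart p t)) analytic_on {0}" using hol p unfolding hol_on_def by blast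
    moreover have "form_at p (zero_off V \<eta>) t = (if p \<in> {} then zero_off V \<eta> (chart p t) / t else zero_off V \<eta> (chart p t))" for t
      by (simp add: form_at_def a)
    ultimately show "\<exists>h. h analytic_on {0} \<and> (\<forall>\<^sub>F t in at 0. form_at p (zero_off V \<eta>) t = (if p \<in> {} then h t / t else h t))"
      by (intro exI[of _ "\<lambda>t. zero_off V \<eta> (chart p t)"]) simp
  qed (rule hol)
qed

lemma residue_simple_pole:
  assumes h: "h analytic_on {0}" and f: "\<forall>\<^sub>F t in at 0. f t = h t / t"
  shows "residue f 0 = h 0"
proof -
  obtain s where s: "open s" "0 \<in> s" "h holomorphic_on s" using h unfolding analytic_at by blast
  have "residue f 0 = residue (\<lambda>t. h t / (t - 0)) 0" by (rule residue_cong) (use f in simp_all)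
  also have "\<dots> = h 0" by (rule residue_simple[OF s])
  finally show ?thesis .
qed

text \<open>An extension of the connection of \<open>\<rho>\<close>, with a fixed isomorphism \<open>\<phi>\<close> over the punctured line, and the
induced isomorphism \<open>\<psi>\<close> of the sheaves of forms with values in the bundles.\<close>

locale log_extension =
  fixes C :: "('s, 't) connection" and n :: nat and \<rho> :: "int \<Rightarrow> complex mat"
    and \<phi> :: "cp1 set \<Rightarrow> 's \<Rightarrow> complex \<Rightarrow> complex Matrix.vec" and \<psi> :: "cp1 set \<Rightarrow> 't \<Rightarrow> complex \<Rightarrow> complex Matrix.vec"
  assumes mrep': "monodromy_rep n \<rho>" and con: "log_connection UNIV {Affine 0, Infty} C"
    and iso_\<phi>: "sheaf_iso punctured_line (vbundle C) (rep_bundle n \<rho>) \<phi>"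
    and iso_\<psi>: "sheaf_iso punctured_line (forms C) (rep_bundle n \<rho>) \<psi>"
    and compat: "\<And>U s. open U \<Longrightarrow> U \<subseteq> punctured_line \<Longrightarrow> s \<in> carrier (Sec (vbundle C) U) \<Longrightarrow>
        (\<forall>\<omega>\<in>carrier (Sec (log_forms {}) U). \<psi> U (tens C U s \<omega>) = tens (rep_connection n \<rho>) U (\<phi> U s) \<omega>) \<and>
        \<psi> U (nabla C U s) = nabla (rep_connection n \<rho>) U (\<phi> U s)"
begin

sublocale E: rep_realization "vbundle C" n \<rho> \<phi>
proof -
  have "omodule_sheaf UNIV (vbundle C)" using con unfolding log_connection_def locally_free_def by blast
  then show "rep_realization (vbundle C) n \<rho> \<phi>"
    unfolding rep_realization_def rep_realization_axioms_def using mrep' iso_\<phi> by blast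
qed

lemma tensor: "is_tensor UNIV (vbundle C) (log_forms {Affine 0, Infty}) (forms C) (tens C)"
  using con unfolding log_connection_def by (elim conjE)

sublocale F: rep_realization "forms C" n \<rho> \<psi>
proof -
  have "omodule_sheaf UNIV (forms C)" using tensor unfolding is_tensor_def by (rule conjunct1)
  then show "rep_realization (forms C) n \<rho> \<psi>"
    unfolding rep_realization_def rep_realization_axioms_def using mrep' iso_\<psi> by blast
qed

lemma tens_closed:
  assumes "open U" "s \<in> carrier (Sec (vbundle C) U)" "w \<in> carrier (Sec (log_forms {Affine 0, Infty}) U)"
  shows "tens C U s w \<in> carrier (Sec (forms C) U)"
  by (rule tensor[unfolded is_tensor_def, THEN conjunct2, THEN spec, THEN mp, OF conjI[OF assms(1) subset_UNIV],
      THEN conjunct1, THEN bspec, OF assms(2), THEN bspec, OF assms(3)])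

lemma tens_Res:
  assumes "open U" "open V" "V \<subseteq> U" "s \<in> carrier (Sec (vbundle C) U)" "w \<in> carrier (Sec (log_forms {Affine 0, Infty}) U)"
  shows "Res (forms C) U V (tens C U s w) = tens C V (Res (vbundle C) U V s) (zero_off V w)"
proof -
  have "Res (forms C) U V (tens C U s w) = tens C V (Res (vbundle C) U V s) (Res (log_forms {Affine 0, Infty}) U V w)"
    by (rule tensor[unfolded is_tensor_def, THEN conjunct2, THEN spec, THEN mp, OF conjI[OF assms(1) subset_UNIV],
        THEN conjunct2, THEN conjunct2, THEN conjunct2, THEN conjunct2, THEN conjunct1, THEN spec, THEN mp, OF conjI[OF assms(2,3)],
        THEN bspec, OF assms(4), THEN bspec, OF assms(5)])
  then show ?thesis by (simp add: log_forms_def function_sheaf_def)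
qed

lemma nabla_Res:
  assumes "open U" "open V" "V \<subseteq> U" "s \<in> carrier (Sec (vbundle C) U)"
  shows "nabla C V (Res (vbundle C) U V s) = Res (forms C) U V (nabla C U s)"
proof -
  note c = con[unfolded log_connection_def, THEN conjunct2, THEN conjunct2, THEN conjunct2, THEN spec, THEN mp, OF conjI[OF assms(1) subset_UNIV]]
  show ?thesis
    by (rule c[THEN conjunct2, THEN conjunct2, THEN conjunct2, THEN conjunct2, THEN spec, THEN mp, OF conjI[OF assms(2,3)], THEN bspec, OF assms(4)])
qed

text \<open>Apply \<open>\<psi>\<close> to both sides of the formula for the covariant derivative. On the bundle of the
representation the connection is \<open>f \<mapsto> f'(u) / (2 \<pi> i z)\<close> with \<open>z = exp(2 \<pi> i u)\<close>.\<close>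

lemma connection_matrix_ode:
  assumes U: "open U" and V: "open V" "V \<subseteq> U" "V \<subseteq> punctured_line"
    and e: "\<And>i. i < n \<Longrightarrow> e i \<in> carrier (Sec (vbundle C) U)"
    and \<omega>: "\<And>i. i < n \<Longrightarrow> \<omega> i \<in> carrier (Sec (log_forms {Affine 0, Infty}) U)"
    and s: "s \<in> carrier (Sec (vbundle C) U)" and eq: "nabla C U s = (\<Oplus>\<^bsub>Sec (forms C) U\<^esub>i\<in>{..<n}. tens C U (e i) (\<omega> i))"
    and u: "cover u \<in> V" and r: "r < n"
  shows "deriv (\<lambda>v. vec_index (\<phi> V (Res (vbundle C) U V s) v) r) u =
    2 * of_real pi * \<i> * exp (2 * of_real pi * \<i> * u) * (\<Sum>i<n. \<omega> i (cover u) * vec_index (\<phi> V (Res (vbundle C) U V (e i)) u) r)"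
proof -
  let ?E = "vbundle C" and ?F = "forms C"
  let ?D = "deriv (\<lambda>v. vec_index (\<phi> V (Res ?E U V s) v) r) u"
  let ?q = "2 * complex_of_real pi * \<i> * exp (2 * of_real pi * \<i> * u)"
  have sV: "Res ?E U V s \<in> carrier (Sec ?E V)" by (rule E.Res_closed[OF U V(1,2) subset_UNIV s])
  have eV: "Res ?E U V (e i) \<in> carrier (Sec ?E V)" if "i < n" for i by (rule E.Res_closed[OF U V(1,2) subset_UNIV e[OF that]])
  have tc: "tens C U (e i) (\<omega> i) \<in> carrier (Sec ?F U)" if "i < n" for i by (rule tens_closed[OF U e[OF that] \<omega>[OF that]])
  have tV: "Res ?F U V (tens C U (e i) (\<omega> i)) \<in> carrier (Sec ?F V)" if "i < n" for i
    by (rule F.Res_closed[OF U V(1,2) subset_UNIV tc[OF that]])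
  have \<omega>V: "zero_off V (\<omega> i) \<in> carrier (Sec (log_forms {}) V)" if "i < n" for i
    by (rule log_forms_restrict_holomorphic[OF \<omega>[OF that] V])
  have "\<psi> V (nabla C V (Res ?E U V s)) = nabla (rep_connection n \<rho>) V (\<phi> V (Res ?E U V s))"
    by (rule compat[OF V(1,3) sV, THEN conjunct2])
  then have 1: "vec_index (\<psi> V (nabla C V (Res ?E U V s)) u) r = ?D / ?q"
    using u r by (simp add: rep_connection_def)
  have one: "zero_off U (\<lambda>_. 1) \<in> carrier (hol_ring U)" by (rule hol_ring_const[OF U])
  have oneV: "zero_off V (zero_off U (\<lambda>_. 1)) \<in> carrier (hol_ring V)" by (rule zero_off_restrict[OF V(1,2) one])
  have fin: "nabla C U s = lincomb ?F U n (\<lambda>_. zero_off U (\<lambda>_. 1)) (\<lambda>i. tens C U (e i) (\<omega> i))"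
    unfolding eq by (rule F.finsum_eq_lincomb[OF U subset_UNIV]) (rule tc)
  have "nabla C V (Res ?E U V s) = lincomb ?F V n (\<lambda>_. zero_off V (zero_off U (\<lambda>_. 1))) (\<lambda>i. Res ?F U V (tens C U (e i) (\<omega> i)))"
    unfolding nabla_Res[OF U V(1,2) s] fin
    by (rule F.lincomb_Res[OF U V(1,2) subset_UNIV one tc])
  then have "\<psi> V (nabla C V (Res ?E U V s)) u = Matrix.vec n (\<lambda>r. \<Sum>i<n. zero_off V (zero_off U (\<lambda>_. 1)) (cover u) *
      vec_index (\<psi> V (Res ?F U V (tens C U (e i) (\<omega> i))) u) r)"
    using F.\<phi>_lincomb[OF V(1,3), where k = n, OF oneV tV] by (simp only:)
  moreover have "zero_off V (zero_off U (\<lambda>_. 1)) (cover u) = 1" using u V(2) by (auto simp: zero_off_def)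
  ultimately have 2: "vec_index (\<psi> V (nabla C V (Res ?E U V s)) u) r = (\<Sum>i<n. vec_index (\<psi> V (Res ?F U V (tens C U (e i) (\<omega> i))) u) r)"
    using r by simp
  have 3: "vec_index (\<psi> V (Res ?F U V (tens C U (e i) (\<omega> i))) u) r = \<omega> i (cover u) * vec_index (\<phi> V (Res ?E U V (e i)) u) r" if i: "i < n" for i
  proof -
    have "\<psi> V (Res ?F U V (tens C U (e i) (\<omega> i))) = tens (rep_connection n \<rho>) V (\<phi> V (Res ?E U V (e i))) (zero_off V (\<omega> i))"
      unfolding tens_Res[OF U V(1,2) e[OF i] \<omega>[OF i]]
      by (rule compat[OF V(1,3) eV[OF i], THEN conjunct1, THEN bspec, OF \<omega>V[OF i]])
    then show ?thesis using u r carrier_vecD[OF E.\<phi>_vec[OF V(1,3) eV[OF i], of u]]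
      by (simp add: rep_connection_def zero_off_apply)
  qed
  have "?D / ?q = (\<Sum>i<n. \<omega> i (cover u) * vec_index (\<phi> V (Res ?E U V (e i)) u) r)"
    unfolding 1[symmetric] 2 by (rule sum.cong[OF refl]) (use 3 in simp)
  then show ?thesis by (simp add: nonzero_divide_eq_eq mult.commute)
qed

text \<open>In the frame of the residue matrix, the connection forms are \<open>h i j dt / t\<close> with \<open>h i j\<close> holomorphic, and
the residues are the values \<open>h i j 0\<close>. Their matrix is similar to \<open>L\<close>, so it has the same eigenvalues
and \<open>local_frame_extension\<close> applies.\<close>

lemma frame_at_pole:
  fixes \<sigma> :: int
  assumes sp: "\<sigma> = 1 \<and> p = Affine 0 \<or> \<sigma> = - 1 \<and> p = Infty"
    and pr: "principal_residue {Affine 0, Infty} C p (\<rho> \<sigma>)"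
  obtains L \<epsilon> where "L \<in> carrier_mat n n" "log_exp L 1 = \<rho> \<sigma>" "\<And>a. eigenvalue L a \<Longrightarrow> 0 \<le> Re a \<and> Re a < 1"
    "is_frame (vbundle C) (punctured_line \<union> {p}) n \<epsilon>"
    "\<And>j u. j < n \<Longrightarrow> \<phi> punctured_line (Res (vbundle C) (punctured_line \<union> {p}) punctured_line (\<epsilon> j)) u = col (log_exp L (of_int \<sigma> * u)) j"
proof -
  let ?E = "vbundle C" and ?Y = punctured_line and ?S = "{Affine 0, Infty}"
  obtain R L where R: "residue_matrix ?S C p R" and L': "principal_log (\<rho> \<sigma>) L" and sim: "similar_mat R L"
    using pr unfolding principal_residue_def by blast
  have L: "L \<in> carrier_mat n n" "log_exp L 1 = \<rho> \<sigma>" "\<And>a. eigenvalue L a \<Longrightarrow> 0 \<le> Re a \<and> Re a < 1"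
    using L' carrier_matD[OF E.rho(1)[of \<sigma>]] unfolding principal_log_def by auto
  obtain k where k: "{R, L} \<subseteq> carrier_mat k k" using similar_matD[OF sim] by blast
  then have Rn: "R \<in> carrier_mat n n" using L(1) by auto
  have ev: "eigenvalue R a \<Longrightarrow> eigenvalue L a" for a
    using eigenvalue_root_char_poly[OF Rn, of a] eigenvalue_root_char_poly[OF L(1), of a] char_poly_similar[OF sim] by simp
  obtain U n' e \<omega> where U: "open U" "p \<in> U" and fr: "is_frame ?E U n' e"
    and \<omega>: "\<forall>i<n'. \<forall>j<n'. \<omega> i j \<in> carrier (Sec (log_forms ?S) U)"
    and nab: "\<forall>j<n'. nabla C U (e j) = (\<Oplus>\<^bsub>Sec (forms C) U\<^esub>i\<in>{..<n'}. tens C U (e i) (\<omega> i j))"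
    and R': "R = Matrix.mat n' n' (\<lambda>(i, j). residue (form_at p (\<omega> i j)) 0)"
    using R unfolding residue_matrix_def by (elim exE conjE) (rule that)
  (* similarity to L forces the rank of the local frame *)
  have n': "n' = n" using Rn R' by auto
  note fr = fr[unfolded n'] and \<omega> = \<omega>[unfolded n'] and nab = nab[unfolded n'] and R' = R'[unfolded n']
  note ec = is_frame_closed[OF fr]
  define V where "V = U \<inter> ?Y"
  have V: "open V" "V \<subseteq> U" "V \<subseteq> ?Y" using U by (auto simp: V_def)
  define h where "h = (\<lambda>i j. SOME h. h analytic_on {0} \<and> (\<forall>\<^sub>F t in at 0. form_at p (\<omega> i j) t = h t / t))"
  have h: "h i j analytic_on {0} \<and> (\<forall>\<^sub>F t in at 0. form_at p (\<omega> i j) t = h i j t / t)" if ij: "i < n" "j < n" for i j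
  proof -
    have "\<omega> i j \<in> carrier (Sec (log_forms ?S) U)" using \<omega> ij by blast
    then have "\<exists>h. h analytic_on {0} \<and> (\<forall>\<^sub>F t in at 0. form_at p (\<omega> i j) t = (if p \<in> ?S then h t / t else h t))"
      using U(2) unfolding log_forms_carrier by blast
    moreover have "p \<in> ?S" using sp by auto
    ultimately have "\<exists>h. h analytic_on {0} \<and> (\<forall>\<^sub>F t in at 0. form_at p (\<omega> i j) t = h t / t)" by simp
    then show ?thesis unfolding h_def by (rule someI_ex)
  qed
  have Rh: "R = Matrix.mat n n (\<lambda>(i, j). h i j 0)"
    unfolding R' by (rule eq_matI) (simp_all add: residue_simple_pole[OF h[THEN conjunct1] h[THEN conjunct2]])
  have "\<forall>\<^sub>F t in at 0. chart p t \<notin> {p}" by (rule eventually_chart_notin_finite) simp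
  with eventually_chart_in(2)[OF U] eventually_chart_notin_finite[of ?S p] have evV: "\<forall>\<^sub>F t in at 0. chart p t \<in> V"
    by (auto simp: V_def punctured_line_def elim: eventually_elim2)
  have evh: "\<forall>\<^sub>F t in at 0. \<forall>i\<in>{..<n}. \<forall>j\<in>{..<n}. form_at p (\<omega> i j) t = h i j t / t"
    by (intro eventually_ball_finite ballI finite_lessThan) (use h in auto)
  have evn: "\<forall>\<^sub>F t in at (0 :: complex). t \<noteq> 0" by (rule eventually_neq_at_within)
  have ode: "\<forall>\<^sub>F t in at 0. \<forall>v. exp (2 * of_real pi * \<i> * v) = t \<longrightarrow> (\<forall>r<n. \<forall>j<n.
      deriv (\<lambda>v. vec_index (\<phi> V (Res ?E U V (e j)) (of_int \<sigma> * v)) r) v =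
      2 * of_real pi * \<i> * (\<Sum>i<n. h i j t * vec_index (\<phi> V (Res ?E U V (e i)) (of_int \<sigma> * v)) r))"
    using evV evh evn
  proof eventually_elim
    case (elim t)
    show ?case
    proof (intro allI impI)
      fix v r j assume v: "exp (2 * of_real pi * \<i> * v) = t" and rj: "r < n" "j < n"
      let ?u = "of_int \<sigma> * v"
      let ?f = "\<lambda>j u. vec_index (\<phi> V (Res ?E U V (e j)) u) r"
      have chart: "chart p t = cover ?u"
        unfolding v[symmetric] using sp by (auto simp: cover_def exp_minus inverse_eq_divide)
      have u: "cover ?u \<in> V" using elim(1) unfolding chart .
      have "Res ?E U V (e j) \<in> carrier (Sec ?E V)" by (rule E.Res_closed[OF U(1) V(1,2) subset_UNIV ec[OF rj(2)]])
      from E.\<phi>_closed[OF V(1,3) this] have "?f j analytic_on {?u}" using rj u unfolding rep_bundle_carrier by blast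
      then have "(?f j has_field_derivative deriv (?f j) ?u) (at ?u)"
        using analytic_on_imp_differentiable_at by (simp add: DERIV_deriv_iff_field_differentiable)
      then have "((\<lambda>v. ?f j (of_int \<sigma> * v)) has_field_derivative deriv (?f j) ?u * of_int \<sigma>) (at v)"
        by (rule DERIV_chain2) (auto intro!: derivative_eq_intros)
      then have "deriv (\<lambda>v. ?f j (of_int \<sigma> * v)) v = deriv (?f j) ?u * of_int \<sigma>" by (rule DERIV_imp_deriv)
      also have "deriv (?f j) ?u = 2 * of_real pi * \<i> * exp (2 * of_real pi * \<i> * ?u) * (\<Sum>i<n. \<omega> i j (cover ?u) * ?f i ?u)"
        by (rule connection_matrix_ode[OF U(1) V ec _ ec[OF rj(2)] _ u rj(1)]) (use \<omega> nab rj in blast)+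
      also have "\<dots> * of_int \<sigma> = 2 * of_real pi * \<i> * (\<Sum>i<n. (of_int \<sigma> * exp (2 * of_real pi * \<i> * ?u) * \<omega> i j (cover ?u)) * ?f i ?u)"
        by (simp add: sum_distrib_left sum_distrib_right mult_ac)
      also have "(\<Sum>i<n. (of_int \<sigma> * exp (2 * of_real pi * \<i> * ?u) * \<omega> i j (cover ?u)) * ?f i ?u) = (\<Sum>i<n. h i j t * ?f i ?u)"
      proof (rule sum.cong[OF refl])
        fix i assume i: "i \<in> {..<n}"
        have "form_at p (\<omega> i j) t = h i j t / t" using elim(2) i rj by simp
        then have "h i j t = t * form_at p (\<omega> i j) t" using elim(3) by simp
        also have "\<dots> = of_int \<sigma> * exp (2 * of_real pi * \<i> * ?u) * \<omega> i j (cover ?u)"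
          unfolding form_at_def chart using sp elim(3)
          by (auto simp: v[symmetric] exp_minus power2_eq_square field_simps)
        finally show "(of_int \<sigma> * exp (2 * of_real pi * \<i> * ?u) * \<omega> i j (cover ?u)) * ?f i ?u = h i j t * ?f i ?u" by simp
      qed
      finally show "deriv (\<lambda>v. ?f j (of_int \<sigma> * v)) v = 2 * of_real pi * \<i> * (\<Sum>i<n. h i j t * ?f i ?u)" .
    qed
  qed
  have hA: "h i j analytic_on {0}" if "i < n" "j < n" for i j using h[OF that] by blast
  have hstrip: "0 \<le> Re a \<and> Re a < 1" if "eigenvalue (Matrix.mat n n (\<lambda>(i, j). h i j 0)) a" for a
    by (rule L(3)[OF ev]) (use that Rh in simp)
  obtain \<epsilon> where \<epsilon>: "is_frame ?E (?Y \<union> {p}) n \<epsilon>"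
    "\<And>j u. j < n \<Longrightarrow> \<phi> ?Y (Res ?E (?Y \<union> {p}) ?Y (\<epsilon> j)) u = col (log_exp L (of_int \<sigma> * u)) j"
    using E.local_frame_extension[of \<sigma> p L U e h, OF sp L(1,2) _ U fr _ _ ode[unfolded V_def]] L(3) hA hstrip by blast
  show ?thesis
  proof (rule that)
    show "0 \<le> Re a \<and> Re a < 1" if "eigenvalue L a" for a using that by (rule L(3))
    show "\<phi> ?Y (Res ?E (?Y \<union> {p}) ?Y (\<epsilon> j)) u = col (log_exp L (of_int \<sigma> * u)) j" if "j < n" for j u
      using that by (rule \<epsilon>(2))
  qed (rule L(1,2) \<epsilon>(1))+
qed

end

section \<open>The transition between the two frames\<close>

text \<open>For \<open>H(z) = exp(2 \<pi> i v L\<^sub>b) exp(2 \<pi> i v L\<^sub>a)\<close>, the differential equation follows from that of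
\<open>log_exp La\<close>; the sum of the coefficients is the value at \<open>z = 1\<close>, that is, at \<open>v = 0\<close>.\<close>

lemma transition_linear:
  assumes La: "La \<in> carrier_mat n n" and Lb: "Lb \<in> carrier_mat n n"
    and strip: "\<And>a. eigenvalue La a \<Longrightarrow> 0 \<le> Re a \<and> Re a < 1" "\<And>a. eigenvalue Lb a \<Longrightarrow> 0 \<le> Re a \<and> Re a < 1"
    and H: "\<And>z. z \<noteq> 0 \<Longrightarrow> has_mat_deriv n H (H' z) z"
    and rel: "\<And>v. log_exp La v = log_exp Lb (- v) * H (exp (2 * of_real pi * \<i> * v))"
  obtains P0 P1 where "P0 \<in> carrier_mat n n" "P1 \<in> carrier_mat n n" "\<And>z. z \<noteq> 0 \<Longrightarrow> H z = P0 + z \<cdot>\<^sub>m P1"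
    "Lb * P0 + P0 * La = 0\<^sub>m n n" "Lb * P1 + P1 * La = P1" "P0 + P1 = 1\<^sub>m n"
proof -
  let ?p = "2 * complex_of_real pi * \<i>"
  (* quotient_ode expects the fundamental matrix of an equation, here with residue - Lb *)
  define L' where "L' = - 1 \<cdot>\<^sub>m Lb"
  have L': "L' \<in> carrier_mat n n" using Lb by (simp add: L'_def)
  have neg: "log_exp L' v = log_exp Lb (- v)" for v
  proof -
    have "(?p * v) \<cdot>\<^sub>m L' = (?p * (- v)) \<cdot>\<^sub>m Lb" using Lb by (intro eq_matI) (auto simp: L'_def)
    then show ?thesis by (rule arg_cong)
  qed
  have Hc: "H z \<in> carrier_mat n n" for z using has_mat_derivD(2)[OF H[of 1]] by simp
  have ode: "z \<cdot>\<^sub>m H' z = Lb * H z + H z * La" if z: "z \<noteq> 0" for z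
  proof -
    define v where "v = Ln z / ?p"
    have v: "z = exp (?p * v)" using z by (simp add: v_def)
    have fn: "(\<lambda>v. log_exp L' v * H (exp (?p * v))) = log_exp La" unfolding neg rel[symmetric] ..
    have val: "log_exp L' v * H z = log_exp La v" unfolding neg rel v[symmetric] ..
    have "has_mat_deriv n (\<lambda>v. log_exp L' v * H (exp (?p * v))) (?p \<cdot>\<^sub>m (log_exp L' v * H z * La)) v"
      unfolding fn val by (rule log_exp_deriv[OF La])
    from quotient_ode[OF L' La H[OF z] v this]
    have "z \<cdot>\<^sub>m H' z = - 1 \<cdot>\<^sub>m (L' * H z) + 1 \<cdot>\<^sub>m (H z * La)" .
    moreover have "- 1 \<cdot>\<^sub>m (L' * H z) = Lb * H z"
      unfolding L'_def mult_smult_assoc_mat[OF Lb Hc] by (intro eq_matI) (simp_all del: index_mult_mat(1))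
    moreover have "1 \<cdot>\<^sub>m (H z * La) = H z * La" by (intro eq_matI) (simp_all del: index_mult_mat(1))
    ultimately show ?thesis by (simp only:)
  qed
  obtain P0 P1 where P: "P0 \<in> carrier_mat n n" "P1 \<in> carrier_mat n n" "\<And>z. z \<noteq> 0 \<Longrightarrow> H z = P0 + z \<cdot>\<^sub>m P1"
    "Lb * P0 + P0 * La = 0\<^sub>m n n" "Lb * P1 + P1 * La = P1"
    by (rule log_transition_linear[OF La Lb strip H ode]; (assumption | (rule that; assumption)))
  have "log_exp Lb (- 0) = 1\<^sub>m n" using log_exp_zero[OF Lb] by simp
  then have "1\<^sub>m n = 1\<^sub>m n * H (exp (?p * 0))" using rel[of 0] log_exp_zero[OF La] by simp
  also have "\<dots> = H 1" using left_mult_one_mat[OF Hc] by simp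
  also have "\<dots> = P0 + 1 \<cdot>\<^sub>m P1" by (rule P(3)) simp
  also have "1 \<cdot>\<^sub>m P1 = P1" by (intro eq_matI) simp_all
  finally have "P0 + P1 = 1\<^sub>m n" by simp
  with P show ?thesis by (rule that)
qed

lemma invertible_column_nonzero:
  assumes S: "S \<in> carrier_mat n n" and T: "T \<in> carrier_mat n n" and TS: "T * S = (1\<^sub>m n :: complex mat)" and j: "j < n"
    and zero: "\<And>i. i < n \<Longrightarrow> S $$ (i, j) = 0"
  shows False
proof -
  have "(T * S) $$ (j, j) = (\<Sum>l<n. T $$ (j, l) * S $$ (l, j))" by (rule sq_mult_entry[OF T S j j])
  also have "\<dots> = 0" by (rule sum.neutral) (simp add: zero)
  finally show False unfolding TS using j by simp
qed

context log_extension
begin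

text \<open>The canonical frames on the two affine lines differ by \<open>P = P\<^sub>0 + z P\<^sub>1\<close>. A constant change of both
frames by the matrix \<open>S\<close> that diagonalizes the idempotent \<open>P\<^sub>1\<close> makes the transition matrix diagonal.
The number \<open>m\<close> of entries \<open>z\<close> is the rank of \<open>P\<^sub>1\<close>. The exponents \<open>a\<close> are prescribed only below \<open>n\<close>, so
that they can be chosen constant when \<open>m\<close> is \<open>0\<close> or \<open>n\<close>.\<close>

theorem splitting_frames:
  assumes pr0: "principal_residue {Affine 0, Infty} C (Affine 0) (\<rho> 1)"
    and prI: "principal_residue {Affine 0, Infty} C Infty (\<rho> (- 1))"
  obtains L0 Li P0 P1 m where "L0 \<in> carrier_mat n n" "log_exp L0 1 = \<rho> 1" "\<And>a. eigenvalue L0 a \<Longrightarrow> 0 \<le> Re a \<and> Re a < 1"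
    "Li \<in> carrier_mat n n" "log_exp Li 1 = \<rho> (- 1)" "\<And>a. eigenvalue Li a \<Longrightarrow> 0 \<le> Re a \<and> Re a < 1"
    "P0 \<in> carrier_mat n n" "P1 \<in> carrier_mat n n" "Li * P0 + P0 * L0 = 0\<^sub>m n n" "Li * P1 + P1 * L0 = P1"
    "m \<le> n" "P1 = 0\<^sub>m n n \<Longrightarrow> m = 0" "P0 = 0\<^sub>m n n \<Longrightarrow> m = n"
    "\<And>a. (\<And>j. j < n \<Longrightarrow> a j = (if j < m then 1 else 0)) \<Longrightarrow> \<exists>e0 e1. two_frames (vbundle C) n e0 e1 a"
proof -
  let ?E = "vbundle C" and ?Y = punctured_line and ?U0 = "- {Infty} :: cp1 set" and ?U1 = "- {Affine 0} :: cp1 set"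
  let ?p = "2 * complex_of_real pi * \<i>"
  have U01: "?Y \<union> {Affine 0} = ?U0" "?Y \<union> {Infty} = ?U1" by (auto simp: punctured_line_def)
  have oU: "open ?U0" "open ?U1" by (simp_all add: open_Compl_finite)
  have YU: "?Y \<subseteq> ?U0" "?Y \<subseteq> ?U1" by (auto simp: punctured_line_def)
  note oY = open_punctured_line
  obtain L0 \<epsilon>0 where L0: "L0 \<in> carrier_mat n n" "log_exp L0 1 = \<rho> 1" and s0: "\<And>a. eigenvalue L0 a \<Longrightarrow> 0 \<le> Re a \<and> Re a < 1"
    and fr0: "is_frame ?E ?U0 n \<epsilon>0" and \<phi>0: "\<And>j u. j < n \<Longrightarrow> \<phi> ?Y (Res ?E ?U0 ?Y (\<epsilon>0 j)) u = col (log_exp L0 u) j"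
  proof (rule frame_at_pole[of 1 "Affine 0", OF _ pr0], goal_cases)
    case (2 L \<epsilon>)
    show ?thesis by (rule 2(1)[of L \<epsilon>]) (use 2(2-) in \<open>simp_all only: U01 of_int_1 mult_1\<close>)
  qed simp
  obtain Li \<epsilon>1 where Li: "Li \<in> carrier_mat n n" "log_exp Li 1 = \<rho> (- 1)" and si: "\<And>a. eigenvalue Li a \<Longrightarrow> 0 \<le> Re a \<and> Re a < 1"
    and fr1: "is_frame ?E ?U1 n \<epsilon>1" and \<phi>1: "\<And>j u. j < n \<Longrightarrow> \<phi> ?Y (Res ?E ?U1 ?Y (\<epsilon>1 j)) u = col (log_exp Li (- u)) j"
  proof (rule frame_at_pole[of "- 1" Infty, OF _ prI], goal_cases)
    case (2 L \<epsilon>)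
    have m: "of_int (- 1) * u = - u" for u :: complex by simp
    show ?thesis by (rule 2(1)[of L \<epsilon>]) (use 2(2-) in \<open>simp_all only: U01 m\<close>)
  qed simp
  note c0 = is_frame_closed[OF fr0] and c1 = is_frame_closed[OF fr1]
  define f0 where "f0 = (\<lambda>i. Res ?E ?U0 ?Y (\<epsilon>0 i))"
  define f1 where "f1 = (\<lambda>i. Res ?E ?U1 ?Y (\<epsilon>1 i))"
  have F0: "is_frame ?E ?Y n f0" unfolding f0_def by (rule E.frame_Res[OF fr0 oU(1) subset_UNIV oY YU(1)])
  have F1: "is_frame ?E ?Y n f1" unfolding f1_def by (rule E.frame_Res[OF fr1 oU(2) subset_UNIV oY YU(2)])
  note d0 = is_frame_closed[OF F0] and d1 = is_frame_closed[OF F1]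
  obtain A B where A: "\<forall>i<n. \<forall>j<n. A i j \<in> carrier (hol_ring ?Y)" and B: "\<forall>i<n. \<forall>j<n. B i j \<in> carrier (hol_ring ?Y)"
    and fA: "\<forall>j<n. f0 j = lincomb ?E ?Y n (\<lambda>i. A i j) f1" and fB: "\<forall>j<n. f1 j = lincomb ?E ?Y n (\<lambda>i. B i j) f0"
    and AB: "\<forall>i<n. \<forall>j<n. \<forall>x\<in>?Y. (\<Sum>l<n. A i l x * B l j x) = (if i = j then 1 else 0)"
    and BA: "\<forall>i<n. \<forall>j<n. \<forall>x\<in>?Y. (\<Sum>l<n. B i l x * A l j x) = (if i = j then 1 else 0)"
    using E.frame_transition[OF F1 F0 oY subset_UNIV] by (elim exE conjE) (rule that)
  define P where "P = (\<lambda>z. Matrix.mat n n (\<lambda>(i, j). A i j (chart (Affine 0) z)))"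
  (* in the coordinate at infinity, so that the two situations are symmetric *)
  define Q where "Q = (\<lambda>z. Matrix.mat n n (\<lambda>(i, j). B i j (chart Infty z)))"
  have cPQ: "P z \<in> carrier_mat n n" "Q z \<in> carrier_mat n n" for z by (simp_all add: P_def Q_def)
  have Yz: "chart (Affine 0) z \<in> ?Y" "chart Infty z \<in> ?Y" if "z \<noteq> 0" for z using that by (simp_all add: punctured_line_def)
  have PD: "has_mat_deriv n P (Matrix.mat n n (\<lambda>(i, j). deriv (\<lambda>z. A i j (chart (Affine 0) z)) z)) z" if z: "z \<noteq> 0" for z
    unfolding P_def
  proof (rule has_mat_deriv_entries)
    fix i j assume "i < n" "j < n"
    then have "hol_on (A i j) ?Y" using A unfolding hol_ring_iff by blast
    from hol_on_chart_analytic[OF this Yz(1)[OF z]] show "(\<lambda>z. A i j (chart (Affine 0) z)) analytic_on {z}" .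
  qed
  have QD: "has_mat_deriv n Q (Matrix.mat n n (\<lambda>(i, j). deriv (\<lambda>z. B i j (chart Infty z)) z)) z" if z: "z \<noteq> 0" for z
    unfolding Q_def
  proof (rule has_mat_deriv_entries)
    fix i j assume "i < n" "j < n"
    then have "hol_on (B i j) ?Y" using B unfolding hol_ring_iff by blast
    from hol_on_chart_analytic[OF this Yz(2)[OF z]] show "(\<lambda>z. B i j (chart Infty z)) analytic_on {z}" .
  qed
  have relP: "log_exp L0 v = log_exp Li (- v) * P (exp (?p * v))" for v
  proof (rule eq_matI)
    note cc = sq_mult[OF log_exp_carrier[OF Li(1)] cPQ(1), of "- v" "exp (?p * v)"]
    fix r j assume "r < dim_row (log_exp Li (- v) * P (exp (?p * v)))" "j < dim_col (log_exp Li (- v) * P (exp (?p * v)))"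
    then have rj: "r < n" "j < n" unfolding carrier_matD[OF cc] by auto
    have "log_exp L0 v $$ (r, j) = vec_index (\<phi> ?Y (f0 j) v) r"
      unfolding f0_def \<phi>0[OF rj(2)] using carrier_matD[OF log_exp_carrier[OF L0(1), of v]] rj by simp
    also have "\<phi> ?Y (f0 j) v = Matrix.vec n (\<lambda>r. \<Sum>i<n. A i j (cover v) * vec_index (\<phi> ?Y (f1 i) v) r)"
      unfolding fA[THEN spec, THEN mp, OF rj(2)] by (rule E.\<phi>_lincomb[OF oY order_refl _ d1]) (use A rj in blast)
    also have "vec_index \<dots> r = (\<Sum>i<n. A i j (cover v) * vec_index (\<phi> ?Y (f1 i) v) r)" using rj by simp
    also have "\<dots> = (\<Sum>i<n. log_exp Li (- v) $$ (r, i) * P (exp (?p * v)) $$ (i, j))"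
    proof (rule sum.cong[OF refl])
      fix i assume "i \<in> {..<n}"
      then have i: "i < n" by simp
      have "vec_index (\<phi> ?Y (f1 i) v) r = log_exp Li (- v) $$ (r, i)"
        unfolding f1_def \<phi>1[OF i] using carrier_matD[OF log_exp_carrier[OF Li(1), of "- v"]] rj i by simp
      moreover have "P (exp (?p * v)) $$ (i, j) = A i j (cover v)" using i rj by (simp add: P_def cover_def)
      ultimately show "A i j (cover v) * vec_index (\<phi> ?Y (f1 i) v) r = log_exp Li (- v) $$ (r, i) * P (exp (?p * v)) $$ (i, j)"
        by (simp only: mult.commute)
    qed
    also have "\<dots> = (log_exp Li (- v) * P (exp (?p * v))) $$ (r, j)"
      by (rule sq_mult_entry[OF log_exp_carrier[OF Li(1)] cPQ(1) rj, symmetric])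
    finally show "log_exp L0 v $$ (r, j) = (log_exp Li (- v) * P (exp (?p * v))) $$ (r, j)" .
  qed (simp_all only: carrier_matD[OF sq_mult[OF log_exp_carrier[OF Li(1)] cPQ(1)]] carrier_matD[OF log_exp_carrier[OF L0(1)]])
  have relQ: "log_exp Li v = log_exp L0 (- v) * Q (exp (?p * v))" for v
  proof (rule eq_matI)
    note cc = sq_mult[OF log_exp_carrier[OF L0(1)] cPQ(2), of "- v" "exp (?p * v)"]
    fix r j assume "r < dim_row (log_exp L0 (- v) * Q (exp (?p * v)))" "j < dim_col (log_exp L0 (- v) * Q (exp (?p * v)))"
    then have rj: "r < n" "j < n" unfolding carrier_matD[OF cc] by auto
    have mm: "- (- v) = v" by simp
    have "log_exp Li v $$ (r, j) = vec_index (\<phi> ?Y (f1 j) (- v)) r"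
      unfolding f1_def \<phi>1[OF rj(2)] mm using carrier_matD[OF log_exp_carrier[OF Li(1), of v]] rj by simp
    also have "\<phi> ?Y (f1 j) (- v) = Matrix.vec n (\<lambda>r. \<Sum>i<n. B i j (cover (- v)) * vec_index (\<phi> ?Y (f0 i) (- v)) r)"
      unfolding fB[THEN spec, THEN mp, OF rj(2)] by (rule E.\<phi>_lincomb[OF oY order_refl _ d0]) (use B rj in blast)
    also have "vec_index \<dots> r = (\<Sum>i<n. B i j (cover (- v)) * vec_index (\<phi> ?Y (f0 i) (- v)) r)" using rj by simp
    also have "\<dots> = (\<Sum>i<n. log_exp L0 (- v) $$ (r, i) * Q (exp (?p * v)) $$ (i, j))"
    proof (rule sum.cong[OF refl])
      fix i assume "i \<in> {..<n}"
      then have i: "i < n" by simp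
      have "vec_index (\<phi> ?Y (f0 i) (- v)) r = log_exp L0 (- v) $$ (r, i)"
        unfolding f0_def \<phi>0[OF i] using carrier_matD[OF log_exp_carrier[OF L0(1), of "- v"]] rj i by simp
      moreover have "Q (exp (?p * v)) $$ (i, j) = B i j (cover (- v))"
        using i rj by (simp add: Q_def cover_def exp_minus inverse_eq_divide)
      ultimately show "B i j (cover (- v)) * vec_index (\<phi> ?Y (f0 i) (- v)) r = log_exp L0 (- v) $$ (r, i) * Q (exp (?p * v)) $$ (i, j)"
        by (simp only: mult.commute)
    qed
    also have "\<dots> = (log_exp L0 (- v) * Q (exp (?p * v))) $$ (r, j)"
      by (rule sq_mult_entry[OF log_exp_carrier[OF L0(1)] cPQ(2) rj, symmetric])
    finally show "log_exp Li v $$ (r, j) = (log_exp L0 (- v) * Q (exp (?p * v))) $$ (r, j)" .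
  qed (simp_all only: carrier_matD[OF sq_mult[OF log_exp_carrier[OF L0(1)] cPQ(2)]] carrier_matD[OF log_exp_carrier[OF Li(1)]])
  obtain P0 P1 where P01: "P0 \<in> carrier_mat n n" "P1 \<in> carrier_mat n n" and Plin: "\<And>z. z \<noteq> 0 \<Longrightarrow> P z = P0 + z \<cdot>\<^sub>m P1"
    and syl: "Li * P0 + P0 * L0 = 0\<^sub>m n n" "Li * P1 + P1 * L0 = P1" and Psum: "P0 + P1 = 1\<^sub>m n"
    by (rule transition_linear[OF L0(1) Li(1) s0 si PD relP]; (assumption | (rule that; assumption)))
  obtain Q0 Q1 where Q01: "Q0 \<in> carrier_mat n n" "Q1 \<in> carrier_mat n n" and Qlin: "\<And>z. z \<noteq> 0 \<Longrightarrow> Q z = Q0 + z \<cdot>\<^sub>m Q1"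
    and Qsum: "Q0 + Q1 = 1\<^sub>m n"
    by (rule transition_linear[OF Li(1) L0(1) si s0 QD relQ]; (assumption | (rule that; assumption)))
  have PQ: "P z * Q (1 / z) = 1\<^sub>m n" if z: "z \<noteq> 0" for z
  proof (rule eq_matI)
    fix i j assume "i < dim_row (1\<^sub>m n :: complex mat)" "j < dim_col (1\<^sub>m n :: complex mat)"
    then have ij: "i < n" "j < n" by auto
    have "(P z * Q (1 / z)) $$ (i, j) = (\<Sum>l<n. A i l (Affine z) * B l j (Affine z))"
      unfolding sq_mult_entry[OF cPQ ij] by (rule sum.cong[OF refl]) (use ij z in \<open>simp add: P_def Q_def\<close>)
    then show "(P z * Q (1 / z)) $$ (i, j) = 1\<^sub>m n $$ (i, j)" using AB ij Yz(1)[OF z] by simp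
  qed (simp_all add: carrier_matD[OF cPQ(1)] carrier_matD[OF cPQ(2)])
  have QP: "Q (1 / z) * P z = 1\<^sub>m n" if z: "z \<noteq> 0" for z
  proof (rule eq_matI)
    fix i j assume "i < dim_row (1\<^sub>m n :: complex mat)" "j < dim_col (1\<^sub>m n :: complex mat)"
    then have ij: "i < n" "j < n" by auto
    have "(Q (1 / z) * P z) $$ (i, j) = (\<Sum>l<n. B i l (Affine z) * A l j (Affine z))"
      unfolding sq_mult_entry[OF cPQ(2,1) ij] by (rule sum.cong[OF refl]) (use ij z in \<open>simp add: P_def Q_def\<close>)
    then show "(Q (1 / z) * P z) $$ (i, j) = 1\<^sub>m n $$ (i, j)" using BA ij Yz(1)[OF z] by simp
  qed (simp_all add: carrier_matD[OF cPQ(1)] carrier_matD[OF cPQ(2)])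
  have "P1 * P1 = P1"
  proof (rule log_transition_idempotent[OF P01 Q01 _ _ Psum Qsum])
    fix z :: complex assume z: "z \<noteq> 0"
    then have z': "1 / z \<noteq> 0" by simp
    show "(P0 + z \<cdot>\<^sub>m P1) * (Q0 + (1 / z) \<cdot>\<^sub>m Q1) = 1\<^sub>m n" using PQ[OF z] unfolding Plin[OF z] Qlin[OF z'] .
    show "(Q0 + (1 / z) \<cdot>\<^sub>m Q1) * (P0 + z \<cdot>\<^sub>m P1) = 1\<^sub>m n" using QP[OF z] unfolding Plin[OF z] Qlin[OF z'] .
  qed
  then obtain S T m where S: "S \<in> carrier_mat n n" and T: "T \<in> carrier_mat n n" and ST: "S * T = 1\<^sub>m n" and TS: "T * S = 1\<^sub>m n" and m: "m \<le> n"
    and P1S: "\<And>i j. i < n \<Longrightarrow> j < n \<Longrightarrow> (P1 * S) $$ (i, j) = (if j < m then S $$ (i, j) else 0)"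
    by (rule idempotent_diagonalize[OF P01(2)]) blast
  have P0S: "(P0 * S) $$ (i, j) = (if j < m then 0 else S $$ (i, j))" if ij: "i < n" "j < n" for i j
  proof -
    have "S = (P0 + P1) * S" unfolding Psum using S by simp
    also have "\<dots> = P0 * S + P1 * S" by (rule add_mult_distrib_mat[OF P01 S])
    finally have "S $$ (i, j) = (P0 * S + P1 * S) $$ (i, j)" by (rule arg_cong)
    also have "\<dots> = (P0 * S) $$ (i, j) + (P1 * S) $$ (i, j)"
      by (rule index_add_mat(1)) (use carrier_matD[OF sq_mult[OF P01(2) S]] ij in simp_all)
    finally show ?thesis unfolding P1S[OF ij] by (simp split: if_splits)
  qed
  have m0: "m = 0" if "P1 = 0\<^sub>m n n"
  proof (rule ccontr)
    assume "m \<noteq> 0"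
    then have j: "0 < m" "0 < n" using m by auto
    have "S $$ (i, 0) = 0" if "i < n" for i
      using P1S[OF that j(2)] j that \<open>P1 = 0\<^sub>m n n\<close> left_mult_zero_mat[OF S] by simp
    then show False by (rule invertible_column_nonzero[OF S T TS j(2)])
  qed
  have mn: "m = n" if "P0 = 0\<^sub>m n n"
  proof (rule ccontr)
    assume "m \<noteq> n"
    then have j: "m < n" using m by auto
    have "S $$ (i, m) = 0" if "i < n" for i
      using P0S[OF that j] j that \<open>P0 = 0\<^sub>m n n\<close> left_mult_zero_mat[OF S] by simp
    then show False by (rule invertible_column_nonzero[OF S T TS j])
  qed
  have ST': "(\<Sum>l<n. zero_off U (\<lambda>_. S $$ (i, l)) x * zero_off U (\<lambda>_. T $$ (l, j)) x) = (if i = j then 1 else 0)"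
    if "i < n" "j < n" "x \<in> U" for i j x U
    using that arg_cong[OF ST, of "\<lambda>M. M $$ (i, j)"] sq_mult_entry[OF S T that(1,2)] by (simp add: zero_off_apply del: index_mult_mat(1))
  have TS': "(\<Sum>l<n. zero_off U (\<lambda>_. T $$ (i, l)) x * zero_off U (\<lambda>_. S $$ (l, j)) x) = (if i = j then 1 else 0)"
    if "i < n" "j < n" "x \<in> U" for i j x U
    using that arg_cong[OF TS, of "\<lambda>M. M $$ (i, j)"] sq_mult_entry[OF T S that(1,2)] by (simp add: zero_off_apply del: index_mult_mat(1))
  define e0 where "e0 = (\<lambda>j. lincomb ?E ?U0 n (\<lambda>i. zero_off ?U0 (\<lambda>_. S $$ (i, j))) \<epsilon>0)"
  define e1 where "e1 = (\<lambda>j. lincomb ?E ?U1 n (\<lambda>i. zero_off ?U1 (\<lambda>_. S $$ (i, j))) \<epsilon>1)"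
  have fe0: "is_frame ?E ?U0 n e0"
    unfolding e0_def by (rule E.frame_transform[OF fr0 oU(1) subset_UNIV hol_ring_const[OF oU(1)] hol_ring_const[OF oU(1)] ST' TS'])
  have fe1: "is_frame ?E ?U1 n e1"
    unfolding e1_def by (rule E.frame_transform[OF fr1 oU(2) subset_UNIV hol_ring_const[OF oU(2)] hol_ring_const[OF oU(2)] ST' TS'])
  have zz: "zero_off ?Y (zero_off U (\<lambda>_. c)) = zero_off ?Y (\<lambda>_. c)" if "?Y \<subseteq> U" for U c
    using that by (auto simp: zero_off_def fun_eq_iff)
  have Re0: "Res ?E ?U0 ?Y (e0 j) = lincomb ?E ?Y n (\<lambda>i. zero_off ?Y (\<lambda>_. S $$ (i, j))) f0" for j
    unfolding e0_def f0_def zz[OF YU(1), symmetric]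
    by (rule E.lincomb_Res[OF oU(1) oY YU(1) subset_UNIV hol_ring_const[OF oU(1)] c0])
  have Re1: "Res ?E ?U1 ?Y (e1 j) = lincomb ?E ?Y n (\<lambda>i. zero_off ?Y (\<lambda>_. S $$ (i, j))) f1" for j
    unfolding e1_def f1_def zz[OF YU(2), symmetric]
    by (rule E.lincomb_Res[OF oU(2) oY YU(2) subset_UNIV hol_ring_const[OF oU(2)] c1])
  have hS: "zero_off ?Y (\<lambda>_. S $$ (i, j)) \<in> carrier (hol_ring ?Y)" for i j by (rule hol_ring_const[OF oY])
  have two: "\<exists>e0 e1. two_frames ?E n e0 e1 a" if a: "\<And>j. j < n \<Longrightarrow> a j = (if j < m then 1 else 0)" for a :: "nat \<Rightarrow> int"
  proof -
    have tr: "Res ?E ?U0 ?Y (e0 j) = zero_off ?Y (\<lambda>x. affine_coord x powi a j) \<odot>\<^bsub>Sec ?E ?Y\<^esub> Res ?E ?U1 ?Y (e1 j)" if j: "j < n" for j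
    proof -
      let ?z = "zero_off ?Y (\<lambda>x. affine_coord x powi a j)"
      have hz: "?z \<in> carrier (hol_ring ?Y)" by (rule hol_ring_coord_powi[OF oY order_refl])
      have hA: "A i l \<in> carrier (hol_ring ?Y)" if "i < n" "l < n" for i l using A that by blast
      have "Res ?E ?U0 ?Y (e0 j) = lincomb ?E ?Y n (\<lambda>i. zero_off ?Y (\<lambda>_. S $$ (i, j))) (\<lambda>l. lincomb ?E ?Y n (\<lambda>i. A i l) f1)"
        unfolding Re0 by (rule E.lincomb_cong[OF oY subset_UNIV hS d0 refl]) (assumption | rule fA[THEN spec, THEN mp])+
      also have "\<dots> = lincomb ?E ?Y n (\<lambda>i x. \<Sum>l<n. A i l x * zero_off ?Y (\<lambda>_. S $$ (l, j)) x) f1"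
        by (rule E.lincomb_lincomb[OF oY subset_UNIV hA hS d1])
      also have "\<dots> = lincomb ?E ?Y n (\<lambda>i x. ?z x * zero_off ?Y (\<lambda>_. S $$ (i, j)) x) f1"
      proof (rule E.lincomb_cong[OF oY subset_UNIV _ d1 _ refl])
        fix i assume i: "i < n"
        show "(\<lambda>x. \<Sum>l<n. A i l x * zero_off ?Y (\<lambda>_. S $$ (l, j)) x) \<in> carrier (hol_ring ?Y)"
          by (intro hol_ring_sum hol_ring_mult hS) (use hA i in simp)
        show "(\<lambda>x. \<Sum>l<n. A i l x * zero_off ?Y (\<lambda>_. S $$ (l, j)) x) = (\<lambda>x. ?z x * zero_off ?Y (\<lambda>_. S $$ (i, j)) x)"
        proof
          fix x
          show "(\<Sum>l<n. A i l x * zero_off ?Y (\<lambda>_. S $$ (l, j)) x) = ?z x * zero_off ?Y (\<lambda>_. S $$ (i, j)) x"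
          proof (cases "x \<in> ?Y")
            case True
            then obtain z where x: "x = Affine z" and z: "z \<noteq> 0" by (cases x) (auto simp: punctured_line_def)
            have "(\<Sum>l<n. A i l x * zero_off ?Y (\<lambda>_. S $$ (l, j)) x) = (\<Sum>l<n. P z $$ (i, l) * S $$ (l, j))"
              by (rule sum.cong[OF refl]) (use i True in \<open>simp add: P_def x zero_off_apply\<close>)
            also have "\<dots> = (P z * S) $$ (i, j)" by (rule sq_mult_entry[OF cPQ(1) S i j, symmetric])
            also have "P z * S = P0 * S + z \<cdot>\<^sub>m (P1 * S)"
              unfolding Plin[OF z] add_mult_distrib_mat[OF P01(1) smult_carrier_mat[OF P01(2)] S] mult_smult_assoc_mat[OF P01(2) S] ..
            also have "(P0 * S + z \<cdot>\<^sub>m (P1 * S)) $$ (i, j) = (P0 * S) $$ (i, j) + z * (P1 * S) $$ (i, j)"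
              using carrier_matD[OF sq_mult[OF P01(2) S]] i j by (simp del: index_mult_mat(1))
            also have "\<dots> = (if j < m then z else 1) * S $$ (i, j)" unfolding P0S[OF i j] P1S[OF i j] by simp
            also have "(if j < m then z else 1) = z powi a j" using a[OF j] by simp
            finally show ?thesis using True x by (simp add: zero_off_apply)
          qed (simp add: zero_off_apply)
        qed
      qed
      also have "\<dots> = ?z \<odot>\<^bsub>Sec ?E ?Y\<^esub> lincomb ?E ?Y n (\<lambda>i. zero_off ?Y (\<lambda>_. S $$ (i, j))) f1"
        by (rule E.lincomb_smult[OF oY subset_UNIV hz hS d1])
      finally show ?thesis unfolding Re1 .
    qed
    have "two_frames ?E n e0 e1 a"
      by (rule two_frames.intro[OF E.omodule_sheaf_axioms two_frames_axioms.intro[OF fe0 fe1 tr]])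
    then show ?thesis by blast
  qed
  show ?thesis
  proof (rule that[of L0 Li P0 P1 m])
    show "0 \<le> Re a \<and> Re a < 1" if "eigenvalue L0 a" for a using that by (rule s0)
    show "0 \<le> Re a \<and> Re a < 1" if "eigenvalue Li a" for a using that by (rule si)
    show "\<exists>e0 e1. two_frames ?E n e0 e1 a" if "\<And>j. j < n \<Longrightarrow> a j = (if j < m then 1 else 0)" for a by (rule two[OF that])
    show "m = 0" if "P1 = 0\<^sub>m n n" using that by (rule m0)
    show "m = n" if "P0 = 0\<^sub>m n n" using that by (rule mn)
  qed (rule L0 Li P01 syl m)+
qed

end

section \<open>Eigenvalues of the residues and the splitting type\<close>

text \<open>The absolute values give the imaginary part of \<open>x\<close>, and the arguments determine its real part up to an
integer.\<close>

lemma exp_eq_polar: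
  assumes "exp (2 * of_real pi * \<i> * x) = of_real r * exp (2 * of_real pi * \<i> * of_real q)" "r > 0"
  shows "\<exists>k::int. Re x = q + of_int k"
proof -
  have "complex_of_real r = exp (of_real (ln r))" using assms(2) by (simp add: exp_of_real)
  then have "exp (2 * of_real pi * \<i> * x) = exp (of_real (ln r) + 2 * of_real pi * \<i> * of_real q)"
    using assms(1) by (simp add: exp_add)
  then obtain k :: int where "2 * of_real pi * \<i> * x = of_real (ln r) + 2 * of_real pi * \<i> * of_real q + (of_int (2 * k) * pi) * \<i>"
    unfolding exp_eq by blast
  from arg_cong[OF this, of Im] have "2 * pi * Re x = 2 * pi * (q + of_int k)" by (simp add: algebra_simps)
  then have "Re x = q + of_int k" by simp
  then show ?thesis by (rule exI)
qed

lemma eigenvalue_jordan_block: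
  assumes "eigenvalue (jordan_block n a) x"
  shows "x = (a :: complex)"
proof -
  have "poly (char_poly (jordan_block n a)) x = 0"
    using assms eigenvalue_root_char_poly[of "jordan_block n a" n x] by simp
  then show ?thesis by (simp add: jordan_block_char_poly poly_power)
qed

lemma eigenvalue_inverse:
  assumes A: "A \<in> carrier_mat n n" and B: "B \<in> carrier_mat n n" and AB: "A * B = (1\<^sub>m n :: complex mat)" and ev: "eigenvalue B x"
  shows "eigenvalue A (1 / x)"
proof -
  obtain v where v: "v \<in> carrier_vec n" "v \<noteq> 0\<^sub>v n" and Bv: "B *\<^sub>v v = x \<cdot>\<^sub>v v"
    using ev B unfolding eigenvalue_def eigenvector_def by auto
  have Av: "A *\<^sub>v v \<in> carrier_vec n" using A v(1) by (rule mult_mat_vec_carrier)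
  have "v = (A * B) *\<^sub>v v" unfolding AB using v(1) by simp
  also have "\<dots> = A *\<^sub>v (x \<cdot>\<^sub>v v)" unfolding assoc_mult_mat_vec[OF A B v(1)] Bv ..
  also have "\<dots> = x \<cdot>\<^sub>v (A *\<^sub>v v)" by (rule mult_mat_vec[OF A v(1)])
  finally have eq: "v = x \<cdot>\<^sub>v (A *\<^sub>v v)" .
  have entry: "vec_index v i = x * vec_index (A *\<^sub>v v) i" if "i < n" for i
    using arg_cong[OF eq, of "\<lambda>w. vec_index w i"] carrier_vecD[OF Av] that by (simp del: index_mult_mat_vec)
  have x: "x \<noteq> 0"
  proof
    assume "x = 0"
    then have "v = 0\<^sub>v n" using entry v(1) by (intro eq_vecI) auto
    then show False using v(2) by simp
  qed
  have "A *\<^sub>v v = (1 / x) \<cdot>\<^sub>v v"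
  proof (rule eq_vecI)
    fix i assume "i < dim_vec ((1 / x) \<cdot>\<^sub>v v)"
    then have i: "i < n" using v(1) by simp
    show "vec_index (A *\<^sub>v v) i = vec_index ((1 / x) \<cdot>\<^sub>v v) i"
      using entry[OF i] i v(1) x by (simp del: index_mult_mat_vec)
  qed (use carrier_vecD[OF Av] carrier_vecD[OF v(1)] in simp)
  then show ?thesis unfolding eigenvalue_def eigenvector_def using v A by auto
qed

text \<open>The eigenvalues of the logarithms exponentiate to those of the monodromies, that is, to \<open>\<mu>\<close> and to
\<open>1 / \<mu>\<close>. So \<open>Re b\<close> is \<open>q\<close> and \<open>Re a\<close> is \<open>- q\<close> up to integers, and the strip \<open>[0, 1)\<close> leaves no choice.\<close>

lemma (in log_extension) jordan_residue_eigenvalues: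
  assumes \<rho>1: "\<rho> 1 = jordan_block n (of_real r * exp (2 * of_real pi * \<i> * of_real q))" and r: "r > 0" and q: "0 \<le> q" "q < 1"
    and L0: "L0 \<in> carrier_mat n n" "log_exp L0 1 = \<rho> 1" "\<And>a. eigenvalue L0 a \<Longrightarrow> 0 \<le> Re a \<and> Re a < 1"
    and Li: "Li \<in> carrier_mat n n" "log_exp Li 1 = \<rho> (- 1)" "\<And>a. eigenvalue Li a \<Longrightarrow> 0 \<le> Re a \<and> Re a < 1"
    and a: "eigenvalue Li a" and b: "eigenvalue L0 b"
  shows "Re (a + b) = (if q = 0 then 0 else 1)"
proof -
  let ?p = "2 * complex_of_real pi * \<i>" and ?\<mu> = "of_real r * exp (2 * complex_of_real pi * \<i> * of_real q)"
  have ev: "eigenvalue (log_exp L 1) (exp (?p * x))" if "L \<in> carrier_mat n n" "eigenvalue L x" for L x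
    using eigenvalue_mat_exp[OF that, of ?p] by simp
  have "exp (?p * b) = ?\<mu>"
    using ev[OF L0(1) b] unfolding L0(2) \<rho>1 by (rule eigenvalue_jordan_block)
  from exp_eq_polar[OF this r] obtain k :: int where k: "Re b = q + of_int k" ..
  have "\<rho> 1 * \<rho> (- 1) = 1\<^sub>m n" using E.rho(3)[of 1 "- 1"] E.rho(2) by simp
  from eigenvalue_inverse[OF E.rho(1) E.rho(1) this ev[OF Li(1) a, unfolded Li(2)]]
  have "1 / exp (?p * a) = ?\<mu>" unfolding \<rho>1 by (rule eigenvalue_jordan_block)
  then have "exp (?p * (- a)) = ?\<mu>" by (simp add: exp_minus inverse_eq_divide)
  from exp_eq_polar[OF this r] obtain l :: int where l: "Re (- a) = q + of_int l" ..
  have "k = 0" using k q L0(3)[OF b] by linarith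
  moreover have "l = (if q = 0 then 0 else - 1)" using l q Li(3)[OF a] by auto
  ultimately show ?thesis using k l by (cases "q = 0") simp_all
qed

theorem theorem1:
  fixes n :: nat and \<rho> :: "int \<Rightarrow> complex mat" and C :: "('s, 't) connection" and \<zeta> :: int
  assumes "monodromy_rep n \<rho>"
    and "extended_log_connection n \<rho> C"
    and "\<zeta> = c1 (vbundle C)"
  shows "(\<forall>(\<mu>::complex) (r::real) (q::real).
            indecomposable_rep n \<rho> \<and> \<rho> 1 = jordan_block n \<mu> \<and>
            \<mu> = complex_of_real r * exp (2 * complex_of_real pi * \<i> * complex_of_real q) \<and>
            r > 0 \<and> 0 \<le> q \<and> q < 1 \<longrightarrow>
              (q = 0 \<longrightarrow> isomorphic_sheaves (vbundle C) (direct_sum n (\<lambda>_. twisting_sheaf 0))) \<and>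
              (q \<noteq> 0 \<longrightarrow> isomorphic_sheaves (vbundle C) (direct_sum n (\<lambda>_. twisting_sheaf (- 1))))) \<and>
         (\<forall>\<rho>s. (\<forall>\<sigma>\<in>set \<rho>s. \<exists>m. indecomposable_rep m \<sigma>) \<and> isomorphic_reps \<rho> (sum_rep \<rho>s) \<longrightarrow>
              0 \<le> - \<zeta> \<and> 0 \<le> int n + \<zeta> \<and>
              isomorphic_sheaves (vbundle C)
                (direct_sum (nat (- \<zeta>) + nat (int n + \<zeta>))
                   (\<lambda>i. if i < nat (- \<zeta>) then twisting_sheaf (- 1) else twisting_sheaf 0)))"
proof -
  note ext = assms(2)[unfolded extended_log_connection_def]
  obtain \<phi> \<psi> where iso: "sheaf_iso punctured_line (vbundle C) (vbundle (rep_connection n \<rho>)) \<phi>"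
      "sheaf_iso punctured_line (forms C) (forms (rep_connection n \<rho>)) \<psi>"
    and compat: "\<forall>U. open U \<and> U \<subseteq> punctured_line \<longrightarrow> (\<forall>s\<in>carrier (Sec (vbundle C) U).
        (\<forall>\<omega>\<in>carrier (Sec (log_forms {}) U). \<psi> U (tens C U s \<omega>) = tens (rep_connection n \<rho>) U (\<phi> U s) \<omega>) \<and>
        \<psi> U (nabla C U s) = nabla (rep_connection n \<rho>) U (\<phi> U s))"
    using ext[THEN conjunct2, THEN conjunct1] unfolding isomorphic_connections_def by (elim exE conjE) (rule that)
  have vb: "vbundle (rep_connection n \<rho>) = rep_bundle n \<rho>" "forms (rep_connection n \<rho>) = rep_bundle n \<rho>"
    by (simp_all add: rep_connection_def)
  interpret log_extension C n \<rho> \<phi> \<psi>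
  proof
    show "sheaf_iso punctured_line (vbundle C) (rep_bundle n \<rho>) \<phi>" "sheaf_iso punctured_line (forms C) (rep_bundle n \<rho>) \<psi>"
      using iso unfolding vb .
    show "(\<forall>\<omega>\<in>carrier (Sec (log_forms {}) U). \<psi> U (tens C U s \<omega>) = tens (rep_connection n \<rho>) U (\<phi> U s) \<omega>) \<and>
        \<psi> U (nabla C U s) = nabla (rep_connection n \<rho>) U (\<phi> U s)"
      if "open U" "U \<subseteq> punctured_line" "s \<in> carrier (Sec (vbundle C) U)" for U s
      by (rule compat[THEN spec, THEN mp, OF conjI[OF that(1,2)], THEN bspec, OF that(3)])
  qed (rule assms(1) ext[THEN conjunct1])+
  obtain L0 Li P0 P1 m where L0: "L0 \<in> carrier_mat n n" "log_exp L0 1 = \<rho> 1" "\<And>a. eigenvalue L0 a \<Longrightarrow> 0 \<le> Re a \<and> Re a < 1"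
    and Li: "Li \<in> carrier_mat n n" "log_exp Li 1 = \<rho> (- 1)" "\<And>a. eigenvalue Li a \<Longrightarrow> 0 \<le> Re a \<and> Re a < 1"
    and P: "P0 \<in> carrier_mat n n" "P1 \<in> carrier_mat n n" and syl: "Li * P0 + P0 * L0 = 0\<^sub>m n n" "Li * P1 + P1 * L0 = P1"
    and m: "m \<le> n" "P1 = 0\<^sub>m n n \<Longrightarrow> m = 0" "P0 = 0\<^sub>m n n \<Longrightarrow> m = n"
    and two: "\<And>a. (\<And>j. j < n \<Longrightarrow> a j = (if j < m then 1 else 0)) \<Longrightarrow> \<exists>e0 e1. two_frames (vbundle C) n e0 e1 a"
  proof (rule splitting_frames[OF ext[THEN conjunct2, THEN conjunct2, THEN conjunct1] ext[THEN conjunct2, THEN conjunct2, THEN conjunct2]], goal_cases)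
    case (1 L0 Li P0 P1 m)
    show ?thesis
    proof (rule that[of L0 Li P0 P1 m])
      show "0 \<le> Re a \<and> Re a < 1" if "eigenvalue L0 a" for a using that by (rule 1(4))
      show "0 \<le> Re a \<and> Re a < 1" if "eigenvalue Li a" for a using that by (rule 1(7))
      show "\<exists>e0 e1. two_frames (vbundle C) n e0 e1 a" if "\<And>j. j < n \<Longrightarrow> a j = (if j < m then 1 else 0)" for a
        by (rule 1(15)) (rule that)
    qed (rule 1(2,3,5,6,8-12) | (rule 1(13,14), assumption))+
  qed
  show ?thesis
  proof (intro conjI allI impI)
    fix \<mu> :: complex and r q :: real
    assume h: "indecomposable_rep n \<rho> \<and> \<rho> 1 = jordan_block n \<mu> \<and>
      \<mu> = complex_of_real r * exp (2 * complex_of_real pi * \<i> * complex_of_real q) \<and> r > 0 \<and> 0 \<le> q \<and> q < 1"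
    then have "\<rho> 1 = jordan_block n (complex_of_real r * exp (2 * complex_of_real pi * \<i> * complex_of_real q))"
      and rq: "r > 0" "0 \<le> q" "q < 1" by auto
    from jordan_residue_eigenvalues[OF this L0 Li]
    have ev: "Re (a + b) = (if q = 0 then 0 else 1)" if "eigenvalue Li a" "eigenvalue L0 b" for a b using that by blast
    have one: "1 \<cdot>\<^sub>m X = X" for X :: "complex mat" by (intro eq_matI) simp_all
    show "isomorphic_sheaves (vbundle C) (direct_sum n (\<lambda>_. twisting_sheaf 0))" if q: "q = 0"
    proof -
      have "P1 = 0\<^sub>m n n"
      proof (rule sylvester_zero[OF Li(1) L0(1) P(2), of 1 1 1])
        show "1 \<cdot>\<^sub>m (Li * P1) + 1 \<cdot>\<^sub>m (P1 * L0) = 1 \<cdot>\<^sub>m P1" unfolding one by (rule syl(2))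
        show "1 * a + 1 * b \<noteq> 1" if "eigenvalue Li a" "eigenvalue L0 b" for a b
        proof
          assume "1 * a + 1 * b = 1"
          then have "a + b = 1" by simp
          then show False using ev[OF that] q by simp
        qed
      qed simp
      then obtain e0 e1 where "two_frames (vbundle C) n e0 e1 (\<lambda>_. 0)" using two[of "\<lambda>_. 0"] m(2) by auto
      from two_frames.isomorphic_direct_sum_twisting[OF this] show ?thesis by simp
    qed
    show "isomorphic_sheaves (vbundle C) (direct_sum n (\<lambda>_. twisting_sheaf (- 1)))" if q: "q \<noteq> 0"
    proof -
      have "P0 = 0\<^sub>m n n"
      proof (rule sylvester_zero[OF Li(1) L0(1) P(1), of 1 1 0])
        have "0 \<cdot>\<^sub>m P0 = 0\<^sub>m n n" using P(1) by (intro eq_matI) auto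
        then show "1 \<cdot>\<^sub>m (Li * P0) + 1 \<cdot>\<^sub>m (P0 * L0) = 0 \<cdot>\<^sub>m P0" unfolding one syl(1) ..
        show "1 * a + 1 * b \<noteq> 0" if "eigenvalue Li a" "eigenvalue L0 b" for a b
        proof
          assume "1 * a + 1 * b = 0"
          then have "a + b = 0" by simp
          then show False using ev[OF that] q by simp
        qed
      qed simp
      then obtain e0 e1 where "two_frames (vbundle C) n e0 e1 (\<lambda>_. 1)" using two[of "\<lambda>_. 1"] m(3) by auto
      from two_frames.isomorphic_direct_sum_twisting[OF this] show ?thesis by simp
    qed
  next
    obtain e0 e1 where "two_frames (vbundle C) n e0 e1 (\<lambda>j. if j < m then 1 else 0)"
      using two[of "\<lambda>j. if j < m then 1 else 0"] by auto
    then interpret T: two_frames "vbundle C" n e0 e1 "\<lambda>j. if j < m then 1 else 0" .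
    have "(\<Sum>i<n. if i < m then 1 else 0 :: int) = (\<Sum>i<m. 1)"
      using m(1) by (intro sum.mono_neutral_cong_right) auto
    then have \<zeta>: "\<zeta> = - int m" using T.c1_eq assms(3) by simp
    show "0 \<le> - \<zeta>" "0 \<le> int n + \<zeta>" using \<zeta> m(1) by auto
    have "nat (- \<zeta>) + nat (int n + \<zeta>) = n" "nat (- \<zeta>) = m" using \<zeta> m(1) by auto
    moreover have "(\<lambda>i. twisting_sheaf (- (if i < m then 1 else 0))) = (\<lambda>i. if i < m then twisting_sheaf (- 1) else twisting_sheaf 0)"
      by auto
    ultimately show "isomorphic_sheaves (vbundle C) (direct_sum (nat (- \<zeta>) + nat (int n + \<zeta>))
        (\<lambda>i. if i < nat (- \<zeta>) then twisting_sheaf (- 1) else twisting_sheaf 0))"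
      using T.isomorphic_direct_sum_twisting by simp
  qed
qed

end
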